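(* Suppose $V$ satisfies GCH, $\kappa=\sup_{n<\omega}\kappa_n$ for cardinals $\kappa_n$, and $\sup_{n<\omega} o(\kappa_n)=\kappa$, where $o(\kappa_n)$ is the Mitchell order of $\kappa_n$. Then there exists a cardinal preserving generic extension $V_1$ of $V$ satisfying GCH and having the same reals as $V$, such that adding $\kappa$-many Cohen reals over $V_1$ produces $\kappa^+$-many Cohen reals over $V$ (i.e. if $G$ is $\mathbb{C}(\kappa)$-generic over $V_1$, then $V_1[G]$ contains a $\mathbb{C}(\kappa^+)$-generic filter over $V$).
   Context: For a set $I$, $\mathbb{C}(I)$ is the poset of finite partial functions from $I\times\omega$ into $2$, ordered by reverse inclusion; "$\mu$-many Cohen reals over $V$" means a $\mathbb{C}(\mu)$-generic sequence over $V$.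
   Formalization: The supremum κ = sup κ_n is taken to be a genuine limit: κ_n < κ is assumed for every n; if it may be attained the claim fails, e.g. κ_0 = λ with o(λ) = λ⁺ and κ_n = λ⁺ = κ for n ≥ 1. *)

theory Defs
  imports "HOL-Library.Countable_Set_Type"
begin

(* Statements about forcing extensions of the universe V are read in the usual way, as statements
   about countable transitive models of ZFC.  Such a model is a set of hereditarily countable sets,
   and the hereditarily countable sets form a datatype; on it membership is well-founded and
   extensional. *)

section \<open>Hereditarily countable sets\<close>

datatype hc = HC (members: "hc cset")

definition elts :: "hc \<Rightarrow> hc set" where
  "elts x = rcset (members x)"

(* Meaningful for countable sets only; see elts_HSet. *)
definition HSet :: "hc set \<Rightarrow> hc" where
  "HSet S = HC (acset S)"

lemma countable_elts [simp]: "countable (elts x)"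
  by (simp add: elts_def)

lemma elts_HSet [simp]: "countable S \<Longrightarrow> elts (HSet S) = S"
  by (simp add: elts_def HSet_def acset_inverse)

lemma HSet_elts [simp]: "HSet (elts x) = x"
  by (simp add: elts_def HSet_def rcset_inverse)

lemma elts_inject: "elts x = elts y \<longleftrightarrow> x = y"
  by (metis HSet_elts)

lemma wf_elts: "wf {(x, y). x \<in> elts y}"
proof (rule wfUNIVI)
  fix P :: "hc \<Rightarrow> bool" and x
  assume *: "\<forall>x. (\<forall>y. (y, x) \<in> {(x, y). x \<in> elts y} \<longrightarrow> P y) \<longrightarrow> P x"
  show "P x"
    by (induction x) (use * in \<open>auto simp: elts_def\<close>)
qed

definition hempty :: hc where
  "hempty = HSet {}"

definition hsucc :: "hc \<Rightarrow> hc" where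
  "hsucc x = HSet (insert x (elts x))"

(* the union of a countable family; for sets of ordinals, the supremum *)
definition hUnion :: "hc set \<Rightarrow> hc" where
  "hUnion S = HSet (\<Union>x\<in>S. elts x)"

(* Kuratowski pairs *)
definition pair :: "hc \<Rightarrow> hc \<Rightarrow> hc" where
  "pair x y = HSet {HSet {x}, HSet {x, y}}"

lemma pair_inject: "pair x y = pair x' y' \<longleftrightarrow> x = x' \<and> y = y'"
proof
  have *: "elts ` elts (pair u v) = {{u}, {u, v}}" for u v
    by (simp add: pair_def countable_finite)
  assume "pair x y = pair x' y'"
  then have "{{x}, {x, y}} = {{x'}, {x', y'}}"
    by (simp flip: *)
  then show "x = x' \<and> y = y'"
    by (auto simp: doubleton_eq_iff)
qed simp

lemma pair_fst_trancl:
  assumes "pair x y \<in> elts z"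
  shows "(x, z) \<in> {(x, y). x \<in> elts y}\<^sup>+"
proof -
  have "(x, HSet {x}) \<in> {(x, y). x \<in> elts y}\<^sup>+"
    by (rule r_into_trancl) (simp add: countable_finite)
  moreover have "(HSet {x}, pair x y) \<in> {(x, y). x \<in> elts y}\<^sup>+"
    by (rule r_into_trancl) (simp add: pair_def countable_finite)
  moreover have "(pair x y, z) \<in> {(x, y). x \<in> elts y}\<^sup>+"
    by (rule r_into_trancl) (use assms in simp)
  ultimately show ?thesis
    by (meson trancl_trans)
qed

primrec hnat :: "nat \<Rightarrow> hc" where
  "hnat 0 = hempty"
| "hnat (Suc n) = hsucc (hnat n)"

definition homega :: hc where
  "homega = HSet (range hnat)"

(* the set coding the sequence s : omega -> hc *)
definition hseq :: "(nat \<Rightarrow> hc) \<Rightarrow> hc" where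
  "hseq s = HSet (range (\<lambda>n. pair (hnat n) (s n)))"

definition fun_on :: "hc \<Rightarrow> hc \<Rightarrow> bool" where
  "fun_on f A \<longleftrightarrow> (\<forall>z\<in>elts f. \<exists>x\<in>elts A. \<exists>y. z = pair x y) \<and> (\<forall>x\<in>elts A. \<exists>!y. pair x y \<in> elts f)"

definition happ :: "hc \<Rightarrow> hc \<Rightarrow> hc" where
  "happ f x = (THE y. pair x y \<in> elts f)"

definition is_bijection :: "hc \<Rightarrow> hc \<Rightarrow> hc \<Rightarrow> bool" where
  "is_bijection f A B \<longleftrightarrow> fun_on f A \<and> bij_betw (happ f) (elts A) (elts B)"

definition is_ordinal :: "hc \<Rightarrow> bool" where
  "is_ordinal x \<longleftrightarrow> (\<forall>y\<in>elts x. elts y \<subseteq> elts x) \<and> (\<forall>y\<in>elts x. \<forall>z\<in>elts y. elts z \<subseteq> elts y)"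

section \<open>Countable transitive models of ZFC\<close>

datatype fm = Mem nat nat | Eq nat nat | Neg fm | Conj fm fm | All nat fm

primrec sat :: "hc set \<Rightarrow> fm \<Rightarrow> (nat \<Rightarrow> hc) \<Rightarrow> bool" where
  "sat M (Mem i j) e \<longleftrightarrow> e i \<in> elts (e j)"
| "sat M (Eq i j) e \<longleftrightarrow> e i = e j"
| "sat M (Neg p) e \<longleftrightarrow> \<not> sat M p e"
| "sat M (Conj p q) e \<longleftrightarrow> sat M p e \<and> sat M q e"
| "sat M (All i p) e \<longleftrightarrow> (\<forall>x\<in>M. sat M p (e(i := x)))"

definition Extensionality_ax :: "hc set \<Rightarrow> bool" where
  "Extensionality_ax M \<longleftrightarrow> (\<forall>x\<in>M. \<forall>y\<in>M. (\<forall>z\<in>M. z \<in> elts x \<longleftrightarrow> z \<in> elts y) \<longrightarrow> x = y)"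

definition Foundation_ax :: "hc set \<Rightarrow> bool" where
  "Foundation_ax M \<longleftrightarrow> (\<forall>x\<in>M. (\<exists>y\<in>M. y \<in> elts x) \<longrightarrow>
     (\<exists>y\<in>M. y \<in> elts x \<and> (\<forall>z\<in>M. \<not> (z \<in> elts x \<and> z \<in> elts y))))"

definition Pairing_ax :: "hc set \<Rightarrow> bool" where
  "Pairing_ax M \<longleftrightarrow> (\<forall>x\<in>M. \<forall>y\<in>M. \<exists>z\<in>M. \<forall>w\<in>M. w \<in> elts z \<longleftrightarrow> w = x \<or> w = y)"

definition Union_ax :: "hc set \<Rightarrow> bool" where
  "Union_ax M \<longleftrightarrow> (\<forall>x\<in>M. \<exists>u\<in>M. \<forall>z\<in>M. z \<in> elts u \<longleftrightarrow> (\<exists>y\<in>M. y \<in> elts x \<and> z \<in> elts y))"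

definition Powerset_ax :: "hc set \<Rightarrow> bool" where
  "Powerset_ax M \<longleftrightarrow>
     (\<forall>x\<in>M. \<exists>p\<in>M. \<forall>y\<in>M. y \<in> elts p \<longleftrightarrow> (\<forall>z\<in>M. z \<in> elts y \<longrightarrow> z \<in> elts x))"

definition Infinity_ax :: "hc set \<Rightarrow> bool" where
  "Infinity_ax M \<longleftrightarrow> (\<exists>w\<in>M. (\<exists>x\<in>M. x \<in> elts w \<and> (\<forall>z\<in>M. z \<notin> elts x)) \<and>
     (\<forall>x\<in>M. x \<in> elts w \<longrightarrow> (\<exists>y\<in>M. y \<in> elts w \<and> (\<forall>z\<in>M. z \<in> elts y \<longleftrightarrow> z \<in> elts x \<or> z = x))))"

(* In the two schemas, the variables other than 0 (and 1) of p serve as parameters. *)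
definition Separation_ax :: "hc set \<Rightarrow> bool" where
  "Separation_ax M \<longleftrightarrow> (\<forall>p e. (\<forall>i. e i \<in> M) \<longrightarrow>
     (\<forall>x\<in>M. \<exists>y\<in>M. \<forall>z\<in>M. z \<in> elts y \<longleftrightarrow> z \<in> elts x \<and> sat M p (e(0 := z))))"

definition Replacement_ax :: "hc set \<Rightarrow> bool" where
  "Replacement_ax M \<longleftrightarrow> (\<forall>p e. (\<forall>i. e i \<in> M) \<longrightarrow>
     (\<forall>a\<in>M. (\<forall>x\<in>M. x \<in> elts a \<longrightarrow> (\<exists>!y. y \<in> M \<and> sat M p (e(0 := x, 1 := y)))) \<longrightarrow>
       (\<exists>b\<in>M. \<forall>x\<in>M. x \<in> elts a \<longrightarrow> (\<exists>y\<in>M. y \<in> elts b \<and> sat M p (e(0 := x, 1 := y))))))"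

definition Choice_ax :: "hc set \<Rightarrow> bool" where
  "Choice_ax M \<longleftrightarrow> (\<forall>a\<in>M.
     (\<forall>x\<in>M. x \<in> elts a \<longrightarrow> (\<exists>z\<in>M. z \<in> elts x)) \<and>
     (\<forall>x\<in>M. \<forall>y\<in>M. x \<in> elts a \<and> y \<in> elts a \<and> x \<noteq> y \<longrightarrow> (\<forall>z\<in>M. \<not> (z \<in> elts x \<and> z \<in> elts y))) \<longrightarrow>
     (\<exists>c\<in>M. \<forall>x\<in>M. x \<in> elts a \<longrightarrow> (\<exists>!z. z \<in> M \<and> z \<in> elts x \<and> z \<in> elts c)))"

definition models_ZFC :: "hc set \<Rightarrow> bool" where
  "models_ZFC M \<longleftrightarrow> Extensionality_ax M \<and> Foundation_ax M \<and> Pairing_ax M \<and> Union_ax M \<and>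
     Powerset_ax M \<and> Infinity_ax M \<and> Separation_ax M \<and> Replacement_ax M \<and> Choice_ax M"

definition ctm :: "hc set \<Rightarrow> bool" where
  "ctm M \<longleftrightarrow> countable M \<and> (\<forall>x\<in>M. elts x \<subseteq> M) \<and> models_ZFC M"

section \<open>Cardinals, GCH and reals of a model\<close>

(* From here on, notions that are absolute for transitive models of ZFC (pairs, functions,
   ordinals, omega, unions, finite sets) are used as such; the others are relativised to M. *)

definition is_cardinal :: "hc set \<Rightarrow> hc \<Rightarrow> bool" where
  "is_cardinal M k \<longleftrightarrow> k \<in> M \<and> is_ordinal k \<and> (\<forall>a\<in>elts k. \<not> (\<exists>f\<in>M. is_bijection f a k))"

definition is_successor_cardinal :: "hc set \<Rightarrow> hc \<Rightarrow> hc \<Rightarrow> bool" where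
  "is_successor_cardinal M k l \<longleftrightarrow> is_cardinal M l \<and> k \<in> elts l \<and>
     (\<forall>m. is_cardinal M m \<and> k \<in> elts m \<longrightarrow> elts l \<subseteq> elts m)"

definition hPow :: "hc set \<Rightarrow> hc \<Rightarrow> hc" where
  "hPow M x = HSet {y \<in> M. elts y \<subseteq> elts x}"

definition GCH :: "hc set \<Rightarrow> bool" where
  "GCH M \<longleftrightarrow> (\<forall>k l. is_cardinal M k \<and> elts homega \<subseteq> elts k \<and> is_successor_cardinal M k l \<longrightarrow>
     (\<exists>f\<in>M. is_bijection f (hPow M k) l))"

definition reals_of :: "hc set \<Rightarrow> hc set" where
  "reals_of M = {x \<in> M. elts x \<subseteq> elts homega}"

section \<open>Normal measures and the Mitchell order\<close>

definition normal_measure :: "hc set \<Rightarrow> hc \<Rightarrow> hc \<Rightarrow> bool" where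
  "normal_measure M k U \<longleftrightarrow>
     is_cardinal M k \<and> homega \<in> elts k \<and>
     \<comment> \<open>a nonprincipal ultrafilter on k\<close>
     U \<in> M \<and> (\<forall>X\<in>elts U. elts X \<subseteq> elts k) \<and>
     k \<in> elts U \<and> hempty \<notin> elts U \<and>
     (\<forall>X\<in>elts U. \<forall>Y\<in>elts U. HSet (elts X \<inter> elts Y) \<in> elts U) \<and>
     (\<forall>X\<in>elts U. \<forall>Y\<in>M. elts X \<subseteq> elts Y \<and> elts Y \<subseteq> elts k \<longrightarrow> Y \<in> elts U) \<and>
     (\<forall>X\<in>M. elts X \<subseteq> elts k \<longrightarrow> X \<in> elts U \<or> HSet (elts k - elts X) \<in> elts U) \<and>
     (\<forall>a\<in>elts k. HSet {a} \<notin> elts U) \<and>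
     \<comment> \<open>k-completeness\<close>
     (\<forall>g\<in>elts k. \<forall>s\<in>M. fun_on s g \<and> (\<forall>x\<in>elts g. happ s x \<in> elts U) \<longrightarrow>
        HSet {a \<in> elts k. \<forall>x\<in>elts g. a \<in> elts (happ s x)} \<in> elts U) \<and>
     \<comment> \<open>normality: closure under diagonal intersections\<close>
     (\<forall>s\<in>M. fun_on s k \<and> (\<forall>x\<in>elts k. happ s x \<in> elts U) \<longrightarrow>
        HSet {a \<in> elts k. \<forall>x\<in>elts a. a \<in> elts (happ s x)} \<in> elts U)"

(* x belongs to (the transitive collapse of) the ultrapower of M by W.  The map pi sends each
   f : k -> M in M to the collapse of its class; functions equal modulo W have the same
   image by extensionality. *)
definition in_ultrapower :: "hc set \<Rightarrow> hc \<Rightarrow> hc \<Rightarrow> hc \<Rightarrow> bool" where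
  "in_ultrapower M k W x \<longleftrightarrow>
     (let F = {f \<in> M. fun_on f k};
          E = (\<lambda>g f. HSet {a \<in> elts k. happ g a \<in> elts (happ f a)} \<in> elts W)
      in \<exists>\<pi>. (\<forall>f\<in>F. \<pi> f = HSet (\<pi> ` {g \<in> F. E g f})) \<and> x \<in> \<pi> ` F)"

definition mitchell_less :: "hc set \<Rightarrow> hc \<Rightarrow> hc \<Rightarrow> hc \<Rightarrow> bool" where
  "mitchell_less M k U W \<longleftrightarrow>
     normal_measure M k U \<and> normal_measure M k W \<and> in_ultrapower M k W U"

(* o(k) = a in M, where o(U) = sup {o(U') + 1 | U' below U} is the rank of U in the Mitchell order
   and o(k) = sup {o(U) + 1 | U a normal measure on k}.  In particular o(k) = 0 if k is not
   measurable. *)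
definition mitchell_order :: "hc set \<Rightarrow> hc \<Rightarrow> hc \<Rightarrow> bool" where
  "mitchell_order M k a \<longleftrightarrow>
     (\<exists>\<rho>. (\<forall>U. normal_measure M k U \<longrightarrow> \<rho> U = hUnion {hsucc (\<rho> U') |U'. mitchell_less M k U' U}) \<and>
          a = hUnion {hsucc (\<rho> U) |U. normal_measure M k U})"

section \<open>Forcing\<close>

(* a preorder with a largest element *)
definition forcing_notion :: "hc set \<Rightarrow> (hc \<Rightarrow> hc \<Rightarrow> bool) \<Rightarrow> bool" where
  "forcing_notion P le \<longleftrightarrow>
     (\<forall>p\<in>P. le p p) \<and> (\<forall>p\<in>P. \<forall>q\<in>P. \<forall>r\<in>P. le p q \<longrightarrow> le q r \<longrightarrow> le p r) \<and> (\<exists>t\<in>P. \<forall>p\<in>P. le p t)"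

definition generic_filter :: "hc set \<Rightarrow> hc set \<Rightarrow> (hc \<Rightarrow> hc \<Rightarrow> bool) \<Rightarrow> hc set \<Rightarrow> bool" where
  "generic_filter M P le G \<longleftrightarrow>
     G \<subseteq> P \<and> G \<noteq> {} \<and>
     (\<forall>p\<in>G. \<forall>q\<in>P. le p q \<longrightarrow> q \<in> G) \<and>
     (\<forall>p\<in>G. \<forall>q\<in>G. \<exists>r\<in>G. le r p \<and> le r q) \<and>
     (\<forall>D\<in>M. elts D \<subseteq> P \<and> (\<forall>p\<in>P. \<exists>q\<in>elts D. le q p) \<longrightarrow> G \<inter> elts D \<noteq> {})"

inductive is_name :: "hc set \<Rightarrow> hc \<Rightarrow> bool" for P where
  "(\<And>x. x \<in> elts t \<Longrightarrow> \<exists>s p. x = pair s p \<and> p \<in> P \<and> is_name P s) \<Longrightarrow> is_name P t"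

function val :: "hc set \<Rightarrow> hc \<Rightarrow> hc" where
  "val G t = HSet (val G ` {s. \<exists>p\<in>G. pair s p \<in> elts t})"
  by auto
termination
proof (relation "inv_image ({(x, y). x \<in> elts y}\<^sup>+) snd")
  show "wf (inv_image ({(x, y). x \<in> elts y}\<^sup>+) (snd :: hc set \<times> hc \<Rightarrow> hc))"
    by (intro wf_inv_image wf_trancl wf_elts)
qed (auto intro: pair_fst_trancl)

declare val.simps [simp del]

(* M[G] *)
definition gen_ext :: "hc set \<Rightarrow> hc set \<Rightarrow> hc set \<Rightarrow> hc set" where
  "gen_ext M P G = {val G t |t. t \<in> M \<and> is_name P t}"

definition is_generic_extension :: "hc set \<Rightarrow> hc set \<Rightarrow> bool" where
  "is_generic_extension M N \<longleftrightarrow>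
     (\<exists>P\<in>M. \<exists>L\<in>M. \<exists>G. let le = (\<lambda>p q. pair p q \<in> elts L) in
        forcing_notion (elts P) le \<and> generic_filter M (elts P) le G \<and> N = gen_ext M (elts P) G)"

(* finite partial functions from I x omega to 2, ordered by reverse inclusion *)
definition Cohen :: "hc \<Rightarrow> hc set" where
  "Cohen I = {f. finite (elts f) \<and>
     (\<forall>z\<in>elts f. \<exists>i\<in>elts I. \<exists>n. \<exists>b\<in>{0, 1}. z = pair (pair i (hnat n)) (hnat b)) \<and>
     (\<forall>x y y'. pair x y \<in> elts f \<and> pair x y' \<in> elts f \<longrightarrow> y = y')}"

definition Cohen_le :: "hc \<Rightarrow> hc \<Rightarrow> bool" where
  "Cohen_le p q \<longleftrightarrow> elts q \<subseteq> elts p"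

definition Cohen_generic :: "hc set \<Rightarrow> hc \<Rightarrow> hc set \<Rightarrow> bool" where
  "Cohen_generic M I G \<longleftrightarrow> generic_filter M (Cohen I) Cohen_le G"

end

theory Submission
  imports Defs "HOL-Library.Multiset"
begin

text \<open>Only the following consequence of the hypothesis is used: the cardinals below \<open>\<kappa>\<close> that carry a
  normal measure are unbounded in \<open>\<kappa>\<close>. Indeed the Mitchell order of \<open>k\<close> is bounded by a cardinal that
  depends on \<open>k\<close> only, since the ultrapower by a measure represents the smaller measures by functions.

  Let \<open>J\<close> be a set of such cardinals, unbounded in \<open>\<kappa>\<close>, bounded below each of its elements. A condition of
  the first forcing is a finite choice of points \<open>\<nu>(\<delta>) < \<delta>\<close> for \<open>\<delta> \<in> J\<close> with a set of measure one
  for every \<open>\<delta>\<close>, from which the later points are chosen. Adding the points in increasing order, one proves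
  the Prikry property, so a subset of \<open>\<lambda>\<close> in the extension is read off a ground set along the stems with
  domain in \<open>\<lambda> + 1\<close>; hence there are no new reals, and cardinals and GCH are preserved. By genericity
  \<open>\<nu>(\<delta>)\<close> avoids all but finitely many sets of a ground sequence of sets of measure zero.

  The second forcing consists of functions \<open>q\<close> from ordinals below \<open>\<kappa>\<^sup>+\<close> to \<open>\<kappa> \<times> \<kappa>\<close> that are
  finite-to-one on countable sets of the ground model. To meet fewer than \<open>\<kappa>\<close> dense sets one takes the
  \<open>\<delta>\<close>-th extension with domain between \<open>e(\<nu>(\<delta>))\<close> and \<open>e(\<nu>(\<delta>)+1)\<close> for a fast ground function \<open>e\<close>
  and fills the gaps injectively: a countable ground set meets only finitely many of these blocks, so
  the union is a condition. So no new sequences of length at most \<open>\<kappa>\<close> are added; this gives \<open>V\<^sub>1\<close> and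
  a map \<open>F\<close> on \<open>\<kappa>\<^sup>+\<close>.

  Finally let \<open>x\<^sub>a\<close>, \<open>a < \<kappa>\<^sup>+\<close>, be distinct subsets of \<open>\<kappa>\<close> in the ground model, and let \<open>y\<^sub>a(n)\<close>
  code \<open>x\<^sub>a \<inter> \<kappa>\<^sub>n\<close>. In a Cohen generic function over \<open>V\<^sub>1\<close>, column \<open>F(a)\<close> has value 1 for the first time at
  some \<open>n\<close>, and the \<open>a\<close>-th bit of the new sequence is the value of the column of \<open>y\<^sub>a(n)\<close> at \<open>n\<close>.
  A dense subset of \<open>\<C>(\<kappa>\<^sup>+)\<close> in the ground model is determined by finite conditions on a countable
  ground set \<open>I\<close>; there \<open>F\<close> is finite-to-one and the codes are eventually different, so a
  condition can be extended to control finitely many bits on \<open>I\<close> without disturbing the others.\<close>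

text \<open>Inside V no map from the successor of \<kappa> into a set of size \<kappa> can serve as
  F: some fibre is infinite, so it contains an infinite countable set of V. The first extension
  supplies, without new reals, infinitely many points \<nu>(\<delta>) that meet each countable
  ground set in a finite set. Hiding the arbitrary parts of a condition in the corresponding blocks
  is what makes the second forcing distributive, although it is not even countably closed. Up to
  \<theta> blocks are required inside one d below \<kappa>, so d is taken as a measurable limit of
  measurable cardinals; Mitchell order at least 2 yields such d.

  When a bit is read, F(a) only determines the position n; the value comes from a column named by a
  code of a. At a fixed n the codes take fewer than \<kappa> values and must coincide for many a,
  but n can be postponed until the finitely many a under consideration have different codes.

  All sets in use must be shown to belong to a countable transitive model. Definability is treated
  semantically, by closure rules for predicates on environments, which takes the place of explicit
  formulas.\<close>

notation elts ("$_" [1000] 1000) and iff (infixr "<->" 25)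

section \<open>Definability over a transitive model\<close>

definition Sep :: "hc => (hc => bool) => hc" where "Sep a P = HSet {x:$a. P x}"
definition Img :: "hc => (hc => hc) => hc" where "Img a F = HSet (F ` $a)"
definition lam :: "hc => (hc => hc) => hc" where "lam a F = Img a (%x. pair x (F x))"
definition Upr :: "hc => hc => hc" where "Upr x y = HSet {x, y}"
definition UU :: "hc => hc" where "UU a = HSet (\<Union>x\<in>$a. $x)"

lemma elts_Sep [simp]: "$(Sep a P) = {x:$a. P x}"
 unfolding Sep_def by (rule elts_HSet) (rule countable_subset[OF _ countable_elts[of a]], auto)
lemma elts_Img [simp]: "$(Img a F) = F ` $a"
 unfolding Img_def by (rule elts_HSet) simp
lemma elts_lam [simp]: "$(lam a F) = (%x. pair x (F x)) ` $a"
 by (simp add: lam_def)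
lemma elts_Upr [simp]: "$(Upr x y) = {x, y}"
 unfolding Upr_def by (rule elts_HSet) (simp add: countable_finite)
lemma elts_UU [simp]: "$(UU a) = (\<Union>x\<in>$a. $x)"
 unfolding UU_def by (rule elts_HSet) simp
lemma elts_hempty [simp]: "$hempty = {}" by (simp add: hempty_def)
lemma elts_hsucc [simp]: "$(hsucc x) = insert x $x" by (simp add: hsucc_def)
lemma pair_Upr: "pair x y = Upr (Upr x x) (Upr x y)" by (simp add: pair_def Upr_def)
lemma hc_eqI: "$x = $y ==> x = y" by (simp add: elts_inject)
lemma UU_single: "$A = {y} ==> UU A = y" by (rule hc_eqI) simp
lemma hsucc_UU: "hsucc x = UU (Upr x (Upr x x))" by (rule hc_eqI) auto

lemma pair_inj [simp]: "pair x y = pair x' y' <-> x = x' & y = y'" by (rule pair_inject)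

text \<open>The union of the set of all values at \<open>x\<close>: a total term built from set
  operations, so its closure and definability follow from those of its parts. On the domain of a
  function it agrees with \<open>happ\<close>.\<close>

definition ap :: "hc => hc => hc" where
 "ap f x = UU (Sep (UU (UU f)) (%y. pair x y:$f))"

lemma pair_in_UU: "pair x y:$f ==> x:$(UU (UU f)) & y:$(UU (UU f))"
proof -
 assume "pair x y:$f"
 moreover have "Upr x y:$(pair x y)" by (simp add: pair_Upr)
 ultimately show ?thesis by (metis UN_I elts_UU elts_Upr insertI1 insertI2)
qed

lemma ap_eq: assumes "!!y'. pair x y':$f <-> y' = y" shows "ap f x = y"
proof -
 have "y:$(UU (UU f))" using assms pair_in_UU by blast
 hence "$(Sep (UU (UU f)) (%y. pair x y:$f)) = {y}" using assms by auto
 thus ?thesis unfolding ap_def by (rule UU_single)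
qed

lemma ap_lam [simp]: "x:$a ==> ap (lam a F) x = F x"
 by (rule ap_eq) auto

lemma fun_on_ap: "fun_on f A ==> x:$A ==> pair x y:$f <-> y = ap f x"
proof -
 assume f: "fun_on f A" and x: "x:$A"
 then obtain y0 where y0: "!!y'. pair x y':$f <-> y' = y0" unfolding fun_on_def by blast
 with ap_eq[OF y0] show ?thesis by simp
qed

lemma fun_on_happ: "fun_on f A ==> x:$A ==> happ f x = ap f x"
 unfolding happ_def by (rule the_equality) (auto simp: fun_on_ap)

lemma fun_on_lam [simp]: "fun_on (lam A F) A" by (auto simp: fun_on_def)

lemma fun_on_eq: "fun_on f A ==> f = lam A (ap f)"
proof (rule hc_eqI, rule set_eqI)
 fix z assume f: "fun_on f A"
 show "z:$f <-> z:$(lam A (ap f))"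
 proof
  assume "z:$f"
  with f obtain x y where "x:$A" "z = pair x y" unfolding fun_on_def by blast
  with \<open>z:$f\<close> fun_on_ap[OF f] show "z:$(lam A (ap f))" by auto
 qed (use fun_on_ap[OF f] in auto)
qed

lemma lam_cong: "(!!x. x:$a ==> F x = G x) ==> lam a F = lam a G"
 by (rule hc_eqI) auto

text \<open>Bound variables are renamed along with free ones; satisfaction under an injective
  renaming is then composition of the environment with it (\<open>sat_ren\<close>).\<close>

primrec ren :: "(nat => nat) => fm => fm" where
 "ren f (Mem i j) = Mem (f i) (f j)"
| "ren f (Eq i j) = Eq (f i) (f j)"
| "ren f (Neg p) = Neg (ren f p)"
| "ren f (Conj p q) = Conj (ren f p) (ren f q)"
| "ren f (All i p) = All (f i) (ren f p)"

lemma sat_ren: "inj f ==> sat M (ren f p) e = sat M p (e \<circ> f)"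
proof (induction p arbitrary: e)
 case (All i p)
 have "(e(f i := x)) \<circ> f = (e \<circ> f)(i := x)" for x
  using All.prems by (auto simp: fun_eq_iff inj_eq)
 thus ?case using All by (simp del: fun_upd_apply comp_apply)
qed auto

text \<open>Even positions carry the arguments of a predicate, odd positions its parameters. Both
  supplies are infinite, which leaves room for joining the parameters of two formulas.\<close>

definition mrg :: "(nat => hc) => (nat => hc) => nat => hc" where
 "mrg e c i = (if even i then e (i div 2) else c (i div 2))"

lemma mrg_simps [simp]: "mrg e c (2*i) = e i" "mrg e c (Suc (2*i)) = c i"
 by (auto simp: mrg_def)

text \<open>Choice is split off: the forcing theorem and the other axioms of the extension are
  proved over \<open>tm\<close>, and \<open>tmc\<close> adds choice.\<close>

definition zf_model :: "hc set => bool" where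
 "zf_model M <-> countable M & (ALL x:M. $x <= M) & Extensionality_ax M & Foundation_ax M & Pairing_ax M &
  Union_ax M & Powerset_ax M & Infinity_ax M & Separation_ax M & Replacement_ax M"

lemma ctm_iff: "ctm M <-> zf_model M & Choice_ax M"
 by (auto simp: ctm_def models_ZFC_def zf_model_def)

locale tm =
 fixes M :: "hc set"
 assumes zf: "zf_model M"
begin

lemma axs: "Extensionality_ax M" "Foundation_ax M" "Pairing_ax M" "Union_ax M" "Powerset_ax M" "Infinity_ax M"
  "Separation_ax M" "Replacement_ax M" using zf by (auto simp: zf_model_def)
lemma countable_M: "countable M" using zf by (simp add: zf_model_def)
lemma trans: "x:M ==> y:$x ==> y:M" using zf by (auto simp: zf_model_def)
lemma M_ext: "x:M ==> y:M ==> (!!z. z:M ==> z:$x <-> z:$y) ==> x = y"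
 by (rule hc_eqI) (use trans in blast)

definition env :: "(nat => hc) => bool" where "env e <-> (ALL i. e i:M)"

lemma env_Suc [simp]: "env e ==> env (%i. e (Suc i))" by (simp add: env_def)
lemma env_f [simp]: "env e ==> env (%i. e (f i))" by (simp add: env_def)
lemma env_case [simp]: "env e ==> x:M ==> env (case_nat x e)"
 by (simp add: env_def split: nat.split)

text \<open>Definability with parameters as a property of HOL predicates on environments. The newest
  variable is \<open>e 0\<close>, and \<open>%i. e (Suc i)\<close> is the environment outside its
  binder; the rules \<open>dfi\<close> then follow the shape of the predicate.\<close>

definition df :: "((nat => hc) => bool) => bool" where
 "df R <-> (EX p c. env c & (ALL e. env e --> sat M p (mrg e c) = R e))"

definition dt :: "((nat => hc) => hc) => bool" where
 "dt t <-> (ALL e. env e --> t e:M) & df (%e. e 0 = t (%i. e (Suc i)))"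

named_theorems dfi

lemma nonempty_M: "EX x. x:M" using axs(6) by (auto simp: Infinity_ax_def)

lemma env_ex: "EX e. env e" using nonempty_M by (auto simp: env_def)

lemma df_cong: "(!!e. env e ==> R e = S e) ==> df R = df S"
 by (simp add: df_def cong: conj_cong)

lemma df_cong': "df R ==> (!!e. env e ==> R e = S e) ==> df S"
 using df_cong by blast

lemma df_memv: "df (%e. e i:$(e j))"
proof -
 obtain c where "env c" using env_ex ..
 thus ?thesis unfolding df_def by (intro exI[of _ "Mem (2*i) (2*j)"] exI[of _ c]) simp
qed

lemma df_eqv: "df (%e. e i = e j)"
proof -
 obtain c where "env c" using env_ex ..
 thus ?thesis unfolding df_def by (intro exI[of _ "Eq (2*i) (2*j)"] exI[of _ c]) simp
qed

lemma df_eqc: "a:M ==> df (%e. e i = a)"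
 unfolding df_def by (intro exI[of _ "Eq (2*i) (Suc 0)"] exI[of _ "%_. a"]) (auto simp: env_def mrg_def)

lemma df_not [dfi]: "df R ==> df (%e. ~ R e)"
 unfolding df_def by (metis sat.simps(3))

lemma df_conj [dfi]: assumes "df R" "df S" shows "df (%e. R e & S e)"
proof -
 obtain p c where p: "env c" "!!e. env e ==> sat M p (mrg e c) = R e" using assms(1) by (auto simp: df_def)
 obtain q d where q: "env d" "!!e. env e ==> sat M q (mrg e d) = S e" using assms(2) by (auto simp: df_def)
 define f where "f i = (if even i then i else Suc (2 * (2 * (i div 2))))" for i :: nat
 define g where "g i = (if even i then i else Suc (2 * (Suc (2 * (i div 2)))))" for i :: nat
 have inj: "inj f" "inj g" unfolding inj_on_def f_def g_def by (auto split: if_splits elim!: oddE evenE; presburger)+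
 have mf: "mrg e (mrg c d) \<circ> f = mrg e c" for e
  by (rule ext) (auto simp: f_def mrg_def elim!: oddE)
 have mg: "mrg e (mrg c d) \<circ> g = mrg e d" for e
  by (rule ext) (auto simp: g_def mrg_def elim!: oddE)
 have "env (mrg c d)" using p(1) q(1) by (simp add: env_def mrg_def)
 moreover have "sat M (Conj (ren f p) (ren g q)) (mrg e (mrg c d)) = (R e & S e)" if "env e" for e
  using that p q by (simp add: sat_ren inj mf mg)
 ultimately show ?thesis unfolding df_def by blast
qed

lemma df_ren: assumes "df R" "inj f" shows "df (%e. R (%i. e (f i)))"
proof -
 obtain p c where p: "env c" "!!e. env e ==> sat M p (mrg e c) = R e" using assms(1) by (auto simp: df_def)
 define g where "g i = (if even i then 2 * f (i div 2) else i)" for i :: nat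
 have inj: "inj g" unfolding inj_on_def g_def
  by (auto split: if_splits elim!: evenE simp: inj_eq[OF assms(2)])
 have "mrg e c \<circ> g = mrg (%i. e (f i)) c" for e
  by (rule ext) (auto simp: g_def mrg_def)
 hence "sat M (ren g p) (mrg e c) = R (%i. e (f i))" if "env e" for e
  using that p by (simp add: sat_ren inj)
 thus ?thesis unfolding df_def using p(1) by blast
qed

lemma df_all: assumes "df (%e. R (e 0) (%i. e (Suc i)))" shows "df (%e. ALL x:M. R x e)"
proof -
 obtain p c where p: "env c" "!!e. env e ==> sat M p (mrg e c) = R (e 0) (%i. e (Suc i))"
  using assms(1) by (auto simp: df_def)
 \<comment> \<open>The quantified variable goes to the first parameter slot, which a dummy
   \<open>a\<close> keeps free; the other arguments move down by one slot and the parameters up by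
   one.\<close>
 define f where "f i = (if i = 0 then Suc 0 else if even i then i - 2 else i + 2)" for i :: nat
 have inj: "inj f" unfolding inj_on_def f_def by (auto split: if_splits elim!: evenE; presburger)
 have eq: "mrg e (case_nat x c) \<circ> f = mrg (case_nat x e) c" for x e
 proof
  fix i
  consider "i = 0" | j where "i = 2 * Suc j" | j where "i = Suc (2*j)"
   by (metis evenE oddE Suc_eq_plus1 not0_implies_Suc mult_0_right)
  thus "(mrg e (case_nat x c) \<circ> f) i = mrg (case_nat x e) c i"
  proof cases
   case 1 thus ?thesis by (simp add: f_def mrg_def)
  next
   case 2 thus ?thesis by (simp add: f_def mrg_def)
  next
   case 3
   hence "f i = Suc (2 * Suc j)" by (simp add: f_def)
   thus ?thesis using 3 by (simp only: comp_apply mrg_simps) simp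
  qed
 qed
 obtain a where a: "a:M" using nonempty_M ..
 have up: "(mrg e (case_nat a c))(Suc 0 := x) = mrg e (case_nat x c)" for e x
  by (rule ext) (auto simp: mrg_def elim!: oddE split: nat.split)
 have "env (case_nat a c)" using p(1) a by simp
 moreover have "sat M (All (Suc 0) (ren f p)) (mrg e (case_nat a c)) = (ALL x:M. R x e)" if "env e" for e
  using that p by (simp add: up sat_ren[OF inj] eq)
 ultimately show ?thesis unfolding df_def by blast
qed

lemma df_disj [dfi]: assumes "df R" "df S" shows "df (%e. R e \<or> S e)"
proof -
 have "df (%e. ~ (~ R e & ~ S e))" by (intro df_not df_conj assms)
 thus ?thesis by simp
qed
lemma df_imp [dfi]: assumes "df R" "df S" shows "df (%e. R e --> S e)"
proof -
 have "df (%e. ~ R e \<or> S e)" by (intro df_disj df_not assms)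
 thus ?thesis by (rule df_cong') blast
qed
lemma df_iff [dfi]: assumes "df R" "df S" shows "df (%e. R e <-> S e)"
proof -
 have "df (%e. (R e --> S e) & (S e --> R e))" by (intro df_conj df_imp assms)
 thus ?thesis by (rule df_cong') blast
qed
lemma df_ex: assumes "df (%e. R (e 0) (%i. e (Suc i)))" shows "df (%e. EX x:M. R x e)"
proof -
 have "df (%e. ~ (ALL x:M. ~ R x e))" by (intro df_not df_all assms)
 thus ?thesis by simp
qed
lemmas [dfi] = df_all df_ex

lemma df_const [dfi]: "df (%e. b)"
 using df_eqv[of 0 0] df_not[OF df_eqv[of 0 0]] by (cases b) auto

lemma dt_M: "dt t ==> env e ==> t e:M" by (simp add: dt_def)

lemma dt_eq:
 assumes "dt t" "k < n" shows "df (%e. e k = t (%i. e (i + n)))"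
proof -
 have "inj (case_nat k (%i. i + n))" using assms(2) by (auto simp: inj_on_def split: nat.splits)
 from df_ren[OF _ this, of "%e. e 0 = t (%i. e (Suc i))"] assms(1) show ?thesis by (simp add: dt_def)
qed

lemma dt_var [dfi]: "dt (%e. e i)" unfolding dt_def using df_eqv[of 0 "Suc i"] by (auto simp: env_def)
lemma dt_const [dfi]: "a:M ==> dt (%e. a)" unfolding dt_def using df_eqc by auto

lemma dt_ren: assumes "dt t" "inj f" shows "dt (%e. t (%i. e (f i)))"
proof -
 have "inj (case_nat 0 (%i. Suc (f i)))" by (auto intro!: injI simp: inj_eq[OF assms(2)] split: nat.splits)
 from df_ren[OF _ this, of "%e. e 0 = t (%i. e (Suc i))"] assms(1) show ?thesis by (simp add: dt_def)
qed

lemma dt_Suc [dfi]: "dt t ==> dt (%e. t (%i. e (Suc i)))" using dt_ren[of t Suc] by simp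
lemma df_Suc: "df t ==> df (%e. t (%i. e (Suc i)))" using df_ren[of t Suc] by simp

lemma df_app1: assumes P: "df (%e. P (e 0))" and t: "dt t" shows "df (%e. P (t e))"
proof -
 have "df (%e. EX x:M. x = t e & P x)" by (intro dfi) (use dt_eq[OF t, of 0 1] P in auto)
 thus ?thesis by (rule df_cong') (use dt_M t in auto)
qed

lemma df_app2: assumes P: "df (%e. P (e 0) (e (Suc 0)))" and t: "dt t" "dt s" shows "df (%e. P (t e) (s e))"
proof -
 have "df (%e. EX y:M. EX x:M. x = t e & y = s e & P x y)"
  by (intro dfi) (use dt_eq[OF t(1), of 0 2] dt_eq[OF t(2), of 1 2] P in simp_all)
 thus ?thesis by (rule df_cong') (use dt_M t in auto)
qed

lemma df_app3: assumes P: "df (%e. P (e 0) (e (Suc 0)) (e (Suc (Suc 0))))" and t: "dt t" "dt s" "dt u"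
 shows "df (%e. P (t e) (s e) (u e))"
proof -
 have "df (%e. EX z:M. EX y:M. EX x:M. x = t e & y = s e & z = u e & P x y z)"
  by (intro dfi) (use dt_eq[OF t(1), of 0 3] dt_eq[OF t(2), of 1 3] dt_eq[OF t(3), of 2 3] P in
   \<open>simp_all add: numeral_eq_Suc\<close>)
 thus ?thesis by (rule df_cong') (use dt_M t in auto)
qed

lemma df_app4: assumes P: "df (%e. P (e 0) (e (Suc 0)) (e (Suc (Suc 0))) (e (Suc (Suc (Suc 0)))))"
 and t: "dt t" "dt s" "dt u" "dt v"
 shows "df (%e. P (t e) (s e) (u e) (v e))"
proof -
 have "df (%e. EX w:M. EX z:M. EX y:M. EX x:M. x = t e & y = s e & z = u e & w = v e & P x y z w)"
  by (intro dfi) (use dt_eq[OF t(1), of 0 4] dt_eq[OF t(2), of 1 4] dt_eq[OF t(3), of 2 4] dt_eq[OF t(4), of 3 4] P in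
   \<open>simp_all add: numeral_eq_Suc\<close>)
 thus ?thesis by (rule df_cong') (use dt_M t in auto)
qed

lemma df_mem [dfi]: "dt s ==> dt t ==> df (%e. s e:$(t e))"
 by (rule df_app2[where P="%x y. x:$y"]) (rule df_memv)
lemma df_eq [dfi]: "dt s ==> dt t ==> df (%e. s e = t e)"
 by (rule df_app2[where P="(=)"]) (rule df_eqv)

lemma dt_app1: assumes "dt (%e. F (e 0))" and "dt t" shows "dt (%e. F (t e))"
proof -
 have "df (%e. e 0 = F (e (Suc 0)))" using assms(1) by (simp add: dt_def)
 from df_app2[where P="%x y. x = F y", OF this dt_var dt_Suc, OF assms(2)]
 show ?thesis using dt_M[OF assms(1), of "%_. _"] dt_M[OF assms(2)] by (auto simp: dt_def env_def)
qed

lemma dt_app2: assumes "dt (%e. F (e 0) (e (Suc 0)))" and "dt t" "dt s" shows "dt (%e. F (t e) (s e))"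
proof -
 have "df (%e. e 0 = F (e (Suc 0)) (e (Suc (Suc 0))))" using assms(1) by (simp add: dt_def)
 from df_app3[where P="%x y z. x = F y z", OF this dt_var dt_Suc dt_Suc, OF assms(2,3)]
 show ?thesis using dt_M[OF assms(1), of "case_nat _ (%_. _)"] dt_M[OF assms(2)] dt_M[OF assms(3)]
  by (auto simp: dt_def env_def split: nat.splits)
qed

lemma dt_app3: assumes "dt (%e. F (e 0) (e (Suc 0)) (e (Suc (Suc 0))))" and "dt t" "dt s" "dt u"
 shows "dt (%e. F (t e) (s e) (u e))"
proof -
 have "df (%e. e 0 = F (e (Suc 0)) (e (Suc (Suc 0))) (e (Suc (Suc (Suc 0)))))" using assms(1) by (simp add: dt_def)
 from df_app4[where P="%x y z w. x = F y z w", OF this dt_var dt_Suc dt_Suc dt_Suc, OF assms(2,3,4)]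
 show ?thesis using dt_M[OF assms(1), of "case_nat _ (case_nat _ (%_. _))"] dt_M[OF assms(2)] dt_M[OF assms(3)] dt_M[OF assms(4)]
  by (auto simp: dt_def env_def split: nat.splits)
qed

lemma df_ball [dfi]: assumes "dt t" "df (%e. R (e 0) (%i. e (Suc i)))" shows "df (%e. ALL x:$(t e). R x e)"
proof -
 have "df (%e. ALL x:M. x:$(t e) --> R x e)" by (intro dfi assms)
 thus ?thesis by (rule df_cong') (use dt_M[OF assms(1)] trans in blast)
qed

lemma df_bex [dfi]: assumes "dt t" "df (%e. R (e 0) (%i. e (Suc i)))" shows "df (%e. EX x:$(t e). R x e)"
proof -
 have "df (%e. ~ (ALL x:$(t e). ~ R x e))" by (intro df_not df_ball assms)
 thus ?thesis by simp
qed

text \<open>By extensionality the graph of a term is definable as soon as membership in its value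
  is.\<close>

lemma dtI:
 assumes "!!e. env e ==> t e:M" "df (%e. e 0:$(t (%i. e (Suc i))))" shows "dt t"
proof -
 have "inj (case_nat 0 (%i. Suc (Suc i)))" by (auto simp: inj_on_def split: nat.splits)
 from df_ren[OF assms(2) this] have "df (%e. e 0:$(t (%i. e (Suc (Suc i)))))" by simp
 from df_iff[OF df_mem[OF dt_var dt_var] this]
 have "df (%e. ALL x:M. x:$(e 0) <-> x:$(t (%i. e (Suc i))))"
  by (rule df_all)
 hence "df (%e. e 0 = t (%i. e (Suc i)))"
  by (rule df_cong') (use M_ext assms(1) env_def in auto)
 with assms(1) show ?thesis by (simp add: dt_def)
qed

section \<open>Closure of a model under definable operations\<close>

lemma M_elts: "z:M ==> S <= M ==> (!!w. w:M ==> w:$z <-> w:S) ==> $z = S"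
 using trans[of z] by (intro set_eqI iffI) (blast+)

lemma Sep_ax: assumes "env e" "x:M"
 shows "EX y:M. ALL z:M. z:$y <-> z:$x & sat M p (e(0 := z))"
 using axs(7) assms unfolding Separation_ax_def env_def by (elim allE[of _ p] allE[of _ e]) simp

lemma Sep_M: assumes "a:M" "df (%e. P (e 0))" shows "Sep a P:M"
proof -
 obtain p c where p: "env c" "!!e. env e ==> sat M p (mrg e c) = P (e 0)"
  using assms(2) by (auto simp: df_def)
 have up: "(mrg (%_. a) c)(0 := z) = mrg (case_nat z (%_. a)) c" for z
  by (rule ext) (auto simp: mrg_def elim!: evenE split: nat.split)
 have "env (mrg (%_. a) c)" using p(1) assms(1) by (auto simp: env_def mrg_def)
 from Sep_ax[OF this assms(1), of p]
 obtain y where y: "y:M" "ALL z:M. z:$y <-> z:$a & sat M p ((mrg (%_. a) c)(0 := z))" ..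
 have "y = Sep a P"
  by (rule hc_eqI, rule M_elts[OF y(1)])
   (use y(2) trans[OF assms(1)] assms(1) p(2) in "auto simp: up env_def split: nat.splits")
 with y show ?thesis by simp
qed

lemma Upr_M: assumes "x:M" "y:M" shows "Upr x y:M"
proof -
 obtain z where "z:M" "!!w. w:M ==> w:$z <-> w = x \<or> w = y"
  using axs(3)[unfolded Pairing_ax_def, rule_format, OF assms] by blast
 moreover have "z = Upr x y"
  by (rule hc_eqI, rule M_elts[OF calculation(1)]) (use assms calculation(2) in simp_all)
 ultimately show ?thesis by simp
qed

lemma UU_M: assumes "x:M" shows "UU x:M"
proof -
 obtain z where "z:M" "!!w. w:M ==> w:$z <-> (EX y:M. y:$x & w:$y)"
  using axs(4)[unfolded Union_ax_def, rule_format, OF assms] by blast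
 moreover have "z = UU x"
  by (rule hc_eqI, rule M_elts[OF calculation(1)]) (use assms calculation(2) trans in "simp_all, blast+")
 ultimately show ?thesis by simp
qed

lemma elts_hPow [simp]: "$(hPow M x) = {y:M. $y <= $x}"
 unfolding hPow_def by (rule elts_HSet) (rule countable_subset[OF _ countable_M], auto)

lemma hPow_M: assumes "x:M" shows "hPow M x:M"
proof -
 obtain p where "p:M" "!!y. y:M ==> y:$p <-> (ALL z:M. z:$y --> z:$x)"
  using axs(5)[unfolded Powerset_ax_def, rule_format, OF assms] by blast
 moreover have "p = hPow M x"
  by (rule hc_eqI, rule M_elts[OF calculation(1)]) (use assms calculation(2) trans in "simp_all, blast+")
 ultimately show ?thesis by simp
qed

lemma dt_Upr [dfi]: "dt s ==> dt t ==> dt (%e. Upr (s e) (t e))"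
 by (rule dt_app2[where F=Upr], rule dtI) (auto intro!: Upr_M dfi simp: env_def)

lemma dt_UU [dfi]: "dt t ==> dt (%e. UU (t e))"
 by (rule dt_app1[where F=UU], rule dtI) (auto intro!: UU_M dfi simp: env_def)

lemma df_subset [dfi]: "dt s ==> dt t ==> df (%e. $(s e) <= $(t e))"
 unfolding subset_iff Ball_def[symmetric] by (intro dfi)

lemma dt_hPow [dfi]: "dt t ==> dt (%e. hPow M (t e))"
proof (rule dt_app1[where F="hPow M"], rule dtI)
 have "df (%e. $(e 0) <= $(e (Suc 0)))" by (intro dfi)
 thus "df (%e. e 0:$(hPow M (e (Suc 0))))"
  by (rule df_cong') (simp add: env_def)
qed (auto intro!: hPow_M simp: env_def)

lemma dt_pair [dfi]: "dt s ==> dt t ==> dt (%e. pair (s e) (t e))"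
 unfolding pair_Upr by (intro dfi)
lemma dt_hsucc [dfi]: "dt t ==> dt (%e. hsucc (t e))"
 unfolding hsucc_UU by (intro dfi)

lemma pair_M: "x:M ==> y:M ==> pair x y:M" by (simp add: pair_Upr Upr_M)
lemma hsucc_M: "x:M ==> hsucc x:M" by (simp add: hsucc_UU Upr_M UU_M)
lemma pair_Md: "pair x y:M ==> x:M & y:M"
 by (metis UnCI elts_Upr insert_iff pair_Upr trans)

lemma dt_Sep [dfi]: assumes "dt t" "df (%e. R (e 0) (%i. e (Suc i)))" shows "dt (%e. Sep (t e) (%x. R x e))"
proof (rule dtI)
 show "df (%e. e 0:$(Sep (t (%i. e (Suc i))) (%x. R x (%i. e (Suc i)))))"
  unfolding elts_Sep mem_Collect_eq by (intro dfi assms)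
next
 fix e assume e: "env e"
 obtain p c where p: "env c" "!!e. env e ==> sat M p (mrg e c) = R (e 0) (%i. e (Suc i))"
  using assms(2) by (auto simp: df_def)
 have up: "(mrg (case_nat (t e) e) c)(0 := z) = mrg (case_nat z e) c" for z
  by (rule ext) (auto simp: mrg_def elim!: evenE split: nat.split)
 have "env (mrg (case_nat (t e) e) c)" using p(1) assms(1) e dt_M by (auto simp: env_def mrg_def split: nat.split)
 from Sep_ax[OF this dt_M[OF assms(1) e], of p]
 obtain y where y: "y:M" "ALL z:M. z:$y <-> z:$(t e) & sat M p ((mrg (case_nat (t e) e) c)(0 := z))" ..
 have "y = Sep (t e) (%x. R x e)"
  by (rule hc_eqI, rule M_elts[OF y(1)]) (use y(2) trans[OF dt_M[OF assms(1) e]] p(2) e in "auto simp: up")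
 with y show "Sep (t e) (%x. R x e):M" by simp
qed

lemma dt_Img [dfi]: assumes "dt t" "dt (%e. F (e 0) (%i. e (Suc i)))" shows "dt (%e. Img (t e) (%x. F x e))"
proof (rule dtI)
 have *: "dt (%e. F (e 0) (%i. e (Suc (Suc i))))"
 proof -
  have "inj (case_nat 0 (%i. Suc (Suc i)))" by (auto simp: inj_on_def split: nat.splits)
  from dt_ren[OF assms(2) this] show ?thesis by simp
 qed
 show "df (%e. e 0:$(Img (t (%i. e (Suc i))) (%x. F x (%i. e (Suc i)))))"
  unfolding elts_Img image_iff by (intro dfi assms *)
next
 fix e assume e: "env e"
 have "df (%e. e (Suc 0) = F (e 0) (%i. e (Suc (Suc i))))"
 proof -
  have "inj (case_nat 1 (case_nat 0 (%i. Suc (Suc i))))" by (auto simp: inj_on_def split: nat.splits)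
  from df_ren[OF _ this, of "%e. e 0 = F (e (Suc 0)) (%i. e (Suc (Suc i)))"] assms(2)
  show ?thesis by (simp add: dt_def)
 qed
 then obtain p c where p: "env c" "!!e. env e ==> sat M p (mrg e c) = (e (Suc 0) = F (e 0) (%i. e (Suc (Suc i))))"
  by (auto simp: df_def)
 \<comment> \<open>Replacement uses variables 0 and 1, but in an interleaved environment the second
   argument sits at position 2. Exchanging 1 and 2 adapts the formula.\<close>
 define f where "f i = (if i = 1 then 2 else if i = 2 then 1 else i)" for i :: nat
 have inj: "inj f" by (auto simp: inj_on_def f_def split: if_splits)
 define E where "E = mrg (case_nat (t e) (case_nat (t e) e)) c"
 have up: "E \<circ> f = E \<circ> f" ..
 have eq: "((E \<circ> f)(0 := x, Suc 0 := y)) \<circ> f = mrg (case_nat x (case_nat y e)) c" for x y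
 proof
  fix i :: nat
  consider "i = 0" | "i = 1" | "i = 2" | "i > 2" by linarith
  thus "(((E \<circ> f)(0 := x, Suc 0 := y)) \<circ> f) i = mrg (case_nat x (case_nat y e)) c i"
  proof cases
   case 4
   hence "f i = i" "i ~= 0" "i ~= 1" by (auto simp: f_def)
   hence l: "(((E \<circ> f)(0 := x, Suc 0 := y)) \<circ> f) i = E i" by simp
   have r: "E i = mrg (case_nat x (case_nat y e)) c i"
    using 4 by (auto simp: E_def mrg_def elim!: evenE split: nat.split)
   show ?thesis using l r by simp
  qed (auto simp: f_def mrg_def E_def)
 qed
 have "env (E \<circ> f)" using p(1) e dt_M[OF assms(1) e] by (auto simp: E_def env_def mrg_def split: nat.split)
 hence ME: "ALL i. (E \<circ> f) i:M" by (simp add: env_def)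
 have FM: "F x e:M" if "x:M" for x using dt_M[OF assms(2), of "case_nat x e"] e that by simp
 have s: "sat M (ren f p) ((E \<circ> f)(0 := x, Suc 0 := y)) <-> y = F x e" if "x:M" "y:M" for x y
  using p(2)[of "case_nat x (case_nat y e)"] that e by (simp add: sat_ren[OF inj] eq)
 have "ALL x:M. x:$(t e) --> (EX! y. y:M & sat M (ren f p) ((E \<circ> f)(0 := x, Suc 0 := y)))"
  using s FM by blast
 then obtain b where b: "b:M" "ALL x:M. x:$(t e) --> (EX y:M. y:$b & sat M (ren f p) ((E \<circ> f)(0 := x, Suc 0 := y)))"
  using axs(8)[unfolded Replacement_ax_def, rule_format, OF _ dt_M[OF assms(1) e], of "E \<circ> f" "ren f p"] ME unfolding One_nat_def by blast
 have sub: "F x e:$b" if "x:$(t e)" for x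
  using b s that trans[OF dt_M[OF assms(1) e]] by blast
 \<comment> \<open>Replacement yields only a superset \<open>b\<close> of the image, so the image is
   separated from it.\<close>
 have "dt (%e'. Sep (e' 0) (%y. EX x:$(e' (Suc 0)). y = F x (%i. e' (Suc (Suc i)))))"
 proof -
  have "inj (case_nat 0 (%i. Suc (Suc (Suc (Suc i)))))" by (auto simp: inj_on_def split: nat.splits)
  from dt_ren[OF assms(2) this] have "dt (%e. F (e 0) (%i. e (Suc (Suc (Suc (Suc i))))))" by simp
  thus ?thesis by (intro dfi)
 qed
 from dt_M[OF this, of "case_nat b (case_nat (t e) e)"]
 have "Sep b (%y. EX x:$(t e). y = F x e):M" using e b(1) dt_M[OF assms(1) e] by simp
 moreover have "Sep b (%y. EX x:$(t e). y = F x e) = Img (t e) (%x. F x e)"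
  using sub by (intro hc_eqI) auto
 ultimately show "Img (t e) (%x. F x e):M" by simp
qed

lemma dt_lam [dfi]: assumes "dt t" "dt (%e. F (e 0) (%i. e (Suc i)))" shows "dt (%e. lam (t e) (%x. F x e))"
 unfolding lam_def by (intro dfi assms)

lemma dt_ap [dfi]: "dt s ==> dt t ==> dt (%e. ap (s e) (t e))"
 unfolding ap_def by (intro dfi)

lemma df_fun_on [dfi]: assumes "dt s" "dt t" shows "df (%e. fun_on (s e) (t e))"
proof (rule df_app2[where P=fun_on, OF _ assms])
 have "df (%e. e 0 = lam (e 1) (ap (e 0)))" by (intro dfi)
 thus "df (%e. fun_on (e 0) (e (Suc 0)))"
  by (rule df_cong') (metis One_nat_def fun_on_eq fun_on_lam)
qed

lemma lam_M: "a:M ==> dt (%e. F (e 0)) ==> lam a F:M"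
 using dt_M[OF dt_lam[where F="%x e. F x", OF dt_const]] env_ex by blast
lemma ap_M: "f:M ==> x:M ==> ap f x:M"
 using dt_M[OF dt_ap[OF dt_const dt_const]] env_ex by blast
declare dt_Suc [dfi del]

lemma dt_M0: "dt (%e. a) ==> a:M" using dt_M env_ex by blast
lemma dt_M1: "dt (%e. F (e 0)) ==> x:M ==> F x:M" using dt_M[of _ "%_. x"] by (simp add: env_def)

end

locale tmc = tm +
 assumes choice: "Choice_ax M"

lemma tmc_ctm: "tmc M <-> ctm M"
 by (simp add: tmc_def tmc_axioms_def tm_def ctm_iff)

context tm begin

lemma dt_if [dfi]: assumes "df R" "dt s" "dt t" shows "dt (%e. if R e then s e else t e)"
proof (rule dtI)
 have "df (%e. (R (%i. e (Suc i)) & e 0:$(s (%i. e (Suc i)))) \<or>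
  (~ R (%i. e (Suc i)) & e 0:$(t (%i. e (Suc i)))))" by (intro dfi assms df_Suc dt_Suc[OF assms(2)] dt_Suc[OF assms(3)])
 thus "df (%e. e 0:$(if R (%i. e (Suc i)) then s (%i. e (Suc i)) else t (%i. e (Suc i))))"
  by (rule df_cong') auto
qed (use dt_M assms in auto)

end

subsection \<open>Recursion\<close>

text \<open>Recursion along any well-founded relation whose predecessor sets are given by a
  definable term \<open>Ext\<close>. The function \<open>F\<close> already exists in HOL; what is at
  stake is its definability over the model, obtained from partial solutions \<open>att\<close> on
  domains closed under \<open>Ext\<close>.\<close>

locale tmrec = tm +
 fixes Ext :: "hc => hc" and H :: "hc => hc => hc" and F :: "hc => hc"
 assumes dt_Ext0: "dt (%e. Ext (e 0))" and dt_H0: "dt (%e. H (e 0) (e (Suc 0)))"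
  and wfE: "wf {(y, x). y:$(Ext x)}"
  and F_eq: "!!x. x:M ==> F x = H x (lam (Ext x) F)"
begin

lemmas dtE [dfi] = dt_app1[OF dt_Ext0]
lemmas dtH [dfi] = dt_app2[OF dt_H0]
lemma Ext_M: "x:M ==> Ext x:M" using dt_M1[OF dt_Ext0] .

definition clo where "clo d <-> (ALL y:$d. $(Ext y) <= $d)"
definition att where "att f d <-> clo d & fun_on f d & (ALL z:$d. ap f z = H z (lam (Ext z) (ap f)))"
definition good where "good y <-> (EX d:M. EX f:M. att f d & y:$d)"

lemma df_clo [dfi]: "dt t ==> df (%e. clo (t e))"
 by (rule df_app1[where P=clo]) (unfold clo_def, intro dfi)
lemma df_att [dfi]: "dt s ==> dt t ==> df (%e. att (s e) (t e))"
 by (rule df_app2[where P=att]) (unfold att_def, intro dfi)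
lemma df_good [dfi]: "dt t ==> df (%e. good (t e))"
 by (rule df_app1[where P=good]) (unfold good_def, intro dfi)

lemma att_F: assumes "att f d" "d:M" "z:$d" shows "ap f z = F z"
 using assms(3)
proof (induction z rule: wf_induct_rule[OF wfE])
 case (1 z)
 have "lam (Ext z) (ap f) = lam (Ext z) F"
  using 1 assms(1) unfolding att_def clo_def by (intro lam_cong) blast
 thus ?case using assms(1) 1(2) F_eq[OF trans[OF assms(2) 1(2)]] by (simp add: att_def)
qed

text \<open>The least closed set containing \<open>y\<close>: a canonical domain, by which the
  partial solutions are united without choice. \<open>Va\<close> is \<open>F\<close> with a default
  value where no partial solution is known yet.\<close>

definition G where "G y = (if good y then HSet {z:M. ALL d:M. clo d & y:$d --> z:$d} else hempty)"
definition Va where "Va y = (if good y then F y else hempty)"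

lemma elts_G: "$(G y) = {z:M. good y & (ALL d:M. clo d & y:$d --> z:$d)}"
 unfolding G_def using countable_subset[OF _ countable_M, of "{z:M. ALL d:M. clo d & y:$d --> z:$d}"]
 by auto

lemma hempty_M: "hempty:M"
proof -
 obtain a where "a:M" using nonempty_M ..
 hence "Sep a (%x. False):M" by (intro Sep_M dfi)
 moreover have "Sep a (%x. False) = hempty" by (rule hc_eqI) simp
 ultimately show ?thesis by simp
qed

lemma G_M: assumes "y:M" shows "G y:M"
proof (cases "good y")
 case True
 then obtain d where d: "d:M" "clo d" "y:$d" by (auto simp: good_def att_def)
 have "Sep d (%z. ALL d:M. clo d & y:$d --> z:$d):M"
  by (intro Sep_M dfi d assms)
 moreover have "Sep d (%z. ALL d:M. clo d & y:$d --> z:$d) = G y"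
  using d True trans by (intro hc_eqI) (auto simp: elts_G)
 ultimately show ?thesis by simp
qed (simp add: G_def hempty_M)

lemma dt_G [dfi]: "dt t ==> dt (%e. G (t e))"
proof (rule dt_app1[where F=G], rule dtI)
 have "df (%e. good (e (Suc 0)) & (ALL d:M. clo d & e (Suc 0):$d --> e 0:$d))" by (intro dfi)
 thus "df (%e. e 0:$(G (e (Suc 0))))" by (rule df_cong') (auto simp: elts_G env_def)
qed (auto simp: G_M env_def)

lemma good_F: "good y ==> F y:M"
 unfolding good_def using att_F ap_M trans by metis

lemma dt_Va [dfi]: "dt t ==> dt (%e. Va (t e))"
proof (rule dt_app1[where F=Va], rule dtI)
 have "df (%e. EX d:M. EX f:M. att f d & e (Suc 0):$d & e 0:$(ap f (e (Suc 0))))" by (intro dfi)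
 moreover have "(EX d:M. EX f:M. att f d & x:$d & z:$(ap f x)) <-> z:$(Va x)" for x z
 proof (cases "good x")
  case True
  thus ?thesis using att_F unfolding Va_def good_def by (simp, metis)
 next
  case False
  thus ?thesis unfolding Va_def good_def by auto
 qed
 ultimately show "df (%e. e 0:$(Va (e (Suc 0))))" by simp
qed (auto simp: Va_def good_F hempty_M env_def)

lemma all_good: "x:M ==> good x"
proof (induction x rule: wf_induct_rule[OF wfE])
 case (1 x)
 have EM: "Ext x:M" using 1(2) by (rule Ext_M)
 have g: "good y" if "y:$(Ext x)" for y
  by (rule 1(1)) (use that trans[OF EM that] in auto)
 define d where "d = UU (Upr (UU (Img (Ext x) G)) (Upr x x))"
 have dM: "d:M" unfolding d_def by (rule dt_M0) (intro dfi EM 1(2))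
 have Gy: "y:$(G y)" if "y:$(Ext x)" for y
  using g[OF that] trans[OF EM that] by (auto simp: elts_G)
 have Gc: "clo (G y)" if "y:$(Ext x)" for y
 proof -
  have "$(Ext z) <= $(G y)" if z: "z:$(G y)" for z
  proof
   fix w assume "w:$(Ext z)"
   moreover from this have "w:M" using z trans Ext_M by (auto simp: elts_G)
   ultimately show "w:$(G y)" using z unfolding elts_G clo_def by blast
  qed
  thus ?thesis by (simp add: clo_def)
 qed
 have dgood: "good z" if "z:$(G y)" "y:$(Ext x)" for z y
 proof -
  obtain d f where "d:M" "f:M" "att f d" "y:$d" using g[OF \<open>y:$(Ext x)\<close>] by (auto simp: good_def)
  thus ?thesis using that(1) unfolding elts_G good_def att_def by blast
 qed
 have dclo: "clo d" using Gy Gc unfolding clo_def d_def by (auto, blast)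
 have "F x = H x (lam (Ext x) Va)"
  using F_eq[OF 1(2)] lam_cong[of "Ext x" F Va] g by (simp add: Va_def)
 moreover have "H x (lam (Ext x) Va):M" by (rule dt_M0) (intro dfi EM 1(2))
 ultimately have FxM: "F x:M" by simp
 have Fz: "F z = (if z = x then F x else Va z)" if "z:$d" for z
  using that dgood by (auto simp: d_def Va_def)
 define f where "f = lam d (%z. if z = x then F x else Va z)"
 have fM: "f:M" unfolding f_def by (rule dt_M0) (intro dfi dM FxM 1(2))
 have f: "f = lam d F" unfolding f_def by (rule lam_cong) (use Fz in auto)
 have "ap f z = H z (lam (Ext z) (ap f))" if "z:$d" for z
 proof -
  have "lam (Ext z) (ap f) = lam (Ext z) F"
   by (rule lam_cong) (use that dclo in "simp add: f clo_def subset_iff")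
  thus ?thesis using F_eq[OF trans[OF dM that]] that by (simp add: f)
 qed
 hence "att f d" using dclo by (simp add: att_def f)
 thus ?case unfolding good_def using dM fM by (auto simp: d_def)
qed

lemma dt_F: "dt t ==> dt (%e. F (t e))"
proof (rule dt_app1[where F=F])
 have "dt (%e. Va (e 0))" by (intro dfi)
 moreover have "df (%e. e 0 = Va (e (Suc 0))) = df (%e. e 0 = F (e (Suc 0)))"
  by (rule df_cong) (simp add: Va_def all_good env_def)
 ultimately show "dt (%e. F (e 0))" unfolding dt_def by (simp add: Va_def all_good env_def)
qed

end

lemma (in tm) mrec: assumes "dt (%e. H (e 0) (e (Suc 0)))"
 obtains F where "!!x. F x = H x (lam x F)" "!!t. dt t ==> dt (%e. F (t e))"
proof -
 define F where "F = wfrec {(x, y). x:$y} (%f x. H x (lam x f))"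
 have F: "F x = H x (lam x F)" for x
 proof -
  have "lam x (cut F {(x, y). x:$y} x) = lam x F" by (rule lam_cong) (simp add: cut_apply)
  thus ?thesis unfolding F_def by (subst wfrec[OF wf_elts]) (simp add: F_def)
 qed
 have "tmrec M (%x. x) H F" by unfold_locales (intro dfi, rule assms, rule wf_elts, rule F)
 from that[OF F tmrec.dt_F[OF this]] show ?thesis .
qed

definition rk :: "hc => hc" where
 "rk = wfrec {(x, y). x:$y} (%f x. UU (Img x (%y. hsucc (f y))))"

lemma Img_cong: "(!!x. x:$a ==> F x = G x) ==> Img a F = Img a G"
 by (rule hc_eqI) auto

lemma rk: "rk x = UU (Img x (%y. hsucc (rk y)))"
 unfolding rk_def
 by (subst wfrec[OF wf_elts], rule arg_cong[where f=UU], rule Img_cong) (simp add: cut_apply)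

lemma elts_rk: "$(rk x) = (\<Union>y\<in>$x. insert (rk y) ($(rk y)))"
 by (subst rk) auto

lemma rk_mono: "y:$x ==> rk y:$(rk x)" by (subst elts_rk) auto

lemma wf_elts_induct [case_names step]: "(!!x. (!!y. y:$x ==> P y) ==> P x) ==> P x"
 using wf_induct_rule[OF wf_elts, of P] by blast

lemma not_mem_self [simp]: "x~:$x"
 by (induction x rule: wf_elts_induct) blast

subsection \<open>Ordinals\<close>

abbreviation Ord :: "hc => bool" where "Ord \<equiv> is_ordinal"

lemma Ord_trans: "Ord a ==> y:$a ==> z:$y ==> z:$a" by (auto simp: is_ordinal_def)
lemma Ord_in: "Ord a ==> y:$a ==> Ord y" by (auto simp: is_ordinal_def) blast+
lemma OrdI: "(!!y z. y:$a ==> z:$y ==> z:$a) ==> (!!y. y:$a ==> Ord y) ==> Ord a"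
 by (auto simp: is_ordinal_def)

lemma Ord_linear: "Ord a ==> Ord b ==> a:$b \<or> a = b \<or> b:$a"
proof (induction a arbitrary: b rule: wf_elts_induct)
 case (step a)
 note IHa = step.IH and a = step.prems(1)
 show ?case using step.prems(2)
 proof (induction b rule: wf_elts_induct)
  case (step b)
  show ?case
  proof (rule ccontr)
   assume n: "~ ?thesis"
   have "x:$b" if "x:$a" for x
    using IHa[OF that Ord_in[OF a that] step.prems] n that Ord_trans[OF a that] by blast
   moreover have "x:$a" if "x:$b" for x
    using step.IH[OF that Ord_in[OF step.prems that]] n that Ord_trans[OF step.prems that] by blast
   ultimately have "a = b" by (intro hc_eqI) blast
   with n show False by simp
  qed
 qed
qed

lemma Ord_subset: "Ord a ==> Ord b ==> $a <= $b <-> a:$b \<or> a = b"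
 using Ord_linear[of a b] Ord_trans[of b a] by (metis not_mem_self subsetD subsetI)

lemma Ord_not_sub: "Ord a ==> Ord b ==> ~ $a <= $b <-> b:$a"
 using Ord_linear[of a b] Ord_subset[of a b] Ord_subset[of b a] by (metis not_mem_self subsetD)

lemma Ord_hsucc: "Ord a ==> Ord (hsucc a)"
 by (rule OrdI) (auto dest: Ord_trans Ord_in)
lemma Ord_hempty [simp]: "Ord hempty" by (rule OrdI) auto
lemma Ord_UU: "(!!x. x:$a ==> Ord x) ==> Ord (UU a)"
 by (rule OrdI) (auto dest: Ord_trans Ord_in)
lemma Ord_rk [simp]: "Ord (rk x)"
 by (induction x rule: wf_elts_induct) (subst rk, rule Ord_UU, auto intro: Ord_hsucc)

lemma Ord_least: assumes "P a" shows "EX b. P b & (ALL c:$b. ~ P c)"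
 using assms by (induction a rule: wf_elts_induct) blast

lemma hsucc_inj: "hsucc a = hsucc b ==> a = b"
proof -
 assume "hsucc a = hsucc b"
 hence *: "insert a $a = insert b $b" by (metis elts_hsucc)
 show "a = b"
 proof (rule ccontr)
  assume "a ~= b"
  with * have "a:$b" "b:$a" by auto
  moreover have "~ (x:$y & y:$x)" for x y
   by (induction x arbitrary: y rule: wf_elts_induct) blast
  ultimately show False by blast
 qed
qed

lemma elts_hnat: "$(hnat n) = hnat ` {..<n}"
 by (induction n) (auto simp: lessThan_Suc)
lemma hnat_inj [simp]: "hnat m = hnat n <-> m = n"
proof -
 have "hnat m ~= hnat n" if "m < n" for m n
  using that elts_hnat[of n] not_mem_self[of "hnat n"] by (metis imageI lessThan_iff)
 thus ?thesis by (metis nat_neq_iff)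
qed
lemma hnat_in [simp]: "hnat m:$(hnat n) <-> m < n" by (auto simp: elts_hnat)
lemma Ord_hnat [simp]: "Ord (hnat n)" by (induction n) (auto intro: Ord_hsucc)
lemma elts_homega [simp]: "$homega = range hnat" unfolding homega_def by (rule elts_HSet) simp
lemma Ord_homega [simp]: "Ord homega" by (rule OrdI) (auto simp: elts_hnat)

context tm begin

lemma hempty_M [simp]: "hempty:M"
proof -
 obtain a where "a:M" using nonempty_M ..
 hence "Sep a (%x. False):M" by (intro Sep_M dfi)
 moreover have "Sep a (%x. False) = hempty" by (rule hc_eqI) simp
 ultimately show ?thesis by simp
qed

lemma hnat_M [simp]: "hnat n:M" by (induction n) (auto intro: hsucc_M)

text \<open>In \<open>W\<close>, the least inductive set of the model, a membership-minimal element
  outside \<open>range hnat\<close> could be deleted without destroying inductivity.\<close>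

lemma homega_M [simp]: "homega:M"
proof -
 obtain w x where w: "w:M" "x:M" "x:$w" "ALL z:M. z~:$x"
  "ALL x:M. x:$w --> (EX y:M. y:$w & (ALL z:M. z:$y <-> z:$x \<or> z = x))"
  using axs(6) unfolding Infinity_ax_def by blast
 have "x = hempty" by (rule M_ext) (use w in auto)
 have suc: "hsucc y:$w" if "y:$w" for y
 proof -
  have yM: "y:M" using that w(1) trans by blast
  obtain u where u: "u:M" "u:$w" "ALL z:M. z:$u <-> z:$y \<or> z = y"
   using bspec[OF w(5) yM] \<open>y:$w\<close> by auto
  hence "u = hsucc y" by (intro M_ext) (use yM hsucc_M in auto)
  with u show ?thesis by simp
 qed
 have nat: "hnat n:$w" for n by (induction n) (use w \<open>x = hempty\<close> suc in auto)
 define W where "W = Sep w (%z. ALL d:M. hempty:$d & (ALL y:$d. hsucc y:$d) --> z:$d)"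
 have WM: "W:M" unfolding W_def by (intro Sep_M dfi w hempty_M)
 have natd: "hnat n:$d" if "hempty:$d" "ALL y:$d. hsucc y:$d" for n d
  using that by (induction n) auto
 have "range hnat <= $W" using nat natd by (auto simp: W_def)
 moreover have "z:range hnat" if "z:$W" for z
 proof (rule ccontr)
  assume "z~:range hnat"
  with that obtain u where u: "u:$W" "u~:range hnat" "!!v. v:$u ==> ~ (v:$W & v~:range hnat)"
   using Ord_least[of "%z. z:$W & z~:range hnat" z] by blast
  define d where "d = Sep W (%x. x ~= u)"
  have "d:M" unfolding d_def by (intro Sep_M dfi WM) (use u WM trans in blast)
  moreover have "hempty:$d" using u(2) \<open>range hnat <= $W\<close> unfolding d_def by (auto) (metis hnat.simps(1) rangeI subsetD)+
  moreover have "hsucc y:$d" if "y:$d" for y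
  proof -
   have yW: "y:$W" using that by (auto simp: d_def)
   hence "hsucc y:$W" using suc unfolding W_def by auto
   moreover have "hsucc y ~= u"
   proof
    assume a: "hsucc y = u"
    hence "y:range hnat" using u(3)[of y] yW by auto
    then obtain n where "y = hnat n" by blast
    hence "u = hnat (Suc n)" using a by simp
    thus False using u(2) by blast
   qed
   ultimately show ?thesis by (simp add: d_def)
  qed
  ultimately show False using u(1) unfolding W_def d_def by auto
 qed
 ultimately have "W = homega" by (intro hc_eqI) auto
 thus ?thesis using WM by simp
qed

lemma dt_rk [dfi]: "dt t ==> dt (%e. rk (t e))"
proof -
 interpret tmrec M "%x. x" "%x f. UU (Img x (%y. hsucc (ap f y)))" rk
 proof unfold_locales
  show "dt (%e. e 0)" "dt (%e. UU (Img (e 0) (%y. hsucc (ap (e (Suc 0)) y))))" by (intro dfi)+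
  show "wf {(y, x). y:$x}" by (rule wf_elts)
  show "rk x = UU (Img x (%y. hsucc (ap (lam x rk) y)))" for x
   by (subst rk, rule arg_cong[where f=UU], rule Img_cong) simp
 qed
 show "dt t ==> dt (%e. rk (t e))" by (rule dt_F)
qed

lemma df_Ord [dfi]: "dt t ==> df (%e. Ord (t e))"
 by (rule df_app1[where P=Ord]) (unfold is_ordinal_def, intro dfi)

end

text \<open>The cumulative hierarchy as computed in \<open>M\<close>.\<close>

definition VV :: "hc set => hc => hc" where
 "VV M = wfrec {(x, y). x:$y} (%f x. UU (Img x (%y. hPow M (f y))))"

lemma VV: "VV M x = UU (Img x (%y. hPow M (VV M y)))"
 unfolding VV_def
 by (subst wfrec[OF wf_elts], rule arg_cong[where f=UU], rule Img_cong) (simp add: cut_apply)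

context tm begin

lemma dt_VV [dfi]: "dt t ==> dt (%e. VV M (t e))"
proof -
 interpret tmrec M "%x. x" "%x f. UU (Img x (%y. hPow M (ap f y)))" "VV M"
 proof unfold_locales
  show "dt (%e. e 0)" "dt (%e. UU (Img (e 0) (%y. hPow M (ap (e (Suc 0)) y))))" by (intro dfi)+
  show "wf {(y, x). y:$x}" by (rule wf_elts)
  show "VV M x = UU (Img x (%y. hPow M (ap (lam x (VV M)) y)))" for x
   by (subst VV, rule arg_cong[where f=UU], rule Img_cong) simp
 qed
 show "dt t ==> dt (%e. VV M (t e))" by (rule dt_F)
qed

lemma VV_rk: "x:M ==> $x <= $(VV M (rk x))"
proof (induction x rule: wf_elts_induct)
 case (step x)
 have "y:$(VV M (rk x))" if y: "y:$x" for y
 proof -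
  have "y:$(hPow M (VV M (rk y)))" using step.IH[OF y] trans[OF step.prems y] by simp
  thus ?thesis using rk_mono[OF y] by (subst VV) auto
 qed
 thus ?case by blast
qed

text \<open>Scott's trick: \<open>r x\<close> is the least rank of a witness for \<open>x\<close>,
  written as an intersection of ranks so that it becomes a definable term. The levels of the
  hierarchy at these ranks contain the witnesses of least rank.\<close>

lemma Collection:
 assumes "a:M" and R: "df (%e. R (e 0) (e (Suc 0)))" and ex: "!!x. x:$a ==> EX y:M. R x y"
 shows "EX b:M. ALL x:$a. EX y:$b. R x y"
proof -
 note RR [dfi] = df_app2[where P=R, OF R]
 define r where "r x = (if EX y:M. R x y then HSet {z:M. ALL y:M. R x y --> z:$(rk y)} else hempty)" for x
 have er: "$(r x) = {z:M. (EX y:M. R x y) & (ALL y:M. R x y --> z:$(rk y))}" for x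
  unfolding r_def using countable_subset[OF _ countable_M, of "{z:M. ALL y:M. R x y --> z:$(rk y)}"] by auto
 have rkM: "rk y:M" if "y:M" for y by (rule dt_M0) (intro dfi that)
 have r_ex: "EX y:M. R x y & r x = rk y" if x: "EX y:M. R x y" for x
 proof -
  obtain y0 where y0: "EX y:M. R x y & rk y0 = rk y" using x by blast
  obtain u where u: "EX y:M. R x y & u = rk y" "ALL c:$u. ~ (EX y:M. R x y & c = rk y)"
   using Ord_least[of "%u. EX y:M. R x y & u = rk y", OF y0] by blast
  then obtain y where y: "y:M" "R x y" "u = rk y" by blast
  have "$u <= $(rk y')" if "y':M" "R x y'" for y'
   using Ord_not_sub[of u "rk y'"] u(2) that y(3) by auto
  hence "r x = u" using y trans[OF rkM[OF y(1)]] by (intro hc_eqI) (auto simp: er)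
  with y show ?thesis by blast
 qed
 have "dt (%e. r (e 0))"
 proof (rule dtI)
  have "df (%e. (EX y:M. R (e (Suc 0)) y) & (ALL y:M. R (e (Suc 0)) y --> e 0:$(rk y)))" by (intro dfi)
  thus "df (%e. e 0:$(r (e (Suc 0))))" by (rule df_cong') (auto simp: er env_def)
  show "r (e 0):M" for e using r_ex[of "e 0"] rkM by (cases "EX y:M. R (e 0) y") (auto simp: r_def)
 qed
 note [dfi] = dt_app1[OF this]
 define b where "b = UU (Img a (%x. hPow M (VV M (r x))))"
 have "b:M" unfolding b_def by (rule dt_M0) (intro dfi assms)
 moreover have "EX y:$b. R x y" if x: "x:$a" for x
 proof -
  obtain y where y: "y:M" "R x y" "r x = rk y" using r_ex ex[OF x] by blast
  hence "y:$(hPow M (VV M (r x)))" using VV_rk by simp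
  hence "y:$b" using x unfolding b_def elts_UU elts_Img by blast
  thus ?thesis using y(2) by blast
 qed
 ultimately show ?thesis by blast
qed

end

context tmc begin

lemma choice_fun:
 assumes "a:M" "!!x. x:$a ==> $x ~= {}"
 shows "EX f:M. ALL x:$a. ap f x:$x"
proof -
 \<comment> \<open>\<open>Choice_ax\<close> concerns disjoint families, so each \<open>x\<close> is
   replaced by its copy {x} \<times> x.\<close>
 define A where "A = Img a (%x. Img x (%y. pair x y))"
 have AM: "A:M" unfolding A_def by (rule dt_M0) (intro dfi assms)
 have "(ALL x:M. x:$A --> (EX z:M. z:$x))"
 proof (intro ballI impI)
  fix x assume "x:M" "x:$A"
  hence "$x ~= {}" using assms(2) by (auto simp: A_def)
  thus "EX z:M. z:$x" using trans[OF \<open>x:M\<close>] by blast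
 qed
 moreover have "ALL x:M. ALL y:M. x:$A & y:$A & x ~= y --> (ALL z:M. ~ (z:$x & z:$y))"
  by (auto simp: A_def)
 ultimately obtain c where c: "c:M" "ALL x:M. x:$A --> (EX! z. z:M & z:$x & z:$c)"
  using choice AM unfolding Choice_ax_def by blast
 define f where "f = lam a (%x. UU (Sep x (%y. pair x y:$c)))"
 have "f:M" unfolding f_def by (rule dt_M0) (intro dfi assms c)
 moreover have "ap f x:$x" if x: "x:$a" for x
 proof -
  have "Img x (pair x):$A" using x by (simp add: A_def)
  hence ex: "EX! z. z:M & z:$(Img x (pair x)) & z:$c"
   using c trans[OF AM] by blast
  obtain z where z: "z:$(Img x (pair x))" "z:$c" "z:M" using ex1_implies_ex[OF ex] by blast
  have z3: "z' = z" if "z':M" "z':$(Img x (pair x))" "z':$c" for z'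
   using ex that z by (elim ex1E) metis
  obtain y where y: "y:$x" "z = pair x y" using z(1) by auto
  have "$(Sep x (%y. pair x y:$c)) = {y}"
  proof -
   have "y' = y" if y': "y':$x" "pair x y':$c" for y'
   proof -
    have "pair x y' = z" by (rule z3) (use y' trans[OF c(1) y'(2)] in auto)
    thus ?thesis using y(2) by simp
   qed
   thus ?thesis using y z(2) unfolding elts_Sep by blast
  qed
  hence "UU (Sep x (%y. pair x y:$c)) = y" by (rule UU_single)
  thus ?thesis using x y by (simp add: f_def)
 qed
 ultimately show ?thesis by blast
qed

lemma AC:
 assumes "a:M" and R: "df (%e. R (e 0) (e (Suc 0)))" and ex: "!!x. x:$a ==> EX y:M. R x y"
 obtains f where "f:M" "fun_on f a" "!!x. x:$a ==> R x (ap f x) & ap f x:M"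
proof -
 note RR [dfi] = df_app2[where P=R, OF R]
 obtain b where b: "b:M" "ALL x:$a. EX y:$b. R x y" using Collection[OF assms(1) R ex] by blast
 define A where "A = Img a (%x. Sep b (%y. R x y))"
 have AM: "A:M" unfolding A_def by (rule dt_M0) (intro dfi assms b)
 obtain c where c: "c:M" "ALL x:$A. ap c x:$x"
 proof -
  have "$x ~= {}" if "x:$A" for x using that b(2) by (auto simp: A_def)
  thus ?thesis using choice_fun[OF AM] that by blast
 qed
 define f where "f = lam a (%x. ap c (Sep b (%y. R x y)))"
 have "f:M" unfolding f_def by (rule dt_M0) (intro dfi assms b c)
 moreover have "ap c (Sep b (%y. R x y)):$(Sep b (%y. R x y))" if "x:$a" for x
  using c(2) that by (auto simp: A_def)
 ultimately show ?thesis using that[of f] trans[OF b(1)] by (auto simp: f_def)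
qed

end

section \<open>Cardinality inside a model\<close>

context tm begin

definition lep :: "hc => hc => bool" where
 "lep A B <-> (EX f:M. inj_on (ap f) $A & ap f ` $A <= $B)"
definition eqp :: "hc => hc => bool" where
 "eqp A B <-> (EX f:M. bij_betw (ap f) $A $B)"

lemma lepI:
 assumes "A:M" "dt (%e. F (e 0))" "inj_on F $A" "!!x. x:$A ==> F x:$B"
 shows "lep A B"
 unfolding lep_def by (rule bexI[of _ "lam A F"]) (use assms in "auto simp: inj_on_def lam_M")

lemma eqpI:
 assumes "A:M" "dt (%e. F (e 0))" "bij_betw F $A $B" shows "eqp A B"
 unfolding eqp_def by (rule bexI[of _ "lam A F"])
  (use assms bij_betw_cong[of "$A" "ap (lam A F)" F "$B"] in "auto simp: lam_M")

lemma eqp_bij: assumes "A:M" shows "(EX f:M. is_bijection f A B) <-> eqp A B"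
proof
 assume "EX f:M. is_bijection f A B"
 thus "eqp A B" unfolding is_bijection_def eqp_def
  using bij_betw_cong[of "$A"] fun_on_happ by metis
next
 assume "eqp A B"
 then obtain f where f: "f:M" "bij_betw (ap f) $A $B" by (auto simp: eqp_def)
 have "lam A (ap f):M" by (rule dt_M0) (intro dfi f assms)
 moreover have "bij_betw (happ (lam A (ap f))) $A $B"
  using f(2) bij_betw_cong[of "$A" "happ (lam A (ap f))" "ap f" "$B"] fun_on_happ[OF fun_on_lam] by simp
 ultimately show "EX f:M. is_bijection f A B" unfolding is_bijection_def using fun_on_lam by blast
qed

lemma lep_trans: assumes "lep A B" "lep B C" "A:M" shows "lep A C"
proof -
 obtain f g where f: "f:M" "inj_on (ap f) $A" "ap f ` $A <= $B"
  and g: "g:M" "inj_on (ap g) $B" "ap g ` $B <= $C"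
  using assms by (auto simp: lep_def)
 have "dt (%e. ap g (ap f (e 0)))" by (intro dfi f g)
 moreover have "inj_on (%x. ap g (ap f x)) $A"
  using comp_inj_on[OF f(2) inj_on_subset[OF g(2) f(3)]] by (simp add: comp_def)
 ultimately show ?thesis by (rule lepI[OF assms(3)]) (use f(3) g(3) in blast)
qed

lemma lep_subset: "A:M ==> $A <= $B ==> lep A B"
 by (rule lepI[where F="%x. x"]) (auto intro: dfi)
lemma lep_refl: "A:M ==> lep A A" by (rule lep_subset) auto

lemma eqp_lep: "eqp A B ==> lep A B" unfolding eqp_def lep_def bij_betw_def by blast

lemma eqp_sym: assumes "eqp A B" "A:M" "B:M" shows "eqp B A"
proof -
 obtain f where f: "f:M" "bij_betw (ap f) $A $B" using assms by (auto simp: eqp_def)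
 define g where "g y = UU (Sep A (%x. ap f x = y))" for y
 have g: "g y = x" if "x:$A" "ap f x = y" for x y
 proof -
  have "$(Sep A (%x. ap f x = y)) = {x}" using that f(2) by (auto simp: bij_betw_def inj_on_def)
  thus ?thesis unfolding g_def by (rule UU_single)
 qed
 have "dt (%e. g (e 0))" unfolding g_def by (intro dfi f assms)
 moreover have "bij_betw g $B $A"
 proof -
  have "g y = inv_into $A (ap f) y" if "y:$B" for y
   by (rule g) (use that f(2) in "auto simp: bij_betw_def inv_into_into f_inv_into_f")
  thus ?thesis using bij_betw_inv_into[OF f(2)] by (simp cong: bij_betw_cong)
 qed
 ultimately show ?thesis by (rule eqpI[OF assms(3)])
qed

lemma eqp_trans: assumes "eqp A B" "eqp B C" "A:M" shows "eqp A C"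
proof -
 obtain f g where f: "f:M" "bij_betw (ap f) $A $B"
  and g: "g:M" "bij_betw (ap g) $B $C"
  using assms by (auto simp: eqp_def)
 have "dt (%e. ap g (ap f (e 0)))" by (intro dfi f g)
 moreover have "bij_betw (%x. ap g (ap f x)) $A $C"
  using bij_betw_trans[OF f(2) g(2)] by (simp add: comp_def)
 ultimately show ?thesis by (rule eqpI[OF assms(3)])
qed

text \<open>\<open>Q S\<close> says that \<open>S\<close> contains each point of \<open>A\<close>
  outside \<open>g[B - f[S]]\<close>. The least such set \<open>Z\<close> is a fixed point;
  \<open>f\<close> is used on \<open>Z\<close> and the inverse of \<open>g\<close> off
  \<open>Z\<close>. Forming \<open>Z\<close> as an intersection over sets of the model avoids
  choice.\<close>

lemma CSB: assumes "lep A B" "lep B A" "A:M" "B:M" shows "eqp A B"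
proof -
 obtain f g where f: "f:M" "inj_on (ap f) $A" "ap f ` $A <= $B"
  and g: "g:M" "inj_on (ap g) $B" "ap g ` $B <= $A"
  using assms by (auto simp: lep_def)
 define Q where "Q S <-> (ALL x:$A. (ALL y:$B. y~:ap f ` $S --> x ~= ap g y) --> x:$S)" for S
 have dQ: "df (%e. Q (e 0))" unfolding Q_def image_iff by (intro dfi assms f g)
 note [dfi] = df_app1[where P=Q, OF dQ]
 define Z where "Z = Sep A (%x. ALL S:M. $S <= $A & Q S --> x:$S)"
 have ZM: "Z:M" unfolding Z_def by (rule Sep_M[OF assms(3)]) (intro dfi assms)
 have mem_Z: "x:$Z <-> x:$A & (ALL S:M. $S <= $A & Q S --> x:$S)" for x
  by (simp add: Z_def)
 have QZ: "Q Z"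
 proof -
  have *: "x:$S" if x: "x:$A" "ALL y:$B. y~:ap f ` $Z --> x ~= ap g y"
   and S: "S:M" "$S <= $A" "Q S" for x S
  proof -
   have "$Z <= $S" using S mem_Z by blast
   hence "ALL y:$B. y~:ap f ` $S --> x ~= ap g y" using x(2) by blast
   thus ?thesis using S(3) x(1) unfolding Q_def by blast
  qed
  show ?thesis unfolding Q_def
  proof (intro ballI impI)
   fix x assume "x:$A" "ALL y:$B. y~:ap f ` $Z --> x ~= ap g y"
   from *[OF this] this(1) show "x:$Z" unfolding mem_Z by simp
  qed
 qed
 have Zf: "ALL y:$B. y~:ap f ` $Z --> x ~= ap g y" if x: "x:$Z" for x
 proof (rule ccontr)
  assume n: "~ ?thesis"
  define S where "S = Sep Z (%z. z ~= x)"
  have "x:M" using x ZM trans by blast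
  hence SM: "S:M" unfolding S_def by (intro Sep_M[OF ZM] dfi)
  have "Q S" unfolding Q_def
  proof (intro ballI impI)
   fix u assume u: "u:$A" "ALL y:$B. y~:ap f ` $S --> u ~= ap g y"
   hence u': "ALL y:$B. y~:ap f ` $Z --> u ~= ap g y" by (auto simp: S_def)
   hence "u:$Z" using QZ u(1) unfolding Q_def by blast
   thus "u:$S" using n u' by (auto simp: S_def)
  qed
  moreover have "$S <= $A" using mem_Z by (auto simp: S_def)
  ultimately have "$Z <= $S" using SM mem_Z by blast
  thus False using x by (auto simp: S_def)
 qed
 define h where "h x = (if x:$Z then ap f x else UU (Sep B (%y. ap g y = x)))" for x
 have hg: "h (ap g y) = y" if y: "y:$B" "ap g y~:$Z" for y
 proof -
  have "$(Sep B (%y'. ap g y' = ap g y)) = {y}" using y g(2) by (auto simp: inj_on_def)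
  hence "UU (Sep B (%y'. ap g y' = ap g y)) = y" by (rule UU_single)
  thus ?thesis using y by (simp add: h_def)
 qed
 have out: "EX y:$B. x = ap g y & y~:ap f ` $Z" if "x:$A" "x~:$Z" for x
  using QZ that unfolding Q_def by blast
 have ZA: "$Z <= $A" using mem_Z by blast
 have "inj_on h $A"
 proof (rule inj_onI)
  fix x x' assume xx: "x:$A" "x':$A" "h x = h x'"
  show "x = x'"
  proof (cases "x:$Z"; cases "x':$Z")
   assume "x:$Z" "x':$Z"
   thus ?thesis using xx f(2) by (auto simp: h_def inj_on_def)
  next
   assume a: "x:$Z" "x'~:$Z"
   then obtain y where "y:$B" "x' = ap g y" "y~:ap f ` $Z" using out xx by blast
   thus ?thesis using a xx hg by (auto simp: h_def)
  next
   assume a: "x~:$Z" "x':$Z"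
   then obtain y where "y:$B" "x = ap g y" "y~:ap f ` $Z" using out xx by blast
   thus ?thesis using a xx hg[of y] by (auto simp: h_def)
  next
   assume a: "x~:$Z" "x'~:$Z"
   then obtain y y' where "y:$B" "x = ap g y" "y':$B" "x' = ap g y'" using out xx by blast
   thus ?thesis using a xx hg by metis
  qed
 qed
 moreover have "h ` $A = $B"
 proof
  show "h ` $A <= $B"
  proof
   fix z assume "z:h ` $A"
   then obtain x where x: "x:$A" "z = h x" by blast
   show "z:$B"
   proof (cases "x:$Z")
    case True thus ?thesis using x f(3) by (auto simp: h_def)
   next
    case False
    then obtain y where "y:$B" "x = ap g y" using out x by blast
    thus ?thesis using hg x False by auto
   qed
  qed
  show "$B <= h ` $A"
  proof
   fix y assume y: "y:$B"
   show "y:h ` $A"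
   proof (cases "y:ap f ` $Z")
    case True
    then obtain x where "x:$Z" "y = ap f x" by blast
    thus ?thesis using ZA by (intro image_eqI[of _ _ x]) (auto simp: h_def)
   next
    case False
    hence "ap g y~:$Z" using Zf y by blast
    thus ?thesis using hg y g(3) by (metis image_eqI image_subset_iff)
   qed
  qed
 qed
 moreover have "dt (%e. h (e 0))" unfolding h_def by (intro dfi f g assms ZM)
 ultimately show ?thesis using eqpI assms by (auto simp: bij_betw_def)
qed

end

context tmc begin

lemma lep_surj: assumes "A:M" "B:M" "dt (%e. F (e 0))" "$B <= F ` $A" shows "lep B A"
proof -
 have "df (%e. e (Suc 0):$A & F (e (Suc 0)) = e 0)" by (intro dfi assms dt_app1[OF assms(3)])
 note * = AC[of B "%y x. x:$A & F x = y", OF assms(2) this]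
 obtain g where g: "g:M" "!!y. y:$B ==> (ap g y:$A & F (ap g y) = y) & ap g y:M"
 proof -
  have "EX x:M. x:$A & F x = y" if "y:$B" for y
   using assms(4) that trans[OF assms(1)] by blast
  from *[OF this] show ?thesis using that by blast
 qed
 have "inj_on (ap g) $B" by (rule inj_on_inverseI[where g=F]) (use g(2) in simp)
 thus ?thesis unfolding lep_def using g by blast
qed

subsection \<open>Well-ordering and cardinals\<close>

lemma Zermelo: assumes AM: "A:M" shows "EX al:M. Ord al & eqp al A"
proof -
 define N where "N = Sep (hPow M A) (%x. x ~= hempty)"
 have NM: "N:M" unfolding N_def by (rule Sep_M) (use hPow_M AM in "auto intro!: dfi")
 have "$x ~= {}" if "x:$N" for x using that hc_eqI[of x hempty] by (auto simp: N_def)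
 then obtain c where c: "c:M" "ALL x:$N. ap c x:$x" using choice_fun[OF NM] by blast
 \<comment> \<open>\<open>A\<close> itself is the stop signal: it is not an element of
   \<open>A\<close>, so it cannot be mistaken for a chosen point.\<close>
 define nx where "nx B = (if $B = {} then A else ap c B)" for B
 define F where "F = wfrec {(x, y). x:$y} (%f x. nx (Sep A (%z. ALL y:$x. z ~= f y)))"
 have Sep_cong: "Sep A P = Sep A P'" if "!!z. z:$A ==> P z = P' z" for P P'
  by (rule hc_eqI) (use that in auto)
 have F: "F x = nx (Sep A (%z. ALL y:$x. z ~= F y))" for x
  unfolding F_def by (subst wfrec[OF wf_elts], rule arg_cong[where f=nx], rule Sep_cong) (simp add: cut_apply)
 have nxe: "nx B = (if B = hempty then A else ap c B)" for B using hc_eqI[of B hempty] by (auto simp: nx_def)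
 have rec: "tmrec M (%x. x) (%x f. nx (Sep A (%z. ALL y:$x. z ~= ap f y))) F"
 proof unfold_locales
  show "dt (%e. e 0)" by (intro dfi)
  show "dt (%e. nx (Sep A (%z. ALL y:$(e 0). z ~= ap (e (Suc 0)) y)))" unfolding nxe by (intro dfi AM c hempty_M)
  show "wf {(y, x). y:$x}" by (rule wf_elts)
  show "F x = nx (Sep A (%z. ALL y:$x. z ~= ap (lam x F) y))" for x
   by (subst F, rule arg_cong[where f=nx], rule Sep_cong) simp
 qed
 note [dfi] = tmrec.dt_F[OF rec]
 define R where "R x = Sep A (%z. ALL y:$x. z ~= F y)" for x
 have RM: "R x:M" if "x:M" for x unfolding R_def by (rule Sep_M[OF AM]) (intro dfi that)
 have FR: "F x = nx (R x)" for x by (subst F) (simp add: R_def)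
 have FA: "F x:$(R x)" if "x:M" "F x ~= A" for x
 proof -
  have "$(R x) ~= {}" using that FR by (auto simp: nx_def)
  hence "R x:$N" using RM[OF that(1)] by (auto simp: N_def) (auto simp: R_def)
  thus ?thesis using c FR[of x] \<open>$(R x) ~= {}\<close> by (simp add: nx_def)
 qed
 have inj: "x = y" if "Ord x" "Ord y" "x:M" "y:M" "F x = F y" "F x ~= A" for x y
 proof -
  have "F x:$(R x)" "F y:$(R y)" using FA[of x] FA[of y] that by simp_all
  thus ?thesis using Ord_linear[OF that(1,2)] that(5) unfolding R_def by auto
 qed
 have "EX be:M. Ord be & F be = A"
 proof (rule ccontr)
  assume n: "~ ?thesis"
  define A' where "A' = Sep A (%a. EX be:M. Ord be & F be = a)"
  have A'M: "A':M" unfolding A'_def by (rule Sep_M[OF AM]) (intro dfi)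
  have "df (%e. Ord (e (Suc 0)) & F (e (Suc 0)) = e 0)" by (intro dfi)
  from Collection[OF A'M this] obtain b where b: "b:M" "ALL a:$A'. EX be:$b. Ord be & F be = a"
   by (auto simp: A'_def)
  \<comment> \<open>An enumeration that never stops injects all ordinals of the model into
    \<open>A\<close>. Collection then gathers them into a set \<open>S\<close>, an ordinal belonging
    to itself.\<close>
  define S where "S = Sep b Ord"
  have SM: "S:M" unfolding S_def by (rule Sep_M[OF b(1)]) (intro dfi)
  have all: "be:$S" if be: "be:M" "Ord be" for be
  proof -
   have FB: "F be ~= A" using n be by blast
   hence "F be:$A" using FA[OF be(1)] by (auto simp: R_def)
   hence "F be:$A'" using be by (auto simp: A'_def)
   then obtain ga where "ga:$b" "Ord ga" "F ga = F be" using b(2) by blast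
   thus ?thesis using inj[of ga be] be FB trans[OF b(1)] by (auto simp: S_def)
  qed
  have SO: "Ord y" if "y:$S" for y using that by (auto simp: S_def)
  have "Ord S"
  proof (rule OrdI)
   fix y z assume "y:$S" "z:$y"
   thus "z:$S" by (intro all) (use trans[OF SM] trans Ord_in SO in blast)+
  qed (rule SO)
  thus False using all[OF SM] not_mem_self by blast
 qed
 then obtain be where be: "be:M" "Ord be" "F be = A" and least: "!!ga. ga:$be ==> ~ (ga:M & Ord ga & F ga = A)"
  using Ord_least[of "%be. be:M & Ord be & F be = A"] by blast
 have ne: "ga:M" "Ord ga" "F ga ~= A" if "ga:$be" for ga
  using least[OF that] trans[OF be(1) that] Ord_in[OF be(2) that] by auto
 have "inj_on F $be" by (rule inj_onI) (rule inj, auto simp: ne)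
 moreover have "F ` $be <= $A" using FA ne by (auto simp: R_def)
 moreover have "$A <= F ` $be"
 proof (rule ccontr)
  assume "~ ?thesis"
  hence "$(R be) ~= {}" by (auto simp: R_def)
  hence RN: "R be:$N" using RM[OF be(1)] by (auto simp: N_def) (auto simp: R_def)
  hence "F be:$(R be)" using c FR[of be] \<open>$(R be) ~= {}\<close> by (simp add: nx_def)
  hence "A:$A" using be(3) by (auto simp: R_def)
  thus False using not_mem_self by blast
 qed
 ultimately have "bij_betw F $be $A" by (auto simp: bij_betw_def)
 hence "eqp be A" by (intro eqpI[where F=F]) (auto intro: be dfi)
 thus ?thesis using be by blast
qed

abbreviation Card :: "hc => bool" where "Card \<equiv> is_cardinal M"

lemma Card_iff: "Card k <-> k:M & Ord k & (ALL a:$k. ~ eqp a k)"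
proof -
 have "(EX f:M. is_bijection f a k) <-> eqp a k" if "k:M" "a:$k" for a
  using eqp_bij[OF trans[OF that]] .
 thus ?thesis unfolding is_cardinal_def by auto
qed

lemma ex_Card_Ord: assumes "a:M" "Ord a" shows "EX k:M. Card k & eqp k a & $k <= $a"
proof -
 have "eqp a a" by (rule eqpI[where F="%x. x"]) (auto intro: dfi assms bij_betw_id[unfolded id_def])
 then obtain k where k: "k:M" "Ord k" "eqp k a" "!!c. c:$k ==> ~ (c:M & Ord c & eqp c a)"
  using Ord_least[of "%k. k:M & Ord k & eqp k a" a] assms by blast
 have "Card k" unfolding Card_iff
  using k eqp_trans trans[OF k(1)] Ord_in[OF k(2)] by blast
 moreover have "$k <= $a"
  using Ord_not_sub[OF k(2) assms(2)] k(4)[of a] assms \<open>eqp a a\<close> by blast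
 ultimately show ?thesis using k by blast
qed

lemma Card_Ord: "Card k ==> Ord k" and Card_M: "Card k ==> k:M" by (auto simp: Card_iff)

lemma Card_not_lep: assumes "Card k" "a:$k" shows "~ lep k a"
proof
 assume "lep k a"
 have aM: "a:M" using assms trans Card_M by blast
 have "$a <= $k" using assms Ord_trans[OF Card_Ord] by blast
 hence "eqp a k" using CSB[OF lep_subset \<open>lep k a\<close>] aM assms Card_M by blast
 thus False using assms by (auto simp: Card_iff)
qed

lemma Cantor: assumes "k:M" shows "~ lep (hPow M k) k"
proof
 assume "lep (hPow M k) k"
 then obtain f where f: "f:M" "inj_on (ap f) ($(hPow M k))" "ap f ` $(hPow M k) <= $k"
  by (auto simp: lep_def)
 define D where "D = Sep k (%x. EX X:$(hPow M k). ap f X = x & x~:$X)"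
 have "D:M" unfolding D_def by (rule Sep_M[OF assms]) (intro dfi assms f)
 hence D: "D:$(hPow M k)" unfolding elts_hPow by (auto simp: D_def)
 hence "ap f D:$k" using f(3) by blast
 have mD: "x:$D <-> x:$k & (EX X:$(hPow M k). ap f X = x & x~:$X)" for x
  unfolding D_def elts_Sep by blast
 have "ap f D:$D <-> ap f D~:$D"
 proof
  assume "ap f D:$D"
  then obtain X where X: "X:$(hPow M k)" "ap f X = ap f D" "ap f D~:$X" using mD by blast
  hence "X = D" using f(2) D by (auto simp: inj_on_def)
  thus "ap f D~:$D" using X by simp
 next
  assume "ap f D~:$D"
  thus "ap f D:$D" using D \<open>ap f D:$k\<close> mD by blast
 qed
 thus False by blast
qed

end

context tm begin

subsection \<open>Finite sets and products\<close>

lemma finite_enum: "finite S ==> S <= M ==> EX n. EX f:M. S = ap f ` $(hnat n)"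
proof (induction S rule: finite_induct)
 case empty
 have "({} :: hc set) = ap hempty ` $(hnat 0)" by (simp add: elts_hnat)
 thus ?case using hempty_M by blast
next
 case (insert a S)
 then obtain n f where f: "f:M" "S = ap f ` $(hnat n)" by blast
 define g where "g = lam (hnat (Suc n)) (%z. if z = hnat n then a else ap f z)"
 have aM: "a:M" using insert.prems by simp
 have "g:M" unfolding g_def by (rule dt_M0) (intro dfi hnat_M f(1) aM)
 moreover have "insert a S = ap g ` $(hnat (Suc n))"
 proof -
  have "ap g (hnat n) = a" unfolding g_def by (subst ap_lam) (auto simp: elts_hnat)
  moreover have "ap g z = ap f z" if "z:$(hnat n)" for z
   unfolding g_def using that by (subst ap_lam) (auto simp: elts_hnat)
  moreover have "$(hnat (Suc n)) = insert (hnat n) ($(hnat n))" by simp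
  ultimately show ?thesis using f(2) by (simp only: image_insert) (simp cong: image_cong)
 qed
 ultimately show ?case by blast
qed

lemma finite_iff: assumes "x:M" shows "finite $x <-> (EX n:$homega. EX f:M. x = Img n (ap f))"
proof
 assume "finite $x"
 moreover have "$x <= M" using trans[OF assms] by blast
 ultimately obtain n f where nf: "f:M" "$x = ap f ` $(hnat n)" using finite_enum[of "$x"] by metis
 hence "x = Img (hnat n) (ap f)" by (intro hc_eqI) (simp only: elts_Img)
 with nf(1) show "EX n:$homega. EX f:M. x = Img n (ap f)" by (metis elts_homega rangeI)
next
 assume "EX n:$homega. EX f:M. x = Img n (ap f)"
 then obtain n f where "x = Img (hnat n) (ap f)" by auto
 hence "$x = ap f ` $(hnat n)" by (simp only: elts_Img)
 thus "finite $x" by (simp only: elts_hnat) simp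
qed

lemma df_finite [dfi]: assumes "dt t" shows "df (%e. finite ($(t e)))"
proof (rule df_app1[where P="%x. finite $x", OF _ assms])
 have "df (%e. EX n:$homega. EX f:M. e 0 = Img n (ap f))" by (intro dfi homega_M)
 thus "df (%e. finite ($(e 0)))" by (rule df_cong') (simp add: finite_iff env_def)
qed

lemma finite_M: assumes "finite S" "S <= M" shows "HSet S:M"
proof -
 obtain n f where f: "f:M" "S = ap f ` $(hnat n)" using finite_enum[OF assms] by blast
 have "Img (hnat n) (ap f):M" by (rule dt_M0) (intro dfi f hnat_M)
 thus ?thesis using f by (simp add: Img_def)
qed

definition Fin :: "hc => hc" where "Fin A = Sep (hPow M A) (%x. finite $x)"
lemma elts_Fin [simp]: "$(Fin A) = {x:M. $x <= $A & finite $x}" by (auto simp: Fin_def)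
lemma dt_Fin [dfi]: "dt t ==> dt (%e. Fin (t e))" unfolding Fin_def by (intro dfi)

end

definition Prod :: "hc => hc => hc" where "Prod A B = UU (Img A (%a. Img B (%b. pair a b)))"
lemma elts_Prod [simp]: "$(Prod A B) = {pair a b | a b. a:$A & b:$B}" by (auto simp: Prod_def)

definition hfst :: "hc => hc" where "hfst p = UU (Sep (UU p) (%x. EX y:$(UU p). p = pair x y))"
definition hsnd :: "hc => hc" where "hsnd p = UU (Sep (UU p) (%y. EX x:$(UU p). p = pair x y))"
lemma UU_pair: "$(UU (pair x y)) = {x, y}" by (auto simp: pair_Upr)
lemma hfst [simp]: "hfst (pair x y) = x" unfolding hfst_def by (rule UU_single) (auto simp: UU_pair simp del: elts_UU)
lemma hsnd [simp]: "hsnd (pair x y) = y" unfolding hsnd_def by (rule UU_single) (auto simp: UU_pair simp del: elts_UU)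

definition inj_into :: "hc => hc => hc => bool" where
 "inj_into f a b <-> (ALL x:$a. ALL y:$a. ap f x = ap f y --> x = y) & (ALL x:$a. ap f x:$b)"

lemma fmax: assumes "finite S" "S ~= {}" "!!z. z:S ==> Ord z" shows "EX m:S. ALL z:S. z:$m \<or> z = m"
 using assms
proof (induction S rule: finite_ne_induct)
 case (insert a S)
 then obtain m where m: "m:S" "ALL z:S. z:$m \<or> z = m" by auto
 show ?case
 proof (cases "a:$m")
  case False
  hence "m:$a \<or> m = a" using Ord_linear[of a m] insert.prems m by auto
  thus ?thesis using m Ord_trans[of a m] insert.prems by (intro bexI[of _ a]) auto
 qed (use m in auto)
qed auto

text \<open>The anti-lexicographic order of finite sets of ordinals; its initial segments are small.\<close>

definition prec :: "hc => hc => bool" where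
 "prec x y <-> (EX m:$y. m~:$x & (ALL z:$x. m:$z --> z:$y) & (ALL z:$y. m:$z --> z:$x))"

definition fos :: "hc => bool" where "fos x <-> finite $x & (ALL z:$x. Ord z)"

lemma prec_total: assumes "fos x" "fos y" "x ~= y" shows "prec x y \<or> prec y x"
proof -
 define D where "D = ($x - $y) \<union> ($y - $x)"
 have "D ~= {}" using assms(3) elts_inject unfolding D_def by blast
 then obtain m where m: "m:D" "ALL z:D. z:$m \<or> z = m"
  using fmax[of D] assms unfolding D_def fos_def by auto
 have *: "z~:D" if "m:$z" "z:$x \<union> $y" for z
 proof
  assume "z:D"
  hence "z:$m \<or> z = m" using m by blast
  moreover have "Ord z" using that assms by (auto simp: fos_def)
  ultimately show False using that Ord_trans[of z m z] by auto
 qed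
 show ?thesis
 proof (cases "m:$y")
  case True
  hence "prec x y" unfolding prec_def using m * by (intro bexI[of _ m]) (auto simp: D_def)
  thus ?thesis ..
 next
  case False
  hence "prec y x" unfolding prec_def using m * by (intro bexI[of _ m]) (auto simp: D_def)
  thus ?thesis ..
 qed
qed

lemma prec_trans: assumes "fos x" "fos y" "fos w" "prec w x" "prec x y" shows "prec w y"
proof -
 obtain m where m: "m:$x" "m~:$w" "!!z. z:$w \<union> $x ==> m:$z ==> z:$w <-> z:$x"
  using assms(4) unfolding prec_def by blast
 obtain n where n: "n:$y" "n~:$x" "!!z. z:$x \<union> $y ==> n:$z ==> z:$x <-> z:$y"
  using assms(5) unfolding prec_def by blast
 have O: "Ord m" "Ord n" using m n assms by (auto simp: fos_def)
 have Oz: "Ord z" if "z:$w \<union> $y" for z using that assms by (auto simp: fos_def)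
 consider "m:$n" | "m = n" | "n:$m" using Ord_linear[OF O] by blast
 thus ?thesis
 proof cases
  case 1
  have "n~:$w" using m(3)[of n] n 1 by blast
  moreover have "z:$w <-> z:$y" if "z:$w \<union> $y" "n:$z" for z
   using m(3)[of z] n(3)[of z] Ord_trans[OF Oz[OF that(1)] that(2) 1] that by blast
  ultimately show ?thesis unfolding prec_def using n(1) by blast
 next
  case 2 thus ?thesis using m n by blast
 next
  case 3
  have "m:$y" using n(3)[of m] m 3 by blast
  moreover have "z:$w <-> z:$y" if "z:$w \<union> $y" "m:$z" for z
   using m(3)[of z] n(3)[of z] Ord_trans[OF Oz[OF that(1)] that(2) 3] that by blast
  ultimately show ?thesis unfolding prec_def using m(2) by blast
 qed
qed


text \<open>The relation lies in the multiset extension of membership: the top point of difference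
  belongs to \<open>y\<close> and dominates every point of \<open>x\<close> missing in
  \<open>y\<close>.\<close>

lemma wf_prec: "wf {(x, y). prec x y & fos x & fos y}"
proof (rule wf_subset)
 show "wf (inv_image (mult ({(x, y). x:$y}\<^sup>+)) (%x. mset_set $x))"
  by (intro wf_inv_image wf_mult wf_trancl wf_elts)
 show "{(x, y). prec x y & fos x & fos y} <= inv_image (mult ({(x, y). x:$y}\<^sup>+)) (%x. mset_set $x)"
 proof clarsimp
  fix x y assume xy: "prec x y" "fos x" "fos y"
  then obtain m where m: "m:$y" "m~:$x" "!!z. z:$x ==> m:$z ==> z:$y"
   by (auto simp: prec_def)
  define I K J where "I = $x \<inter> $y" "K = $x - $y" "J = $y - $x"
  have fin: "finite I" "finite K" "finite J" using xy by (auto simp: fos_def I_K_J_def)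
  have "(mset_set I + mset_set K, mset_set I + mset_set J):mult ({(x, y). x:$y}\<^sup>+)"
  proof (rule one_step_implies_mult)
   show "mset_set J ~= {#}" using m fin by (auto simp: mset_set_empty_iff I_K_J_def)
   show "ALL k:set_mset (mset_set K). EX j:set_mset (mset_set J). (k, j):{(x, y). x:$y}\<^sup>+"
   proof
    fix k assume "k:set_mset (mset_set K)"
    hence k: "k:$x" "k~:$y" using fin by (auto simp: I_K_J_def)
    hence "k ~= m" "m~:$k" using m by auto
    moreover have "Ord k" "Ord m" using k m xy by (auto simp: fos_def)
    ultimately have "k:$m" using Ord_linear by blast
    thus "EX j:set_mset (mset_set J). (k, j):{(x, y). x:$y}\<^sup>+"
     using m fin by (intro bexI[of _ m]) (auto simp: I_K_J_def)
   qed
  qed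
  moreover have "mset_set $x = mset_set I + mset_set K"
   by (subst mset_set_Union[symmetric]) (use fin in "auto simp: I_K_J_def Int_Diff_Un")
  moreover have "mset_set $y = mset_set I + mset_set J"
  proof -
   have "$y = I \<union> J" by (auto simp: I_K_J_def)
   moreover have "mset_set (I \<union> J) = mset_set I + mset_set J"
    by (rule mset_set_Union) (use fin in "auto simp: I_K_J_def")
   ultimately show ?thesis by simp
  qed
  ultimately show "(mset_set $x, mset_set $y):mult ({(x, y). x:$y}\<^sup>+)" by simp
 qed
qed

lemma prec_bound: assumes "prec x y" "fos x" "fos y" "m:$y" "ALL z:$y. z:$m \<or> z = m"
 shows "$x <= $(hsucc m)"
proof
 fix z assume z: "z:$x"
 obtain n where n: "n:$y" "!!z. z:$x ==> n:$z ==> z:$y"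
  using assms(1) by (auto simp: prec_def)
 have O: "Ord z" "Ord n" "Ord m" using z n assms by (auto simp: fos_def)
 show "z:$(hsucc m)"
 proof (cases "n:$z")
  case True thus ?thesis using n(2)[OF z] assms(5) by auto
 next
  case False
  hence "z:$n \<or> z = n" using Ord_linear[OF O(1,2)] by blast
  thus ?thesis using assms(5) n(1) Ord_trans[OF O(3)] by auto
 qed
qed

context tm begin

lemma dt_Prod [dfi]: assumes "dt s" "dt t" shows "dt (%e. Prod (s e) (t e))"
 by (rule dt_app2[where F=Prod, OF _ assms]) (unfold Prod_def, intro dfi)
lemma dt_hfst [dfi]: assumes "dt s" shows "dt (%e. hfst (s e))"
 by (rule dt_app1[where F=hfst, OF _ assms]) (unfold hfst_def, intro dfi)
lemma dt_hsnd [dfi]: assumes "dt s" shows "dt (%e. hsnd (s e))"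
 by (rule dt_app1[where F=hsnd, OF _ assms]) (unfold hsnd_def, intro dfi)
lemma df_prec [dfi]: assumes "dt s" "dt t" shows "df (%e. prec (s e) (t e))"
 by (rule df_app2[where P=prec, OF _ assms]) (unfold prec_def, intro dfi)
lemma df_inj_into [dfi]: assumes "dt s" "dt t" "dt u" shows "df (%e. inj_into (s e) (t e) (u e))"
 by (rule df_app3[where P=inj_into, OF _ assms]) (unfold inj_into_def, intro dfi)

lemma inv_fun: assumes i: "i:M" "inj_into i l k" and M: "l:M" "k:M" and y0: "y0:$l"
 obtains f where "f:M" "fun_on f k" "!!y. y:$l ==> ap i y:$k & ap f (ap i y) = y" "!!x. x:$k ==> ap f x:$l"
proof -
 define f where "f = lam k (%x. if (EX y:$l. ap i y = x) then UU (Sep l (%y. ap i y = x)) else y0)"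
 have fi: "ap i y:$k & ap f (ap i y) = y" if y: "y:$l" for y
 proof -
  have "$(Sep l (%y'. ap i y' = ap i y)) = {y}" using y i(2) by (auto simp: inj_into_def)
  hence "UU (Sep l (%y'. ap i y' = ap i y)) = y" by (rule UU_single)
  moreover have "ap i y:$k" using i(2) y by (auto simp: inj_into_def)
  ultimately show ?thesis using y by (auto simp: f_def)
 qed
 show ?thesis
 proof (rule that[of f])
  show "f:M" unfolding f_def by (rule dt_M0) (intro dfi M i trans[OF M(1) y0])
  show "ap f x:$l" if "x:$k" for x
   using fi that y0 by (cases "EX y:$l. ap i y = x") (metis, simp add: f_def)
 qed (simp add: f_def, rule fi)
qed

lemma lep_iff: "lep a b <-> (EX f:M. inj_into f a b)"
 unfolding lep_def inj_into_def inj_on_def image_subset_iff ..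
lemma df_lep [dfi]: assumes "dt s" "dt t" shows "df (%e. lep (s e) (t e))"
 by (rule df_app2[where P=lep, OF _ assms]) (unfold lep_iff, intro dfi)

lemma Prod_M: "A:M ==> B:M ==> Prod A B:M" by (rule dt_M0) (intro dfi)
lemma Fin_M: "A:M ==> Fin A:M" by (rule dt_M0) (intro dfi)

lemma lep_Fin_mono: assumes "lep A B" "A:M" "B:M" shows "lep (Fin A) (Fin B)"
proof -
 obtain f where f: "f:M" "inj_on (ap f) $A" "ap f ` $A <= $B" using assms by (auto simp: lep_def)
 show ?thesis
 proof (rule lepI[where F="%x. Img x (ap f)"])
  show "Fin A:M" by (rule Fin_M[OF assms(2)])
  show dt: "dt (%e. Img (e 0) (ap f))" by (intro dfi f)
  show "inj_on (%x. Img x (ap f)) ($(Fin A))"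
  proof (rule inj_onI)
   fix x y assume *: "x:$(Fin A)" "y:$(Fin A)" "Img x (ap f) = Img y (ap f)"
   hence "ap f ` $x = ap f ` $y" by (metis elts_Img)
   thus "x = y" using inj_on_image_eq_iff[OF f(2)] * hc_eqI[of x y] by simp
  qed
  show "Img x (ap f):$(Fin B)" if "x:$(Fin A)" for x
   using that f(3) dt_M1[where F="%x. Img x (ap f)", OF dt] by auto
 qed
qed

lemma lep_Prod_mono: assumes "lep A A'" "lep B B'" "A:M" "B:M" shows "lep (Prod A B) (Prod A' B')"
proof -
 obtain f where f: "f:M" "inj_into f A A'" using assms by (auto simp: lep_iff)
 obtain g where g: "g:M" "inj_into g B B'" using assms by (auto simp: lep_iff)
 show ?thesis
 proof (rule lepI[where F="%p. pair (ap f (hfst p)) (ap g (hsnd p))"])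
  show "Prod A B:M" by (intro Prod_M assms)
  show "dt (%e. pair (ap f (hfst (e 0))) (ap g (hsnd (e 0))))" by (intro dfi f g)
  show "inj_on (%p. pair (ap f (hfst p)) (ap g (hsnd p))) ($(Prod A B))"
   using f(2) g(2) unfolding inj_into_def inj_on_def by auto
  show "pair (ap f (hfst p)) (ap g (hsnd p)):$(Prod A' B')" if "p:$(Prod A B)" for p
   using that f(2) g(2) unfolding inj_into_def by auto
 qed
qed

lemma lep_hsucc: assumes "be:M" "Ord be" "$homega <= $be" shows "lep (hsucc be) be"
proof (rule lepI[where F="%x. if x = be then hempty else if x:$homega then hsucc x else x"])
 show "dt (%e. if e 0 = be then hempty else if e 0:$homega then hsucc (e 0) else e 0)"
  by (intro dfi assms hempty_M homega_M)
 have s: "hsucc (hnat n) = hnat (Suc n)" for n by simp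
 have "be~:$homega" using assms(3) not_mem_self by blast
 thus "inj_on (%x. if x = be then hempty else if x:$homega then hsucc x else x) ($(hsucc be))"
  by (auto simp: inj_on_def s simp flip: hnat.simps(1) simp del: hnat.simps)
 show "(if x = be then hempty else if x:$homega then hsucc x else x):$be" if "x:$(hsucc be)" for x
  using that assms(3) by (auto simp: s simp flip: hnat.simps(1) simp del: hnat.simps)
qed (use assms hsucc_M in auto)

lemma lep_infinite: "lep A B ==> infinite $A ==> infinite $B"
 unfolding lep_def using finite_imageD finite_subset by blast

lemma infinite_homega: "infinite $homega"
 using finite_imageD[of hnat UNIV] by (auto simp: inj_on_def)

lemma Ord_infinite: assumes "Ord a" "infinite $a" shows "$homega <= $a"
 using Ord_not_sub[of homega a] assms by (auto simp: elts_hnat)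

lemma infinite_Ord: assumes "$homega <= $a" shows "infinite $a"
 using infinite_homega finite_subset assms by blast

end

context tmc begin

text \<open>A finite set whose rank under \<open>prec\<close> is at least \<open>a\<close> would
  have at least \<open>a\<close> many predecessors. These are finite sets of ordinals up to its
  maximum \<open>m\<close>, and by induction there are at most \<open>m\<close> many of them, or
  finitely many if \<open>m\<close> is finite. Products are bounded afterwards through Kuratowski
  pairs, which are finite sets of finite sets.\<close>

lemma lep_Fin_Card:
 assumes a: "Card a" "$homega <= $a"
  and IH: "!!b. b:$a ==> $homega <= $b ==> lep (Fin b) b"
 shows "lep (Fin a) a"
proof -
 have aM: "a:M" and aO: "Ord a" using a Card_M Card_Ord by auto
 have fosF: "fos x" if "x:$(Fin a)" for x using that Ord_in[OF aO] by (auto simp: fos_def)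
 define Ext where "Ext y = Sep (Fin a) (%x. prec x y & y:$(Fin a))" for y
 have wfE: "wf {(x, y). x:$(Ext y)}"
  by (rule wf_subset[OF wf_prec]) (use fosF in "auto simp: Ext_def simp del: elts_Fin")
 define F where "F = wfrec {(x, y). x:$(Ext y)} (%f y. Img (Ext y) f)"
 have F: "F y = Img (Ext y) F" for y
  unfolding F_def by (subst wfrec[OF wfE], rule Img_cong) (simp add: cut_apply)
 have dE: "dt (%e. Ext (e 0))" unfolding Ext_def by (intro dfi aM)
 note [dfi] = dt_app1[where F=Ext, OF dE]
 have "tmrec M Ext (%y f. Img (Ext y) (ap f)) F"
 proof unfold_locales
  show "dt (%e. Ext (e 0))" by (rule dE)
  show "dt (%e. Img (Ext (e 0)) (ap (e (Suc 0))))" by (intro dfi)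
  show "F x = Img (Ext x) (ap (lam (Ext x) F))" for x by (subst F, rule Img_cong) simp
 qed (rule wfE)
 note dF [dfi] = tmrec.dt_F[OF this]
 have elF: "$(F y) = F ` $(Ext y)" for y by (subst F) simp
 have tr: "x:$(Ext z)" if "x:$(Ext y)" "y:$(Ext z)" for x y z
  using that fosF prec_trans[of y z x] by (auto simp: Ext_def simp del: elts_Fin)
 have FO: "Ord (F y)" for y
 proof (induction y rule: wf_induct_rule[OF wfE])
  case (1 y)
  show ?case
  proof (rule OrdI)
   fix u v assume "u:$(F y)" "v:$u"
   thus "v:$(F y)" using tr unfolding elF by (auto simp: elF)
  next
   fix u assume "u:$(F y)"
   thus "Ord u" using 1 unfolding elF by auto
  qed
 qed
 have Finj: "inj_on F ($(Fin a))"
 proof (rule inj_onI, rule ccontr)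
  fix x y assume *: "x:$(Fin a)" "y:$(Fin a)" "F x = F y" "x ~= y"
  hence "prec x y \<or> prec y x" by (intro prec_total fosF)
  hence "F x:$(F y) \<or> F y:$(F x)" using * unfolding elF Ext_def elts_Sep by blast
  thus False using * by simp
 qed
 have "F y:$a" if y: "y:$(Fin a)" for y
 proof (rule ccontr)
  assume "F y~:$a"
  hence "$a <= $(F y)" using Ord_not_sub[OF aO FO] by blast
  hence 1: "lep a (F y)" by (rule lep_subset[OF aM])
  have yM: "y:M" using y by simp
  have dF0: "dt (%e. F (e 0))" by (intro dfi)
  have FM: "F y:M" "Ext y:M" using dt_M1[OF dF0 yM] dt_M1[OF dE yM] by simp_all
  have 2: "lep (F y) (Ext y)" by (rule lep_surj[OF FM(2,1) dF0]) (simp add: elF)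
  have inf: "infinite ($(Ext y))"
   using lep_infinite[OF 2 lep_infinite[OF 1 infinite_Ord[OF a(2)]]] .
  have "$y ~= {}"
  proof
   assume "$y = {}"
   hence "$(Ext y) = {}" by (auto simp: Ext_def prec_def)
   thus False using inf by simp
  qed
  then obtain m where m: "m:$y" "ALL z:$y. z:$m \<or> z = m"
   using fmax[of "$y"] fosF[OF y] by (auto simp: fos_def)
  have ma: "m:$a" using m y by auto
  hence mO: "Ord m" and mM: "m:M" using Ord_in[OF aO] trans[OF aM] by auto
  have sub: "$(Ext y) <= $(Fin (hsucc m))"
   using prec_bound[OF _ _ fosF[OF y] m] fosF by (auto simp: Ext_def simp del: elts_hsucc)
  hence 3: "lep (Ext y) (Fin (hsucc m))" by (rule lep_subset[OF FM(2)])
  show False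
  proof (cases "$homega <= $m")
   case True
   have "lep (Fin (hsucc m)) (Fin m)" by (rule lep_Fin_mono[OF lep_hsucc]) (use mO mM True hsucc_M in auto)
   hence "lep (Fin (hsucc m)) m" using lep_trans IH[OF ma True] Fin_M hsucc_M mM by blast
   hence "lep a m" using 1 2 3 lep_trans aM FM by metis
   thus False using Card_not_lep[OF a(1) ma] by simp
  next
   case False
   hence "finite ($(hsucc m))" using Ord_infinite[OF mO] by auto
   moreover have "elts ` $(Fin (hsucc m)) <= Pow ($(hsucc m))" by auto
   ultimately have "finite (elts ` $(Fin (hsucc m)))" using finite_subset finite_Pow_iff by blast
   hence "finite ($(Fin (hsucc m)))" by (rule finite_imageD) (auto simp: inj_on_def elts_inject)
   thus False using inf sub finite_subset by blast
  qed
 qed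
 moreover have "dt (%e. F (e 0))" by (intro dfi)
 ultimately show ?thesis by (intro lepI[where F=F] Finj Fin_M aM)
qed

lemma lep_Fin: "a:M ==> Ord a ==> $homega <= $a ==> lep (Fin a) a"
proof (induction a rule: wf_elts_induct)
 case (step a)
 show ?case
 proof (cases "Card a")
  case True
  show ?thesis
   by (rule lep_Fin_Card[OF True step.prems(3)]) (use step trans Ord_in in blast)
 next
  case False
  obtain k where k: "k:M" "Card k" "eqp k a" "$k <= $a" using ex_Card_Ord step by blast
  have kO: "Ord k" using k Card_Ord by blast
  have "k ~= a" using False k by blast
  hence ka: "k:$a" using k Ord_subset[OF kO step.prems(2)] by blast
  have ak: "lep a k" by (rule eqp_lep[OF eqp_sym]) (use k step in auto)
  have "$homega <= $k"
   using Ord_infinite[OF kO lep_infinite[OF ak infinite_Ord[OF step.prems(3)]]] .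
  hence "lep (Fin k) k" using step.IH[OF ka k(1) kO] by blast
  moreover have "lep (Fin a) (Fin k)" by (rule lep_Fin_mono[OF ak]) (use step k in auto)
  moreover have "lep k a" using k lep_subset by blast
  ultimately show ?thesis using lep_trans Fin_M step.prems(1) k(1) by metis
 qed
qed

definition InfO :: "hc => bool" where "InfO a <-> a:M & Ord a & $homega <= $a"

lemma lep_FinI: assumes "lep A a" "InfO a" "A:M" shows "lep (Fin A) a"
 using assms lep_trans[OF lep_Fin_mono[OF assms(1,3)] lep_Fin] Fin_M by (simp add: InfO_def)

lemma lep_ProdI: assumes "lep A a" "lep B a" "InfO a" "A:M" "B:M" shows "lep (Prod A B) a"
proof -
 have aM: "a:M" using assms by (simp add: InfO_def)
 have "Upr x y:$(Fin a)" if "x:$a" "y:$a" for x y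
  using that Upr_M trans[OF aM] by auto
 hence "pair x y:$(Fin (Fin a))" if "x:$a" "y:$a" for x y
  using that Upr_M unfolding pair_Upr elts_Fin[of "Fin a"] by (auto simp del: elts_Fin) (auto)
 hence "$(Prod a a) <= $(Fin (Fin a))" by (auto simp del: elts_Fin)
 hence 1: "lep (Prod a a) (Fin (Fin a))" by (intro lep_subset Prod_M aM)
 have "lep (Fin a) a" using assms lep_Fin by (simp add: InfO_def)
 hence "lep (Fin (Fin a)) a" using lep_FinI assms Fin_M aM by blast
 thus ?thesis
  using 1 lep_trans lep_Prod_mono[OF assms(1,2,4,5)] Prod_M assms aM by metis
qed

lemma lep_UU: assumes "A:M" "lep A a" "InfO a" "!!x. x:$A ==> lep x a" shows "lep (UU A) a"
proof -
 have aM: "a:M" using assms by (simp add: InfO_def)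
 have "df (%e. inj_into (e (Suc 0)) (e 0) a)" by (intro dfi aM)
 from AC[OF assms(1) this] assms(4) obtain c where
  c: "c:M" "!!x. x:$A ==> inj_into (ap c x) x a" unfolding lep_iff by metis
 have "df (%e. e (Suc 0):$A & e 0:$(e (Suc 0)))" by (intro dfi assms)
 from AC[OF UU_M[OF assms(1)] this] trans[OF assms(1)] obtain g where
  g: "g:M" "!!x. x:$(UU A) ==> ap g x:$A & x:$(ap g x)" unfolding elts_UU by (smt (verit) UN_iff)
 obtain i where i: "i:M" "inj_into i A a" using assms(2) by (auto simp: lep_iff)
 have "lep (UU A) (Prod a a)"
 proof (rule lepI[where F="%x. pair (ap i (ap g x)) (ap (ap c (ap g x)) x)"])
  show "dt (%e. pair (ap i (ap g (e 0))) (ap (ap c (ap g (e 0))) (e 0)))" by (intro dfi i g c)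
  show "inj_on (%x. pair (ap i (ap g x)) (ap (ap c (ap g x)) x)) ($(UU A))"
  proof (rule inj_onI)
   fix x y assume x: "x:$(UU A)" and y: "y:$(UU A)"
    and eq: "pair (ap i (ap g x)) (ap (ap c (ap g x)) x) = pair (ap i (ap g y)) (ap (ap c (ap g y)) y)"
   have gg: "ap g x = ap g y" using i(2) g(2)[OF x] g(2)[OF y] eq unfolding inj_into_def by simp
   thus "x = y" using c(2)[of "ap g x"] g(2)[OF x] g(2)[OF y] eq unfolding inj_into_def by simp
  qed
  show "pair (ap i (ap g x)) (ap (ap c (ap g x)) x):$(Prod a a)" if "x:$(UU A)" for x
   using g(2)[OF that] i(2) c(2)[of "ap g x"] unfolding inj_into_def by simp
 qed (rule UU_M[OF assms(1)])
 moreover have "lep (Prod a a) a" by (rule lep_ProdI) (use lep_refl aM assms in auto)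
 ultimately show ?thesis using lep_trans UU_M assms(1) by blast
qed

lemma lep_Upr: assumes "InfO a" "x:M" "y:M" shows "lep (Upr x y) a"
proof (rule lepI[where F="%z. if z = x then hnat 0 else hnat 1"])
 show "dt (%e. if e 0 = x then hnat 0 else hnat 1)" by (intro dfi assms hnat_M)
qed (use assms Upr_M in "auto simp: InfO_def inj_on_def simp del: hnat.simps One_nat_def")

subsection \<open>Successor cardinals\<close>

lemma succ_lep: assumes "is_successor_cardinal M k l" "Ord k" "k:M" "a:$l" shows "lep a k"
proof -
 have l: "Card l" "k:$l" "!!m. Card m ==> k:$m ==> $l <= $m"
  using assms by (auto simp: is_successor_cardinal_def)
 have a: "a:M" "Ord a" using assms(4) l trans Card_M Card_Ord Ord_in by blast+
 obtain c where c: "c:M" "Card c" "eqp c a" "$c <= $a" using ex_Card_Ord[OF a] by blast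
 have "k~:$c" using l(3)[OF c(2)] c(4) assms(4) not_mem_self by blast
 hence "$c <= $k" using Ord_not_sub[OF Card_Ord[OF c(2)] assms(2)] by blast
 thus ?thesis using lep_trans[OF eqp_lep[OF eqp_sym[OF c(3)]] lep_subset] a c by blast
qed

lemma succ_not_lep: assumes "is_successor_cardinal M k l" shows "~ lep l k"
 using assms Card_not_lep by (auto simp: is_successor_cardinal_def)

text \<open>Regularity of a successor cardinal, in the form that keeps suprema of domains below
  it.\<close>

lemma succ_sup:
 assumes "is_successor_cardinal M k l" "InfO k" "X:M" "$X <= $l" "lep X k" shows "UU X:$l"
proof (rule ccontr)
 assume n: "UU X~:$l"
 have l: "Ord l" "l:M" using assms Card_M Card_Ord by (auto simp: is_successor_cardinal_def)
 have "Ord (UU X)" using assms(4) Ord_in[OF l(1)] by (intro Ord_UU) blast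
 hence "$l <= $(UU X)" using n Ord_not_sub[OF l(1)] by blast
 hence "lep l (UU X)" by (rule lep_subset[OF l(2)])
 moreover have "lep (UU X) k"
  by (rule lep_UU) (use assms succ_lep in "auto simp: InfO_def")
 ultimately show False using lep_trans l succ_not_lep[OF assms(1)] by blast
qed

end

section \<open>Forcing\<close>

lemma elts_val: "$(val G t) = {val G s | s p. p:G & pair s p:$t}"
proof -
 have "{s. EX p:G. pair s p:$t} <= hfst ` $t"
 proof clarify
  fix s p assume "pair s p:$t"
  hence "hfst (pair s p):hfst ` $t" by (rule imageI)
  thus "s:hfst ` $t" by (simp only: hfst)
 qed
 hence "countable {s. EX p:G. pair s p:$t}" by (rule countable_subset) simp
 hence "$(val G t) = val G ` {s. EX p:G. pair s p:$t}" by (subst val.simps) (rule elts_HSet, simp)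
 thus ?thesis by blast
qed

definition dm :: "hc => hc" where
 "dm t = Img (Sep t (%z. EX s:$(UU (UU t)). EX p:$(UU (UU t)). z = pair s p)) hfst"
lemma elts_dm [simp]: "$(dm t) = {s. EX p. pair s p:$t}"
proof -
 have "s:$(dm t)" if "pair s p:$t" for s p
  unfolding dm_def elts_Img elts_Sep using pair_in_UU[OF that] that
  by (intro image_eqI[of _ _ "pair s p"]) auto
 thus ?thesis by (auto simp: dm_def simp del: elts_UU)
qed

lemma wf_dm: "wf {(s, t). s:$(dm t)}"
 by (rule wf_subset[OF wf_trancl[OF wf_elts]]) (auto dest: pair_fst_trancl)

lemma dm_induct [case_names step]: "(!!x. (!!y. y:$(dm x) ==> P y) ==> P x) ==> P x"
 using wf_induct_rule[OF wf_dm, of P] by blast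

context tm begin
lemma dt_dm [dfi]: assumes "dt s" shows "dt (%e. dm (s e))"
 by (rule dt_app1[where F=dm, OF _ assms]) (unfold dm_def, intro dfi)
lemma dm_M: "x:M ==> dm x:M" by (rule dt_M0) (intro dfi)
end

context tm begin
text \<open>All outer variables become parameters. The truth lemma calls for this: a formula comes
  with an infinite environment of names, whereas genericity concerns a predicate of a single
  condition.\<close>

lemma df_fix: assumes "df (%e. R (e 0) (%i. e (Suc i)))" "env d" shows "df (%x. R (x 0) d)"
proof -
 obtain p c where p: "env c" "!!e. env e ==> sat M p (mrg e c) = R (e 0) (%i. e (Suc i))"
  using assms(1) by (auto simp: df_def)
 define f where "f i = (if i = 0 then 0 else if even i then Suc (2 * (2 * (i div 2))) else Suc (2 * (Suc (2 * (i div 2)))))" for i :: nat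
 have inj: "inj f" unfolding inj_on_def f_def by (auto split: if_splits elim!: oddE evenE; presburger)
 define c' where "c' = mrg (case_nat (d 0) d) c"
 have c': "env c'" unfolding c'_def env_def mrg_def using p(1) assms(2) by (auto simp: env_def split: nat.split)
 have "mrg x c' \<circ> f = mrg (case_nat (x 0) d) c" for x
 proof
  fix i :: nat
  consider "i = 0" | j where "i = 2 * Suc j" | j where "i = Suc (2*j)"
   by (metis evenE oddE Suc_eq_plus1 not0_implies_Suc mult_0_right)
  thus "(mrg x c' \<circ> f) i = mrg (case_nat (x 0) d) c i"
  proof cases
   case 1 thus ?thesis by (simp add: f_def mrg_def)
  next
   case 2
   hence "f i = Suc (2 * (2 * Suc j))" by (simp add: f_def)
   thus ?thesis using 2 by (simp only: comp_apply mrg_simps c'_def) simp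
  next
   case 3
   hence "f i = Suc (2 * Suc (2 * j))" by (simp add: f_def)
   thus ?thesis using 3 by (simp only: comp_apply mrg_simps c'_def)
  qed
 qed
 hence "sat M (ren f p) (mrg x c') = R (x 0) d" if "env x" for x
  using p(2)[of "case_nat (x 0) d"] that assms(2) by (simp add: sat_ren[OF inj] env_def split: nat.split)
 thus ?thesis unfolding df_def using c' by blast
qed
end

locale forcing = tm +
 fixes P L :: hc
 assumes PM: "P:M" and LM: "L:M"
  and fn: "forcing_notion $P (%p q. pair p q:$L)"
begin

abbreviation le :: "hc => hc => bool" where "le p q \<equiv> pair p q:$L"

lemma le_refl: "p:$P ==> le p p" using fn by (auto simp: forcing_notion_def)
lemma le_trans: "le p q ==> le q r ==> p:$P ==> q:$P ==> r:$P ==> le p r"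
 using fn unfolding forcing_notion_def by blast
lemma P_M: "p:$P ==> p:M" using trans[OF PM] .

definition one where "one = (SOME t. t:$P & (ALL p:$P. le p t))"
lemma one: "one:$P" "p:$P ==> le p one"
proof -
 have "EX t. t:$P & (ALL p:$P. le p t)" using fn unfolding forcing_notion_def by blast
 hence "one:$P & (ALL p:$P. le p one)" unfolding one_def by (rule someI_ex)
 thus "one:$P" "p:$P ==> le p one" by auto
qed
lemma one_M: "one:M" using one(1) by (rule P_M)

subsection \<open>Names\<close>

definition cl0 where "cl0 t = Sep t (%z. EX s:$(UU (UU t)). EX p:$P. z = pair s p)"
lemma elts_cl0: "$(cl0 t) = {pair s p | s p. pair s p:$t & p:$P}"
 unfolding cl0_def elts_Sep using pair_in_UU[where f=t] by blast

text \<open>Hereditarily discards elements that are not pairs of a set and a condition. For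
  \<open>G <= $P\<close> the value does not change, so every set of the ground model may serve as a
  name and \<open>gen_ext\<close> is the image of \<open>M\<close> under
  \<open>val G\<close>.\<close>

definition clean :: "hc => hc" where
 "clean = wfrec {(s, t). s:$(dm t)} (%f t. Img (cl0 t) (%z. pair (f (hfst z)) (hsnd z)))"

lemma clean: "clean t = Img (cl0 t) (%z. pair (clean (hfst z)) (hsnd z))"
 unfolding clean_def
 by (subst wfrec[OF wf_dm], rule Img_cong) (auto simp: cut_def elts_cl0)

lemma clean_M: "t:M ==> clean t:M"
proof -
 have dcl: "dt (%e. cl0 (e 0))" unfolding cl0_def by (intro dfi PM)
 note [dfi] = dt_app1[where F=cl0, OF dcl]
 have "tmrec M dm (%t f. Img (cl0 t) (%z. pair (ap f (hfst z)) (hsnd z))) clean"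
 proof unfold_locales
  show "dt (%e. dm (e 0))" "dt (%e. Img (cl0 (e 0)) (%z. pair (ap (e (Suc 0)) (hfst z)) (hsnd z)))" by (intro dfi)+
  show "wf {(s, t). s:$(dm t)}" by (rule wf_dm)
  show "clean t = Img (cl0 t) (%z. pair (ap (lam (dm t) clean) (hfst z)) (hsnd z))" for t
  proof (subst clean, rule Img_cong)
   fix z assume "z:$(cl0 t)"
   then obtain s p where "z = pair s p" "s:$(dm t)" by (auto simp: elts_cl0)
   thus "pair (clean (hfst z)) (hsnd z) = pair (ap (lam (dm t) clean) (hfst z)) (hsnd z)"
    by (simp del: elts_dm)
  qed
 qed
 from tmrec.dt_F[OF this dt_const] show "t:M ==> clean t:M" using dt_M0 by blast
qed

lemma clean_name: "is_name $P (clean t)"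
proof (induction t rule: dm_induct)
 case (step t)
 show ?case
 proof (rule is_name.intros)
  fix x assume "x:$(clean t)"
  then obtain s p where "pair s p:$t" "p:$P" "x = pair (clean s) p"
   by (subst (asm) clean) (auto simp: elts_cl0)
  thus "EX s p. x = pair s p & p:$P & is_name $P s" using step[of s] by auto
 qed
qed

lemma val_clean: assumes "G <= $P" shows "val G (clean t) = val G t"
proof (induction t rule: dm_induct)
 case (step t)
 have pc: "pair s' p:$(clean t) <-> p:$P & (EX s. pair s p:$t & s' = clean s)" for s' p
  by (subst clean) (auto simp: elts_cl0 image_iff, force)
 hence "$(val G (clean t)) = {val G (clean s) | s p. p:G & pair s p:$t}"
 proof (intro subset_antisym subsetI)
  fix z assume "z:$(val G (clean t))"
  then obtain s' p where *: "z = val G s'" "p:G" "pair s' p:$(clean t)" unfolding elts_val by blast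
  moreover from *(3) obtain s where "pair s p:$t" "s' = clean s" unfolding pc by blast
  ultimately show "z:{val G (clean s) | s p. p:G & pair s p:$t}" by blast
 next
  fix z assume "z:{val G (clean s) | s p. p:G & pair s p:$t}"
  then obtain s p where *: "z = val G (clean s)" "p:G" "pair s p:$t" by blast
  hence "pair (clean s) p:$(clean t)" using pc assms by blast
  thus "z:$(val G (clean t))" using * unfolding elts_val by blast
 qed
 also have "\<dots> = {val G s | s p. p:G & pair s p:$t}"
 proof -
  have "val G (clean s) = val G s" if "pair s p:$t" for s p by (rule step) (use that in auto)
  thus ?thesis by metis
 qed
 also have "\<dots> = $(val G t)" by (simp add: elts_val)
 finally show ?case by (rule hc_eqI)
qed

lemma gen_ext_eq: assumes "G <= $P" shows "gen_ext M $P G = val G ` M"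
proof
 show "gen_ext M $P G <= val G ` M" unfolding gen_ext_def by blast
 show "val G ` M <= gen_ext M $P G"
  unfolding gen_ext_def using clean_M clean_name val_clean[OF assms] by (auto, metis)
qed

definition check :: "hc => hc" where
 "check = wfrec {(x, y). x:$y} (%f x. Img x (%y. pair (f y) one))"
lemma check: "check x = Img x (%y. pair (check y) one)"
 unfolding check_def by (subst wfrec[OF wf_elts], rule Img_cong) (simp add: cut_apply)

lemma dt_check [dfi]: "dt t ==> dt (%e. check (t e))"
proof -
 have "tmrec M (%x. x) (%x f. Img x (%y. pair (ap f y) one)) check"
 proof unfold_locales
  show "dt (%e. e 0)" "dt (%e. Img (e 0) (%y. pair (ap (e (Suc 0)) y) one))" by (intro dfi one_M)+
  show "wf {(y, x). y:$x}" by (rule wf_elts)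
  show "check x = Img x (%y. pair (ap (lam x check) y) one)" for x
   by (subst check, rule Img_cong) simp
 qed
 thus "dt t ==> dt (%e. check (t e))" by (rule tmrec.dt_F)
qed

lemma check_M: "x:M ==> check x:M" by (rule dt_M0) (intro dfi)

lemma val_check: assumes "one:G" shows "val G (check x) = x"
proof (induction x rule: wf_elts_induct)
 case (step x)
 have "pair s p:$(check x) <-> p = one & (EX y:$x. s = check y)" for s p
  by (subst check) auto
 hence "$(val G (check x)) = (%y. val G (check y)) ` $x" using assms by (auto simp: elts_val)
 also have "\<dots> = $x" using step by simp
 finally show ?case by (rule hc_eqI)
qed

definition upn where "upn s t = Upr (pair s one) (pair t one)"
definition pn where "pn s t = upn (upn s s) (upn s t)"
lemma val_upn: assumes "one:G" shows "val G (upn s t) = Upr (val G s) (val G t)"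
 using assms by (intro hc_eqI) (auto simp: elts_val upn_def)
lemma val_pn: assumes "one:G" shows "val G (pn s t) = pair (val G s) (val G t)"
 using assms by (simp add: pn_def val_upn pair_Upr)
lemma dt_upn [dfi]: "dt s ==> dt t ==> dt (%e. upn (s e) (t e))" unfolding upn_def by (intro dfi one_M)
lemma dt_pn [dfi]: "dt s ==> dt t ==> dt (%e. pn (s e) (t e))" unfolding pn_def by (intro dfi)

subsection \<open>The forcing relation for atomic formulas\<close>

text \<open>One inclusion of a forced equality of \<open>x\<close> and \<open>y\<close>, where
  \<open>E s s'\<close> is the set of conditions forcing \<open>s = s'\<close>. The recursion
  concerns equality alone, as \<open>memf\<close> reduces to it. Pairs of names descend in both
  coordinates; the first one suffices for well-foundedness.\<close>

definition half :: "hc => hc => hc => (hc => hc => hc) => bool" where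
 "half p x y E <-> (ALL s:$(dm x). ALL r:$P. pair s r:$x --> (ALL q:$P. le q p & le q r -->
  (EX q':$P. le q' q & (EX s':$(dm y). EX r':$P. pair s' r':$y & le q' r' & q':$(E s s')))))"

definition EqH :: "hc => hc => hc" where
 "EqH z f = Sep P (%p. half p (hfst z) (hsnd z) (%s s'. ap f (pair s s')) & half p (hsnd z) (hfst z) (%s' s. ap f (pair s s')))"
definition EqX :: "hc => hc" where "EqX z = Prod (dm (hfst z)) (dm (hsnd z))"

lemma half_cong: "(!!s s'. s:$(dm x) ==> s':$(dm y) ==> E s s' = E' s s') ==> half p x y E = half p x y E'"
 unfolding half_def by (intro ball_cong refl imp_cong bex_cong conj_cong) auto

lemma wf_EqX: "wf {(w, z). w:$(EqX z)}"
 by (rule wf_subset[OF wf_inv_image[OF wf_dm, of hfst]]) (auto simp: EqX_def inv_image_def)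

lemma EqH_lam: "EqH z (lam (EqX z) F) = EqH z (lam (EqX z) F')" if "!!w. w:$(EqX z) ==> F w = F' w"
 using lam_cong[of "EqX z" F F', OF that] by simp

definition Eqf :: "hc => hc" where
 "Eqf = wfrec {(w, z). w:$(EqX z)} (%f z. EqH z (lam (EqX z) f))"

lemma Eqf: "Eqf z = EqH z (lam (EqX z) Eqf)"
 unfolding Eqf_def by (subst wfrec[OF wf_EqX], rule EqH_lam) (simp add: cut_apply)

lemma dt_Eqf: "dt t ==> dt (%e. Eqf (t e))"
proof -
 have "tmrec M EqX EqH Eqf"
 proof unfold_locales
  show "dt (%e. EqX (e 0))" unfolding EqX_def by (intro dfi)
  show "dt (%e. EqH (e 0) (e (Suc 0)))" unfolding EqH_def half_def by (intro dfi PM LM)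
 qed (rule wf_EqX Eqf)+
 thus "dt t ==> dt (%e. Eqf (t e))" by (rule tmrec.dt_F)
qed

definition eqf where "eqf p x y <-> p:$(Eqf (pair x y))"
lemma df_eqf [dfi]: "dt s ==> dt t ==> dt u ==> df (%e. eqf (s e) (t e) (u e))"
 unfolding eqf_def by (intro dfi dt_Eqf)

definition sub :: "hc => hc => hc => (hc => hc => hc => bool) => bool" where
 "sub p x y E <-> (ALL s r q. r:$P & pair s r:$x & q:$P & le q p & le q r -->
  (EX q':$P. le q' q & (EX s'. EX r':$P. pair s' r':$y & le q' r' & E q' s s')))"

lemma eqf: "eqf p x y <-> p:$P & sub p x y (%q s s'. eqf q s s') & sub p y x (%q s' s. eqf q s s')"
proof -
 let ?l = "lam (EqX (pair x y)) Eqf"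
 have 1: "half p x y (%s s'. ap ?l (pair s s')) = half p x y (%s s'. Eqf (pair s s'))"
  by (rule half_cong, rule ap_lam) (simp add: EqX_def del: elts_dm)
 have 2: "half p y x (%s' s. ap ?l (pair s s')) = half p y x (%s' s. Eqf (pair s s'))"
  by (rule half_cong, rule ap_lam) (simp add: EqX_def del: elts_dm)
 show ?thesis unfolding eqf_def
  by (subst Eqf) (simp add: EqH_def 1 2, auto simp: half_def sub_def, (meson | metis)+)
qed

definition memf where
 "memf p x y <-> p:$P & (ALL q:$P. le q p -->
  (EX q':$P. le q' q & (EX s:$(dm y). EX r:$P. pair s r:$y & le q' r & eqf q' x s)))"
lemma df_memf [dfi]: "dt s ==> dt t ==> dt u ==> df (%e. memf (s e) (t e) (u e))"
 by (rule df_app3[where P=memf]) (unfold memf_def, intro dfi PM LM)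

lemma sub_mono: "sub p x y E ==> le q p ==> q:$P ==> p:$P ==> sub q x y E"
 unfolding sub_def using le_trans by meson
lemma sub_dense: assumes "!!q. q:$P ==> le q p ==> EX r:$P. le r q & sub r x y E" "p:$P"
 shows "sub p x y E"
 unfolding sub_def
proof (intro allI impI)
 fix s r q assume *: "r:$P & pair s r:$x & q:$P & le q p & le q r"
 then obtain q1 where q1: "q1:$P" "le q1 q" "sub q1 x y E" using assms(1) by blast
 hence "le q1 r" using * le_trans by blast
 then obtain q' where "q':$P" "le q' q1" "EX s'. EX r':$P. pair s' r':$y & le q' r' & E q' s s'"
  using q1 * le_refl[of q1] unfolding sub_def by meson
 thus "EX q':$P. le q' q & (EX s'. EX r':$P. pair s' r':$y & le q' r' & E q' s s')"
  using le_trans[of q' q1 q] q1 * by blast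
qed

lemma eqf_mono: "eqf p x y ==> le q p ==> q:$P ==> eqf q x y"
 using sub_mono by (subst (asm) eqf, subst eqf) blast
lemma eqf_P: "eqf p x y ==> p:$P" using eqf by blast
lemma eqf_dense:
 assumes "p:$P" "!!q. q:$P ==> le q p ==> EX r:$P. le r q & eqf r x y" shows "eqf p x y"
proof (subst eqf, intro conjI assms(1))
 have *: "EX r:$P. le r q & sub r x y eqf & sub r y x (%q s' s. eqf q s s')" if "q:$P" "le q p" for q
  using assms(2)[OF that] eqf by metis
 show "sub p x y eqf" "sub p y x (%q s' s. eqf q s s')"
  by (rule sub_dense[OF _ assms(1)], use * in blast)+
qed

lemma memf_mono: "memf p x y ==> le q p ==> q:$P ==> memf q x y"
 unfolding memf_def using le_trans by meson
lemma memf_P: "memf p x y ==> p:$P" by (simp add: memf_def)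
lemma memf_dense:
 assumes "p:$P" "!!q. q:$P ==> le q p ==> EX r:$P. le r q & memf r x y" shows "memf p x y"
 unfolding memf_def
proof (intro conjI ballI impI assms(1))
 fix q assume q: "q:$P" "le q p"
 then obtain r where r: "r:$P" "le r q" "memf r x y" using assms(2) by blast
 then obtain q' where "q':$P" "le q' r" "EX s:$(dm y). EX r:$P. pair s r:$y & le q' r & eqf q' x s"
  unfolding memf_def using le_refl by meson
 thus "EX q':$P. le q' q & (EX s:$(dm y). EX r:$P. pair s r:$y & le q' r & eqf q' x s)"
  using le_trans q r by blast
qed

subsection \<open>The forcing relation for all formulas\<close>

primrec frc :: "fm => hc => (nat => hc) => bool" where
 "frc (Mem i j) p e <-> memf p (e i) (e j)"
| "frc (Eq i j) p e <-> eqf p (e i) (e j)"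
| "frc (Neg ph) p e <-> p:$P & (ALL q:$P. le q p --> ~ frc ph q e)"
| "frc (Conj ph \<psi>) p e <-> frc ph p e & frc \<psi> p e"
| "frc (All i ph) p e <-> (ALL x:M. frc ph p (e(i := x)))"

lemma df_frc: "df (%e. frc ph (e 0) (%i. e (Suc i)))"
proof (induction ph)
 case (Neg ph)
 have "inj (case_nat 0 (%i. Suc (Suc i)))" by (auto simp: inj_on_def split: nat.splits)
 from df_ren[OF Neg this] have "df (%e. frc ph (e 0) (%i. e (Suc (Suc i))))" by simp
 thus ?case unfolding frc.simps by (intro dfi PM LM)
next
 case (All i ph)
 have "inj (case_nat 1 (%j. if j = i then 0 else Suc (Suc j)))" by (auto simp: inj_on_def split: nat.splits)
 from df_ren[OF All this] have "df (%e. frc ph (e 1) (%j. e (if j = i then 0 else Suc (Suc j))))" by simp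
 moreover have "(%j. e (if j = i then 0 else Suc (Suc j))) = (%j. e (Suc (Suc j)))(i := e 0)" for e :: "nat => hc"
  by (auto simp: fun_eq_iff)
 ultimately have "df (%e. frc ph (e (Suc 0)) ((%j. e (Suc (Suc j)))(i := e 0)))" by (simp only: One_nat_def)
 thus ?case unfolding frc.simps by (rule df_all[where R="%x e. frc ph (e 0) ((%j. e (Suc j))(i := x))"])
next
 case (Mem i j) show ?case unfolding frc.simps by (intro dfi)
next
 case (Eq i j) show ?case unfolding frc.simps by (intro dfi)
next
 case (Conj ph \<psi>) show ?case unfolding frc.simps by (intro dfi Conj)
qed

lemma frc_mono: "frc ph p e ==> le q p ==> q:$P ==> frc ph q e"
proof (induction ph arbitrary: e)
 case (Neg ph) thus ?case using le_trans by auto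
qed (auto dest: eqf_mono memf_mono)

text \<open>Used through its contrapositive: a condition that does not force a formula has an
  extension below which no condition forces it. This settles the universal quantifier in the truth
  lemma.\<close>

lemma frc_dense:
 "p:$P ==> (!!q. q:$P ==> le q p ==> EX r:$P. le r q & frc ph r e) ==> frc ph p e"
proof (induction ph arbitrary: e)
 case (Mem i j) thus ?case using memf_dense by auto
next
 case (Eq i j) thus ?case using eqf_dense by auto
next
 case (Neg ph)
 have "~ frc ph q e" if q: "q:$P" "le q p" for q
 proof
  assume "frc ph q e"
  moreover obtain r where "r:$P" "le r q" "frc (Neg ph) r e" using Neg(3)[OF q] by blast
  ultimately show False using frc_mono[of ph q e r] le_refl by auto
 qed
 thus ?case using Neg(2) by simp
next
 case (Conj ph \<psi>)
 show ?case unfolding frc.simps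
 proof (intro conjI Conj.IH Conj.prems(1))
  show "EX r:$P. le r q & frc ph r e" "EX r:$P. le r q & frc \<psi> r e" if "q:$P" "le q p" for q
   using Conj.prems(2)[OF that] by auto
 qed
next
 case (All i ph)
 show ?case unfolding frc.simps
 proof (intro ballI All.IH All.prems(1))
  show "EX r:$P. le r q & frc ph r (e(i := x))" if "x:M" "q:$P" "le q p" for x q
   using All.prems(2)[OF that(2,3)] that(1) unfolding frc.simps by blast
 qed
qed

end

locale generic = forcing +
 fixes G :: "hc set"
 assumes gen: "generic_filter M $P (%p q. pair p q:$L) G"
begin

lemma G_P: "p:G ==> p:$P" using gen by (auto simp: generic_filter_def)
lemma G_sub: "G <= $P" using G_P by blast
lemma G_up: "p:G ==> le p q ==> q:$P ==> q:G" using gen unfolding generic_filter_def by blast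
lemma G_dir: "p:G ==> q:G ==> EX r:G. le r p & le r q" using gen unfolding generic_filter_def by blast
lemma G_one: "one:G"
proof -
 obtain p where "p:G" using gen by (auto simp: generic_filter_def)
 thus ?thesis using G_up[OF _ one(2) one(1)] G_P by blast
qed

lemma G_dense: assumes "df (%e. D (e 0))" "!!p. p:$P ==> EX q:$P. le q p & D q" shows "EX p:G. D p"
proof -
 have "Sep P D:M" by (rule Sep_M[OF PM assms(1)])
 moreover have "$(Sep P D) <= $P" "ALL p:$P. EX q:$(Sep P D). le q p" using assms(2) by auto
 ultimately have "G \<inter> $(Sep P D) ~= {}" using gen unfolding generic_filter_def by blast
 thus ?thesis by auto
qed

text \<open>Adding the conditions incompatible with \<open>p0\<close> makes the set dense, and none
  of those can belong to a filter containing \<open>p0\<close>.\<close>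

lemma G_dense_below:
 assumes "df (%e. D (e 0))" "p0:G" "!!p. p:$P ==> le p p0 ==> EX q:$P. le q p & D q"
 shows "EX p:G. le p p0 & D p"
proof -
 have p0M: "p0:M" using assms(2) G_P P_M by blast
 have "df (%e. (le (e 0) p0 & D (e 0)) \<or> ~ (EX q:$P. le q p0 & le q (e 0)))"
  by (intro dfi assms LM PM p0M)
 hence "EX p:G. (le p p0 & D p) \<or> ~ (EX q:$P. le q p0 & le q p)"
 proof (rule G_dense)
  fix p assume p: "p:$P"
  show "EX q:$P. le q p & ((le q p0 & D q) \<or> ~ (EX r:$P. le r p0 & le r q))"
  proof (cases "EX r:$P. le r p0 & le r p")
   case True
   then obtain r where r: "r:$P" "le r p0" "le r p" by blast
   then obtain q where "q:$P" "le q r" "D q" using assms(3) by blast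
   thus ?thesis using r p le_trans G_P assms(2) by blast
  qed (use p le_refl in blast)
 qed
 thus ?thesis using G_dir[OF _ assms(2)] G_P by blast
qed

lemma G_sub_ev:
 assumes "sub p x y E" "p:G" "pair s r:$x" "r:G"
  and d: "df (%e. EX s':$(dm y). EX r':$P. pair s' r':$y & le (e 0) r' & E (e 0) s s')"
 shows "EX q:G. EX s' r'. r':G & pair s' r':$y & E q s s'"
proof -
 obtain q0 where q0: "q0:G" "le q0 p" "le q0 r" using G_dir assms by blast
 have "EX q:G. le q q0 & (EX s':$(dm y). EX r':$P. pair s' r':$y & le q r' & E q s s')"
 proof (rule G_dense_below[OF d q0(1)])
  fix q assume q: "q:$P" "le q q0"
  hence "le q p" "le q r" using q0 le_trans G_P assms by blast+
  thus "EX q':$P. le q' q & (EX s':$(dm y). EX r':$P. pair s' r':$y & le q' r' & E q' s s')"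
   using assms(1,3) q G_P[OF assms(4)] unfolding sub_def elts_dm by blast
 qed
 thus ?thesis using G_up by blast
qed

text \<open>For the converse, the conditions forcing equality are completed to a dense set by those
  witnessing a difference: under \<open>A p x y E\<close>, some \<open>s\<close> is put into the
  value of \<open>x\<close>, while no extension of \<open>p\<close> forces it to be equal to an
  element of \<open>y\<close>.\<close>

lemma eq_truth: "x:M ==> y:M ==> (EX p:G. eqf p x y) <-> val G x = val G y"
proof (induction x arbitrary: y rule: dm_induct)
 case (step x)
 have sM: "s:M" if "pair s r:$z" "z:M" for s r z using that trans pair_Md by blast
 have IH: "(EX p:G. eqf p s s') <-> val G s = val G s'"
  if "pair s r:$x" "pair s' r':$y" for s s' r r'
  by (rule step.IH) (use that sM step.prems in auto)
 show ?case
 proof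
  assume "EX p:G. eqf p x y"
  then obtain p where p: "p:G" "sub p x y eqf" "sub p y x (%q s' s. eqf q s s')" using eqf by blast
  show "val G x = val G y"
  proof (rule hc_eqI, rule set_eqI)
   fix z
   show "z:$(val G x) <-> z:$(val G y)"
   proof
    assume "z:$(val G x)"
    then obtain s r where s: "pair s r:$x" "r:G" "z = val G s" by (auto simp: elts_val)
    have "df (%e. EX s':$(dm y). EX r':$P. pair s' r':$y & le (e 0) r' & eqf (e 0) s s')"
     by (intro dfi PM LM step.prems sM[OF s(1)])
    from G_sub_ev[OF p(2,1) s(1,2) this] obtain q s' r' where
     "q:G" "r':G" "pair s' r':$y" "eqf q s s'" by blast
    hence "val G s = val G s'" using IH[OF s(1)] by blast
    thus "z:$(val G y)" using s(3) \<open>r':G\<close> \<open>pair s' r':$y\<close> unfolding elts_val by blast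
   next
    assume "z:$(val G y)"
    then obtain s r where s: "pair s r:$y" "r:G" "z = val G s" by (auto simp: elts_val)
    have "df (%e. EX s':$(dm x). EX r':$P. pair s' r':$x & le (e 0) r' & eqf (e 0) s' s)"
     by (intro dfi PM LM step.prems sM[OF s(1)])
    from G_sub_ev[OF p(3,1) s(1,2) this] obtain q s' r' where
     "q:G" "r':G" "pair s' r':$x" "eqf q s' s" by blast
    hence "val G s = val G s'" using IH[OF _ s(1)] by metis
    thus "z:$(val G x)" using s(3) \<open>r':G\<close> \<open>pair s' r':$x\<close> unfolding elts_val by blast
   qed
  qed
 next
  assume eq: "val G x = val G y"
  define A where "A p x y E <-> (EX s:$(dm x). EX r:$P. pair s r:$x & le p r &
   (ALL q:$P. le q p --> (ALL s':$(dm y). ALL r':$P. pair s' r':$y & le q r' --> ~ E q s s')))"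
   for p x y and E :: "hc => hc => hc => bool"
  have nsub: "EX q:$P. le q p & A q x y E" if "~ sub p x y E" "p:$P" for p x y E
  proof -
   obtain s r q where *: "r:$P" "pair s r:$x" "q:$P" "le q p" "le q r"
    "~ (EX q':$P. le q' q & (EX s'. EX r':$P. pair s' r':$y & le q' r' & E q' s s'))"
    using \<open>~ sub p x y E\<close> unfolding sub_def by blast
   hence "A q x y E" unfolding A_def elts_dm by blast
   thus ?thesis using * by blast
  qed
  have "df (%e. eqf (e 0) x y \<or> A (e 0) x y eqf \<or> A (e 0) y x (%q s' s. eqf q s s'))"
   unfolding A_def by (intro dfi PM LM step.prems)
  hence "EX p:G. eqf p x y \<or> A p x y eqf \<or> A p y x (%q s' s. eqf q s s')"
  proof (rule G_dense)
   fix p assume p: "p:$P"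
   show "EX q:$P. le q p & (eqf q x y \<or> A q x y eqf \<or> A q y x (%q s' s. eqf q s s'))"
    using nsub[of p x y eqf] nsub[of p y x "%q s' s. eqf q s s'"] p le_refl eqf[of p x y] by blast
  qed
  then obtain p where p: "p:G" "eqf p x y \<or> A p x y eqf \<or> A p y x (%q s' s. eqf q s s')" by blast
  have 1: "~ A p x y eqf"
  proof
   assume "A p x y eqf"
   then obtain s r where s: "pair s r:$x" "r:G"
    "!!q s' r'. q:$P ==> le q p ==> r':$P ==> pair s' r':$y ==> le q r' ==> ~ eqf q s s'"
    unfolding A_def elts_dm using G_up p by blast
   hence "val G s:$(val G x)" unfolding elts_val by blast
   hence "val G s:$(val G y)" by (simp only: eq)
   then obtain s' r' where s': "pair s' r':$y" "r':G" "val G s = val G s'" by (auto simp: elts_val)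
   then obtain p' where "p':G" "eqf p' s s'" using IH[OF s(1) s'(1)] by blast
   moreover obtain q where "q:G" "le q p" "le q p'" "le q r'"
    using G_dir[OF p(1) \<open>p':G\<close>] G_dir[OF _ s'(2)] le_trans G_P p(1) \<open>p':G\<close> by metis
   ultimately show False using s(3)[of q r' s'] eqf_mono s'(1,2) G_P by blast
  qed
  have 2: "~ A p y x (%q s' s. eqf q s s')"
  proof
   assume "A p y x (%q s' s. eqf q s s')"
   then obtain s r where s: "pair s r:$y" "r:G"
    "!!q s' r'. q:$P ==> le q p ==> r':$P ==> pair s' r':$x ==> le q r' ==> ~ eqf q s' s"
    unfolding A_def elts_dm using G_up p by blast
   hence "val G s:$(val G y)" unfolding elts_val by blast
   hence "val G s:$(val G x)" by (simp only: eq)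
   then obtain s' r' where s': "pair s' r':$x" "r':G" "val G s' = val G s" by (auto simp: elts_val)
   then obtain p' where "p':G" "eqf p' s' s" using IH[OF s'(1) s(1)] by blast
   moreover obtain q where "q:G" "le q p" "le q p'" "le q r'"
    using G_dir[OF p(1) \<open>p':G\<close>] G_dir[OF _ s'(2)] le_trans G_P p(1) \<open>p':G\<close> by metis
   ultimately show False using s(3)[of q r' s'] eqf_mono s'(1,2) G_P by blast
  qed
  show "EX p:G. eqf p x y" using p 1 2 by blast
 qed
qed

lemma mem_truth: assumes "x:M" "y:M" shows "(EX p:G. memf p x y) <-> val G x:$(val G y)"
proof
 assume "EX p:G. memf p x y"
 then obtain p where p: "p:G" "memf p x y" by blast
 have "df (%e. EX s:$(dm y). EX r:$P. pair s r:$y & le (e 0) r & eqf (e 0) x s)"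
  by (intro dfi PM LM assms)
 from G_dense_below[OF this p(1)] obtain q where
  "q:G" "EX s:$(dm y). EX r:$P. pair s r:$y & le q r & eqf q x s"
  using p(2) unfolding memf_def by blast
 then obtain s r where s: "pair s r:$y" "r:G" "eqf q x s" using G_up by auto
 hence "val G x = val G s" using eq_truth[OF assms(1)] \<open>q:G\<close> pair_Md trans[OF assms(2)] by blast
 thus "val G x:$(val G y)" using s by (auto simp: elts_val)
next
 assume "val G x:$(val G y)"
 then obtain s r where s: "pair s r:$y" "r:G" "val G x = val G s" by (auto simp: elts_val)
 then obtain p where p: "p:G" "eqf p x s" using eq_truth[OF assms(1)] pair_Md trans[OF assms(2)] by blast
 obtain q where q: "q:G" "le q p" "le q r" using G_dir p s by blast
 have "memf q x y" unfolding memf_def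
 proof (intro conjI ballI impI)
  fix q1 assume q1: "q1:$P" "le q1 q"
  have "le q1 r" "le q1 p" using le_trans q1 q G_P s p by blast+
  hence "eqf q1 x s" using eqf_mono p q1 by blast
  thus "EX q':$P. le q' q1 & (EX s:$(dm y). EX r:$P. pair s r:$y & le q' r & eqf q' x s)"
   using q1 le_refl s G_P \<open>le q1 r\<close> unfolding elts_dm by blast
 qed (use q G_P in blast)
 thus "EX p:G. memf p x y" using q by blast
qed

definition N where "N = val G ` M"

lemma truth: "env e ==> (EX p:G. frc ph p e) <-> sat N ph (%i. val G (e i))"
proof (induction ph arbitrary: e)
 case (Mem i j) thus ?case using mem_truth by (simp add: env_def)
next
 case (Eq i j) thus ?case using eq_truth by (simp add: env_def)
next
 case (Neg ph)
 show ?case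
 proof
  assume "EX p:G. frc (Neg ph) p e"
  then obtain p where p: "p:G" "!!q. q:$P ==> le q p ==> ~ frc ph q e" by auto
  have "~ (EX p:G. frc ph p e)" using G_dir[OF p(1)] p(2) frc_mono G_P by metis
  thus "sat N (Neg ph) (%i. val G (e i))" using Neg by simp
 next
  assume "sat N (Neg ph) (%i. val G (e i))"
  hence n: "~ (EX p:G. frc ph p e)" using Neg by simp
  have "df (%x. frc ph (x 0) e \<or> (ALL q:$P. le q (x 0) --> ~ frc ph q e))"
  proof (rule df_fix[where R="%p e. frc ph p e \<or> (ALL q:$P. le q p --> ~ frc ph q e)", OF _ Neg.prems])
   have "inj (case_nat 0 (%i. Suc (Suc i)))" by (auto simp: inj_on_def split: nat.splits)
   from df_ren[OF df_frc this] have "df (%e. frc ph (e 0) (%i. e (Suc (Suc i))))" by simp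
   thus "df (%x. frc ph (x 0) (%i. x (Suc i)) \<or> (ALL q:$P. le q (x 0) --> ~ frc ph q (%i. x (Suc i))))"
    by (intro dfi PM LM df_frc)
  qed
  from G_dense[OF this] have "EX p:G. frc ph p e \<or> (ALL q:$P. le q p --> ~ frc ph q e)"
   using le_refl by blast
  thus "EX p:G. frc (Neg ph) p e" using n G_P by auto
 qed
next
 case (Conj ph \<psi>)
 show ?case using Conj G_dir frc_mono G_P by (simp, meson)
next
 case (All i ph)
 have upd: "(%j. val G ((e(i := x)) j)) = (%j. val G (e j))(i := val G x)" for x by auto
 have IH: "(EX p:G. frc ph p (e(i := x))) <-> sat N ph ((%j. val G (e j))(i := val G x))" if "x:M" for x
 proof -
  have "env (e(i := x))" using All.prems that by (simp add: env_def)
  from All.IH[OF this] show ?thesis unfolding upd .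
 qed
 show ?case
 proof
  assume "EX p:G. frc (All i ph) p e"
  thus "sat N (All i ph) (%i. val G (e i))" using IH by (auto simp: N_def)
 next
  assume s: "sat N (All i ph) (%i. val G (e i))"
  have "df (%x. frc (All i ph) (x 0) e \<or> (EX y:M. ALL q:$P. le q (x 0) --> ~ frc ph q (e(i := y))))"
  proof (rule df_fix[where R="%p e. frc (All i ph) p e \<or> (EX y:M. ALL q:$P. le q p --> ~ frc ph q (e(i := y)))", OF _ All.prems])
   have "inj (case_nat 0 (%j. if j = i then 1 else Suc (Suc (Suc j))))" by (auto simp: inj_on_def split: nat.splits)
   from df_ren[OF df_frc this] have "df (%e. frc ph (e 0) (%j. e (if j = i then 1 else Suc (Suc (Suc j)))))"
    by (simp only: nat.case)
   moreover have "(%j. e (if j = i then 1 else Suc (Suc (Suc j)))) = (%j. e (Suc (Suc (Suc j))))(i := e (Suc 0))" for e :: "nat => hc"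
    by (auto simp: fun_eq_iff)
   ultimately have "df (%e. frc ph (e 0) ((%j. e (Suc (Suc (Suc j))))(i := e (Suc 0))))" by (simp only:)
   thus "df (%x. frc (All i ph) (x 0) (%i. x (Suc i)) \<or>
     (EX y:M. ALL q:$P. le q (x 0) --> ~ frc ph q ((%i. x (Suc i))(i := y))))"
    by (intro dfi PM LM df_frc)
  qed
  hence "EX p:G. frc (All i ph) p e \<or> (EX y:M. ALL q:$P. le q p --> ~ frc ph q (e(i := y)))"
  proof (rule G_dense)
   fix p assume p: "p:$P"
   show "EX q:$P. le q p & (frc (All i ph) q e \<or> (EX y:M. ALL r:$P. le r q --> ~ frc ph r (e(i := y))))"
   proof (cases "frc (All i ph) p e")
    case False
    then obtain y where y: "y:M" "~ frc ph p (e(i := y))" by auto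
    then obtain q where "q:$P" "le q p" "ALL r:$P. le r q --> ~ frc ph r (e(i := y))"
     using frc_dense[OF p, of ph "e(i := y)"] by blast
    thus ?thesis using y by blast
   qed (use p le_refl in blast)
  qed
  then obtain p where p: "p:G" "frc (All i ph) p e \<or> (EX y:M. ALL q:$P. le q p --> ~ frc ph q (e(i := y)))" by blast
  have "False" if y: "y:M" "ALL q:$P. le q p --> ~ frc ph q (e(i := y))" for y
  proof -
   have "val G y:N" using y by (simp add: N_def)
   then obtain p' where "p':G" "frc ph p' (e(i := y))" using IH[OF y(1)] s by auto
   thus False using G_dir[OF p(1)] y(2) frc_mono G_P by metis
  qed
  thus "EX p:G. frc (All i ph) p e" using p by blast
 qed
qed

end

subsection \<open>The generic extension is a model\<close>

context tm begin

lemma df_fixk: assumes "df R" "env d" shows "df (%x. R (%i. if i < k then x i else d (i - k)))"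
proof -
 obtain p c where p: "env c" "!!e. env e ==> sat M p (mrg e c) = R e" using assms(1) by (auto simp: df_def)
 define f where "f i = (if even i then (if i div 2 < k then i else Suc (2 * (2 * (i div 2 - k)))) else Suc (2 * (Suc (2 * (i div 2)))))" for i :: nat
 have inj: "inj f" unfolding inj_on_def f_def by (auto split: if_splits elim!: oddE evenE; presburger)
 have c': "env (mrg d c)" unfolding env_def mrg_def using p(1) assms(2) by (auto simp: env_def)
 have "mrg x (mrg d c) \<circ> f = mrg (%i. if i < k then x i else d (i - k)) c" for x
  by (rule ext) (auto simp: f_def mrg_def elim!: oddE evenE)
 hence "sat M (ren f p) (mrg x (mrg d c)) = R (%i. if i < k then x i else d (i - k))" if "env x" for x
  using p(2)[of "%i. if i < k then x i else d (i - k)"] that assms(2) by (simp add: sat_ren[OF inj] env_def)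
 thus ?thesis unfolding df_def using c' by blast
qed

lemma df_fix2: "df (%e. R (e 0) (e (Suc 0)) (%i. e (Suc (Suc i)))) ==> env d ==> df (%x. R (x 0) (x (Suc 0)) d)"
 using df_fixk[of "%e. R (e 0) (e (Suc 0)) (%i. e (Suc (Suc i)))" d 2] by simp
lemma df_fix3: "df (%e. R (e 0) (e (Suc 0)) (e (Suc (Suc 0))) (%i. e (Suc (Suc (Suc i))))) ==> env d ==>
  df (%x. R (x 0) (x (Suc 0)) (x (Suc (Suc 0))) d)"
 using df_fixk[of "%e. R (e 0) (e (Suc 0)) (e (Suc (Suc 0))) (%i. e (Suc (Suc (Suc i))))" d 3] by simp

end

lemma elts_valI: "pair s p:$t ==> p:G ==> val G s:$(val G t)"
 unfolding elts_val by blast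

lemma val_Img: "$(val G (Img b (%y. pair (s y) (r y)))) = {val G (s y) | y. y:$b & r y:G}"
proof (intro subset_antisym subsetI)
 fix z assume "z:$(val G (Img b (%y. pair (s y) (r y))))"
 then obtain s' p where "z = val G s'" "p:G" "pair s' p:$(Img b (%y. pair (s y) (r y)))"
  unfolding elts_val by blast
 thus "z:{val G (s y) | y. y:$b & r y:G}" by auto
qed (auto intro!: elts_valI[where t="Img b (%y. pair (s y) (r y))" and p="r _"])

context generic begin

lemma val_upd: "(%i. val G ((f(j := x)) i)) = (%i. val G (f i))(j := val G x)" by auto

lemma N_I: "x:M ==> val G x:N" by (simp add: N_def)
lemma N_E: assumes "y:N" obtains x where "x:M" "y = val G x" using assms by (auto simp: N_def)
lemma M_N: "x:M ==> x:N" using N_I[OF check_M, of x] by (simp add: val_check G_one)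
lemma N_gen: "gen_ext M $P G = N" by (simp add: gen_ext_eq G_sub N_def)

lemma N_trans: assumes "y:N" "z:$y" shows "z:N"
proof -
 obtain x where x: "x:M" "y = val G x" using N_E assms by blast
 obtain s p where "z = val G s" "pair s p:$x" using assms(2) unfolding x(2) elts_val by blast
 thus ?thesis using x pair_Md trans N_I by blast
qed

definition Gh where "Gh = HSet G"
lemma elts_Gh: "$Gh = G"
 unfolding Gh_def by (rule elts_HSet) (rule countable_subset[OF G_sub], simp)
lemma Gh_N: "Gh:N"
proof -
 define n where "n = Img P (%p. pair (check p) p)"
 have "n:M" unfolding n_def by (rule dt_M0) (intro dfi PM)
 moreover have "val G n = Gh"
  unfolding n_def by (rule hc_eqI) (use G_sub in "auto simp: val_Img val_check[OF G_one] elts_Gh")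
 ultimately show ?thesis using N_I by metis
qed

lemma Upr_N: assumes "x:N" "y:N" shows "Upr x y:N"
proof -
 obtain s t where s: "s:M" "t:M" "x = val G s" "y = val G t" using assms N_E by metis
 have "upn s t:M" by (rule dt_M0) (intro dfi s)
 thus ?thesis using N_I val_upn[OF G_one] s by metis
qed

lemma envM_ex: assumes "ALL i. e i:N" shows "EX f. env f & e = (%i. val G (f i))"
proof -
 have "ALL i. EX x:M. e i = val G x" using assms N_E by metis
 then obtain f where "ALL i. f i:M & e i = val G (f i)" by metis
 thus ?thesis by (intro exI[of _ f]) (auto simp: env_def)
qed

lemma df_frc_upd: assumes "env f" shows "df (%e. frc ph (e 0) (f(0 := e (Suc 0))))"
proof -
 have "df (%e. frc ph (e 0) ((%j. e (Suc (Suc j)))(0 := e (Suc 0))))"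
 proof -
  have "inj (case_nat 0 (%j. if j = 0 then 1 else Suc (Suc j)))" by (auto simp: inj_on_def split: nat.splits)
  from df_ren[OF df_frc this] have "df (%e. frc ph (e 0) (%j. e (if j = 0 then 1 else Suc (Suc j))))"
   by (simp only: nat.case)
  moreover have "(%j. e (if j = 0 then 1 else Suc (Suc j))) = (%j. e (Suc (Suc j)))(0 := e (Suc 0))" for e :: "nat => hc"
   by (auto simp: fun_eq_iff)
  ultimately show ?thesis by (simp only:)
 qed
 from df_fix2[where R="%p x e. frc ph p (e(0 := x))", OF this assms] show ?thesis .
qed

lemma df_frc_upd2: assumes "env f" shows "df (%e. frc ph (e 0) (f(0 := e (Suc 0), 1 := e (Suc (Suc 0)))))"
proof -
 have "df (%e. frc ph (e 0) ((%j. e (Suc (Suc (Suc j))))(0 := e (Suc 0), 1 := e (Suc (Suc 0)))))"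
 proof -
  have "inj (case_nat 0 (%j. if j = 0 then 1 else if j = 1 then 2 else Suc (Suc (Suc j))))"
   by (auto simp: inj_on_def split: nat.splits)
  from df_ren[OF df_frc this]
  have "df (%e. frc ph (e 0) (%j. e (if j = 0 then 1 else if j = 1 then 2 else Suc (Suc (Suc j)))))"
   by (simp only: nat.case)
  moreover have "(%j. e (if j = 0 then 1 else if j = 1 then 2 else Suc (Suc (Suc j)))) =
    (%j. e (Suc (Suc (Suc j))))(0 := e (Suc 0), 1 := e (Suc (Suc 0)))" for e :: "nat => hc"
   by (auto simp: fun_eq_iff numeral_eq_Suc)
  ultimately show ?thesis by (simp only:)
 qed
 from df_fix3[where R="%p x y e. frc ph p (e(0 := x, 1 := y))", OF this assms] show ?thesis .
qed

lemma sat_upd: assumes "env f" "x:M"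
 shows "(EX p:G. frc ph p (f(0 := x))) <-> sat N ph ((%i. val G (f i))(0 := val G x))"
proof -
 have "env (f(0 := x))" using assms by (simp add: env_def)
 from truth[OF this, of ph] show ?thesis
  unfolding val_upd .
qed

lemma Sep_N: "Separation_ax N"
 unfolding Separation_ax_def
proof (intro allI impI ballI)
 fix ph and e :: "nat => hc" and x assume e: "ALL i. e i:N" and x: "x:N"
 obtain f where f: "env f" "e = (%i. val G (f i))" using envM_ex[OF e] by blast
 obtain t where t: "t:M" "x = val G t" using x N_E by blast
 note [dfi] = df_app2[where P="%p x. frc ph p (f(0 := x))", OF df_frc_upd[OF f(1)]]
 define n where "n = Sep (Prod (dm t) P) (%z. memf (hsnd z) (hfst z) t & frc ph (hsnd z) (f(0 := hfst z)))"
 have nM: "n:M" unfolding n_def by (rule Sep_M) (intro dfi Prod_M dm_M t PM)+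
 have "z:$(val G n) <-> z:$x & sat N ph (e(0 := z))" if zN: "z:N" for z
 proof
  assume "z:$(val G n)"
  then obtain s p where s: "z = val G s" "p:G" "pair s p:$n" unfolding elts_val by blast
  hence *: "s:$(dm t)" "memf p s t" "frc ph p (f(0 := s))" by (auto simp: n_def)
  have sM: "s:M" using *(1) trans[OF dm_M[OF t(1)]] by blast
  show "z:$x & sat N ph (e(0 := z))"
   using mem_truth[OF sM t(1)] sat_upd[OF f(1) sM] * s t(2) f(2) by blast
 next
  assume z: "z:$x & sat N ph (e(0 := z))"
  then obtain s r where s: "z = val G s" "pair s r:$t" unfolding t(2) elts_val by blast
  have sM: "s:M" using s(2) pair_Md trans[OF t(1)] by blast
  obtain p where p: "p:G" "memf p s t" using mem_truth[OF sM t(1)] z s t(2) by blast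
  obtain q where q: "q:G" "frc ph q (f(0 := s))" using sat_upd[OF f(1) sM] z s f(2) by blast
  obtain u where u: "u:G" "le u p" "le u q" using G_dir p q by blast
  have "pair s u:$n" unfolding n_def elts_Sep elts_Prod
   using s(2) G_P[OF u(1)] memf_mono[OF p(2) u(2)] frc_mono[OF q(2) u(3)] by auto
  thus "z:$(val G n)" using s(1) u(1) unfolding elts_val by blast
 qed
 thus "EX y:N. ALL z:N. z:$y <-> z:$x & sat N ph (e(0 := z))" using N_I[OF nM] by blast
qed

text \<open>Collection in the ground model, over pairs of a name in the domain of \<open>t\<close>
  and a condition, gives one set of names that contains for every argument a name forced to be its
  image.\<close>

lemma Repl_N: "Replacement_ax N"
 unfolding Replacement_ax_def
proof (intro allI impI ballI)
 fix ph and e :: "nat => hc" and a assume e: "ALL i. e i:N" and a: "a:N"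
  and un: "ALL x:N. x:$a --> (EX! y. y:N & sat N ph (e(0 := x, 1 := y)))"
 obtain f where f: "env f" "e = (%i. val G (f i))" using envM_ex[OF e] by blast
 obtain t where t: "t:M" "a = val G t" using a N_E by blast
 have s2: "(EX p:G. frc ph p (f(0 := x, 1 := y))) <-> sat N ph (e(0 := val G x, 1 := val G y))" if "x:M" "y:M" for x y
 proof -
  have "env (f(0 := x, 1 := y))" using f(1) that by (simp add: env_def)
  from truth[OF this, of ph] show ?thesis unfolding f(2) val_upd .
 qed
 note [dfi] = df_app3[where P="%p x y. frc ph p (f(0 := x, 1 := y))", OF df_frc_upd2[OF f(1)]]
 define A where "A = Sep (Prod (dm t) P) (%z. EX y:M. frc ph (hsnd z) (f(0 := hfst z, 1 := y)))"
 have AM: "A:M" unfolding A_def by (rule Sep_M) (intro dfi Prod_M dm_M t PM)+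
 have "df (%e. frc ph (hsnd (e 0)) (f(0 := hfst (e 0), 1 := e (Suc 0))))" by (intro dfi)
 from Collection[OF AM this] obtain b where b: "b:M" "ALL z:$A. EX y:$b. frc ph (hsnd z) (f(0 := hfst z, 1 := y))"
  unfolding A_def elts_Sep by blast
 define n where "n = Img b (%y. pair y one)"
 have nM: "n:M" unfolding n_def by (rule dt_M0) (intro dfi b one_M)
 have en: "$(val G n) = val G ` $b" using G_one unfolding elts_val n_def by auto
 show "EX b:N. ALL x:N. x:$a --> (EX y:N. y:$b & sat N ph (e(0 := x, 1 := y)))"
 proof (rule bexI[OF _ N_I[OF nM]], intro ballI impI)
  fix x assume x: "x:N" "x:$a"
  obtain s r where s: "x = val G s" "pair s r:$t" using x(2) unfolding t(2) elts_val by blast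
  have sM: "s:M" using s(2) pair_Md trans[OF t(1)] by blast
  obtain y where "y:N" "sat N ph (e(0 := x, 1 := y))" using un x by blast
  then obtain u where u: "u:M" "sat N ph (e(0 := val G s, 1 := val G u))" using N_E s(1) by metis
  then obtain p where p: "p:G" "frc ph p (f(0 := s, 1 := u))" using s2[OF sM] by blast
  hence "pair s p:$A" unfolding A_def elts_Sep elts_Prod using s(2) G_P u(1) by auto
  then obtain v where v: "v:$b" "frc ph p (f(0 := s, 1 := v))" using b(2) by fastforce
  have vM: "v:M" using v(1) trans[OF b(1)] by blast
  have "sat N ph (e(0 := x, 1 := val G v))" using s2[OF sM vM] p(1) v(2) s(1) by blast
  thus "EX y:N. y:$(val G n) & sat N ph (e(0 := x, 1 := y))"
   using N_I[OF vM] v(1) unfolding en by blast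
 qed
qed

text \<open>A name for the intersection whose domain lies inside that of \<open>t\<close>. Every
  subset of the value of \<open>t\<close> thus has a name in a single power set of the ground model,
  which yields the power set axiom.\<close>

definition int where "int s t = Sep (Prod (dm t) P) (%z. memf (hsnd z) (hfst z) s & memf (hsnd z) (hfst z) t)"
lemma dt_int [dfi]: assumes "dt s" "dt t" shows "dt (%e. int (s e) (t e))"
 by (rule dt_app2[where F=int, OF _ assms]) (unfold int_def, intro dfi PM)
lemma val_int: assumes "s:M" "t:M" shows "$(val G (int s t)) = $(val G s) \<inter> $(val G t)"
proof (intro subset_antisym subsetI)
 fix z assume "z:$(val G (int s t))"
 then obtain u p where u: "z = val G u" "p:G" "pair u p:$(int s t)" unfolding elts_val by blast
 hence *: "u:$(dm t)" "memf p u s" "memf p u t" by (auto simp: int_def)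
 have "u:M" using *(1) trans[OF dm_M[OF assms(2)]] by blast
 thus "z:$(val G s) \<inter> $(val G t)" using mem_truth assms * u by blast
next
 fix z assume z: "z:$(val G s) \<inter> $(val G t)"
 then obtain u r where u: "z = val G u" "pair u r:$t" unfolding elts_val by blast
 have uM: "u:M" using u(2) pair_Md trans[OF assms(2)] by blast
 obtain p q where p: "p:G" "memf p u s" "q:G" "memf q u t" using mem_truth[OF uM] assms z u(1) by blast
 obtain w where w: "w:G" "le w p" "le w q" using G_dir p by blast
 have "pair u w:$(int s t)" unfolding int_def elts_Sep elts_Prod
  using u(2) G_P[OF w(1)] memf_mono[OF p(2) w(2)] memf_mono[OF p(4) w(3)] by auto
 thus "z:$(val G (int s t))" using u(1) w(1) unfolding elts_val by blast
qed

lemma zf_N: "zf_model N"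
 unfolding zf_model_def
proof (intro conjI)
 show "countable N" using countable_M by (simp add: N_def)
 show "ALL x:N. $x <= N" using N_trans by blast
 show "Extensionality_ax N" unfolding Extensionality_ax_def
 proof (intro ballI impI)
  fix x y assume xy: "x:N" "y:N" "ALL z:N. z:$x <-> z:$y"
  have "$x <= N" "$y <= N" using N_trans[OF xy(1)] N_trans[OF xy(2)] by blast+
  hence "$x = $y" using xy(3) by blast
  thus "x = y" by (rule hc_eqI)
 qed
 show "Foundation_ax N" unfolding Foundation_ax_def
 proof (intro ballI impI)
  fix x assume "x:N" "EX y:N. y:$x"
  then obtain y where "y:$x" by blast
  then obtain z where "z:$x" "ALL c:$z. c~:$x" using Ord_least[of "%y. y:$x"] by blast
  thus "EX y:N. y:$x & (ALL z:N. ~ (z:$x & z:$y))" using N_trans[OF \<open>x:N\<close>] by blast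
 qed
 show "Pairing_ax N" unfolding Pairing_ax_def
 proof (intro ballI)
  fix x y assume "x:N" "y:N"
  thus "EX z:N. ALL w:N. w:$z <-> w = x \<or> w = y" by (intro bexI[of _ "Upr x y"] Upr_N) auto
 qed
 show "Union_ax N" unfolding Union_ax_def
 proof (intro ballI)
  fix x assume x: "x:N"
  obtain t where t: "t:M" "x = val G t" using x N_E by blast
  define n where "n = Sep (Prod (UU (Img (dm t) dm)) P)
   (%z. EX y:$(dm t). memf (hsnd z) y t & memf (hsnd z) (hfst z) y)"
  have nM: "n:M" unfolding n_def by (rule dt_M0) (intro dfi PM t)
  have "z:$(val G n) <-> (EX y:N. y:$x & z:$y)" for z
  proof
   assume "z:$(val G n)"
   then obtain s p where s: "z = val G s" "p:G" "pair s p:$n" unfolding elts_val by blast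
   have "s:M" using s(3) pair_Md trans[OF nM] by blast
   from s(3) obtain y where y: "y:$(dm t)" "memf p y t" "memf p s y"
    unfolding n_def elts_Sep mem_Collect_eq hfst hsnd by blast
   have "y:M" using y(1) trans[OF dm_M[OF t(1)]] by blast
   hence "val G y:$x" "z:$(val G y)" using mem_truth y s t \<open>s:M\<close> by blast+
   thus "EX y:N. y:$x & z:$y" using N_I[OF \<open>y:M\<close>] by blast
  next
   assume "EX y:N. y:$x & z:$y"
   then obtain w where w: "w:$x" "z:$w" by blast
   then obtain y r where y: "w = val G y" "pair y r:$t" unfolding t(2) elts_val by blast
   then obtain s r' where s: "z = val G s" "pair s r':$y" using w(2) unfolding y(1) elts_val by blast
   have yM: "y:M" using y(2) pair_Md trans[OF t(1)] by blast
   have sM: "s:M" using s(2) pair_Md trans[OF yM] by blast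
   obtain p q where p: "p:G" "memf p y t" "q:G" "memf q s y"
    using mem_truth[OF yM t(1)] mem_truth[OF sM yM] w s(1) y(1) t(2) by blast
   obtain u where u: "u:G" "le u p" "le u q" using G_dir p by blast
   have "memf u y t" "memf u s y" using memf_mono p u G_P by blast+
   moreover have "y:$(dm t)" "s:$(dm y)" using y s by auto
   ultimately have "pair s u:$n" unfolding n_def elts_Sep mem_Collect_eq hfst hsnd
    using G_P[OF u(1)] by (auto simp del: elts_dm)
   thus "z:$(val G n)" using s(1) u(1) unfolding elts_val by blast
  qed
  thus "EX u:N. ALL z:N. z:$u <-> (EX y:N. y:$x & z:$y)" using N_I[OF nM] by blast
 qed
 show "Powerset_ax N" unfolding Powerset_ax_def
 proof (intro ballI)
  fix x assume x: "x:N"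
  obtain t where t: "t:M" "x = val G t" using x N_E by blast
  define n where "n = Img (hPow M (Prod (dm t) P)) (%s. pair (int s t) one)"
  have nM: "n:M" unfolding n_def by (rule dt_M0) (intro dfi PM t one_M)
  have en: "$(val G n) = (%s. val G (int s t)) ` $(hPow M (Prod (dm t) P))"
   using G_one unfolding elts_val n_def by auto
  have "y:$(val G n) <-> (ALL z:N. z:$y --> z:$x)" if y: "y:N" for y
  proof
   assume "y:$(val G n)"
   thus "ALL z:N. z:$y --> z:$x" unfolding en using val_int t by auto
  next
   assume *: "ALL z:N. z:$y --> z:$x"
   obtain s where s: "s:M" "y = val G s" using y N_E by blast
   have iM: "int s t:M" by (rule dt_M0) (intro dfi s t)
   have "$(int s t) <= $(Prod (dm t) P)" by (auto simp: int_def)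
   hence 1: "int s t:$(hPow M (Prod (dm t) P))" using iM by simp
   have sub: "$y <= $x" using * N_trans[OF y] by blast
   have "val G (int (int s t) t) = y"
    by (rule hc_eqI) (use val_int[OF iM t(1)] val_int[OF s(1) t(1)] sub s(2) t(2) in auto)
   thus "y:$(val G n)" unfolding en using 1 by blast
  qed
  thus "EX p:N. ALL y:N. y:$p <-> (ALL z:N. z:$y --> z:$x)" using N_I[OF nM] by blast
 qed
 show "Infinity_ax N" unfolding Infinity_ax_def
 proof (rule bexI[OF _ M_N[OF homega_M]], intro conjI ballI impI)
  show "EX x:N. x:$homega & (ALL z:N. z~:$x)"
   by (rule bexI[OF _ M_N[OF hempty_M]]) (simp, metis hnat.simps(1) rangeI)
  fix x assume "x:N" "x:$homega"
  then obtain n where "x = hnat n" by auto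
  thus "EX y:N. y:$homega & (ALL z:N. z:$y <-> z:$x \<or> z = x)"
   by (intro bexI[OF _ M_N[OF hnat_M[of "Suc n"]]]) (auto simp del: hnat.simps simp: elts_hnat lessThan_Suc)
 qed
qed (rule Sep_N Repl_N)+

end

sublocale generic < N: tm N by (rule tm.intro) (rule zf_N)

locale genericc = generic + tmc M
begin

lemma choice_N: "Choice_ax N"
 unfolding Choice_ax_def
proof (intro ballI impI)
 fix a assume a: "a:N" and *: "(ALL x:N. x:$a --> (EX z:N. z:$x)) &
  (ALL x:N. ALL y:N. x:$a & y:$a & x ~= y --> (ALL z:N. ~ (z:$x & z:$y)))"
 obtain t where t: "t:M" "a = val G t" using a N_E by blast
 \<comment> \<open>\<open>D\<close> contains names for all members of members of \<open>a\<close>. A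
   ground well-ordering of \<open>D\<close> becomes an enumeration \<open>h\<close> of these members
   in the extension, and the choice set takes those of least index.\<close>
 define D where "D = UU (Img (dm t) dm)"
 have "D:M" unfolding D_def by (rule dt_M0) (intro dfi t)
 then obtain al g where al: "al:M" "Ord al" "g:M" "bij_betw (ap g) $al $D"
  using Zermelo unfolding eqp_def by blast
 define n where "n = Img al (%be. pair (pn (check be) (ap g be)) one)"
 have nM: "n:M" unfolding n_def by (rule dt_M0) (intro dfi al one_M)
 define h where "h = lam al (%be. val G (ap g be))"
 have "val G n = h"
  unfolding n_def h_def
  by (rule hc_eqI) (use G_one in "auto simp: val_Img val_pn[OF G_one] val_check[OF G_one]")
 hence hN: "h:N" using N_I[OF nM] by simp
 have hh: "ap h be = val G (ap g be)" if "be:$al" for be using that by (simp add: h_def)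
 have alN: "al:N" using al M_N by blast
 define c where "c = Sep (UU a) (%z. EX y:$a. z:$y & (EX be:$al. ap h be = z & (ALL ga:$be. ap h ga~:$y)))"
 have cN: "c:N" unfolding c_def by (rule N.Sep_M[OF N.UU_M[OF a]]) (intro N.dfi hN alN a)
 show "EX c:N. ALL x:N. x:$a --> (EX! z. z:N & z:$x & z:$c)"
 proof (rule bexI[OF _ cN], intro ballI impI)
  fix x assume x: "x:N" "x:$a"
  have ex: "EX be. be:$al & ap h be:$x"
  proof -
   obtain z where z: "z:$x" using * x by blast
   obtain u r where u: "x = val G u" "pair u r:$t" using x(2) unfolding t(2) elts_val by blast
   obtain s r' where s: "z = val G s" "pair s r':$u" using z unfolding u(1) elts_val by blast
   have "u:$(dm t)" "s:$(dm u)" using u s by auto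
   hence "s:$D" unfolding D_def elts_UU elts_Img by blast
   hence "s:ap g ` $al" using bij_betw_imp_surj_on[OF al(4)] by simp
   then obtain be where b: "be:$al" "s = ap g be" by blast
   have "ap h be:$x" using hh[OF b(1)] s(1) z b(2) by simp
   thus ?thesis using b(1) by blast
  qed
  then obtain be where be: "be:$al" "ap h be:$x" "!!ga. ga:$be ==> ~ (ga:$al & ap h ga:$x)"
   using Ord_least[of "%be. be:$al & ap h be:$x"] by blast
  have ga: "ap h ga~:$x" if "ga:$be" for ga using be(3)[OF that] Ord_trans[OF al(2) be(1) that] by blast
  have "ap h be:N" using be(2) N_trans[OF x(1)] by blast
  show "EX! z. z:N & z:$x & z:$c"
  proof (rule ex1I[of _ "ap h be"])
   show "ap h be:N & ap h be:$x & ap h be:$c"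
    unfolding c_def elts_Sep elts_UU using be(1,2) ga x(2) \<open>ap h be:N\<close> by blast
  next
   fix z assume z: "z:N & z:$x & z:$c"
   then obtain y dl where y: "y:$a" "z:$y" "dl:$al" "ap h dl = z" "ALL ga:$dl. ap h ga~:$y"
    unfolding c_def elts_Sep by blast
   have "y = x"
   proof (rule ccontr)
    assume "y ~= x"
    thus False using bspec[OF bspec[OF conjunct2[OF *] N_trans[OF a y(1)]] x(1)] y(1,2) x(2) z by blast
   qed
   have "Ord be" "Ord dl" using be(1) y(3) Ord_in[OF al(2)] by blast+
   then consider "be = dl" | "be:$dl" | "dl:$be" using Ord_linear by blast
   thus "z = ap h be" using y \<open>y = x\<close> be(2) ga by cases blast+
  qed
 qed
qed

end

sublocale genericc < N: tmc N by (intro tmc.intro tmc_axioms.intro N.tm_axioms choice_N)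

subsection \<open>Minimality and iteration\<close>

text \<open>Evaluation is a recursion on the domains of names, so any transitive model containing
  \<open>G\<close> can carry it out. Minimality of the extension follows.\<close>

lemma (in tm) dt_val: assumes "HSet G:M" "countable G" shows "dt s ==> dt (%e. val G (s e))"
proof -
 have eG: "$(HSet G) = G" using assms by simp
 define H where "H t f = Img (Sep (dm t) (%s. EX p:$(HSet G). pair s p:$t)) (%s. ap f s)" for t f
 have "tmrec M dm H (val G)"
 proof unfold_locales
  show "dt (%e. dm (e 0))" "dt (%e. H (e 0) (e (Suc 0)))" unfolding H_def by (intro dfi assms)+
  show "val G t = H t (lam (dm t) (val G))" for t
  proof -
   have "$(H t (lam (dm t) (val G))) = (%s. ap (lam (dm t) (val G)) s) ` {s:$(dm t). EX p:G. pair s p:$t}"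
    by (simp only: H_def elts_Img elts_Sep eG)
   also have "\<dots> = val G ` {s:$(dm t). EX p:G. pair s p:$t}"
    by (rule image_cong[OF refl], rule ap_lam) blast
   also have "\<dots> = $(val G t)" unfolding elts_val by auto
   finally show ?thesis by (intro hc_eqI) simp
  qed
 qed (rule wf_dm)
 thus "dt s ==> dt (%e. val G (s e))" by (rule tmrec.dt_F)
qed

lemma (in tm) val_closed: assumes "HSet G:M" "countable G" "t:M" shows "val G t:M"
 by (rule dt_M0) (intro dt_val assms dfi)

lemma (in generic) N_minimal: assumes "tm K" "M <= K" "Gh:K" shows "N <= K"
 using tm.val_closed[OF assms(1), of G] assms countable_subset[OF G_sub] by (auto simp: N_def Gh_def)

text \<open>\<open>B\<close> typically says that a condition forces some failure. Excluding it below
  one condition of the filter turns a truth of the extension into a fact about all stronger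
  conditions.\<close>

lemma (in generic) Bad_dense:
 assumes d: "df (%e. B (e 0))" and n: "!!p. p:G ==> ~ B p"
 obtains p where "p:G" "!!q. q:$P ==> le q p ==> ~ B q"
proof -
 have "df (%e. B (e 0) \<or> (ALL q:$P. le q (e 0) --> ~ B q))"
  by (intro dfi df_app1[where P=B, OF d] LM PM)
 hence "EX p:G. B p \<or> (ALL q:$P. le q p --> ~ B q)"
  by (rule G_dense) (use le_refl in blast)
 thus ?thesis using n that by blast
qed

lemma gen_extE:
 assumes "is_generic_extension M K" "ctm M"
 obtains P L G where "genericc M P L G" "K = val G ` M"
proof -
 obtain P L G where *: "P:M" "L:M" "forcing_notion $P (%p q. pair p q:$L)"
  "generic_filter M $P (%p q. pair p q:$L) G" "K = gen_ext M $P G"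
  using assms(1) unfolding is_generic_extension_def Let_def by blast
 have t: "tmc M" using assms(2) by (simp add: tmc_ctm)
 then interpret tmc M .
 interpret genericc M P L G by unfold_locales (use * in auto)
 show ?thesis using that[OF genericc_axioms] * N_gen by (simp add: N_def)
qed

lemma (in generic) is_gen_ext: "is_generic_extension M N"
 unfolding is_generic_extension_def Let_def using PM LM fn gen N_gen by metis

text \<open>Two-step iteration. A condition is a pair of a condition of the first forcing and a name
  from the domain \<open>T\<close> of a fixed name \<open>q\<close> of the second; \<open>T\<close>
  is a set, and every element of \<open>Q\<close> is the value of some name in it. The resulting
  model is identified by minimality in both directions.\<close>

theorem generic_extension_trans:
 assumes "ctm V" "is_generic_extension V V'" "is_generic_extension V' V''"
 shows "is_generic_extension V V''"
proof -
 obtain P L G where A: "genericc V P L G" "V' = val G ` V" using gen_extE assms(1,2) by metis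
 interpret A: genericc V P L G by (rule A)
 have V': "V' = A.N" by (simp add: A(2) A.N_def)
 have ctmN: "ctm A.N" using A.N.tmc_axioms tmc_ctm by blast
 obtain Q R H where B: "genericc A.N Q R H" "V'' = val H ` A.N" using gen_extE[OF assms(3)] ctmN V' by metis
 interpret B: genericc A.N Q R H by (rule B)
 have V'': "V'' = B.N" by (simp add: B(2) B.N_def)
 obtain q where q: "q:V" "Q = val G q" using A.N_E[OF B.PM] by blast
 obtain r where r: "r:V" "R = val G r" using A.N_E[OF B.LM] by blast
 define T where "T = dm q"
 have TM: "T:V" unfolding T_def by (rule A.dm_M[OF q(1)])
 have TV: "s:V" if "s:$T" for s using that A.trans[OF TM] by blast
 define mf where "mf p s <-> A.memf p s q" for p s
 define lf where "lf p s t <-> A.memf p (A.pn s t) r" for p s t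
 have df_mf [A.dfi]: "A.df (%e. mf (s e) (t e))" if "A.dt s" "A.dt t" for s t
  unfolding mf_def by (intro A.dfi that q)
 have df_lf [A.dfi]: "A.df (%e. lf (s e) (t e) (u e))" if "A.dt s" "A.dt t" "A.dt u" for s t u
  unfolding lf_def by (intro A.dfi that r)
 have mf_mono: "mf p' s" if "mf p s" "A.le p' p" "p':$P" for p p' s
  using that A.memf_mono by (auto simp: mf_def)
 have lf_mono: "lf p' s t" if "lf p s t" "A.le p' p" "p':$P" for p p' s t
  using that A.memf_mono by (auto simp: lf_def)
 have mf_truth: "(EX p:G. mf p s) <-> val G s:$Q" if "s:V" for s
  unfolding mf_def q(2) by (rule A.mem_truth[OF that q(1)])
 have lf_truth: "(EX p:G. lf p s t) <-> B.le (val G s) (val G t)" if "s:V" "t:V" for s t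
 proof -
  have "A.pn s t:V" by (rule A.dt_M0) (intro A.dfi that)
  thus ?thesis unfolding lf_def r(2) using A.mem_truth[OF _ r(1)] A.val_pn[OF A.G_one] by simp
 qed
 have QT: "EX s:$T. h = val G s" if "h:$Q" for h
  using that unfolding q(2) T_def elts_val elts_dm by blast
 obtain ta where ta: "ta:$T" "val G ta = B.one" using QT[OF B.one(1)] by metis
 define nof where "nof p X <-> (ALL q:$P. A.le q p --> ~ X q)" for p and X :: "hc => bool"
 \<comment> \<open>In the extension the second forcing is a preorder with top
   \<open>val G ta\<close>, but an arbitrary condition need not force this. \<open>p0\<close> is
   taken such that no stronger condition refutes it, and the iteration is built below
   \<open>p0\<close>.\<close>
 define Bad where "Bad p <-> nof p (%q. mf q ta) \<or>
  (EX s:$T. mf p s & nof p (%q. lf q s s)) \<or> (EX s:$T. mf p s & nof p (%q. lf q s ta)) \<or>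
  (EX s:$T. EX t:$T. EX u:$T. mf p s & mf p t & mf p u & lf p s t & lf p t u & nof p (%q. lf q s u))" for p
 have "A.df (%e. Bad (e 0))" unfolding Bad_def nof_def by (intro A.dfi TM A.PM A.LM TV[OF ta(1)])
 moreover have "~ Bad p" if p: "p:G" for p
 proof
  assume "Bad p"
  have nn: False if nX: "nof p X" "EX q:G. X q" "!!q q'. X q ==> A.le q' q ==> q':$P ==> X q'" for X
  proof -
   obtain q where "q:G" "X q" using nX(2) by blast
   then obtain w where "w:G" "A.le w p" "A.le w q" using A.G_dir p by blast
   thus False using nX(1,3) \<open>X q\<close> A.G_P unfolding nof_def by blast
  qed
  have nl: "~ nof p (%q. lf q s t)" if "B.le (val G s) (val G t)" "s:$T" "t:$T" for s t
   using nn[of "%q. lf q s t"] lf_mono lf_truth[OF TV TV] that by metis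
  have mQ: "val G s:$Q" if "mf p s" "s:$T" for s using mf_truth[OF TV] that p by blast
  have lQ: "B.le (val G s) (val G t)" if "lf p s t" "s:$T" "t:$T" for s t
   using lf_truth[OF TV TV] that p by blast
  have 1: "~ nof p (%q. mf q ta)" using nn[of "%q. mf q ta"] mf_mono mf_truth[OF TV[OF ta(1)]] ta(2) B.one(1) by metis
  have 2: "~ nof p (%q. lf q s s)" if "mf p s" "s:$T" for s using nl B.le_refl mQ that by metis
  have 3: "~ nof p (%q. lf q s ta)" if "mf p s" "s:$T" for s using nl ta B.one(2) mQ that by metis
  have 4: "~ nof p (%q. lf q s u)" if "mf p s" "mf p t" "mf p u" "s:$T" "t:$T" "u:$T" "lf p s t" "lf p t u" for s t u
   by (rule nl) (use B.le_trans[OF lQ lQ mQ mQ mQ] that in blast)+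
  show False using \<open>Bad p\<close> 1 2 3 4 unfolding Bad_def by blast
 qed
 ultimately obtain p0 where p0: "p0:G" "!!q. q:$P ==> A.le q p0 ==> ~ Bad q" using A.Bad_dense by metis
 have p0P: "p0:$P" using p0 A.G_P by blast
 have lfD: "lf p s t" if p: "p:$P" "A.le p p0" and c: "!!p'. p':$P ==> A.le p' p ==> ~ nof p' (%q. lf q s t)" for p s t
  unfolding lf_def
 proof (rule A.memf_dense[OF p(1)])
  fix p' assume "p':$P" "A.le p' p"
  thus "EX r':$P. A.le r' p' & A.memf r' (A.pn s t) r" using c unfolding nof_def lf_def by blast
 qed
 have F2: "lf p s s" if p: "p:$P" "A.le p p0" "mf p s" "s:$T" for p s
 proof (rule lfD[OF p(1,2)])
  fix p' assume "p':$P" "A.le p' p"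
  thus "~ nof p' (%q. lf q s s)" using p0(2)[of p'] A.le_trans[OF _ p(2) _ p(1) p0P] mf_mono[OF p(3)] p(4) unfolding Bad_def by blast
 qed
 have F3: "lf p s ta" if p: "p:$P" "A.le p p0" "mf p s" "s:$T" for p s
 proof (rule lfD[OF p(1,2)])
  fix p' assume "p':$P" "A.le p' p"
  thus "~ nof p' (%q. lf q s ta)" using p0(2)[of p'] A.le_trans[OF _ p(2) _ p(1) p0P] mf_mono[OF p(3)] p(4) unfolding Bad_def by blast
 qed
 have F4: "lf p s u" if p: "p:$P" "A.le p p0" and s: "s:$T" "t:$T" "u:$T"
  and m: "mf p s" "mf p t" "mf p u" and l: "lf p s t" "lf p t u" for p s t u
 proof (rule lfD[OF p(1,2)])
  fix p' assume p': "p':$P" "A.le p' p"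
  have "A.le p' p0" using A.le_trans[OF p'(2) p(2) p'(1) p(1) p0P] .
  thus "~ nof p' (%q. lf q s u)"
   using p0(2)[OF p'(1)] mf_mono[OF m(1) p'(2,1)] mf_mono[OF m(2) p'(2,1)] mf_mono[OF m(3) p'(2,1)]
    lf_mono[OF l(1) p'(2,1)] lf_mono[OF l(2) p'(2,1)] s unfolding Bad_def by blast
 qed
 have F1: "mf p0 ta" unfolding mf_def
 proof (rule A.memf_dense[OF p0P])
  fix p' assume "p':$P" "A.le p' p0"
  thus "EX r:$P. A.le r p' & A.memf r ta q" using p0(2)[of p'] unfolding Bad_def nof_def mf_def by blast
 qed
 define S where "S = Sep (Prod P T) (%z. A.le (hfst z) p0 & mf (hfst z) (hsnd z))"
 define LS where "LS = Sep (Prod S S) (%z. A.le (hfst (hfst z)) (hfst (hsnd z)) &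
  lf (hfst (hfst z)) (hsnd (hfst z)) (hsnd (hsnd z)))"
 have p0V: "p0:V" using A.P_M p0P by blast
 have SM: "S:V" unfolding S_def by (rule A.dt_M0) (intro A.dfi A.PM A.LM TM p0V)
 have LSM: "LS:V" unfolding LS_def by (rule A.dt_M0) (intro A.dfi A.PM A.LM SM)
 have inS: "pair p s:$S <-> p:$P & s:$T & A.le p p0 & mf p s" for p s
  by (auto simp: S_def)
 have SE: "EX p s. z = pair p s" if "z:$S" for z using that by (auto simp: S_def)
 have leS: "pair (pair p s) (pair p' s'):$LS <-> pair p s:$S & pair p' s':$S & A.le p p' & lf p s s'" for p s p' s'
  by (auto simp: LS_def)
 have fnS: "forcing_notion $S (%a b. pair a b:$LS)"
  unfolding forcing_notion_def
 proof (intro conjI ballI impI)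
  fix a assume "a:$S"
  thus "pair a a:$LS" using SE[of a] F2 A.le_refl by (auto simp: leS inS)
 next
  fix a b c assume abc: "a:$S" "b:$S" "c:$S" "pair a b:$LS" "pair b c:$LS"
  obtain p s p' s' p'' s'' where e: "a = pair p s" "b = pair p' s'" "c = pair p'' s''" using SE abc by metis
  note i = abc[unfolded e leS inS]
  have "A.le p p''" using A.le_trans i by blast
  moreover have "lf p s s''"
   by (rule F4[of p s s' s'']) (use i mf_mono lf_mono \<open>A.le p p''\<close> in blast)+
  ultimately show "pair a c:$LS" unfolding e leS inS using i by blast
 next
  show "EX t:$S. ALL a:$S. pair a t:$LS"
  proof (rule bexI[of _ "pair p0 ta"], rule ballI)
   show t: "pair p0 ta:$S" unfolding inS using p0P ta F1 A.le_refl by blast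
   fix a assume a: "a:$S"
   then obtain p s where e: "a = pair p s" using SE by blast
   show "pair a (pair p0 ta):$LS" using a t F3 unfolding e leS inS by blast
  qed
 qed
 define K where "K = {pair p s | p s. pair p s:$S & p:G & val G s:H}"
 have HQ: "h:$Q" if "h:H" for h using that B.G_P by blast
 have gK: "generic_filter V $S (%a b. pair a b:$LS) K"
  unfolding generic_filter_def
 proof (intro conjI ballI impI)
  show "K <= $S" by (auto simp: K_def)
  have "pair p0 ta:K" unfolding K_def using p0 p0P ta F1 A.le_refl B.G_one inS by auto
  thus "K ~= {}" by blast
 next
  fix a b assume a: "a:K" and b: "b:$S" "pair a b:$LS"
  obtain p s where e: "a = pair p s" "p:G" "val G s:H" "pair p s:$S" using a by (auto simp: K_def)
  obtain p' s' where e': "b = pair p' s'" using SE b by blast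
  note i = b[unfolded e e' leS inS]
  have "p':G" using A.G_up e(2) i by blast
  moreover have "val G s':$Q" using mf_truth[OF TV] i \<open>p':G\<close> by blast
  moreover have "B.le (val G s) (val G s')" using lf_truth[OF TV TV] i e(2) by blast
  ultimately show "b:K" unfolding K_def using B.G_up e(3) b e' by blast
 next
  fix a b assume "a:K" "b:K"
  then obtain p s p' s' where e: "a = pair p s" "b = pair p' s'" "p:G" "p':G" "val G s:H" "val G s':H"
   "pair p s:$S" "pair p' s':$S" by (auto simp: K_def)
  note i = e(7,8)[unfolded inS]
  obtain h where h: "h:H" "B.le h (val G s)" "B.le h (val G s')" using B.G_dir e by blast
  obtain u where u: "u:$T" "h = val G u" using QT HQ[OF h(1)] by blast
  obtain w1 where w1: "w1:G" "mf w1 u" using mf_truth[OF TV[OF u(1)]] HQ h u by blast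
  obtain w2 where w2: "w2:G" "lf w2 u s" using lf_truth[OF TV[OF u(1)] TV] i h u by blast
  obtain w3 where w3: "w3:G" "lf w3 u s'" using lf_truth[OF TV[OF u(1)] TV] i h u by blast
  obtain x1 where x1: "x1:G" "A.le x1 w1" "A.le x1 w2" using A.G_dir w1 w2 by blast
  obtain x2 where x2: "x2:G" "A.le x2 w3" "A.le x2 p" using A.G_dir w3 e by blast
  obtain x3 where x3: "x3:G" "A.le x3 p'" "A.le x3 p0" using A.G_dir p0 e by blast
  obtain y1 where y1: "y1:G" "A.le y1 x1" "A.le y1 x2" using A.G_dir x1 x2 by blast
  obtain y where y: "y:G" "A.le y y1" "A.le y x3" using A.G_dir y1 x3 by blast
  note GP = A.G_P[OF w1(1)] A.G_P[OF w2(1)] A.G_P[OF w3(1)] A.G_P[OF x1(1)] A.G_P[OF x2(1)] A.G_P[OF x3(1)] A.G_P[OF y1(1)] A.G_P[OF y(1)]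
  have yx: "A.le y x1" "A.le y x2" using A.le_trans y y1 GP by blast+
  have yy: "A.le y w1" "A.le y w2" "A.le y w3" "A.le y p" "A.le y p'" "A.le y p0"
   using A.le_trans yx y x1 x2 x3 GP i p0P by blast+
  have "mf y u" "lf y u s" "lf y u s'" using mf_mono lf_mono w1 w2 w3 yy GP by blast+
  hence "pair y u:$S" unfolding inS using GP yy u by blast
  hence "pair y u:K" unfolding K_def using y h u by blast
  thus "EX c:K. pair c a:$LS & pair c b:$LS"
   using \<open>lf y u s\<close> \<open>lf y u s'\<close> \<open>pair y u:$S\<close> e yy leS by blast
 next
  fix D assume D: "D:V" "$D <= $S & (ALL a:$S. EX b:$D. pair b a:$LS)"
  \<comment> \<open>Exchanging components turns a dense set of the iteration into a name for a dense
    subset of \<open>Q\<close>.\<close>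
  define n where "n = Img D (%z. pair (hsnd z) (hfst z))"
  have nM: "n:V" unfolding n_def by (rule A.dt_M0) (intro A.dfi D)
  have en: "$(val G n) = {val G (hsnd z) | z. z:$D & hfst z:G}" unfolding n_def by (rule val_Img)
  have ND: "$(val G n) <= $Q"
  proof
   fix x assume "x:$(val G n)"
   then obtain z where z: "x = val G (hsnd z)" "z:$D" "hfst z:G" unfolding en by blast
   obtain p s where zz: "z = pair p s" using SE D(2) z(2) by blast
   hence "s:$T" "mf p s" using D(2) z(2) inS by blast+
   thus "x:$Q" using mf_truth[OF TV] z zz by auto
  qed
  have "EX b:$(val G n). B.le b h" if h: "h:$Q" for h
  proof -
   obtain u where u: "u:$T" "h = val G u" using QT h by blast
   obtain w where w: "w:G" "mf w u" using mf_truth[OF TV[OF u(1)]] h u by blast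
   obtain p where p: "p:G" "A.le p w" "A.le p p0" using A.G_dir w p0 by blast
   have "A.df (%e. EX s:$T. pair (e 0) s:$D & lf (e 0) s u)" by (intro A.dfi TM D TV u)
   from A.G_dense_below[OF this p(1)] obtain p' where "p':G" "EX s:$T. pair p' s:$D & lf p' s u"
   proof -
    have "EX q':$P. A.le q' q & (EX s:$T. pair q' s:$D & lf q' s u)" if q: "q:$P" "A.le q p" for q
    proof -
     have "A.le q w" "A.le q p0" using A.le_trans q p A.G_P w p0P by blast+
     hence "pair q u:$S" unfolding inS using q u mf_mono w by blast
     then obtain b where b: "b:$D" "pair b (pair q u):$LS" using D by blast
     then obtain q' s where e: "b = pair q' s" using D SE by blast
     show ?thesis using b unfolding e leS inS by blast
    qed
    thus ?thesis using that A.G_dense_below[OF \<open>A.df (%e. EX s:$T. pair (e 0) s:$D & lf (e 0) s u)\<close> p(1)] by blast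
   qed
   then obtain s where s: "s:$T" "pair p' s:$D" "lf p' s u" by blast
   have "val G s:$(val G n)" unfolding en using s \<open>p':G\<close> by (intro CollectI exI[of _ "pair p' s"]) simp
   moreover have "B.le (val G s) h" using lf_truth[OF TV TV] s u \<open>p':G\<close> by blast
   ultimately show ?thesis by blast
  qed
  hence "H \<inter> $(val G n) ~= {}"
   using B.gen A.N_I[OF nM] ND unfolding generic_filter_def by blast
  then obtain z where z: "z:$D" "hfst z:G" "val G (hsnd z):H" unfolding en by blast
  obtain p s where e: "z = pair p s" using SE D z by blast
  have "z:K" unfolding K_def using z e D by auto
  thus "K \<inter> $D ~= {}" using z by blast
 qed
 interpret C: genericc V S LS K by unfold_locales (use SM LSM fnS gK in auto)
 have GV: "countable G" and HV: "countable H" and KV: "countable K"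
  using countable_subset[OF A.G_sub] countable_subset[OF B.G_sub] countable_subset[OF C.G_sub] by auto
 \<comment> \<open>The filters determine each other: \<open>G\<close> consists of the conditions
   above first components of \<open>K\<close>, \<open>H\<close> of the values of its second
   components, and \<open>K\<close> is defined from both.\<close>
 have Gh_C: "A.Gh:C.N"
 proof -
  have "A.Gh = Sep P (%p. EX z:$C.Gh. A.le (hfst z) p)"
  proof (rule hc_eqI, intro set_eqI iffI)
   fix p assume "p:$A.Gh"
   hence p: "p:G" by (simp add: A.elts_Gh)
   then obtain w where w: "w:G" "A.le w p" "A.le w p0" using A.G_dir p0 by blast
   hence "pair w ta:K" unfolding K_def using inS A.G_P[OF w(1)] ta mf_mono[OF F1 w(3)] B.G_one by auto
   hence "EX z:K. A.le (hfst z) p" using w(2) by (intro bexI[of _ "pair w ta"]) simp_all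
   thus "p:$(Sep P (%p. EX z:$C.Gh. A.le (hfst z) p))" using A.G_P[OF p] by (simp add: C.elts_Gh)
  next
   fix p assume "p:$(Sep P (%p. EX z:$C.Gh. A.le (hfst z) p))"
   hence "p:$P" "EX z:K. A.le (hfst z) p" by (auto simp: C.elts_Gh)
   thus "p:$A.Gh" unfolding K_def A.elts_Gh using A.G_up by auto
  qed
  moreover have "Sep P (%p. EX z:$C.Gh. A.le (hfst z) p):C.N"
   by (rule C.N.dt_M0) (intro C.N.dfi C.Gh_N C.M_N A.PM A.LM)
  ultimately show ?thesis by simp
 qed
 hence sub1: "A.N <= C.N" using A.N_minimal[OF C.N.tm_axioms] C.M_N by blast
 have "B.Gh = Img C.Gh (%z. val G (hsnd z))"
 proof (rule hc_eqI, intro set_eqI iffI)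
  fix h assume "h:$B.Gh"
  hence h: "h:H" by (simp add: B.elts_Gh)
  obtain u where u: "u:$T" "h = val G u" using QT HQ[OF h] by blast
  obtain w where w: "w:G" "mf w u" using mf_truth[OF TV[OF u(1)]] HQ[OF h] u by blast
  obtain p where p: "p:G" "A.le p w" "A.le p p0" using A.G_dir w p0 by blast
  have "pair p u:K" unfolding K_def using inS A.G_P[OF p(1)] u mf_mono[OF w(2) p(2)] p h by auto
  thus "h:$(Img C.Gh (%z. val G (hsnd z)))" using u(2)
   by (simp add: C.elts_Gh image_iff) (metis hsnd)
 next
  fix h assume "h:$(Img C.Gh (%z. val G (hsnd z)))"
  hence "h:(%z. val G (hsnd z)) ` K" by (simp add: C.elts_Gh)
  thus "h:$B.Gh" by (auto simp: B.elts_Gh K_def)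
 qed
 moreover have "Img C.Gh (%z. val G (hsnd z)):C.N"
  by (rule C.N.dt_M0) (intro C.N.dfi C.Gh_N C.N.dt_val Gh_C[unfolded A.Gh_def] GV)
 ultimately have "B.Gh:C.N" by simp
 hence BC: "B.N <= C.N" using B.N_minimal[OF C.N.tm_axioms sub1] by blast
 have "C.Gh = Sep S (%z. hfst z:$A.Gh & val G (hsnd z):$B.Gh)"
 proof (rule hc_eqI, intro set_eqI iffI)
  fix z assume "z:$C.Gh"
  hence "z:K" by (simp add: C.elts_Gh)
  thus "z:$(Sep S (%z. hfst z:$A.Gh & val G (hsnd z):$B.Gh))"
   by (auto simp: A.elts_Gh B.elts_Gh K_def)
 next
  fix z assume z: "z:$(Sep S (%z. hfst z:$A.Gh & val G (hsnd z):$B.Gh))"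
  then obtain p s where "z = pair p s" using SE[of z] unfolding elts_Sep by blast
  hence "z:K" using z by (auto simp: A.elts_Gh B.elts_Gh K_def)
  thus "z:$C.Gh" by (simp add: C.elts_Gh)
 qed
 moreover have "Sep S (%z. hfst z:$A.Gh & val G (hsnd z):$B.Gh):B.N"
  by (rule B.N.dt_M0) (intro B.N.dfi B.Gh_N B.N.dt_val B.M_N A.Gh_N A.Gh_N[unfolded A.Gh_def] GV A.M_N SM)
 ultimately have "C.Gh:B.N" by simp
 moreover have "V <= B.N" using A.M_N B.M_N by blast
 ultimately have "C.N <= B.N" using C.N_minimal[OF B.N.tm_axioms] by blast
 thus ?thesis using BC C.is_gen_ext V'' by auto
qed

section \<open>Measurable cardinals\<close>

context tmc begin

text \<open>The notion that reflects: if one normal measure on \<open>k\<close> lies below another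
  in the Mitchell order, almost all \<open>a\<close> below \<open>k\<close> carry such a filter. Its
  completeness drives the product of one-point choices.\<close>

definition meas :: "hc => hc => bool" where
 "meas d u <-> d:M & u:M & Ord d & homega:$d &
  (ALL X:$u. $X <= $d) & hempty~:$u &
  (ALL X:$u. ALL Y:M. $X <= $Y & $Y <= $d --> Y:$u) &
  (ALL X:M. $X <= $d --> X:$u \<or> Sep d (%z. z~:$X):$u) &
  (ALL a:$d. Upr a a~:$u) &
  (ALL g:$d. ALL s:M. fun_on s g & (ALL x:$g. ap s x:$u) -->
    Sep d (%a. ALL x:$g. a:$(ap s x)):$u)"

lemma df_meas [dfi]: assumes "dt s" "dt t" shows "df (%e. meas (s e) (t e))"
proof (rule df_app2[where P=meas, OF _ assms])
 have "df (%e. e 0:$(Upr (e 0) (e 0)) & meas (e 0) (e (Suc 0)))"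
 proof -
  have "df (%e. EX d:M. EX u:M. d = e 0 & u = e (Suc 0) & Ord d & homega:$d &
  (ALL X:$u. $X <= $d) & hempty~:$u &
  (ALL X:$u. ALL Y:M. $X <= $Y & $Y <= $d --> Y:$u) &
  (ALL X:M. $X <= $d --> X:$u \<or> Sep d (%z. z~:$X):$u) &
  (ALL a:$d. Upr a a~:$u) &
  (ALL g:$d. ALL s:M. fun_on s g & (ALL x:$g. ap s x:$u) -->
    Sep d (%a. ALL x:$g. a:$(ap s x)):$u))"
   by (intro dfi homega_M hempty_M)
  thus ?thesis by (rule df_cong') (auto simp: meas_def)
 qed
 thus "df (%e. meas (e 0) (e (Suc 0)))" by simp
qed

abbreviation df1 :: "(hc => bool) => bool" where "df1 P \<equiv> df (%e. P (e 0))"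
abbreviation df2 :: "(hc => hc => bool) => bool" where "df2 P \<equiv> df (%e. P (e 0) (e (Suc 0)))"

text \<open>To be read as a quantifier: almost all points below \<open>d\<close> satisfy
  \<open>P\<close>.\<close>

definition Lg :: "hc => hc => (hc => bool) => bool" where "Lg d u P <-> Sep d P:$u"

lemma df_fixM: assumes "df2 P" "x:M" shows "df1 (P x)" "df1 (%y. P y x)"
 using df_app2[where P=P, OF assms(1) dt_const[OF assms(2)] dt_var] df_app2[where P=P, OF assms(1) dt_var dt_const[OF assms(2)]] .

lemma df_Lg: assumes "df2 P" "d:M" "u:M" shows "df1 (%x. Lg d u (P x))"
proof -
 note [dfi] = df_app2[where P=P, OF assms(1)]
 show ?thesis unfolding Lg_def by (intro dfi assms)
qed

lemma Sep_cong: "(!!x. x:$a ==> P x = Q x) ==> Sep a P = Sep a Q"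
 by (rule hc_eqI) auto

end

locale measure = tmc +
 fixes d u assumes meas: "meas d u"
begin

lemma d: "d:M" "u:M" "Ord d" "homega:$d" using meas by (auto simp: meas_def)
lemma dsub: "x:$d ==> x:M" using trans d by blast

abbreviation "L \<equiv> Lg d u"

lemma L_cong: "(!!a. a:$d ==> P a = Q a) ==> L P = L Q"
 unfolding Lg_def by (subst Sep_cong[of d P Q]) auto

lemma L_mono: assumes "L P" "!!a. a:$d ==> P a ==> Q a" "df1 Q" shows "L Q"
proof -
 have "Sep d Q:M" by (rule Sep_M[OF d(1) assms(3)])
 moreover have "$(Sep d P) <= $(Sep d Q)" using assms(2) by auto
 moreover have "$(Sep d Q) <= $d" by auto
 ultimately show ?thesis using meas assms(1) unfolding meas_def Lg_def by blast
qed

lemma L_ex: assumes "L P" shows "EX a:$d. P a"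
proof (rule ccontr)
 assume "~ ?thesis"
 hence "Sep d P = hempty" by (intro hc_eqI) auto
 thus False using assms meas by (simp add: Lg_def meas_def)
qed

lemma L_complete: assumes "g:$d" "df2 P" "!!x. x:$g ==> L (P x)"
 shows "L (%a. ALL x:$g. P x a)"
proof -
 define s where "s = lam g (%x. Sep d (P x))"
 note [dfi] = df_app2[where P=P, OF assms(2)]
 have "s:M" unfolding s_def by (rule dt_M0) (intro dfi d dsub assms(1))
 moreover have "ap s x:$u" if "x:$g" for x using assms(3)[OF that] that by (simp add: s_def Lg_def)
 moreover have "fun_on s g" by (simp add: s_def)
 ultimately have "Sep d (%a. ALL x:$g. a:$(ap s x)):$u" using meas assms(1) unfolding meas_def by blast
 moreover have "Sep d (%a. ALL x:$g. a:$(ap s x)) = Sep d (%a. ALL x:$g. P x a)"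
  by (rule Sep_cong) (simp add: s_def)
 ultimately show ?thesis by (simp add: Lg_def)
qed

lemma hnat_d: "hnat n:$d" using Ord_trans[OF d(3,4)] by simp

lemma L_conj: assumes "L P" "L Q" "df1 P" "df1 Q" shows "L (%a. P a & Q a)"
proof -
 define R where "R x a <-> (x = hnat 0 --> P a) & (x = hnat 1 --> Q a)" for x a
 note [dfi] = df_app1[where P=P, OF assms(3)] df_app1[where P=Q, OF assms(4)]
 have dR: "df2 R" unfolding R_def by (intro dfi hnat_M)
 have e2: "$(hnat 2) = {hnat 0, hnat 1}" by (auto simp: elts_hnat lessThan_Suc numeral_2_eq_2 simp del: hnat.simps)
 have "hnat 0 ~= hnat 1" by (simp del: hnat.simps)
 hence "R (hnat 0) = P" "R (hnat 1) = Q" unfolding R_def by auto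
 hence "L (%a. ALL x:$(hnat 2). R x a)"
  by (intro L_complete[OF hnat_d dR]) (use assms(1,2) in "auto simp: e2")
 moreover have "(%a. ALL x:$(hnat 2). R x a) = (%a. P a & Q a)"
  using \<open>R (hnat 0) = P\<close> \<open>R (hnat 1) = Q\<close> by (auto simp: e2)
 ultimately show ?thesis by simp
qed

lemma L_no: assumes "L P" "L Q" "!!a. a:$d ==> P a ==> Q a ==> False" "df1 P" "df1 Q" shows False
 using L_ex[OF L_conj[OF assms(1,2,4,5)]] assms(3) by blast

lemma L_mono2: assumes "L P" "L Q" "!!a. a:$d ==> P a ==> Q a ==> R a" "df1 P" "df1 Q" "df1 R" shows "L R"
 using L_mono[OF L_conj[OF assms(1,2,4,5)] _ assms(6)] assms(3) by blast

lemma L_not: assumes "df1 P" shows "L (%a. ~ P a) <-> ~ L P"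
proof
 assume n: "L (%a. ~ P a)"
 show "~ L P"
 proof
  assume "L P"
  from L_ex[OF L_conj[OF this n assms df_not[OF assms]]] show False by blast
 qed
next
 assume "~ L P"
 moreover have "Sep d P:M" by (rule Sep_M[OF d(1) assms])
 moreover have "$(Sep d P) <= $d" by auto
 ultimately have "Sep d (%z. z~:$(Sep d P)):$u" using meas unfolding meas_def Lg_def by blast
 moreover have "Sep d (%z. z~:$(Sep d P)) = Sep d (%z. ~ P z)" by (rule Sep_cong) simp
 ultimately show "L (%a. ~ P a)" by (simp add: Lg_def)
qed

lemma L_all: assumes "!!a. a:$d ==> P a" shows "L P"
proof -
 have "L (%a. True)"
 proof (rule ccontr)
  assume "~ ?thesis"
  hence "L (%a. ~ True)" using L_not[of "%a. True"] df_const by blast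
  thus False using L_ex by blast
 qed
 thus ?thesis using L_cong[of "%a. True" P] assms by blast
qed

lemma L_ne: assumes "x:$d" shows "L (%a. a ~= x)"
proof -
 have "~ L (%a. a = x)"
 proof
  assume "L (%a. a = x)"
  moreover have "Sep d (%a. a = x) = Upr x x" using assms by (intro hc_eqI) auto
  ultimately show False using meas assms by (auto simp: Lg_def meas_def)
 qed
 moreover have "df1 (%a. a = x)" by (intro dfi dsub assms)
 ultimately show ?thesis using L_not[of "%a. a = x"] by blast
qed

lemma L_or: assumes "L (%a. P a \<or> Q a)" "df1 P" "df1 Q" shows "L P \<or> L Q"
proof (rule ccontr)
 assume "~ ?thesis"
 hence "L (%a. ~ P a)" "L (%a. ~ Q a)" using L_not[OF assms(2)] L_not[OF assms(3)] by auto
 from L_conj[OF this df_not[OF assms(2)] df_not[OF assms(3)]] assms(1) show False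
  by (rule L_no) (blast, intro dfi df_app1[where P=P, OF assms(2)] df_app1[where P=Q, OF assms(3)],
   intro dfi df_app1[where P=P, OF assms(2)] df_app1[where P=Q, OF assms(3)])
qed

lemma L_complete_ex: assumes "g:$d" "df2 P" "L (%a. EX x:$g. P x a)"
 shows "EX x:$g. L (P x)"
proof (rule ccontr)
 assume n: "~ ?thesis"
 note [dfi] = df_app2[where P=P, OF assms(2)]
 have gM: "g:M" using dsub assms(1) .
 have "L (%a. ~ P x a)" if "x:$g" for x
  using L_not[OF df_fixM(1)[OF assms(2) trans[OF gM that]]] n that by blast
 hence "L (%a. ALL x:$g. ~ P x a)"
  by (intro L_complete[where P="%x a. ~ P x a", OF assms(1)]) (intro dfi)
 from this assms(3) show False by (rule L_no) (blast, intro dfi gM, intro dfi gM)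
qed

text \<open>Otherwise \<open>d\<close> is the successor of \<open>x\<close>, and by completeness
  almost all points differ from every element of \<open>x\<close> and from \<open>x\<close>
  itself.\<close>

lemma dsucc: assumes "x:$d" shows "hsucc x:$d"
proof (rule ccontr)
 assume n: "hsucc x~:$d"
 have "Ord x" using Ord_in[OF d(3) assms] .
 hence "$d <= $(hsucc x)" using Ord_not_sub[OF d(3) Ord_hsucc] n by blast
 hence sub: "y:$x \<or> y = x" if "y:$d" for y using that by auto
 have df: "df2 (%x a. a ~= x)" by (intro dfi)
 have "L (%a. ALL y:$x. a ~= y)"
  by (rule L_complete[where P="%x a. a ~= x", OF assms df]) (rule L_ne, rule Ord_trans[OF d(3) assms])
 from this L_ne[OF assms] show False by (rule L_no) (use sub in blast, intro dfi dsub assms, intro dfi dsub assms)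
qed

lemma L_tail: assumes "x:$d" shows "L (%a. x:$a)"
proof -
 have df: "df2 (%x a. a ~= x)" by (intro dfi)
 have sx: "hsucc x:$d" by (rule dsucc[OF assms])
 have "L (%a. ALL y:$(hsucc x). a ~= y)"
  by (rule L_complete[where P="%x a. a ~= x", OF sx df]) (rule L_ne, rule Ord_trans[OF d(3) sx])
 thus ?thesis
 proof (rule L_mono)
  fix a assume a: "a:$d" "ALL y:$(hsucc x). a ~= y"
  hence "a ~= x" "a~:$x" by auto
  thus "x:$a" using Ord_linear[of a x] Ord_in[OF d(3)] a(1) assms by blast
 qed (intro dfi dsub assms)
qed

lemma L_choice: assumes "df2 R" "L (%a. EX y:M. R a y)"
 obtains h where "h:M" "fun_on h d" "L (%a. R a (ap h a))"
proof -
 note [dfi] = df_app2[where P=R, OF assms(1)]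
 have dR: "df2 (%a y. (EX y:M. R a y) --> R a y)" by (intro dfi)
 have ex: "EX y:M. (EX y:M. R a y) --> R a y" for a using hempty_M by blast
 obtain h where h: "h:M" "fun_on h d"
  "!!a. a:$d ==> ((EX y:M. R a y) --> R a (ap h a)) & ap h a:M"
  by (rule AC[OF d(1) dR ex]) blast
 have "L (%a. R a (ap h a))" by (rule L_mono[OF assms(2)]) (use h in blast, intro dfi h)
 thus ?thesis using that h by blast
qed

end

context tmc begin

lemma normal_iff: "normal_measure M k U <-> Card k & meas k U & k:$U &
  (ALL X:$U. ALL Y:$U. Sep X (%z. z:$Y):$U) &
  (ALL s:M. fun_on s k & (ALL x:$k. ap s x:$U) --> Sep k (%a. ALL x:$a. a:$(ap s x)):$U)"
proof (cases "Card k")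
 case k: True
 have s: "HSet {a} = Upr a a" "HSet ($X \<inter> $Y) = Sep X (%z. z:$Y)" "HSet ($X - $Y) = Sep X (%z. z~:$Y)" for a X Y
  by (simp_all add: Upr_def Sep_def set_diff_eq Int_def)
 have h: "(fun_on s g & (ALL x:$g. happ s x:$U) --> HSet {a:$k. ALL x:$g. a:$(happ s x)}:$U) <->
  (fun_on s g & (ALL x:$g. ap s x:$U) --> Sep k (%a. ALL x:$g. a:$(ap s x)):$U)" for s g
  using fun_on_happ[of s g] by (simp add: Sep_def cong: conj_cong imp_cong ball_cong)
 have h2: "(fun_on s k & (ALL x:$k. happ s x:$U) --> HSet {a:$k. ALL x:$a. a:$(happ s x)}:$U) <->
  (fun_on s k & (ALL x:$k. ap s x:$U) --> Sep k (%a. ALL x:$a. a:$(ap s x)):$U)" for s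
 proof -
  have "{a:$k. ALL x:$a. a:$(happ s x)} = {a:$k. ALL x:$a. a:$(ap s x)}" if f: "fun_on s k"
   using fun_on_happ[OF f] Ord_trans[OF Card_Ord[OF k]] by auto
  thus ?thesis using fun_on_happ[of s k] by (simp add: Sep_def cong: conj_cong imp_cong)
 qed
 show ?thesis unfolding normal_measure_def s h h2 meas_def using k Card_M[OF k] Card_Ord[OF k] by (simp only: simp_thms conj_ac)
qed (simp add: normal_measure_def)

lemma normal_meas: "normal_measure M k W ==> meas k W" by (simp add: normal_iff)

end

section \<open>Normal measures and representing functions in their ultrapowers\<close>

locale normal = tmc +
 fixes d u assumes nm: "normal_measure M d u"
begin

sublocale measure M d u by unfold_locales (rule normal_meas[OF nm])

lemma L_normal: assumes "df2 P" "!!x. x:$d ==> L (P x)" shows "L (%a. ALL x:$a. P x a)"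
proof -
 define s where "s = lam d (%x. Sep d (P x))"
 note [dfi] = df_app2[where P=P, OF assms(1)]
 have "s:M" unfolding s_def by (rule dt_M0) (intro dfi d)
 moreover have ap: "ap s x = Sep d (P x)" if "x:$d" for x using that by (simp add: s_def)
 ultimately have "Sep d (%a. ALL x:$a. a:$(ap s x)):$u"
  using nm assms(2) unfolding normal_iff Lg_def by (simp add: s_def)
 moreover have "Sep d (%a. ALL x:$a. a:$(ap s x)) = Sep d (%a. ALL x:$a. P x a)"
  by (rule Sep_cong) (use ap Ord_trans[OF d(3)] in auto)
 ultimately show ?thesis by (simp add: Lg_def)
qed

lemma L_press: assumes "dt (%e. h (e 0))" "L (%a. h a:$a)" shows "EX x:$d. L (%a. h a = x)"
proof (rule ccontr)
 assume n: "~ ?thesis"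
 note [dfi] = dt_app1[where F=h, OF assms(1)]
 have "L (%a. h a ~= x)" if "x:$d" for x
 proof -
  have "df1 (%a. h a = x)" by (intro dfi dsub that)
  from L_not[OF this] show ?thesis using n that by blast
 qed
 hence "L (%a. ALL x:$a. h a ~= x)" by (intro L_normal[where P="%x a. h a ~= x"]) (intro dfi)
 from this assms(2) show False by (rule L_no) (blast, intro dfi, intro dfi)
qed

end

text \<open>The part of Los's theorem that is needed: an element of the ultrapower that is a measure on
  \<open>d\<close> is represented by a function whose values are measures almost everywhere.\<close>

locale ultra = normal +
 fixes pe :: "hc => hc"
 assumes pi0: "!!f. f:M ==> fun_on f d ==>
   $(pe f) = pe ` {g:M. fun_on g d & L (%a. ap g a:$(ap f a))}"
begin

lemma pi_in: "g:M ==> fun_on g d ==> h:M ==> fun_on h d ==> L (%a. ap h a:$(ap g a)) ==> pe h:$(pe g)"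
 using pi0 by blast
lemma pi_out: assumes "g:M" "fun_on g d" "z:$(pe g)"
 obtains h where "h:M" "fun_on h d" "L (%a. ap h a:$(ap g a))" "z = pe h"
 using pi0[OF assms(1,2)] assms(3) by blast

definition cn where "cn x = lam d (%_. x)"
lemma cn: "x:M ==> cn x:M" "fun_on (cn x) d" "a:$d ==> ap (cn x) a = x"
 unfolding cn_def by ((rule dt_M0), intro dfi d) simp_all

text \<open>Ordinals below \<open>d\<close> are not moved: a function with values in a fixed
  \<open>x\<close> below \<open>d\<close> is constant almost everywhere, by completeness.\<close>

lemma pi_ord: "x:$d ==> g:M ==> fun_on g d ==> pe g = x <-> L (%a. ap g a = x)"
proof (induction x arbitrary: g rule: wf_elts_induct)
 case (step x)
 note xd = step.prems(1) and g = step.prems(2,3)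
 have xM: "x:M" using dsub xd .
 have IH: "pe h = y <-> L (%a. ap h a = y)" if "y:$x" "h:M" "fun_on h d" for y h
  using step.IH[OF that(1) Ord_trans[OF d(3) xd that(1)] that(2,3)] .
 have IHc: "pe (cn y) = y" if "y:$x" for y
 proof -
  have "y:M" using trans[OF xM that] .
  thus ?thesis using IH[OF that cn(1,2)] L_all[of "%a. ap (cn y) a = y"] cn(3) by blast
 qed
 have d1: "df1 (%a. ap g a = x)" by (intro dfi g xM)
 have dm1: "df1 (%a. ap h a:$(ap g a))" if "h:M" for h by (intro dfi that g)
 show ?case
 proof
  assume l: "L (%a. ap g a = x)"
  have "$(pe g) = $x"
  proof (intro subset_antisym subsetI)
   fix z assume "z:$(pe g)"
   then obtain h where h: "h:M" "fun_on h d" "L (%a. ap h a:$(ap g a))" "z = pe h" using pi_out g by metis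
   have "L (%a. EX y:$x. ap h a = y)"
    by (rule L_mono2[OF l h(3)]) (simp, (intro dfi h g xM)+)
   then obtain y where "y:$x" "L (%a. ap h a = y)"
    using L_complete_ex[OF xd, of "%y a. ap h a = y"] df_eq[OF dt_ap[OF dt_const[OF h(1)] dt_var] dt_var] by blast
   thus "z:$x" using IH h by blast
  next
   fix y assume y: "y:$x"
   have yM: "y:M" using trans[OF xM y] .
   have "L (%a. ap (cn y) a:$(ap g a))"
    by (rule L_mono[OF l]) (use cn(3) y in simp, rule dm1[OF cn(1)[OF yM]])
   hence "pe (cn y):$(pe g)" using pi_in g cn yM by blast
   thus "y:$(pe g)" using IHc[OF y] by simp
  qed
  thus "pe g = x" by (rule hc_eqI)
 next
  assume p: "pe g = x"
  show "L (%a. ap g a = x)"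
  proof (rule ccontr)
   assume "~ ?thesis"
   hence n: "L (%a. ap g a ~= x)" using L_not[OF d1] by blast
   have 1: "df1 (%a. EX z:M. z:$(ap g a) & z~:$x)" by (intro dfi g xM)
   have 2: "df1 (%a. EX z:$x. z~:$(ap g a))" by (intro dfi g xM)
   have "L (%a. (EX z:M. z:$(ap g a) & z~:$x) \<or> (EX z:$x. z~:$(ap g a)))"
   proof (rule L_mono[OF n])
    fix a assume a: "a:$d" "ap g a ~= x"
    have "ap g a:M" using ap_M g dsub a by blast
    thus "(EX z:M. z:$(ap g a) & z~:$x) \<or> (EX z:$x. z~:$(ap g a))"
     using a(2) hc_eqI[of "ap g a" x] trans[of "ap g a"] by blast
   qed (intro df_disj 1 2)
   from L_or[OF this 1 2]
   consider "L (%a. EX z:M. z:$(ap g a) & z~:$x)" | "L (%a. EX z:$x. z~:$(ap g a))"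
    by blast
   thus False
   proof cases
    case 1
    have "df2 (%a z. z:$(ap g a) & z~:$x)" by (intro dfi g xM)
    from L_choice[OF this 1] obtain h where h: "h:M" "fun_on h d" "L (%a. ap h a:$(ap g a) & ap h a~:$x)" .
    have "L (%a. ap h a:$(ap g a))" by (rule L_mono[OF h(3)]) (auto intro: dm1 h)
    hence y: "pe h:$x" using pi_in g h p by blast
    hence "L (%a. ap h a = pe h)" using IH h by blast
    have pM: "pe h:M" using trans[OF xM y] .
    from \<open>L (%a. ap h a = pe h)\<close> h(3) show False by (rule L_no) (use y in auto, (intro dfi h g xM pM)+)
   next
    case 2
    have "df2 (%z a. z~:$(ap g a))" by (intro dfi g)
    from L_complete_ex[OF xd this 2] obtain y where y: "y:$x" "L (%a. y~:$(ap g a))" by blast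
    have yM: "y:M" using trans[OF xM y(1)] .
    obtain h where h: "h:M" "fun_on h d" "L (%a. ap h a:$(ap g a))" "y = pe h" using pi_out g p y(1) by metis
    hence "L (%a. ap h a = y)" using IH y by blast
    hence "L (%a. y:$(ap g a))" by (rule L_mono2[OF _ h(3)]) (use y in blast, (intro dfi h g yM)+)
    from this y(2) show False by (rule L_no) (blast, (intro dfi h g yM)+)
   qed
  qed
 qed
qed

text \<open>The subset of \<open>d\<close> that \<open>g\<close> represents if \<open>g(a)\<close>
  is a subset of \<open>a\<close> almost everywhere: functions below such a \<open>g\<close> are
  regressive, hence constant almost everywhere by normality (\<open>pi_hat\<close>).\<close>

definition hat where "hat g = Sep d (%x. L (%a. x:$(ap g a)))"
lemma hat_M: "g:M ==> hat g:M"
proof -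
 assume g: "g:M"
 have "df2 (%x a. x:$(ap g a))" by (intro dfi g)
 from Sep_M[OF d(1) df_Lg[OF this d(1,2)]] show ?thesis by (simp add: hat_def)
qed

lemma regr_ex: assumes "h:M" "fun_on h d" "L (%a. ap h a:$a)"
 obtains x where "x:$d" "pe h = x" "L (%a. ap h a = x)"
proof -
 have "dt (%e. ap h (e 0))" by (intro dfi assms)
 from L_press[OF this assms(3)] show ?thesis using that pi_ord assms by blast
qed

lemma pi_cn: "x:$d ==> pe (cn x) = x"
 using pi_ord[OF _ cn(1,2)] dsub L_all[of "%a. ap (cn x) a = x"] cn(3) by blast

lemma pi_hat: assumes g: "g:M" "fun_on g d" "L (%a. $(ap g a) <= $a)" shows "pe g = hat g"
proof (rule hc_eqI, intro subset_antisym subsetI)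
 fix z assume "z:$(pe g)"
 then obtain h where h: "h:M" "fun_on h d" "L (%a. ap h a:$(ap g a))" "z = pe h" using pi_out g by metis
 have df: "df1 (%a. ap h a:$(ap g a))" "df1 (%a. $(ap g a) <= $a)" by (intro dfi h g)+
 have "L (%a. ap h a:$a)" by (rule L_mono[OF L_conj[OF h(3) g(3) df]]) (blast, intro dfi h)
 then obtain x where x: "x:$d" "pe h = x" "L (%a. ap h a = x)" using regr_ex h by metis
 have "df1 (%a. ap h a = x)" by (intro dfi h dsub x)
 have "L (%a. x:$(ap g a))"
  by (rule L_mono[OF L_conj[OF x(3) h(3) \<open>df1 (%a. ap h a = x)\<close> df(1)]]) (blast, intro dfi dsub x g)
 thus "z:$(hat g)" using x h by (simp add: hat_def)
next
 fix x assume "x:$(hat g)"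
 hence x: "x:$d" "L (%a. x:$(ap g a))" by (auto simp: hat_def)
 have xM: "x:M" using dsub x by blast
 have "L (%a. ap (cn x) a:$(ap g a))"
  by (rule L_mono[OF x(2)]) (use cn(3) in simp, intro dfi cn xM g)
 hence "pe (cn x):$(pe g)" using pi_in g cn xM by blast
 thus "x:$(pe g)" using pi_cn x by simp
qed

lemma sub_of_pi: assumes g: "g:M" "fun_on g d" "$(pe g) <= $d" shows "L (%a. $(ap g a) <= $a)"
proof (rule ccontr)
 assume n: "~ ?thesis"
 have df: "df1 (%a. $(ap g a) <= $a)" by (intro dfi g)
 have n': "L (%a. ~ $(ap g a) <= $a)" using L_not[OF df] n by blast
 have l: "L (%a. EX y:M. y:$(ap g a) & y~:$a)"
 proof (rule L_mono[OF n'])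
  fix a assume a: "a:$d" "~ $(ap g a) <= $a"
  have "ap g a:M" using ap_M g dsub a by blast
  thus "EX y:M. y:$(ap g a) & y~:$a" using a(2) trans by blast
 qed (intro dfi g)
 have "df2 (%a y. y:$(ap g a) & y~:$a)" by (intro dfi g)
 from L_choice[OF this l]
 obtain h where h: "h:M" "fun_on h d" "L (%a. ap h a:$(ap g a) & ap h a~:$a)" .
 have "L (%a. ap h a:$(ap g a))" by (rule L_mono[OF h(3)]) (blast, intro dfi h g)
 hence x: "pe h:$d" using pi_in g h by blast
 hence xM: "pe h:M" using dsub by blast
 have "L (%a. ap h a = pe h)" using pi_ord[OF x h(1,2)] by blast
 moreover have "L (%a. pe h:$a)" by (rule L_tail[OF x])
 ultimately have "L (%a. ap h a = pe h & pe h:$a)" by (rule L_conj) (intro dfi h xM)+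
 from this h(3) show False by (rule L_no) (simp, (intro dfi h g xM)+)
qed

lemma hat_eq: assumes g: "g:M" "L (%a. $(ap g a) <= $a)" and h: "h:M" "L (%a. $(ap h a) <= $a)"
 and eq: "hat g = hat h" shows "L (%a. ap g a = ap h a)"
proof -
 have "L (%a. x:$(ap g a) <-> x:$(ap h a))" if x: "x:$d" for x
 proof -
  have df: "df1 (%a. x:$(ap g a))" "df1 (%a. x:$(ap h a))"
   "df1 (%a. x:$(ap g a) <-> x:$(ap h a))" by (intro dfi g h dsub x)+
  show ?thesis
  proof (cases "x:$(hat g)")
   case True
   moreover have "x:$(hat h)" using True eq by simp
   ultimately have "L (%a. x:$(ap g a))" "L (%a. x:$(ap h a))" by (auto simp: hat_def)
   from L_mono[OF L_conj[OF this df(1,2)] _ df(3)] show ?thesis by blast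
  next
   case False
   moreover have "x~:$(hat h)" using False eq by simp
   ultimately have "~ L (%a. x:$(ap g a))" "~ L (%a. x:$(ap h a))" using x by (auto simp: hat_def)
   hence "L (%a. x~:$(ap g a))" "L (%a. x~:$(ap h a))"
    using L_not[OF df(1)] L_not[OF df(2)] by auto
   from L_mono[OF L_conj[OF this df_not[OF df(1)] df_not[OF df(2)]] _ df(3)] show ?thesis by blast
  qed
 qed
 hence "L (%a. ALL x:$a. x:$(ap g a) <-> x:$(ap h a))"
  by (intro L_normal[where P="%x a. x:$(ap g a) <-> x:$(ap h a)"]) (intro dfi g h)
 moreover have "L (%a. $(ap g a) <= $a & $(ap h a) <= $a)"
  by (rule L_conj[OF g(2) h(2)]) (intro dfi g h)+
 ultimately show ?thesis by (rule L_mono2) (rule hc_eqI, blast, (intro dfi g h)+)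
qed

end

locale ultrapower = ultra +
 fixes f U assumes f: "f:M" "fun_on f d" "pe f = U" and mU: "meas d U"
begin

text \<open>Membership in \<open>U\<close> becomes an almost-everywhere statement about
  \<open>f\<close>. The choice of representatives is immaterial, because functions with the same
  \<open>hat\<close> agree almost everywhere by a diagonal intersection.\<close>

lemma rep: assumes g: "g:M" "fun_on g d" "L (%a. $(ap g a) <= $a)"
 shows "L (%a. ap g a:$(ap f a)) <-> hat g:$U"
proof
 assume "L (%a. ap g a:$(ap f a))"
 thus "hat g:$U" using pi_in[OF f(1,2) g(1,2)] pi_hat[OF g] f(3) by simp
next
 assume "hat g:$U"
 then obtain h where h: "h:M" "fun_on h d" "L (%a. ap h a:$(ap f a))" "hat g = pe h" using pi_out f by metis
 have "$(hat g) <= $d" by (auto simp: hat_def)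
 hence "$(pe h) <= $d" using h(4) by simp
 hence s: "L (%a. $(ap h a) <= $a)" using sub_of_pi h by blast
 hence "hat g = hat h" using pi_hat[OF h(1,2)] h(4) by simp
 hence "L (%a. ap g a = ap h a)" using hat_eq g h s by blast
 hence "L (%a. ap g a = ap h a & ap h a:$(ap f a))" by (rule L_conj[OF _ h(3)]) (intro dfi g h f)+
 thus "L (%a. ap g a:$(ap f a))" by (rule L_mono) (simp, intro dfi g f)
qed

end

context ultrapower begin

text \<open>The clauses of \<open>meas\<close> that quantify over sets are transferred by
  contradiction. If one fails for the filters \<open>f(a)\<close>, counterexamples are chosen as a
  function \<open>h\<close> of \<open>a\<close>, and what \<open>h\<close> represents violates the
  clause for \<open>U\<close>.\<close>

lemma neg_choice:
 assumes "~ L P" "df1 P" "df2 R" "!!a. a:$d ==> ~ P a ==> EX y:M. R a y"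
 obtains h where "h:M" "fun_on h d" "L (%a. R a (ap h a))"
proof -
 have "L (%a. ~ P a)" using L_not[OF assms(2)] assms(1) by blast
 hence "L (%a. EX y:M. R a y)"
  by (rule L_mono) (use assms(4) in blast, intro dfi df_app2[where P=R, OF assms(3)])
 from L_choice[OF assms(3) this] show ?thesis using that .
qed

lemma fM: "a:$d ==> ap f a:M" using ap_M f dsub by blast

lemma U_sub: "X:$U ==> $X <= $d" using mU by (simp add: meas_def)

lemma c1: "L (%a. ALL X:$(ap f a). $X <= $a)"
proof (rule ccontr)
 assume n: "~ ?thesis"
 have 1: "df1 (%a. ALL X:$(ap f a). $X <= $a)" by (intro dfi f)
 have 2: "df2 (%a X. X:$(ap f a) & ~ $X <= $a)" by (intro dfi f)
 from neg_choice[OF n 1 2] obtain h where h: "h:M" "fun_on h d" "L (%a. ap h a:$(ap f a) & ~ $(ap h a) <= $a)"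
  using trans fM by blast
 have "L (%a. ap h a:$(ap f a))" by (rule L_mono[OF h(3)]) (blast, intro dfi h f)
 hence "pe h:$U" using pi_in f h by blast
 hence "L (%a. $(ap h a) <= $a)" using sub_of_pi[OF h(1,2)] U_sub by blast
 from this h(3) show False by (rule L_no) (blast, (intro dfi h f)+)
qed

lemma rep_lam: assumes "dt (%e. F (e 0))" "L (%a. $(F a) <= $a)"
 shows "L (%a. F a:$(ap f a)) <-> Sep d (%x. L (%a. x:$(F a))):$U"
proof -
 note [dfi] = dt_app1[where F=F, OF assms(1)]
 have g: "lam d F:M" by (rule dt_M0) (intro dfi d)
 have e: "L (%a. Q a (ap (lam d F) a)) = L (%a. Q a (F a))" for Q by (rule L_cong) simp
 have "L (%a. $(ap (lam d F) a) <= $a)" using assms(2) unfolding e[of "%a y. $y <= $a"] .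
 from rep[OF g fun_on_lam this] show ?thesis
  unfolding hat_def e[of "%a y. y:$(ap f a)"] e[of "%a y. _:$y"] .
qed

lemma c2: "L (%a. hempty~:$(ap f a))"
proof (rule ccontr)
 assume n: "~ ?thesis"
 have "df1 (%a. hempty:$(ap f a))" by (intro dfi f hempty_M)
 from L_not[OF this] n have 1: "L (%a. hempty:$(ap f a))" by blast
 have "dt (%e. hempty)" by (intro dfi hempty_M)
 from rep_lam[OF this] 1 L_all[of "%a. $hempty <= $a"]
 have "Sep d (%x. L (%a. x:$hempty)):$U" by simp
 moreover have "Sep d (%x. L (%a. x:$hempty)) = hempty" using L_ex by (intro hc_eqI) auto
 ultimately show False using mU by (simp add: meas_def)
qed

lemma c3: "L (%a. ALL X:$(ap f a). ALL Y:M. $X <= $Y & $Y <= $a --> Y:$(ap f a))"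
proof (rule ccontr)
 assume n: "~ ?thesis"
 have 1: "df1 (%a. ALL X:$(ap f a). ALL Y:M. $X <= $Y & $Y <= $a --> Y:$(ap f a))" by (intro dfi f)
 have 2: "df2 (%a p. hfst p:$(ap f a) & $(hfst p) <= $(hsnd p) & $(hsnd p) <= $a & hsnd p~:$(ap f a))"
  by (intro dfi f)
 have "EX p:M. hfst p:$(ap f a) & $(hfst p) <= $(hsnd p) & $(hsnd p) <= $a & hsnd p~:$(ap f a)"
  if ad: "a:$d" and na: "~ (ALL X:$(ap f a). ALL Y:M. $X <= $Y & $Y <= $a --> Y:$(ap f a))" for a
 proof -
  obtain X Y where "X:$(ap f a)" "Y:M" "$X <= $Y" "$Y <= $a" "Y~:$(ap f a)" using na by blast
  moreover have "X:M" using trans[OF fM[OF ad] calculation(1)] .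
  ultimately show ?thesis by (intro bexI[of _ "pair X Y"]) (auto intro: pair_M)
 qed
 from neg_choice[OF n 1 2 this] obtain h where h: "h:M" "fun_on h d"
  "L (%a. hfst (ap h a):$(ap f a) & $(hfst (ap h a)) <= $(hsnd (ap h a)) & $(hsnd (ap h a)) <= $a & hsnd (ap h a)~:$(ap f a))"
  by blast
 have dts: "dt (%e. hfst (ap h (e 0)))" "dt (%e. hsnd (ap h (e 0)))" by (intro dfi h)+
 have l1: "L (%a. hfst (ap h a):$(ap f a))" "L (%a. $(hfst (ap h a)) <= $a)" "L (%a. $(hsnd (ap h a)) <= $a)"
  by (rule L_mono[OF h(3)], blast, intro dfi h f)+
 have U1: "Sep d (%x. L (%a. x:$(hfst (ap h a)))):$U" using rep_lam[OF dts(1) l1(2)] l1(1) by simp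
 have S2: "Sep d (%x. L (%a. x:$(hsnd (ap h a)))):M"
 proof -
  have "df2 (%x a. x:$(hsnd (ap h a)))" by (intro dfi h)
  from Sep_M[OF d(1) df_Lg[OF this d(1,2)]] show ?thesis .
 qed
 have "L (%a. x:$(hsnd (ap h a)))" if "x:$d" "L (%a. x:$(hfst (ap h a)))" for x
  by (rule L_mono2[OF that(2) h(3)]) (blast, (intro dfi h f dsub that)+)
 hence "$(Sep d (%x. L (%a. x:$(hfst (ap h a))))) <= $(Sep d (%x. L (%a. x:$(hsnd (ap h a)))))" by auto
 moreover have "$(Sep d (%x. L (%a. x:$(hsnd (ap h a))))) <= $d" by auto
 ultimately have "Sep d (%x. L (%a. x:$(hsnd (ap h a)))):$U" using mU U1 S2 unfolding meas_def by blast
 hence "L (%a. hsnd (ap h a):$(ap f a))" using rep_lam[OF dts(2) l1(3)] by simp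
 from this h(3) show False by (rule L_no) (blast, (intro dfi h f)+)
qed

lemma hat_compl: assumes h: "h:M"
 shows "Sep d (%x. L (%a. x:$(Sep a (%z. z~:$(ap h a))))) = Sep d (%x. x~:$(hat h))"
proof (rule Sep_cong)
 fix x assume x: "x:$d"
 have df: "df1 (%a. x:$(ap h a))" by (intro dfi h dsub x)
 have "L (%a. x:$(Sep a (%z. z~:$(ap h a)))) <-> L (%a. x~:$(ap h a))"
 proof
  assume "L (%a. x:$(Sep a (%z. z~:$(ap h a))))"
  thus "L (%a. x~:$(ap h a))" by (rule L_mono) (simp, intro dfi h dsub x)
 next
  assume "L (%a. x~:$(ap h a))"
  from this L_tail[OF x] show "L (%a. x:$(Sep a (%z. z~:$(ap h a))))"
   by (rule L_mono2) (simp, (intro dfi h dsub x)+)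
 qed
 thus "L (%a. x:$(Sep a (%z. z~:$(ap h a)))) = (x~:$(hat h))"
  using L_not[OF df] x by (simp add: hat_def)
qed

lemma c4: "L (%a. ALL X:M. $X <= $a --> X:$(ap f a) \<or> Sep a (%z. z~:$X):$(ap f a))"
proof (rule ccontr)
 assume n: "~ ?thesis"
 have 1: "df1 (%a. ALL X:M. $X <= $a --> X:$(ap f a) \<or> Sep a (%z. z~:$X):$(ap f a))" by (intro dfi f)
 have 2: "df2 (%a X. $X <= $a & X~:$(ap f a) & Sep a (%z. z~:$X)~:$(ap f a))" by (intro dfi f)
 from neg_choice[OF n 1 2] obtain h where h: "h:M" "fun_on h d"
  "L (%a. $(ap h a) <= $a & ap h a~:$(ap f a) & Sep a (%z. z~:$(ap h a))~:$(ap f a))"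
  by blast
 have l: "L (%a. $(ap h a) <= $a)" by (rule L_mono[OF h(3)]) (blast, intro dfi h)
 have "hat h~:$U"
 proof
  assume "hat h:$U"
  hence "L (%a. ap h a:$(ap f a))" using rep[OF h(1,2) l] by simp
  from this h(3) show False by (rule L_no) (blast, (intro dfi h f)+)
 qed
 moreover have "$(hat h) <= $d" by (auto simp: hat_def)
 ultimately have "Sep d (%x. x~:$(hat h)):$U" using mU hat_M[OF h(1)] unfolding meas_def by blast
 moreover have "dt (%e. Sep (e 0) (%z. z~:$(ap h (e 0))))" by (intro dfi h)
 ultimately have "L (%a. Sep a (%z. z~:$(ap h a)):$(ap f a))"
  using rep_lam[of "%a. Sep a (%z. z~:$(ap h a))"] hat_compl[OF h(1)] L_all[of "%a. $(Sep a (%z. z~:$(ap h a))) <= $a"] by auto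
 from this h(3) show False by (rule L_no) (blast, (intro dfi h f)+)
qed

lemma c5: "L (%a. ALL x:$a. Upr x x~:$(ap f a))"
proof (rule ccontr)
 assume n: "~ ?thesis"
 have 1: "df1 (%a. ALL x:$a. Upr x x~:$(ap f a))" by (intro dfi f)
 have 2: "df2 (%a x. x:$a & Upr x x:$(ap f a))" by (intro dfi f)
 from neg_choice[OF n 1 2] obtain h where h: "h:M" "fun_on h d" "L (%a. ap h a:$a & Upr (ap h a) (ap h a):$(ap f a))"
  using dsub trans by blast
 have "L (%a. ap h a:$a)" by (rule L_mono[OF h(3)]) (blast, intro dfi h)
 then obtain x where x: "x:$d" "L (%a. ap h a = x)" using regr_ex h by metis
 have xM: "x:M" using dsub x by blast
 have l: "L (%a. Upr x x:$(ap f a))" by (rule L_mono2[OF x(2) h(3)]) (blast, (intro dfi h f xM)+)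
 have l2: "L (%a. $(Upr x x) <= $a)" by (rule L_mono[OF L_tail[OF x(1)]]) (simp, intro dfi xM)
 have "dt (%e. Upr x x)" by (intro dfi xM)
 from rep_lam[OF this l2] l have "Sep d (%y. L (%a. y:$(Upr x x))):$U" by blast
 moreover have "Sep d (%y. L (%a. y:$(Upr x x))) = Upr x x"
  using x(1) L_all[of "%a. x:$(Upr x x)"] L_ex by (intro hc_eqI) fastforce
 ultimately show False using mU x(1) by (simp add: meas_def)
qed

lemma c6: "L (%a. ALL g:$a. ALL s:M. fun_on s g & (ALL x:$g. ap s x:$(ap f a)) -->
    Sep a (%z. ALL x:$g. z:$(ap s x)):$(ap f a))" (is "L (%a. ?Q a)")
proof (rule ccontr)
 assume n: "~ ?thesis"
 have 1: "df1 (%a. ?Q a)" by (intro dfi f)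
 let ?R = "%a p. hfst p:$a & (ALL x:$(hfst p). ap (hsnd p) x:$(ap f a)) &
   Sep a (%z. ALL x:$(hfst p). z:$(ap (hsnd p) x))~:$(ap f a)"
 have 2: "df2 ?R" by (intro dfi f)
 have "EX p:M. ?R a p" if ad: "a:$d" and na: "~ ?Q a" for a
 proof -
  obtain g s where "g:$a" "s:M" "ALL x:$g. ap s x:$(ap f a)"
   "Sep a (%z. ALL x:$g. z:$(ap s x))~:$(ap f a)" using na by blast
  moreover have "g:M" using trans[OF dsub[OF ad] calculation(1)] .
  ultimately show ?thesis by (intro bexI[of _ "pair g s"]) (auto intro: pair_M)
 qed
 from neg_choice[OF n 1 2 this] obtain h where h: "h:M" "fun_on h d" "L (%a. ?R a (ap h a))" by blast
 \<comment> \<open>The length of the sequence chosen at \<open>a\<close> is below \<open>a\<close>,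
   hence constant almost everywhere by pressing down. With one length \<open>g\<close> for all
   \<open>a\<close>, the completeness of \<open>U\<close> applies.\<close>
 define ga where "ga = lam d (%a. hfst (ap h a))"
 have ga: "ga:M" "fun_on ga d" unfolding ga_def by ((rule dt_M0), intro dfi d h) simp
 have "L (%a. ap ga a:$a)" by (rule L_mono[OF h(3)]) (simp add: ga_def, intro dfi ga)
 then obtain g where g: "g:$d" "L (%a. ap ga a = g)" using regr_ex ga by metis
 have gM: "g:M" using dsub g by blast
 define s where "s a = hsnd (ap h a)" for a
 have dts: "dt (%e. s (e 0))" unfolding s_def by (intro dfi h)
 note [dfi] = dt_app1[where F=s, OF dts]
 let ?G = "%a. Sep a (%z. ALL x:$g. z:$(ap (s a) x))"
 have l: "L (%a. (ALL x:$g. ap (s a) x:$(ap f a)) & ?G a~:$(ap f a))"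
  by (rule L_mono2[OF g(2) h(3)]) (simp add: ga_def s_def, (intro dfi ga h f gM)+)
 let ?hx = "%x. Sep d (%z. L (%a. z:$(ap (s a) x)))"
 have hx: "?hx x:$U" if x: "x:$g" for x
 proof -
  have xM: "x:M" using trans[OF gM x] .
  have 1: "L (%a. ap (s a) x:$(ap f a))" by (rule L_mono[OF l]) (use x in blast, intro dfi xM f)
  have 2: "L (%a. $(ap (s a) x) <= $a)" by (rule L_mono2[OF 1 c1]) (blast, (intro dfi xM f)+)
  have "dt (%e. ap (s (e 0)) x)" by (intro dfi xM)
  from rep_lam[OF this 2] 1 show ?thesis by blast
 qed
 interpret U: measure M d U by unfold_locales (rule mU)
 have dd: "df (%e. e (Suc 0):$(ap (s (e 0)) (e (Suc (Suc 0)))))" by (intro dfi)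
 have "dt (%e. Sep d (%z. Lg d u (%a. z:$(ap (s a) (e 0)))))" unfolding Lg_def by (intro dfi d)
 note [dfi] = dt_app1[where F="?hx", OF this]
 have "U.L (%z. ALL x:$g. z:$(?hx x))"
 proof (rule U.L_complete[where P="%x z. z:$(?hx x)", OF g(1)])
  show "df2 (%x z. z:$(?hx x))" by (intro dfi)
  fix x assume "x:$g"
  moreover have "Sep d (%z. z:$(?hx x)) = ?hx x" by (rule hc_eqI) auto
  ultimately show "U.L (%z. z:$(?hx x))" using hx unfolding Lg_def[of d U] by simp
 qed
 moreover have "Sep d (%z. ALL x:$g. z:$(?hx x)) = Sep d (%z. L (%a. z:$(?G a)))"
 proof (rule Sep_cong)
  fix z assume z: "z:$d"
  have zM: "z:M" using dsub z by blast
  show "(ALL x:$g. z:$(?hx x)) = L (%a. z:$(?G a))"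
  proof
   assume "ALL x:$g. z:$(?hx x)"
   hence "L (%a. z:$(ap (s a) x))" if "x:$g" for x using that by simp
   hence "L (%a. ALL x:$g. z:$(ap (s a) x))"
    by (intro L_complete[where P="%x a. z:$(ap (s a) x)", OF g(1)]) (intro dfi zM)
   from this L_tail[OF z] show "L (%a. z:$(?G a))" by (rule L_mono2) (simp, (intro dfi zM gM)+)
  next
   assume lz: "L (%a. z:$(?G a))"
   have "L (%a. z:$(ap (s a) x))" if "x:$g" for x
    by (rule L_mono[OF lz]) (use that in simp, intro dfi zM trans[OF gM that])
   thus "ALL x:$g. z:$(?hx x)" using z by simp
  qed
 qed
 ultimately have "Sep d (%z. L (%a. z:$(?G a))):$U" unfolding Lg_def[of d U] by simp
 moreover have "dt (%e. ?G (e 0))" by (intro dfi gM)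
 moreover have "L (%a. $(?G a) <= $a)" by (rule L_all) auto
 ultimately have "L (%a. ?G a:$(ap f a))" using rep_lam[of ?G] by blast
 from this l show False by (rule L_no) (blast, (intro dfi gM f)+)
qed

lemma L_meas: "L (%a. meas a (ap f a))"
proof -
 let ?P3 = "%a. ALL X:$(ap f a). ALL Y:M. $X <= $Y & $Y <= $a --> Y:$(ap f a)"
 let ?P4 = "%a. ALL X:M. $X <= $a --> X:$(ap f a) \<or> Sep a (%z. z~:$X):$(ap f a)"
 let ?P6 = "%a. ALL g:$a. ALL s:M. fun_on s g & (ALL x:$g. ap s x:$(ap f a)) -->
    Sep a (%z. ALL x:$g. z:$(ap s x)):$(ap f a)"
 have 1: "L (%a. homega:$a & (ALL X:$(ap f a). $X <= $a))"
  by (rule L_conj[OF L_tail[OF d(4)] c1]) (intro dfi f homega_M)+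
 have 2: "L (%a. hempty~:$(ap f a) & ?P3 a)" by (rule L_conj[OF c2 c3]) (intro dfi f hempty_M)+
 have 3: "L (%a. ?P4 a & (ALL x:$a. Upr x x~:$(ap f a)))" by (rule L_conj[OF c4 c5]) (intro dfi f)+
 have 4: "L (%a. (homega:$a & (ALL X:$(ap f a). $X <= $a)) & hempty~:$(ap f a) & ?P3 a)"
  by (rule L_conj[OF 1 2]) (intro dfi f hempty_M homega_M)+
 have 5: "L (%a. (?P4 a & (ALL x:$a. Upr x x~:$(ap f a))) & ?P6 a)"
  by (rule L_conj[OF 3 c6]) (intro dfi f)+
 show ?thesis
 proof (rule L_mono2[OF 4 5])
  fix a assume a: "a:$d" and A: "(homega:$a & (ALL X:$(ap f a). $X <= $a)) & hempty~:$(ap f a) & ?P3 a"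
   and B: "(?P4 a & (ALL x:$a. Upr x x~:$(ap f a))) & ?P6 a"
  show "meas a (ap f a)" unfolding meas_def using A B dsub[OF a] fM[OF a] Ord_in[OF d(3) a] by (intro conjI) blast+
 qed (intro dfi f hempty_M homega_M)+
qed

end

context tmc begin

lemma ultra_eq: assumes "fun_on f k" "fun_on g k"
 shows "HSet {a:$k. happ g a:$(happ f a)}:$W <-> Lg k W (%a. ap g a:$(ap f a))"
proof -
 have "{a:$k. happ g a:$(happ f a)} = {a:$k. ap g a:$(ap f a)}"
  using fun_on_happ[OF assms(1)] fun_on_happ[OF assms(2)] by auto
 thus ?thesis by (simp add: Lg_def Sep_def)
qed

lemma ultra_iff: assumes "normal_measure M k W"
 shows "(ALL f:{f:M. fun_on f k}. pe f = HSet (pe ` {g:{f:M. fun_on f k}. HSet {a:$k. happ g a:$(happ f a)}:$W}))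
  <-> ultra M k W pe" (is "?l <-> _")
proof -
 have e: "{g:{f:M. fun_on f k}. HSet {a:$k. happ g a:$(happ f a)}:$W}
   = {g:M. fun_on g k & Lg k W (%a. ap g a:$(ap f a))}" if "fun_on f k" for f
  using ultra_eq[OF that] by auto
 have c: "countable (pe ` {g:M. fun_on g k & Lg k W (%a. ap g a:$(ap f a))})" for f
  by (intro countable_image countable_subset[OF _ countable_M]) auto
 have h: "x = HSet S <-> $x = S" if "countable S" for x S using elts_HSet[OF that] elts_inject[of x "HSet S"] by simp
 have "?l <-> (ALL f:M. fun_on f k --> $(pe f) = pe ` {g:M. fun_on g k & Lg k W (%a. ap g a:$(ap f a))})"
  using e h[OF c] by (simp cong: conj_cong imp_cong) blast
 moreover have "normal M k W" by unfold_locales (rule assms)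
 ultimately show ?thesis by (auto simp: ultra_def ultra_axioms_def)
qed

lemma mitchell_ultra: assumes "mitchell_less M k U W" obtains pe f where "ultrapower M k W pe f U"
proof -
 have nU: "normal_measure M k U" and nW: "normal_measure M k W" and iu: "in_ultrapower M k W U"
  using assms by (auto simp: mitchell_less_def)
 obtain pe f where "ultra M k W pe" "f:M" "fun_on f k" "pe f = U"
  using iu unfolding in_ultrapower_def Let_def ultra_iff[OF nW] by blast
 thus ?thesis using that normal_meas[OF nU] by (auto simp: ultrapower_def ultrapower_axioms_def)
qed

text \<open>The ultrapower by \<open>W\<close> contains the measure \<open>U\<close> on
  \<open>k\<close>; this reflects to almost all \<open>a\<close> below \<open>k\<close>, and almost
  all of these exceed \<open>b\<close>.\<close>

lemma mitchell_meas:
 assumes "mitchell_less M k U W" "b:$k"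
 shows "EX a:$k. b:$a & (EX v:M. meas a v)"
proof -
 obtain pe f where "ultrapower M k W pe f U" by (rule mitchell_ultra[OF assms(1)])
 then interpret ultrapower M k W pe f U .
 from L_tail[OF assms(2)] L_meas have "L (%a. b:$a & meas a (ap f a))"
  by (rule L_conj) (intro dfi dsub assms f)+
 from L_ex[OF this] show ?thesis using fM by blast
qed

text \<open>Without comparable measures all ranks vanish, and the order of \<open>k\<close> is at
  most 1.\<close>

lemma mitchell_order_pos:
 assumes "mitchell_order M k a" "$(hnat 2) <= $a"
 shows "EX U W. mitchell_less M k U W"
proof (rule ccontr)
 assume n: "~ ?thesis"
 obtain rh where r: "ALL U. normal_measure M k U --> rh U = hUnion {hsucc (rh U') |U'. mitchell_less M k U' U}"
  "a = hUnion {hsucc (rh U) |U. normal_measure M k U}" using assms(1) unfolding mitchell_order_def by blast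
 have re: "rh U = hempty" if "normal_measure M k U" for U
 proof -
  have "rh U = hUnion {hsucc (rh U') |U'. mitchell_less M k U' U}" using r(1) that by blast
  also have "{hsucc (rh U') |U'. mitchell_less M k U' U} = {}" using n by blast
  finally show ?thesis by (simp add: hUnion_def hempty_def)
 qed
 have h1: "hsucc hempty = hnat 1" by simp
 have S: "{hsucc (rh U) |U. normal_measure M k U} <= {hnat 1}"
  unfolding h1[symmetric] using re by (auto simp del: hnat.simps)
 hence "countable {hsucc (rh U) |U. normal_measure M k U}" by (rule countable_subset) simp
 hence cU: "countable (\<Union>x\<in>{hsucc (rh U) |U. normal_measure M k U}. $x)" by (rule countable_UN) simp
 have "$a = (\<Union>x\<in>{hsucc (rh U) |U. normal_measure M k U}. $x)" unfolding r(2) hUnion_def by (rule elts_HSet[OF cU])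
 also have "\<dots> <= (\<Union>x\<in>{hnat 1}. $x)" by (rule UN_mono[OF S order_refl])
 finally have "$a <= $(hnat 1)" by simp
 hence "$a <= {hnat 0}" by (simp add: elts_hnat)
 moreover have "hnat 1:$a" using assms(2) hnat_in[of 1 2] by (auto simp del: hnat.simps)
 ultimately show False using hnat_inj[of 1 0] by auto
qed

end

section \<open>A bound for the Mitchell order\<close>

text \<open>The \<open>y\<close>-th level of the rank function of \<open>R\<close> on
  \<open>A\<close>: elements outside the earlier levels all of whose predecessors lie in earlier
  levels. The definition makes sense before \<open>R\<close> is known to be well-founded.\<close>

definition stg :: "hc => (hc => hc => bool) => hc => hc" where
 "stg A R = wfrec {(x, y). x:$y} (%s y. Sep A (%f. f~:$(UU (Img y s)) & (ALL g:$A. R g f --> g:$(UU (Img y s)))))"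

lemma stg: "$(stg A R y) = {f:$A. (ALL z:$y. f~:$(stg A R z)) & (ALL g:$A. R g f --> (EX z:$y. g:$(stg A R z)))}"
proof -
 have "Img y (cut (stg A R) {(x, y). x:$y} y) = Img y (stg A R)" by (rule Img_cong) (simp add: cut_apply)
 hence "stg A R y = Sep A (%f. f~:$(UU (Img y (stg A R))) & (ALL g:$A. R g f --> g:$(UU (Img y (stg A R)))))"
  unfolding stg_def by (subst wfrec[OF wf_elts]) simp
 thus ?thesis by auto
qed

lemma Ord_SucUU: "Ord n ==> UU (hsucc n) = n"
 by (rule hc_eqI) (auto dest: Ord_trans)

context tmc begin

context fixes A R assumes A: "A:M" and R: "df2 R" begin

lemma dt_stg: "dt t ==> dt (%e. stg A R (t e))"
proof -
 note [dfi] = df_app2[where P=R, OF R]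
 let ?H = "%y s. Sep A (%f. f~:$(UU (Img y (ap s))) & (ALL g:$A. R g f --> g:$(UU (Img y (ap s)))))"
 have "tmrec M (%x. x) ?H (stg A R)"
 proof unfold_locales
  show "dt (%e. e 0)" "dt (%e. ?H (e 0) (e (Suc 0)))" by (intro dfi A)+
  show "wf {(y, x). y:$x}" by (rule wf_elts)
  fix y
  have "Img y (ap (lam y (stg A R))) = Img y (stg A R)" by (rule Img_cong) simp
  thus "stg A R y = ?H y (lam y (stg A R))" by (intro hc_eqI) (subst stg, auto)
 qed
 thus "dt t ==> dt (%e. stg A R (t e))" by (rule tmrec.dt_F)
qed

lemma lep_stg: assumes a: "a:M" "Ord a" and ne: "!!y. y:$a ==> $(stg A R y) ~= {}" shows "lep a A"
proof -
 have dS: "df (%e. e (Suc 0):$(stg A R (e 0)))" by (intro dfi dt_stg)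
 have ex: "EX f:M. f:$(stg A R y)" if y: "y:$a" for y
 proof -
  obtain f where f: "f:$(stg A R y)" using ne[OF y] by blast
  hence "f:$A" unfolding stg[of A R y] by blast
  thus ?thesis using f trans[OF A] by blast
 qed
 obtain c where c: "c:M" "fun_on c a" "!!y. y:$a ==> ap c y:$(stg A R y) & ap c y:M"
  by (rule AC[OF a(1) dS ex], assumption) (rule that)
 show ?thesis
 proof (rule lepI[OF a(1), where F="ap c"])
  show "dt (%e. ap c (e 0))" by (intro dfi c)
  show "inj_on (ap c) $a"
  proof (rule inj_onI)
   have n: False if "y:$y'" "y:$a" "y':$a" "ap c y = ap c y'" for y y'
    using c(3)[OF that(2)] c(3)[OF that(3)] that(1,4) unfolding stg[of A R y'] by auto
   fix y y' assume "y:$a" "y':$a" "ap c y = ap c y'"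
   thus "y = y'" using n[of y y'] n[of y' y] Ord_linear[of y y'] Ord_in[OF a(2)] by metis
  qed
  show "ap c y:$A" if "y:$a" for y using c(3)[OF that] unfolding stg[of A R y] by blast
 qed
qed

text \<open>Absoluteness of well-foundedness. The levels are disjoint, so by Cantor's theorem an
  empty one occurs. The elements outside all earlier levels then form a set of the model without
  minimal element, that is, the empty set, and the index of the level is a rank function.\<close>

lemma wf_internal: assumes min: "!!C. C:M ==> $C <= $A ==> $C ~= {} ==> EX f:$C. ALL g:$C. ~ R g f"
 shows "wf {(g, f). g:$A & f:$A & R g f}"
proof -
 obtain a where a: "a:M" "Ord a" "eqp a (hPow M A)" using Zermelo[OF hPow_M[OF A]] by blast
 have "~ lep a A"
 proof
  assume "lep a A"
  hence "lep (hPow M A) A" using lep_trans[OF eqp_lep[OF eqp_sym[OF a(3) a(1) hPow_M[OF A]]]] hPow_M[OF A] by blast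
  thus False using Cantor[OF A] by blast
 qed
 then obtain y where y: "y:$a" "$(stg A R y) = {}" using lep_stg[OF a(1,2)] by blast
 define C where "C = Sep A (%f. ALL z:$y. f~:$(stg A R z))"
 have CM: "C:M" unfolding C_def by (rule dt_M0) (intro dt_Sep df_ball df_not df_mem dt_stg dfi A trans[OF a(1) y(1)])
 have all: "EX z:$y. f:$(stg A R z)" if f: "f:$A" for f
 proof (rule ccontr)
  assume "~ ?thesis"
  hence "$C ~= {}" using f unfolding C_def by auto
  then obtain g where g: "g:$C" "ALL h:$C. ~ R h g" using min[OF CM] unfolding C_def by auto
  hence "g:$(stg A R y)" unfolding stg[of A R y] unfolding C_def by auto
  thus False using y by blast
 qed
 define r where "r f = (SOME z. z:$y & f:$(stg A R z))" for f
 have r: "r f:$y & f:$(stg A R (r f))" if "f:$A" for f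
  unfolding r_def by (rule someI_ex) (use all[OF that] in blast)
 have u: False if "f:$(stg A R z)" "f:$(stg A R z')" "z:$z'" for f z z'
  using that unfolding stg[of A R z'] by blast
 have yO: "Ord y" using Ord_in[OF a(2) y(1)] .
 have "r g:$(r f)" if gf: "g:$A" "f:$A" "R g f" for g f
 proof -
  have "f:$(stg A R (r f))" using r[OF gf(2)] by blast
  then obtain z where z: "z:$(r f)" "g:$(stg A R z)" using gf unfolding stg[of A R "r f"] by blast
  have "z:$y" using Ord_trans[OF yO] r[OF gf(2)] z(1) by blast
  hence "z = r g" using Ord_linear[of z "r g"] Ord_in[OF yO] u[OF z(2)] u[of g "r g" z] r[OF gf(1)] z(2) by blast
  thus ?thesis using z by simp
 qed
 thus ?thesis by (intro wf_subset[OF wf_inv_image[OF wf_elts, of r]]) (auto simp: inv_image_def)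
qed

end

end

context measure begin

text \<open>A set without minimal element would give, by choice and recursion inside the model, a
  descending omega-sequence of functions. By completeness all its inequalities hold at one common
  point, where the values descend in the true membership relation.\<close>

lemma L_min: assumes C: "C:M" "$C ~= {}" shows "EX f:$C. ALL g:$C. ~ L (%a. ap g a:$(ap f a))"
proof (rule ccontr)
 assume n: "~ ?thesis"
 define R where "R f g <-> g:$C & L (%a. ap g a:$(ap f a))" for f g
 have dR: "df2 R" unfolding R_def Lg_def by (intro dfi C d)
 have ex: "EX g:M. R f g" if "f:$C" for f using n that trans[OF C(1)] unfolding R_def by blast
 obtain h where h: "h:M" "fun_on h C" "!!f. f:$C ==> R f (ap h f) & ap h f:M"
  by (rule AC[OF C(1) dR ex], assumption) (rule that)
 obtain c0 where c0: "c0:$C" using C by blast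
 have c0M: "c0:M" using trans[OF C(1) c0] .
 define H where "H n s = (if n = hempty then c0 else ap h (ap s (UU n)))" for n s
 have dH: "dt (%e. H (e 0) (e (Suc 0)))" unfolding H_def by (intro dfi c0M h hempty_M)
 obtain c where c: "!!n. c n = H n (lam n c)" and dc: "!!t. dt t ==> dt (%e. c (t e))"
  by (rule mrec[OF dH]) (rule that)
 have cS: "c (hnat (Suc n)) = ap h (c (hnat n))" for n
 proof -
  have "hnat (Suc n) ~= hempty" using hnat_inj[of "Suc n" 0] by simp
  hence "c (hnat (Suc n)) = ap h (ap (lam (hnat (Suc n)) c) (hnat n))"
   by (subst c) (simp add: H_def Ord_SucUU)
  thus ?thesis by simp
 qed
 have cC: "c (hnat n):$C" for n
 proof (induction n)
  case 0 show ?case by (subst c) (simp add: H_def c0)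
 next
  case (Suc n) thus ?case unfolding cS using h(3) unfolding R_def by blast
 qed
 have "L (%a. ALL n:$homega. ap (c (hsucc n)) a:$(ap (c n) a))"
 proof (rule L_complete[where P="%n a. ap (c (hsucc n)) a:$(ap (c n) a)", OF d(4)])
  show "df2 (%n a. ap (c (hsucc n)) a:$(ap (c n) a))" by (intro dfi dc)
  fix n assume "n:$homega"
  then obtain m where m: "n = hnat m" by auto
  show "L (%a. ap (c (hsucc n)) a:$(ap (c n) a))" using h(3)[OF cC[of m]] cS[of m] unfolding R_def m by simp
 qed
 then obtain a where a: "!!n. n:$homega ==> ap (c (hsucc n)) a:$(ap (c n) a)" using L_ex by blast
 have "ap (c (hnat (Suc n))) a:$(ap (c (hnat n)) a)" for n using a[of "hnat n"] by simp
 hence "EX s. ALL n. (s (Suc n), s n):{(x, y). x:$y}" by (intro exI[of _ "%n. ap (c (hnat n)) a"]) simp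
 thus False using wf_elts unfolding wf_iff_no_infinite_down_chain by blast
qed

text \<open>A descending sequence may lie outside the model, where completeness says nothing about
  it. Truncating its functions to values of rank below \<open>al\<close> places them in one set
  \<open>A\<close> of the model, for which internal and external well-foundedness agree.\<close>

lemma wf_L: "wf {(g, f). g:M & fun_on g d & f:M & fun_on f d & L (%a. ap g a:$(ap f a))}"
 unfolding wf_iff_no_infinite_down_chain
proof
 assume "EX s. ALL i. (s (Suc i), s i):{(g, f). g:M & fun_on g d & f:M & fun_on f d & L (%a. ap g a:$(ap f a))}"
 then obtain s where *: "!!i. (s (Suc i), s i):{(g, f). g:M & fun_on g d & f:M & fun_on f d & L (%a. ap g a:$(ap f a))}" by blast
 hence s: "!!i. s i:M" "!!i. L (%a. ap (s (Suc i)) a:$(ap (s i) a))" by blast+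
 have sF: "fun_on (s 0) d" using * by blast
 define al where "al = rk (s 0)"
 have alO: "Ord al" by (simp add: al_def)
 have alM: "al:M" unfolding al_def by (rule dt_M0) (intro dfi s)
 define T where "T = VV M al"
 have TM: "T:M" unfolding T_def by (rule dt_M0) (intro dfi alM)
 have inT: "x:$T" if "x:M" "rk x:$al" for x
 proof -
  have "x:$(hPow M (VV M (rk x)))" using VV_rk[OF that(1)] that(1) by simp
  thus ?thesis unfolding T_def VV[of M al] using that(2) by auto
 qed
 have r0: "rk (ap (s 0) a):$al" if "a:$d" for a
 proof -
  have p: "pair a (ap (s 0) a):$(s 0)" using fun_on_ap[OF sF that] by simp
  have "rk (ap (s 0) a):$(rk (Upr a (ap (s 0) a)))" by (rule rk_mono) simp
  moreover have "rk (Upr a (ap (s 0) a)):$(rk (pair a (ap (s 0) a)))" by (rule rk_mono) (simp add: pair_Upr)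
  ultimately show ?thesis using rk_mono[OF p] Ord_trans[OF Ord_rk] unfolding al_def by blast
 qed
 have hal: "rk hempty:$al"
 proof -
  have "rk hempty = hempty" by (rule hc_eqI) (subst elts_rk, simp)
  moreover have "$al ~= {}" using r0[OF d(4)] by blast
  ultimately show ?thesis using Ord_linear[OF alO Ord_hempty] by auto
 qed
 have Lr: "L (%a. rk (ap (s i) a):$al)" for i
 proof (induction i)
  case 0 show ?case using r0 by (intro L_all) simp
 next
  case (Suc i)
  from s(2)[of i] Suc show ?case
   by (rule L_mono2) (use Ord_trans[OF alO] rk_mono in blast, (intro dfi s alM)+)
 qed
 define tr where "tr g = lam d (%a. if rk (ap g a):$al then ap g a else hempty)" for g
 define A where "A = hPow M (Prod d T)"
 have AM: "A:M" unfolding A_def by (rule dt_M0) (intro dfi d TM)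
 have trA: "tr g:$A" if g: "g:M" for g
 proof -
  have "tr g:M" unfolding tr_def by (rule dt_M0) (intro dfi d g alM hempty_M)
  moreover have "$(tr g) <= $(Prod d T)"
   using inT ap_M[OF g dsub] hempty_M hal by (auto simp: tr_def)
  ultimately show ?thesis by (simp add: A_def del: elts_Prod)
 qed
 have dL: "df2 (%g f. L (%a. ap g a:$(ap f a)))" unfolding Lg_def by (intro dfi d)
 have wA: "wf {(g, f). g:$A & f:$A & L (%a. ap g a:$(ap f a))}"
  by (rule wf_internal[OF AM dL]) (rule L_min)
 have "L (%a. ap (tr (s (Suc i))) a:$(ap (tr (s i)) a))" for i
 proof -
  have "L (%a. rk (ap (s (Suc i)) a):$al & rk (ap (s i) a):$al)"
   by (rule L_conj[OF Lr Lr]) (intro dfi s alM)+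
  from this s(2)[of i] show ?thesis
  proof (rule L_mono2)
   fix a assume "a:$d" "rk (ap (s (Suc i)) a):$al & rk (ap (s i) a):$al" "ap (s (Suc i)) a:$(ap (s i) a)"
   thus "ap (tr (s (Suc i))) a:$(ap (tr (s i)) a)" unfolding tr_def by simp
  qed (unfold tr_def, (intro dfi s alM d hempty_M)+)
 qed
 hence "EX t. ALL i. (t (Suc i), t i):{(g, f). g:$A & f:$A & L (%a. ap g a:$(ap f a))}"
  using trA[OF s(1)] by (intro exI[of _ "%i. tr (s i)"]) simp
 thus False using wA unfolding wf_iff_no_infinite_down_chain by blast
qed

end

context tmc begin

lemma ex_ultra: assumes nW: "normal_measure M k W" shows "EX pe. ultra M k W pe"
proof -
 interpret normal M k W by unfold_locales (rule nW)
 define rl where "rl = {(g, f). g:M & fun_on g k & f:M & fun_on f k & L (%a. ap g a:$(ap f a))}"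
 define S where "S p f = HSet (p ` {g:M. fun_on g k & L (%a. ap g a:$(ap f a))})" for p :: "hc => hc" and f
 define pe where "pe = wfrec rl S"
 have "$(pe f) = pe ` {g:M. fun_on g k & L (%a. ap g a:$(ap f a))}" if f: "f:M" "fun_on f k" for f
 proof -
  have "cut pe rl f ` {g:M. fun_on g k & L (%a. ap g a:$(ap f a))} = pe ` {g:M. fun_on g k & L (%a. ap g a:$(ap f a))}"
   by (intro image_cong refl cut_apply) (use f in "auto simp: rl_def")
  moreover have "pe f = S (cut pe rl f) f" unfolding pe_def by (rule wfrec) (use wf_L in "simp add: rl_def")
  ultimately have "pe f = HSet (pe ` {g:M. fun_on g k & L (%a. ap g a:$(ap f a))})" unfolding S_def by simp
  thus ?thesis by (metis (no_types, lifting) countable_M countable_image countable_subset elts_HSet mem_Collect_eq subsetI)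
 qed
 hence "ultra M k W pe" by unfold_locales
 thus ?thesis by blast
qed

text \<open>Membership of \<open>U\<close> in the ultrapower by \<open>W\<close>, expressed inside
  the model: \<open>f\<close> represents \<open>U\<close>. The collapse \<open>pe\<close> is an
  external map, whereas the levels of the Mitchell order have to be sets of the model.\<close>

definition Rep where "Rep k U W <-> (EX f:M. fun_on f k & Lg k W (%a. ALL X:$(ap f a). $X <= $a) &
 (ALL g:M. fun_on g k & Lg k W (%a. $(ap g a) <= $a) -->
  (Lg k W (%a. ap g a:$(ap f a)) <-> Sep k (%x. Lg k W (%a. x:$(ap g a))):$U)))"

lemma df_Rep: "k:M ==> df2 (Rep k)" unfolding Rep_def Lg_def by (intro dfi)

lemma mitchell_Rep: "mitchell_less M k U W <-> normal_measure M k U & normal_measure M k W & Rep k U W"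
proof
 assume m: "mitchell_less M k U W"
 obtain pe f where "ultrapower M k W pe f U" by (rule mitchell_ultra[OF m])
 then interpret ultrapower M k W pe f U .
 have "Rep k U W" unfolding Rep_def using f(1,2) c1 rep unfolding hat_def by blast
 thus "normal_measure M k U & normal_measure M k W & Rep k U W" using m unfolding mitchell_less_def by blast
next
 assume a: "normal_measure M k U & normal_measure M k W & Rep k U W"
 obtain pe where pi: "ultra M k W pe" using ex_ultra a by blast
 then interpret ultra M k W pe .
 obtain f where f: "f:M" "fun_on f k" "L (%a. ALL X:$(ap f a). $X <= $a)"
  "!!g. g:M ==> fun_on g k ==> L (%a. $(ap g a) <= $a) ==> L (%a. ap g a:$(ap f a)) <-> hat g:$U"
  using a unfolding Rep_def hat_def by blast
 have U: "$X <= $k & X:M" if "X:$U" for X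
 proof -
  have "meas k U" using normal_meas a by blast
  hence "ALL X:$U. $X <= $k" "U:M" by (simp_all add: meas_def)
  thus ?thesis using that trans by blast
 qed
 have "pe f = U"
 proof (rule hc_eqI, intro subset_antisym subsetI)
  fix z assume "z:$(pe f)"
  then obtain h where h: "h:M" "fun_on h k" "L (%a. ap h a:$(ap f a))" "z = pe h" using pi_out f by metis
  have s: "L (%a. $(ap h a) <= $a)" by (rule L_mono2[OF f(3) h(3)]) (blast, (intro dfi f h)+)
  show "z:$U" using f(4)[OF h(1,2) s] h(3) pi_hat[OF h(1,2) s] h(4) by simp
 next
  fix X assume X: "X:$U"
  have XM: "X:M" "$X <= $k" using U[OF X] by auto
  define g where "g = lam k (%a. Sep X (%x. x:$a))"
  have g: "g:M" "fun_on g k" unfolding g_def by ((rule dt_M0), intro dfi XM d) simp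
  have s: "L (%a. $(ap g a) <= $a)" by (rule L_all) (auto simp: g_def)
  have "hat g = X"
  proof (rule hc_eqI, intro subset_antisym subsetI)
   fix x assume "x:$(hat g)"
   then obtain a where "a:$k" "x:$(ap g a)" using L_ex unfolding hat_def by auto
   thus "x:$X" by (simp add: g_def)
  next
   fix x assume x: "x:$X"
   have xM: "x:M" using trans[OF XM(1) x] .
   have "L (%a. x:$(ap g a))"
    by (rule L_mono[OF L_tail[OF subsetD[OF XM(2) x]]]) (use x in "simp add: g_def", intro dfi g xM)
   thus "x:$(hat g)" using x XM by (auto simp: hat_def)
  qed
  hence "L (%a. ap g a:$(ap f a))" "pe g = X" using f(4)[OF g s] X pi_hat[OF g s] by auto
  thus "X:$(pe f)" using pi_in[OF f(1,2) g] by simp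
 qed
 hence "in_ultrapower M k W U" using pi f(1,2) a unfolding in_ultrapower_def Let_def
  using ultra_iff[of k W] by blast
 thus "mitchell_less M k U W" using a by (simp add: mitchell_less_def)
qed

lemma normal_df: "k:M ==> df (%e. normal_measure M k (e 0))" unfolding normal_iff by (intro dfi)

text \<open>The rank function of the Mitchell order is external, but its levels are the levels
  \<open>stg\<close> of \<open>Rep\<close>. These are disjoint and nonempty sets of measures, and
  the measures on \<open>k\<close> belong to the double power set of \<open>k\<close>.\<close>

lemma mitchell_order_bound:
 assumes o: "mitchell_order M k a" and k: "k:M" and x: "x:M" "Ord x" "x:$a"
 shows "lep x (hPow M (hPow M k))" "$x <= $a"
proof -
 obtain rh where r: "!!U. normal_measure M k U ==> rh U = hUnion {hsucc (rh U') |U'. mitchell_less M k U' U}"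
  "a = hUnion {hsucc (rh U) |U. normal_measure M k U}" using o unfolding mitchell_order_def by blast
 have nM: "U:M" if "normal_measure M k U" for U using that unfolding normal_measure_def by blast
 have cc: "countable {U. normal_measure M k U}" by (rule countable_subset[OF _ countable_M]) (use nM in blast)
 have e: "$(hUnion {hsucc (rh U) |U. P U}) = (\<Union>U\<in>{U. P U}. insert (rh U) ($(rh U)))" if "!!U. P U ==> normal_measure M k U" for P
 proof -
  have eq: "(\<Union>x\<in>{hsucc (rh U) |U. P U}. $x) = (\<Union>U\<in>{U. P U}. insert (rh U) ($(rh U)))" by auto
  have "countable {U. P U}" by (rule countable_subset[OF _ cc]) (use that in blast)
  hence "countable (\<Union>U\<in>{U. P U}. insert (rh U) ($(rh U)))" by (intro countable_UN) auto
  thus ?thesis unfolding hUnion_def eq by (rule elts_HSet)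
 qed
 have er: "$(rh U) = (\<Union>U'\<in>{U'. mitchell_less M k U' U}. insert (rh U') ($(rh U')))" if "normal_measure M k U" for U
  unfolding r(1)[OF that] by (rule e) (simp add: mitchell_less_def)
 have ea: "$a = (\<Union>U\<in>{U. normal_measure M k U}. insert (rh U) ($(rh U)))" unfolding r(2) by (rule e)
 have sub: "y:$(rh U) ==> normal_measure M k U ==> EX U'. normal_measure M k U' & y = rh U'" for y U
 proof (induction "rh U" arbitrary: U rule: wf_elts_induct)
  case step
  obtain U' where U': "mitchell_less M k U' U" "y = rh U' \<or> y:$(rh U')" using step.prems(1) unfolding er[OF step.prems(2)] by blast
  have n: "normal_measure M k U'" using U'(1) by (simp add: mitchell_less_def)
  have "rh U':$(rh U)" unfolding er[OF step.prems(2)] using U'(1) by blast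
  thus ?case using step.hyps[of U'] U'(2) n by blast
 qed
 have xr: "EX U. normal_measure M k U & x = rh U" using x(3) sub unfolding ea by blast
 thus "$x <= $a" unfolding ea by blast
 define A where "A = Sep (hPow M (hPow M k)) (normal_measure M k)"
 have AM: "A:M" unfolding A_def by (intro Sep_M hPow_M k normal_df)
 have A: "U:$A <-> normal_measure M k U" for U
 proof -
  have "U:$(hPow M (hPow M k))" if n: "normal_measure M k U"
  proof -
   have "ALL X:$U. $X <= $k" using normal_meas[OF n] by (simp add: meas_def)
   thus ?thesis using nM[OF n] trans[OF nM[OF n]] by auto
  qed
  thus ?thesis unfolding A_def by auto
 qed
 have S: "$(stg A (Rep k) y) = {U. normal_measure M k U & rh U = y}" if "y:$(hsucc x)" for y
  using that
 proof (induction y rule: wf_elts_induct)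
  case (step y)
  have yO: "Ord y" using Ord_in[OF Ord_hsucc[OF x(2)] step.prems] .
  have IH: "$(stg A (Rep k) z) = {U. normal_measure M k U & rh U = z}" if "z:$y" for z
   using step.IH[OF that Ord_trans[OF Ord_hsucc[OF x(2)] step.prems that]] .
  have *: "U:$(stg A (Rep k) y) <-> normal_measure M k U & rh U~:$y & (ALL U'. mitchell_less M k U' U --> rh U':$y)" for U
   unfolding stg[of A "Rep k" y] mitchell_Rep using IH A by auto
  have "(rh U~:$y & (ALL U'. mitchell_less M k U' U --> rh U':$y)) <-> rh U = y" if n: "normal_measure M k U" for U
  proof
   assume "rh U = y"
   thus "rh U~:$y & (ALL U'. mitchell_less M k U' U --> rh U':$y)" using er[OF n] not_mem_self[of y] by blast
  next
   assume b: "rh U~:$y & (ALL U'. mitchell_less M k U' U --> rh U':$y)"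
   have s: "$(rh U) <= $y" unfolding er[OF n] using b Ord_trans[OF yO] by blast
   have "Ord (rh U)"
   proof (rule OrdI)
    fix v w assume v: "v:$(rh U)" "w:$v"
    then obtain U' where U': "mitchell_less M k U' U" "v = rh U' \<or> v:$(rh U')" unfolding er[OF n] by blast
    hence "w:$(rh U')" using v(2) Ord_trans[OF Ord_in[OF yO]] b by blast
    thus "w:$(rh U)" unfolding er[OF n] using U'(1) by blast
   qed (use s Ord_in[OF yO] in blast)
   thus "rh U = y" using Ord_subset[OF _ yO] s b by blast
  qed
  thus ?case using * by blast
 qed
 have "lep x A"
 proof (rule lep_stg[OF AM df_Rep[OF k] x(1,2)])
  fix y assume y: "y:$x"
  then obtain U where "normal_measure M k U" "y = rh U" using xr sub by blast
  thus "$(stg A (Rep k) y) ~= {}" using S[of y] y by auto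
 qed
 moreover have "lep A (hPow M (hPow M k))" by (rule lep_subset[OF AM]) (auto simp: A_def)
 ultimately show "lep x (hPow M (hPow M k))" using lep_trans x(1) by blast
qed

end

section \<open>The product of one-point choices\<close>

context measure begin

lemma L_completeE: assumes "E:M" "g:$d" "lep E g" "df2 P" "!!x. x:$E ==> L (P x)"
 shows "L (%a. ALL x:$E. P x a)"
proof -
 obtain i where i: "i:M" "inj_into i E g" using assms(3) by (auto simp: lep_iff)
 note [dfi] = df_app2[where P=P, OF assms(4)]
 define Q where "Q y a <-> (ALL x:$E. ap i x = y --> P x a)" for y a
 have dQ: "df2 Q" unfolding Q_def by (intro dfi i assms)
 have "L (%a. ALL y:$g. Q y a)"
 proof (rule L_complete[OF assms(2) dQ])
  fix y assume y: "y:$g"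
  have yM: "y:M" using trans[OF dsub[OF assms(2)] y] .
  show "L (Q y)"
  proof (cases "EX x:$E. ap i x = y")
   case True
   then obtain x where x: "x:$E" "ap i x = y" by blast
   hence "Q y a <-> P x a" for a using i(2) unfolding Q_def inj_into_def by blast
   thus ?thesis using L_cong[of "Q y" "P x"] assms(5)[OF x(1)] by blast
  next
   case False
   thus ?thesis by (intro L_all) (auto simp: Q_def)
  qed
 qed
 thus ?thesis
  by (rule L_mono) (use i(2) in "auto simp: Q_def inj_into_def", intro dfi assms)
qed

text \<open>Fewer than \<open>d\<close> many yes-no questions receive the same answers almost
  everywhere.\<close>

lemma L_const: assumes "E:M" "g:$d" "lep E g" "h:M"
 obtains C where "C:M" "$C <= $E" "L (%a. ALL x:$E. x:$(ap h a) <-> x:$C)"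
proof -
 define C where "C = Sep E (%x. L (%a. x:$(ap h a)))"
 have d2: "df2 (%x a. x:$(ap h a))" by (intro dfi assms)
 have CM: "C:M" unfolding C_def by (rule Sep_M[OF assms(1) df_Lg[OF d2 d(1,2)]])
 have "L (%a. ALL x:$E. x:$(ap h a) <-> x:$C)"
 proof (rule L_completeE[where P="%x a. x:$(ap h a) <-> x:$C", OF assms(1-3)])
  show "df2 (%x a. x:$(ap h a) <-> x:$C)" by (intro dfi assms CM)
  fix x assume x: "x:$E"
  have df: "df1 (%a. x:$(ap h a))" by (intro dfi assms trans[OF assms(1) x])
  show "L (%a. x:$(ap h a) <-> x:$C)"
  proof (cases "x:$C")
   case True
   thus ?thesis by (simp add: C_def)
  next
   case False
   thus ?thesis using L_not[OF df] x by (simp add: C_def)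
  qed
 qed
 thus ?thesis using that[OF CM] by (auto simp: C_def)
qed

end

locale prodf = tmc +
 fixes J Um
 assumes JM: "J:M" and UmM: "Um:M" and Jm: "!!dl. dl:$J ==> meas dl (ap Um dl)"
  and Jb: "!!dl. dl:$J ==> EX be:$dl. ALL x:$J. x:$dl --> x:$be"
begin

lemma mz: "dl:$J ==> measure M dl (ap Um dl)"
 by unfold_locales (rule Jm)
lemma J_M: "dl:$J ==> dl:M" using trans[OF JM] .
lemma J_Ord: "dl:$J ==> Ord dl" using Jm by (simp add: meas_def)

definition X0 where "X0 = Sep (Prod J (UU J)) (%z. hsnd z:$(hfst z))"
lemma X0: "pair dl nv:$X0 <-> dl:$J & nv:$dl" by (auto simp: X0_def)
lemma X0E: assumes "z:$X0" obtains dl nv where "z = pair dl nv" "dl:$J" "nv:$dl"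
 using assms by (auto simp: X0_def)
lemma X0_M: "X0:M" unfolding X0_def by (rule dt_M0) (intro dfi JM)

definition fnl where "fnl t <-> (ALL z:$t. ALL w:$t. hfst z = hfst w --> z = w)"
definition St where "St = Sep (Fin X0) fnl"
definition sec where "sec A dl = Sep dl (%nv. pair dl nv:$A)"
definition Sd where "Sd = Sep (hPow M X0) (%A. ALL dl:$J. sec A dl:$(ap Um dl))"
definition P where "P = Prod St Sd"
definition dif where "dif s t = Sep s (%z. z~:$t)"
lemma elts_dif: "$(dif s t) = $s - $t" by (auto simp: dif_def)
definition L where "L = Sep (Prod P P) (%z. $(hfst (hsnd z)) <= $(hfst (hfst z)) &
 $(hsnd (hfst z)) <= $(hsnd (hsnd z)) & $(dif (hfst (hfst z)) (hfst (hsnd z))) <= $(hsnd (hsnd z)))"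
abbreviation leq where "leq p q \<equiv> pair p q:$L"

lemma df_fnl [dfi]: "dt t ==> df (%e. fnl (t e))"
 by (rule df_app1[where P=fnl]) (unfold fnl_def, intro dfi)
lemma dt_sec [dfi]: "dt s ==> dt t ==> dt (%e. sec (s e) (t e))"
 by (rule dt_app2[where F=sec]) (unfold sec_def, intro dfi)
lemma dt_dif [dfi]: "dt s ==> dt t ==> dt (%e. dif (s e) (t e))"
 by (rule dt_app2[where F=dif]) (unfold dif_def, intro dfi)

lemma St_M: "St:M" unfolding St_def by (rule dt_M0) (intro dfi X0_M)
lemma Sd_M: "Sd:M" unfolding Sd_def by (rule dt_M0) (intro dfi X0_M JM UmM)
lemma P_in_M: "P:M" unfolding P_def by (rule Prod_M[OF St_M Sd_M])
lemma L_in_M: "L:M" unfolding L_def by (rule dt_M0) (intro dfi P_in_M)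

lemma inP: "pair t A:$P <-> t:$St & A:$Sd" by (auto simp: P_def)
lemma PE: assumes "p:$P" obtains t A where "p = pair t A" "t:$St" "A:$Sd"
 using assms by (auto simp: P_def)
lemma inL: "leq (pair t A) (pair t' A') <-> pair t A:$P & pair t' A':$P & $t' <= $t & $A <= $A' &
  $t - $t' <= $A'"
 by (auto simp: L_def dif_def)

lemma SdD: "A:$Sd ==> A:M & $A <= $X0" by (auto simp: Sd_def)
lemma StD: "t:$St ==> t:M & $t <= $X0 & finite $t & fnl t" by (auto simp: St_def)
lemma StI: "t:M ==> $t <= $X0 ==> finite $t ==> fnl t ==> t:$St" by (auto simp: St_def)

lemma Sd_sec: "A:$Sd ==> dl:$J ==> Lg dl (ap Um dl) (%nv. pair dl nv:$A)"
 by (simp add: Sd_def Lg_def sec_def)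
lemma SdI: "A:M ==> $A <= $X0 ==> (!!dl. dl:$J ==> Lg dl (ap Um dl) (%nv. pair dl nv:$A)) ==> A:$Sd"
 by (simp add: Sd_def Lg_def sec_def)

definition Int2 where "Int2 A B = Sep A (%z. z:$B)"
lemma elts_Int2 [simp]: "$(Int2 A B) = $A \<inter> $B" by (auto simp: Int2_def)
lemma Sd_Int: assumes "A:$Sd" "B:$Sd" shows "Int2 A B:$Sd"
proof (rule SdI)
 have AB: "A:M" "B:M" using assms SdD by auto
 show "Int2 A B:M" unfolding Int2_def by (rule dt_M0) (intro dfi AB)
 show "$(Int2 A B) <= $X0" using SdD assms by auto
 fix dl assume dl: "dl:$J"
 interpret m: measure M dl "ap Um dl" by (rule mz[OF dl])
 have "m.L (%nv. pair dl nv:$A & pair dl nv:$B)"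
  by (rule m.L_conj[OF Sd_sec[OF assms(1) dl] Sd_sec[OF assms(2) dl]]) (intro dfi AB J_M dl)+
 thus "m.L (%nv. pair dl nv:$(Int2 A B))" by simp
qed

lemma X0_Sd: "X0:$Sd"
proof (rule SdI[OF X0_M order_refl])
 fix dl assume dl: "dl:$J"
 interpret m: measure M dl "ap Um dl" by (rule mz[OF dl])
 show "m.L (%nv. pair dl nv:$X0)" by (rule m.L_all) (simp add: X0 dl)
qed

lemma hempty_St: "hempty:$St" by (rule StI) (auto simp: fnl_def)

lemma leE: assumes "leq q (pair t A)" obtains r B where "q = pair r B" "r:$St" "B:$Sd"
  "$t <= $r" "$B <= $A" "$r - $t <= $A"
proof -
 have "q:$P" using assms by (auto simp: L_def)
 then obtain r B where e: "q = pair r B" by (rule PE)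
 note i = assms[unfolded e inL inP]
 show ?thesis by (rule that[OF e]) (use i in blast)+
qed

lemma fn: "forcing_notion $P (%p q. leq p q)"
 unfolding forcing_notion_def
proof (intro conjI ballI impI)
 fix p assume "p:$P"
 thus "leq p p" by (auto elim!: PE simp: inL inP)
next
 fix p q r assume a: "p:$P" "q:$P" "r:$P" "leq p q" "leq q r"
 obtain t A where r: "r = pair t A" using a(3) by (rule PE)
 obtain t' A' where q: "q = pair t' A'" using a(2) by (rule PE)
 obtain t'' A'' where p: "p = pair t'' A''" using a(1) by (rule PE)
 show "leq p r" using a unfolding p q r inL by blast
next
 have "leq p (pair hempty X0)" if p: "p:$P" for p
 proof -
  obtain t A where e: "p = pair t A" using p by (rule PE)
  show ?thesis unfolding e inL using p e inP X0_Sd hempty_St SdD StD by auto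
 qed
 thus "EX t:$P. ALL p:$P. leq p t" using inP X0_Sd hempty_St by blast
qed

sublocale forcing M P L by unfold_locales (use P_in_M L_in_M fn in auto)

definition ins where "ins t z = UU (Upr t (Upr z z))"
lemma elts_ins [simp]: "$(ins t z) = insert z $t" by (auto simp: ins_def)
lemma dt_ins [dfi]: "dt s ==> dt t ==> dt (%e. ins (s e) (t e))" unfolding ins_def by (intro dfi)
definition nd where "nd dl t <-> (ALL z:$t. hfst z ~= dl)"
lemma df_nd [dfi]: "dt s ==> dt t ==> df (%e. nd (s e) (t e))"
 by (rule df_app2[where P=nd]) (unfold nd_def, intro dfi)

lemma ins_St: assumes "t:$St" "nd dl t" "dl:$J" "nv:$dl" shows "ins t (pair dl nv):$St"
proof (rule StI)
 have M: "t:M" "pair dl nv:M" using assms StD trans[OF J_M] J_M pair_M by auto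
 show "ins t (pair dl nv):M" by (rule dt_M0) (intro dfi M)
 show "$(ins t (pair dl nv)) <= $X0" "finite ($(ins t (pair dl nv)))" using StD[OF assms(1)] assms X0 by auto
 show "fnl (ins t (pair dl nv))" using StD[OF assms(1)] assms(2) unfolding fnl_def nd_def elts_ins
  by (metis hfst insert_iff)
qed

definition low where "low dl = Sep X0 (%z. hfst z:$dl)"
lemma low_M: "dl:M ==> low dl:M" unfolding low_def by (rule dt_M0) (intro dfi X0_M)

text \<open>This is what boundedness of \<open>J\<close> below each of its elements is for: the
  completeness of the measure on \<open>dl\<close> can handle everything that a stem may contain
  below \<open>dl\<close>.\<close>

lemma low_small: assumes "dl:$J" obtains ga where "ga:$dl" "InfO ga" "lep (low dl) ga"
proof -
 interpret m: measure M dl "ap Um dl" by (rule mz[OF assms])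
 obtain be where b: "be:$dl" "!!x. x:$J ==> x:$dl ==> x:$be" using Jb[OF assms] by blast
 have bO: "Ord be" using Ord_in[OF m.d(3) b(1)] .
 obtain ga where g: "ga:$dl" "$be <= $ga" "$homega <= $ga"
 proof (cases "$homega <= $be")
  case True thus ?thesis using that b by blast
 next
  case False
  hence "$be <= $homega" using Ord_not_sub[OF Ord_homega bO] Ord_subset[OF bO Ord_homega] by blast
  thus ?thesis using that[OF m.d(4)] by blast
 qed
 have I: "InfO ga" unfolding InfO_def using g m.dsub Ord_in[OF m.d(3)] by blast
 have gaM: "ga:M" using m.dsub g by blast
 have "$(low dl) <= $(Prod ga ga)"
 proof
  fix z assume "z:$(low dl)"
  then obtain x nv where "z = pair x nv" "x:$J" "nv:$x" "x:$dl"
   unfolding low_def using X0E by (metis (mono_tags, lifting) elts_Sep hfst mem_Collect_eq)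
  thus "z:$(Prod ga ga)" using b(2) g(2) Ord_trans[OF bO] by auto
 qed
 hence "lep (low dl) (Prod ga ga)" by (intro lep_subset low_M J_M assms)
 hence "lep (low dl) ga" using lep_trans[OF _ lep_ProdI[OF lep_refl lep_refl]] I low_M J_M assms gaM by blast
 thus ?thesis using that g I by blast
qed

text \<open>Regular open sets of conditions, for example the conditions forcing a given
  statement.\<close>

definition oreg where "oreg D <-> df1 D & (ALL p q. D p --> le q p --> D q) &
 (ALL p:$P. (ALL q:$P. le q p --> (EX r:$P. le r q & D r)) --> D p)"

lemma oregD: assumes "oreg D" shows "df1 D" "D p ==> le q p ==> D q"
 "p:$P ==> (!!q. q:$P ==> le q p ==> EX r:$P. le r q & D r) ==> D p"
 using assms unfolding oreg_def by blast+

lemma leP: "le p q ==> p:$P & q:$P" by (auto simp: L_def)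

definition neg where "neg D p <-> (ALL q:$P. le q p --> ~ D q)"

lemma oreg_neg: assumes "oreg D" shows "oreg (%p. p:$P & neg D p)"
 unfolding oreg_def neg_def
proof (intro conjI allI impI ballI)
 note [dfi] = df_app1[where P=D, OF oregD(1)[OF assms]]
 show "df1 (%p. p:$P & (ALL q:$P. le q p --> ~ D q))" by (intro dfi PM LM)
next
 fix p q r assume "p:$P & (ALL q:$P. le q p --> ~ D q)" "le q p" "r:$P" "le r q"
 thus "~ D r" using le_trans leP by blast
next
 fix p q assume p: "p:$P" "ALL q:$P. le q p --> (EX r:$P. le r q & r:$P & (ALL q:$P. le q r --> ~ D q))"
  and q: "q:$P" "le q p"
 then obtain r where "r:$P" "le r q" "ALL q:$P. le q r --> ~ D q" by blast
 thus "~ D q" using oregD(2)[OF assms, of q r] le_refl by blast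
qed (use leP in auto)

definition c1 where "c1 D t <-> (EX A:$Sd. D (pair t A))"

lemma df_c1: "df1 D ==> df1 (c1 D)"
proof -
 assume "df1 D"
 note [dfi] = df_app1[where P=D, OF this]
 show ?thesis unfolding c1_def by (intro dfi Sd_M)
qed

lemma ext_dom: assumes "r:$St" "E:$Sd" "dl:$J"
 obtains r' nv where "le (pair r' E) (pair r E)" "pair dl nv:$r'"
proof (cases "nd dl r")
 case True
 interpret m: measure M dl "ap Um dl" by (rule mz[OF assms(3)])
 obtain nv where nv: "nv:$dl" "pair dl nv:$E" using m.L_ex[OF Sd_sec[OF assms(2,3)]] by blast
 have "ins r (pair dl nv):$St" by (rule ins_St[OF assms(1) True assms(3) nv(1)])
 thus ?thesis using that[of "ins r (pair dl nv)" nv] assms nv by (auto simp: inL inP)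
next
 case False
 then obtain z where z: "z:$r" "hfst z = dl" by (auto simp: nd_def)
 then obtain nv where "z = pair dl nv" using StD[OF assms(1)] X0E by (metis hfst subsetD)
 thus ?thesis using that[of r nv] assms z by (auto simp: inL inP)
qed

text \<open>The choices of the new point are amalgamated: below it the side condition is constant almost
  everywhere, above it one intersects.\<close>

lemma one_step: assumes D: "oreg D" and t: "t:$St" "nd dl t" "dl:$J"
 and l: "Lg dl (ap Um dl) (%nv. c1 D (ins t (pair dl nv)))"
 shows "c1 D t"
proof -
 interpret m: measure M dl "ap Um dl" by (rule mz[OF t(3)])
 have tM: "t:M" using StD t by blast
 have dlM: "dl:M" using m.d by blast
 note [dfi] = df_app1[where P=D, OF oregD(1)[OF D]]
 have R: "df2 (%nv B. B:$Sd & ((EX A:$Sd. D (pair (ins t (pair dl nv)) A)) --> D (pair (ins t (pair dl nv)) B)))"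
  by (intro dfi tM dlM Sd_M)
 have ex: "EX B:M. B:$Sd & ((EX A:$Sd. D (pair (ins t (pair dl nv)) A)) --> D (pair (ins t (pair dl nv)) B))" for nv
  using X0_Sd SdD by blast
 obtain B where B: "B:M" "fun_on B dl" "!!nv. nv:$dl ==> (ap B nv:$Sd &
   ((EX A:$Sd. D (pair (ins t (pair dl nv)) A)) --> D (pair (ins t (pair dl nv)) (ap B nv)))) & ap B nv:M"
  by (rule AC[OF dlM R ex]) blast
 obtain ga where ga: "ga:$dl" "InfO ga" "lep (low dl) ga" by (rule low_small[OF t(3)])
 obtain C where C: "C:M" "$C <= $(low dl)" "m.L (%nv. ALL x:$(low dl). x:$(ap B nv) <-> x:$C)"
  by (rule m.L_const[OF low_M[OF dlM] ga(1,3) B(1)])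
 define Xp where "Xp nv <-> D (pair (ins t (pair dl nv)) (ap B nv)) & (ALL x:$(low dl). x:$(ap B nv) <-> x:$C)" for nv
 have dX: "df1 Xp" unfolding Xp_def by (intro dfi tM dlM B C low_M)
 note [dfi] = df_app1[where P=Xp, OF dX]
 have lX: "m.L Xp"
 proof (rule m.L_mono2[OF l C(3)])
  fix nv assume "nv:$dl" "c1 D (ins t (pair dl nv))" "ALL x:$(low dl). x:$(ap B nv) <-> x:$C"
  thus "Xp nv" using B(3) unfolding Xp_def c1_def by blast
 next
  show "df1 (%nv. c1 D (ins t (pair dl nv)))" unfolding c1_def by (intro dfi tM dlM Sd_M)
  show "df1 (%nv. ALL x:$(low dl). x:$(ap B nv) <-> x:$C)" by (intro dfi B C low_M dlM)
 qed (rule dX)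
 obtain nv0 where nv0: "nv0:$dl" "Xp nv0" using m.L_ex[OF lX] by blast
 \<comment> \<open>One side condition fitting all choices at \<open>dl\<close>: below
   \<open>dl\<close> the constant trace \<open>C\<close>, at \<open>dl\<close> the typical points,
   and above \<open>dl\<close> the intersection of the sets \<open>B nv\<close>, whose number
   \<open>dl\<close> is less than the completeness of the measures there.\<close>
 define A where "A = Sep X0 (%z. (hfst z:$dl --> z:$C) & (hfst z = dl --> Xp (hsnd z)) &
   (dl:$(hfst z) --> (ALL nv:$dl. z:$(ap B nv))))"
 have AM: "A:M" unfolding A_def by (rule dt_M0) (intro dfi X0_M dlM C B)
 have ASd: "A:$Sd"
 proof (rule SdI[OF AM])
  show "$A <= $X0" by (auto simp: A_def)
  fix \<epsilon> assume e: "\<epsilon>:$J"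
  interpret n: measure M \<epsilon> "ap Um \<epsilon>" by (rule mz[OF e])
  have eM: "\<epsilon>:M" using n.d by blast
  have d1: "df1 (%nv. pair \<epsilon> nv:$A)" by (intro dfi eM AM)
  consider "\<epsilon>:$dl" | "\<epsilon> = dl" | "dl:$\<epsilon>" using Ord_linear[OF n.d(3) m.d(3)] by blast
  thus "n.L (%nv. pair \<epsilon> nv:$A)"
  proof cases
   case 1
   have "~ dl:$\<epsilon>" "\<epsilon> ~= dl" using 1 Ord_trans[OF m.d(3) 1, of dl] by auto
   show ?thesis
   proof (rule n.L_mono[OF Sd_sec[OF _ e]])
    show "ap B nv0:$Sd" using B(3) nv0 by blast
    fix nv assume "nv:$\<epsilon>" "pair \<epsilon> nv:$(ap B nv0)"
    thus "pair \<epsilon> nv:$A" using nv0(2) 1 e \<open>~ dl:$\<epsilon>\<close> \<open>\<epsilon> ~= dl\<close> by (simp add: A_def X0 Xp_def low_def)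
   qed (rule d1)
  next
   case 2
   have "m.L (%nv. pair dl nv:$A)" by (rule m.L_mono[OF lX]) (use t(3) d1 2 in "auto simp: A_def X0")
   thus ?thesis using 2 by simp
  next
   case 3
   have "~ \<epsilon>:$dl" "\<epsilon> ~= dl" using 3 Ord_trans[OF n.d(3) 3, of \<epsilon>] by auto
   have "n.L (%nv. ALL x:$dl. pair \<epsilon> nv:$(ap B x))"
   proof (rule n.L_complete[where P="%x nv. pair \<epsilon> nv:$(ap B x)", OF 3])
    show "df2 (%x nv. pair \<epsilon> nv:$(ap B x))" by (intro dfi eM B)
   qed (use Sd_sec[OF _ e] B(3) in blast)
   thus ?thesis
    by (rule n.L_mono) (use e \<open>~ \<epsilon>:$dl\<close> \<open>\<epsilon> ~= dl\<close> in "simp add: A_def X0", rule d1)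
  qed
 qed
 have "D (pair t A)"
 proof (rule oregD(3)[OF D])
  show "pair t A:$P" using t ASd inP by blast
  fix q assume q: "le q (pair t A)"
  then obtain r E where r: "q = pair r E" "r:$St" "E:$Sd" "$t <= $r" "$E <= $A" "$r - $t <= $A"
   by (rule leE)
  \<comment> \<open>An extension may first be made to choose a point at \<open>dl\<close>. That
    point is typical, and the remaining new points lie in \<open>B nv\<close>, so there is a common
    extension with a member of \<open>D\<close>.\<close>
  obtain r' nv where r': "le (pair r' E) (pair r E)" "pair dl nv:$r'" by (rule ext_dom[OF r(2,3) t(3)])
  have r'2: "le (pair r' E) (pair t A)" using le_trans[OF r'(1) q[unfolded r(1)]] leP[OF r'(1)] leP[OF q] by blast
  note i = r'2[unfolded inL inP]
  have "pair dl nv~:$t" using t(2) by (auto simp: nd_def)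
  hence iA: "pair dl nv:$A" using i r' by blast
  hence X: "Xp nv" "nv:$dl" by (auto simp: A_def X0)
  have BS: "ap B nv:$Sd" using B(3) X by blast
  have I: "Int2 E (ap B nv):$Sd" using Sd_Int i BS by blast
  have "$r' - $(ins t (pair dl nv)) <= $(ap B nv)"
  proof
   fix z assume z: "z:$r' - $(ins t (pair dl nv))"
   hence zA: "z:$A" using i by auto
   have zO: "Ord (hfst z)" using zA J_Ord by (auto simp: A_def elim: X0E)
   have "hfst z ~= dl" using z r'(2) StD[of r'] i unfolding fnl_def by auto
   then consider "hfst z:$dl" | "dl:$(hfst z)" using Ord_linear[OF zO m.d(3)] by blast
   thus "z:$(ap B nv)"
   proof cases
    case 1
    hence "z:$C" using zA by (simp add: A_def)
    thus ?thesis using X C(2) unfolding Xp_def by blast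
   qed (use zA X in "simp add: A_def")
  qed
  moreover have "ins t (pair dl nv):$St" by (rule ins_St[OF t X(2)])
  ultimately have "le (pair r' (Int2 E (ap B nv))) (pair (ins t (pair dl nv)) (ap B nv))"
   unfolding inL inP using I i BS r'(2) by auto
  hence "D (pair r' (Int2 E (ap B nv)))" using oregD(2)[OF D] X unfolding Xp_def by blast
  moreover have "le (pair r' (Int2 E (ap B nv))) q"
   unfolding r(1) inL inP using I i r'(1)[unfolded inL inP] by auto
  ultimately show "EX r:$P. le r q & D r" using leP by blast
 qed
 thus ?thesis unfolding c1_def using ASd by blast
qed

definition Und where "Und D t <-> ~ c1 D t & ~ c1 (%p. p:$P & neg D p) t"

lemma Und_step: assumes D: "oreg D" and t: "t:$St" "nd dl t" "dl:$J" and u: "Und D t"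
 shows "Lg dl (ap Um dl) (%nv. Und D (ins t (pair dl nv)))"
proof -
 interpret m: measure M dl "ap Um dl" by (rule mz[OF t(3)])
 have M: "t:M" "dl:M" using StD t m.d by blast+
 let ?N = "%p. p:$P & neg D p"
 have a: "df1 (%nv. c1 D (ins t (pair dl nv)))"
  by (rule df_app1[where P="c1 D", OF df_c1[OF oregD(1)[OF D]]]) (intro dfi M)
 have b: "df1 (%nv. c1 ?N (ins t (pair dl nv)))"
  by (rule df_app1[where P="c1 ?N", OF df_c1[OF oregD(1)[OF oreg_neg[OF D]]]]) (intro dfi M)
 have "m.L (%nv. ~ c1 D (ins t (pair dl nv)))"
  using m.L_not[OF a] one_step[OF D t] u unfolding Und_def by blast
 moreover have "m.L (%nv. ~ c1 ?N (ins t (pair dl nv)))"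
  using m.L_not[OF b] one_step[OF oreg_neg[OF D] t] u unfolding Und_def by blast
 ultimately show ?thesis unfolding Und_def by (rule m.L_conj) (intro df_not a b)+
qed

text \<open>If \<open>t0\<close> is undecided, \<open>A\<close> is diagonalised so that each of its
  points keeps undecided every undecided stem whose new points have smaller index; fewer than
  \<delta> stems compete at \<delta>. Inserting points in increasing order, every stem obtained from
  \<open>t0\<close> by points of \<open>A\<close> stays undecided, whereas some extension of
  \<open>(t0, A)\<close> must belong to \<open>D\<close>.\<close>

lemma Prikry: assumes D: "oreg D" and t0: "t0:$St"
 shows "EX A:$Sd. D (pair t0 A) \<or> neg D (pair t0 A)"
proof (rule ccontr)
 assume n: "~ ?thesis"
 hence U0: "Und D t0" unfolding Und_def c1_def by blast
 have t0M: "t0:M" using StD t0 by blast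
 have dU: "df1 (Und D)" unfolding Und_def
  by (intro df_conj df_not df_c1 oregD(1)[OF D] oregD(1)[OF oreg_neg[OF D]])
 note [dfi] = df_app1[where P="Und D", OF dU]
 define Q where "Q s z <-> $t0 <= $s & (ALL w:$(dif s t0). hfst w:$(hfst z)) & Und D s & nd (hfst z) s" for s z
 have dQ: "df2 Q" unfolding Q_def by (intro dfi t0M)
 note [dfi] = df_app2[where P=Q, OF dQ]
 define A where "A = Sep X0 (%z. ALL s:$St. Q s z --> Und D (ins s z))"
 have AM: "A:M" unfolding A_def by (rule dt_M0) (intro dfi X0_M St_M)
 have ASd: "A:$Sd"
 proof (rule SdI[OF AM])
  show "$A <= $X0" by (auto simp: A_def)
  fix dl assume dl: "dl:$J"
  interpret m: measure M dl "ap Um dl" by (rule mz[OF dl])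
  have dlM: "dl:M" using m.d by blast
  obtain ga where ga: "ga:$dl" "InfO ga" "lep (low dl) ga" by (rule low_small[OF dl])
  define E where "E = Sep St (%s. $t0 <= $s & (ALL w:$(dif s t0). hfst w:$dl))"
  have EM: "E:M" unfolding E_def by (rule dt_M0) (intro dfi St_M t0M dlM)
  have "lep E (Fin (low dl))"
  proof (rule lepI[OF EM, where F="%s. dif s t0"])
   show "dt (%e. dif (e 0) t0)" by (intro dfi t0M)
   show "inj_on (%s. dif s t0) $E"
   proof (rule inj_onI)
    fix s s' assume "s:$E" "s':$E" "dif s t0 = dif s' t0"
    hence "$(dif s t0) = $(dif s' t0)" "$t0 <= $s" "$t0 <= $s'"
     by (auto simp: E_def)
    thus "s = s'" unfolding elts_dif by (intro hc_eqI) blast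
   qed
   fix s assume s: "s:$E"
   hence sS: "s:$St" by (simp add: E_def)
   have "dif s t0:M" by (rule dt_M0) (intro dfi t0M conjunct1[OF StD[OF sS]])
   thus "dif s t0:$(Fin (low dl))" using s StD[OF sS] by (auto simp: E_def low_def dif_def)
  qed
  hence lE: "lep E ga" using lep_trans[OF _ lep_FinI[OF ga(3,2) low_M[OF dlM]] EM] by blast
  have "m.L (%nv. ALL s:$E. Q s (pair dl nv) --> Und D (ins s (pair dl nv)))"
  proof (rule m.L_completeE[where P="%s nv. Q s (pair dl nv) --> Und D (ins s (pair dl nv))", OF EM ga(1) lE])
   show "df2 (%s nv. Q s (pair dl nv) --> Und D (ins s (pair dl nv)))" by (intro dfi dlM)
   fix s assume s: "s:$E"
   hence sS: "s:$St" by (simp add: E_def)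
   have sM: "s:M" using StD sS by blast
   show "m.L (%nv. Q s (pair dl nv) --> Und D (ins s (pair dl nv)))"
   proof (cases "Und D s & nd dl s")
    case True
    have "m.L (%nv. Und D (ins s (pair dl nv)))" using Und_step[OF D sS _ dl] True by blast
    thus ?thesis by (rule m.L_mono) (blast, intro dfi sM dlM)
   next
    case False
    thus ?thesis by (intro m.L_all) (auto simp: Q_def)
   qed
  qed
  thus "m.L (%nv. pair dl nv:$A)"
  proof (rule m.L_mono)
   fix nv assume "nv:$dl" "ALL s:$E. Q s (pair dl nv) --> Und D (ins s (pair dl nv))"
   thus "pair dl nv:$A" using dl unfolding A_def E_def by (auto simp: X0 Q_def)
  qed (intro dfi dlM AM)
 qed
 have all: "Und D r" if "r:$St" "$t0 <= $r" "$r - $t0 <= $A" for r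
  using that
 proof (induction "card ($r - $t0)" arbitrary: r)
  case 0
  hence "$r - $t0 = {}" using StD[OF 0(2)] by auto
  hence "r = t0" using 0 by (intro hc_eqI) blast
  thus ?case using U0 by simp
 next
  case (Suc n)
  note rS = StD[OF Suc.prems(1)]
  have finr: "finite ($r - $t0)" using rS by auto
  have ne: "$r - $t0 ~= {}" using Suc(2) by (metis card.empty nat.distinct(1))
  have "EX m:hfst ` ($r - $t0). ALL y:hfst ` ($r - $t0). y:$m \<or> y = m"
   by (rule fmax) (use finr ne rS J_Ord in \<open>auto elim!: X0E dest!: subsetD[of "$r" "$X0"]\<close>)
  then obtain z where z: "z:$r - $t0" "!!w. w:$r - $t0 ==> hfst w:$(hfst z) \<or> hfst w = hfst z" by blast
  define s where "s = dif r (Upr z z)"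
  have es: "$s = $r - {z}" by (auto simp: s_def dif_def)
  have rM: "r:M" "z:M" using rS z trans by blast+
  have sM: "s:M" unfolding s_def by (rule dt_M0) (intro dfi rM)
  have sS: "s:$St" by (rule StI[OF sM]) (use rS in "auto simp: es fnl_def")
  have "n = card ($s - $t0)"
  proof -
   have "$s - $t0 = ($r - $t0) - {z}" by (auto simp: es)
   thus ?thesis using Suc(2) z(1) finr by (simp add: card_Diff_singleton)
  qed
  moreover have "$t0 <= $s" "$s - $t0 <= $A" using Suc.prems z by (auto simp: es)
  ultimately have Us: "Und D s" using Suc.hyps(1) sS by blast
  have "Q s z" unfolding Q_def
  proof (intro conjI Us ballI)
   fix w assume "w:$(dif s t0)"
   hence w: "w:$r - $t0" "w ~= z" by (auto simp: dif_def es)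
   hence "hfst w ~= hfst z" using rS z(1) unfolding fnl_def by blast
   thus "hfst w:$(hfst z)" using z(2)[OF w(1)] by blast
  next
   show "nd (hfst z) s" using rS z(1) unfolding nd_def fnl_def es by blast
  qed (rule \<open>$t0 <= $s\<close>)
  moreover have "z:$A" using Suc.prems z by blast
  ultimately have "Und D (ins s z)" using sS unfolding A_def by simp
  moreover have "ins s z = r" using z(1) by (intro hc_eqI) (auto simp: es)
  ultimately show ?case by simp
 qed
 have "~ neg D (pair t0 A)" using n ASd by blast
 then obtain q where q: "le q (pair t0 A)" "D q" unfolding neg_def by blast
 from q(1) obtain r B where "q = pair r B" "r:$St" "B:$Sd" "$t0 <= $r" "$r - $t0 <= $A" by (rule leE)
 thus False using all[of r] q(2) unfolding Und_def c1_def by blast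
qed

end

section \<open>Cardinals and GCH in extensions\<close>

lemma rk_Ord: "Ord a ==> rk a = a"
proof (induction a rule: wf_elts_induct)
 case (step a)
 have e: "rk y = y" if "y:$a" for y using step.IH[OF that Ord_in[OF step.prems that]] .
 have "$(rk a) = (\<Union>y\<in>$a. insert y $y)" unfolding elts_rk[of a] using e by simp
 also have "\<dots> = $a" using Ord_trans[OF step.prems] by blast
 finally show ?case by (rule hc_eqI)
qed

lemma trancl_rk: "(x, y):{(x, y). x:$y}\<^sup>+ ==> rk x:$(rk y)"
 by (induction rule: trancl_induct) (auto intro: rk_mono Ord_trans[OF Ord_rk])

lemma rk_val: "$(rk (val G t)) <= $(rk t)"
proof (induction t rule: dm_induct)
 case (step t)
 show ?case
 proof
  fix z assume "z:$(rk (val G t))"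
  then obtain u where u: "u:$(val G t)" "z:$(rk u) \<or> z = rk u" by (subst (asm) elts_rk) auto
  then obtain s p where s: "u = val G s" "pair s p:$t" unfolding elts_val by blast
  have "$(rk u) <= $(rk s)" unfolding s(1) by (rule step) (use s in auto)
  hence "rk u:$(rk s) \<or> rk u = rk s" using Ord_subset[OF Ord_rk Ord_rk] by blast
  moreover have "rk s:$(rk t)" by (rule trancl_rk[OF pair_fst_trancl[OF s(2)]])
  ultimately show "z:$(rk t)" using u(2) Ord_trans[OF Ord_rk] by metis
 qed
qed

text \<open>Evaluation does not raise ranks, so an ordinal of the extension is bounded by the rank
  of its name.\<close>

lemma (in generic) Ord_N: assumes "a:N" "Ord a" shows "a:M"
proof -
 obtain t where t: "t:M" "a = val G t" using N_E assms by blast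
 have "$a <= $(rk t)" using rk_val[of G t] rk_Ord[OF assms(2)] t(2) by simp
 hence "a:$(rk t) \<or> a = rk t" using Ord_subset[OF assms(2) Ord_rk] by blast
 moreover have "rk t:M" by (rule dt_M0) (intro dfi t)
 ultimately show ?thesis using trans by blast
qed

lemma (in tmc) lep_hPow: assumes "lep A B" "A:M" "B:M" shows "lep (hPow M A) (hPow M B)"
proof -
 obtain f where f: "f:M" "inj_on (ap f) $A" "ap f ` $A <= $B" using assms by (auto simp: lep_def)
 have dt: "dt (%e. Img (e 0) (ap f))" by (intro dfi f)
 show ?thesis
 proof (rule lepI[OF hPow_M[OF assms(2)] dt])
  show "inj_on (%x. Img x (ap f)) ($(hPow M A))"
  proof (rule inj_onI)
   fix x y assume *: "x:$(hPow M A)" "y:$(hPow M A)" "Img x (ap f) = Img y (ap f)"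
   hence "ap f ` $x = ap f ` $y" by (metis elts_Img)
   thus "x = y" using inj_on_image_eq_iff[OF f(2)] * hc_eqI[of x y] by simp
  qed
  show "Img x (ap f):$(hPow M B)" if "x:$(hPow M A)" for x
   using that f(3) dt_M1[OF dt] by auto
 qed
qed

lemma (in tmc) GCH_eqp: assumes "GCH M" "Card k" "$homega <= $k" "is_successor_cardinal M k l"
 shows "eqp (hPow M k) l"
 using assms eqp_bij[OF hPow_M[OF Card_M[OF assms(2)]]] unfolding GCH_def by blast

locale exts = M: tmc M + N: tmc N for M N +
 assumes sub: "M <= N" and Ords: "!!a. a:N ==> Ord a ==> a:M"
begin

lemma lep_MN: "M.lep a b ==> N.lep a b" unfolding M.lep_def N.lep_def using sub by blast
lemma eqp_MN: "M.eqp a b ==> N.eqp a b" unfolding M.eqp_def N.eqp_def using sub by blast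

lemma Card_NM: "N.Card k ==> M.Card k" using eqp_MN Ords unfolding M.Card_iff N.Card_iff by blast

text \<open>Only collapses of a successor to its predecessor have to be excluded. For a collapse of
  \<open>mm\<close> to a smaller \<open>a\<close> of ground cardinality \<open>k\<close>, the least
  ordinal \<open>l\<close> up to \<open>mm\<close> not injecting into \<open>k\<close> is the ground
  successor of \<open>k\<close>, and it would inject into \<open>k\<close> in the larger
  model.\<close>

lemma Card_MN:
 assumes NS: "!!k l. M.Card k ==> $homega <= $k ==> is_successor_cardinal M k l ==> ~ N.lep l k"
  and mm: "M.Card mm" shows "N.Card mm"
 unfolding N.Card_iff
proof (intro conjI ballI notI)
 have mmM: "mm:M" and mmO: "Ord mm" using mm M.Card_M M.Card_Ord by auto
 thus "mm:N" "Ord mm" using sub by auto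
 fix a assume a: "a:$mm" "N.eqp a mm"
 have aM: "a:M" and aO: "Ord a" using a M.trans[OF mmM] Ord_in[OF mmO] by auto
 have submm: "$a <= $mm" using Ord_trans[OF mmO a(1)] by blast
 have mma: "N.lep mm a" by (rule N.eqp_lep[OF N.eqp_sym[OF a(2)]]) (use aM mmM sub in auto)
 show False
 proof (cases "finite $a")
  case True
  obtain f where "bij_betw (ap f) $a $mm" using a(2) by (auto simp: N.eqp_def)
  hence "card $a = card $mm" "finite $mm" using bij_betw_same_card bij_betw_finite True by blast+
  hence "$a = $mm" using card_subset_eq[OF _ submm] by blast
  thus False using a(1) not_mem_self[of a] by simp
 next
  case False
  obtain k where k: "k:M" "M.Card k" "M.eqp k a" "$k <= $a" using M.ex_Card_Ord[OF aM aO] by blast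
  have ak: "M.lep a k" by (rule M.eqp_lep[OF M.eqp_sym[OF k(3)]]) (use k aM in auto)
  have kO: "Ord k" using k M.Card_Ord by blast
  have kinf: "$homega <= $k" using M.Ord_infinite[OF kO M.lep_infinite[OF ak False]] .
  have "~ M.lep mm k" using M.Card_not_lep[OF mm a(1)] M.lep_trans[OF _ M.eqp_lep[OF k(3)] mmM] by blast
  then obtain l where l: "l:$(hsucc mm)" "~ M.lep l k" "!!c. c:$l ==> ~ (c:$(hsucc mm) & ~ M.lep c k)"
   using Ord_least[of "%l. l:$(hsucc mm) & ~ M.lep l k" mm] by auto
  have lO: "Ord l" using Ord_in[OF Ord_hsucc[OF mmO] l(1)] .
  have lM: "l:M" using M.trans[OF M.hsucc_M[OF mmM] l(1)] .
  have below: "M.lep c k" if "c:$l" for c using l(3)[OF that] Ord_trans[OF Ord_hsucc[OF mmO] l(1) that] by blast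
  have lC: "M.Card l" unfolding M.Card_iff
  proof (intro conjI ballI notI lM lO)
   fix b assume b: "b:$l" "M.eqp b l"
   have bM: "b:M" using M.trans[OF lM b(1)] .
   show False using M.lep_trans[OF M.eqp_lep[OF M.eqp_sym[OF b(2) bM lM]] below[OF b(1)] lM] l(2) by blast
  qed
  have kl: "k:$l" using Ord_not_sub[OF lO kO] M.lep_subset[OF lM, of k] l(2) by blast
  have "is_successor_cardinal M k l" unfolding is_successor_cardinal_def
  proof (intro conjI allI impI lC kl)
   fix m assume m: "M.Card m & k:$m"
   hence "~ M.lep m k" using M.Card_not_lep by blast
   hence "m~:$l" using below by blast
   thus "$l <= $m" using Ord_not_sub[OF lO] m M.Card_Ord by blast
  qed
  hence n: "~ N.lep l k" by (rule NS[OF k(2) kinf])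
  have "$l <= $mm" using l(1) Ord_trans[OF mmO] by auto
  hence "N.lep l mm" using N.lep_subset lM sub by blast
  hence "N.lep l k" using N.lep_trans[OF N.lep_trans[OF _ mma] lep_MN[OF ak]] lM sub by blast
  thus False using n by blast
 qed
qed

lemma succ_NM:
 assumes C: "!!mm. M.Card mm ==> N.Card mm" and s: "is_successor_cardinal N k l" shows "is_successor_cardinal M k l"
 using s C Card_NM unfolding is_successor_cardinal_def by blast

lemma GCH_N:
 assumes C: "!!mm. M.Card mm ==> N.Card mm" and G: "GCH M"
  and le: "!!k l. M.Card k ==> $homega <= $k ==> is_successor_cardinal M k l ==> N.lep (hPow N k) l"
 shows "GCH N"
 unfolding GCH_def
proof (intro allI impI)
 fix k l assume *: "N.Card k & $homega <= $k & is_successor_cardinal N k l"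
 hence k: "M.Card k" "$homega <= $k" "is_successor_cardinal M k l" using Card_NM succ_NM[OF C] by auto
 have kM: "k:M" "l:M" using k M.Card_M by (auto simp: is_successor_cardinal_def)
 have "M.eqp l (hPow M k)" by (rule M.eqp_sym[OF M.GCH_eqp[OF G k] M.hPow_M]) (use kM in auto)
 hence "N.lep l (hPow M k)" using eqp_MN N.eqp_lep by blast
 moreover have "$(hPow M k) <= $(hPow N k)" using sub by auto
 hence "N.lep (hPow M k) (hPow N k)" by (intro N.lep_subset) (use sub M.hPow_M kM in auto)
 ultimately have "N.lep l (hPow N k)" using N.lep_trans kM sub by blast
 hence "N.eqp (hPow N k) l" by (intro N.CSB le[OF k]) (use N.hPow_M kM sub in auto)
 thus "EX f:N. is_bijection f (hPow N k) l" using N.eqp_bij[OF N.hPow_M] kM sub by blast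
qed

end

sublocale genericc < E: exts M N
 by unfold_locales (use M_N Ord_N in auto)

context genericc begin

lemma fun_bad:
 assumes "ta:M" "a:M" "b:M" and f: "!!x y y'. x:$a ==> pair x y:$(val G ta) ==> pair x y':$(val G ta) ==> y = y'"
 obtains p0 where "p0:G" "!!p x y y'. p:$P ==> le p p0 ==> x:$a ==> y:$b ==> y':$b ==>
  memf p (check (pair x y)) ta ==> memf p (check (pair x y')) ta ==> y = y'"
proof -
 define B where "B p <-> (EX x:$a. EX y:$b. EX y':$b. y ~= y' & memf p (check (pair x y)) ta & memf p (check (pair x y')) ta)" for p
 have "df (%e. B (e 0))" unfolding B_def by (intro dfi assms)
 moreover have "~ B p" if "p:G" for p
 proof
  assume "B p"
  then obtain x y y' where *: "x:$a" "y:$b" "y':$b" "y ~= y'" "memf p (check (pair x y)) ta" "memf p (check (pair x y')) ta"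
   by (auto simp: B_def)
  have M: "check (pair x y):M" "check (pair x y'):M" using check_M pair_M trans assms * by blast+
  have "pair x y:$(val G ta)" "pair x y':$(val G ta)"
   using mem_truth[OF M(1) assms(1)] mem_truth[OF M(2) assms(1)] * that val_check[OF G_one] by auto
  thus False using f * by blast
 qed
 ultimately obtain p0 where "p0:G" "!!q. q:$P ==> le q p0 ==> ~ B q" using Bad_dense by metis
 thus ?thesis using that[of p0] unfolding B_def by blast
qed

text \<open>Two conditions with the same \<open>st\<close> that force values at \<open>x\<close> are
  compatible, so the values agree; hence at most \<open>S\<close> many values are possible at each
  argument.\<close>

lemma cover:
 assumes S: "S:M" "dt (%e. st (e 0))" "!!p. p:$P ==> st p:$S"
  and comp: "!!p q r. p:$P ==> q:$P ==> st p = st q ==> r:$P ==> le p r ==> le q r ==> EX w:$P. le w p & le w q"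
  and f: "f:N" "fun_on f a" "a:M" "b:M" "!!x. x:$a ==> ap f x:$b"
 obtains C where "C:M" "!!x. x:$a ==> $(ap C x) <= $b & ap f x:$(ap C x) & lep (ap C x) S"
proof -
 obtain ta where ta: "ta:M" "f = val G ta" using N_E f(1) by blast
 note [dfi] = dt_app1[where F=st, OF S(2)]
 have un: "y = y'" if "x:$a" "pair x y:$(val G ta)" "pair x y':$(val G ta)" for x y y'
  using fun_on_ap[OF f(2) that(1)] that(2,3) ta(2) by auto
 obtain p0 where p0: "p0:G" "!!p x y y'. p:$P ==> le p p0 ==> x:$a ==> y:$b ==> y':$b ==>
  memf p (check (pair x y)) ta ==> memf p (check (pair x y')) ta ==> y = y'"
  by (rule fun_bad[OF ta(1) f(3,4)]) (rule un, assumption+, blast)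
 have p0P: "p0:$P" using G_P p0(1) by blast
 have p0M: "p0:M" using P_M p0P .
 define R where "R x y p <-> p:$P & le p p0 & memf p (check (pair x y)) ta" for x y p
 define C where "C = lam a (%x. Sep b (%y. EX p:M. R x y p))"
 have CM: "C:M" unfolding C_def R_def by (rule dt_M0) (intro dfi f PM LM p0M ta)
 have "$(ap C x) <= $b & ap f x:$(ap C x) & lep (ap C x) S" if x: "x:$a" for x
 proof (intro conjI)
  have xM: "x:M" using trans f x by blast
  have Cx: "ap C x = Sep b (%y. EX p:M. R x y p)" using x by (simp add: C_def)
  show "$(ap C x) <= $b" unfolding Cx by auto
  have yM: "ap f x:M" using trans f(4,5) x by blast
  have "pair x (ap f x):$f" using fun_on_ap[OF f(2) x] by simp
  then obtain p where p: "p:G" "memf p (check (pair x (ap f x))) ta"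
   using mem_truth[OF check_M[OF pair_M[OF xM yM]] ta(1)] ta(2) val_check[OF G_one] by auto
  obtain q where q: "q:G" "le q p" "le q p0" using G_dir[OF p(1) p0(1)] by blast
  hence "R x (ap f x) q" unfolding R_def using memf_mono[OF p(2) q(2)] q G_P by blast
  moreover have "q:M" using G_P P_M q by blast
  ultimately show "ap f x:$(ap C x)" unfolding Cx using f(5)[OF x] by auto
  have CxM: "ap C x:M" using ap_M CM xM by blast
  have dR: "df (%e. R x (e 0) (e (Suc 0)))" unfolding R_def by (intro dfi PM LM p0M ta xM)
  obtain c where c: "c:M" "fun_on c (ap C x)" "!!y. y:$(ap C x) ==> R x y (ap c y) & ap c y:M"
   by (rule AC[OF CxM dR]) (auto simp: Cx)
  show "lep (ap C x) S"
  proof (rule lepI[OF CxM, where F="%y. st (ap c y)"])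
   show "dt (%e. st (ap c (e 0)))" by (intro dfi c)
   show "inj_on (%y. st (ap c y)) ($(ap C x))"
   proof (rule inj_onI)
    fix y y' assume yy: "y:$(ap C x)" "y':$(ap C x)" "st (ap c y) = st (ap c y')"
    note r = c(3)[OF yy(1)] c(3)[OF yy(2)]
    obtain w where w: "w:$P" "le w (ap c y)" "le w (ap c y')"
     using comp[of "ap c y" "ap c y'" p0] r yy(3) p0P unfolding R_def by blast
    have "le w p0" using le_trans w r p0P unfolding R_def by blast
    thus "y = y'" using p0(2)[OF w(1) _ x, of y y'] yy memf_mono w r unfolding R_def Cx by auto
   qed
   show "st (ap c y):$S" if "y:$(ap C x)" for y using S(3) c(3)[OF that] unfolding R_def by blast
  qed
 qed
 thus ?thesis using that CM by blast
qed

lemma cover_no_surj: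
 assumes S: "S:M" "dt (%e. st (e 0))" "!!p. p:$P ==> st p:$S"
  and comp: "!!p q r. p:$P ==> q:$P ==> st p = st q ==> r:$P ==> le p r ==> le q r ==> EX w:$P. le w p & le w q"
  and k: "InfO k" "lep S k" "l:M" "~ lep l k"
 shows "~ N.lep l k"
proof
 assume "N.lep l k"
 have kM: "k:M" using k by (simp add: InfO_def)
 obtain i where i: "i:N" "inj_into i l k" using \<open>N.lep l k\<close> by (auto simp: N.lep_iff)
 show False
 proof (cases "$l = {}")
  case True
  hence "lep l k" by (intro lep_subset k) auto
  thus False using k by blast
 next
  case False
  then obtain y0 where y0: "y0:$l" by blast
  have NM: "k:N" "l:N" using M_N kM k by blast+
  obtain f where fN: "f:N" and ff: "fun_on f k" and fi: "!!y. y:$l ==> ap i y:$k & ap f (ap i y) = y"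
   and fb: "!!x. x:$k ==> ap f x:$l" by (rule N.inv_fun[OF i NM(2,1) y0]) (rule that)
  obtain C where C: "C:M" "!!x. x:$k ==> $(ap C x) <= $l & ap f x:$(ap C x) & lep (ap C x) S"
   by (rule cover[where st=st and f=f and a=k and b=l, OF S(1,2)]) ((rule S(3) comp fN ff kM k(3) fb; assumption)+, blast)
  define Z where "Z = Img k (ap C)"
  have ZM: "Z:M" unfolding Z_def by (rule dt_M0) (intro dfi kM C)
  have "lep Z k"
  proof (rule lep_surj[OF kM ZM, where F="ap C"])
   show "dt (%e. ap C (e 0))" by (intro dfi C)
  qed (simp add: Z_def)
  have "lep (UU Z) k"
  proof (rule lep_UU[OF ZM \<open>lep Z k\<close> k(1)])
   fix x assume "x:$Z"
   then obtain y where y: "y:$k" "x = ap C y" by (auto simp: Z_def)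
   thus "lep x k" using lep_trans[OF _ k(2)] C(2)[OF y(1)] trans[OF ZM \<open>x:$Z\<close>] by blast
  qed
  moreover have "$l <= $(UU Z)"
  proof
   fix y assume y: "y:$l"
   hence "y:$(ap C (ap i y))" using C(2)[of "ap i y"] fi[OF y] by metis
   thus "y:$(UU Z)" using fi[OF y] by (auto simp: Z_def)
  qed
  ultimately show False using lep_trans[OF lep_subset[OF k(3)] _ k(3)] k(4) by blast
 qed
qed

end

section \<open>Coding sets of the first extension by ground sets and low stems\<close>

context prodf begin

definition rl where "rl l t = Sep t (%z. hfst z:$(hsucc l))"
definition ru where "ru l t = Sep t (%z. hfst z~:$(hsucc l))"
definition StL where "StL l = Sep St (%s. ALL z:$s. hfst z:$(hsucc l))"
definition un where "un s t = UU (Upr s t)"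
lemma elts_un [simp]: "$(un s t) = $s \<union> $t" by (auto simp: un_def)
lemma dt_rl [dfi]: "dt s ==> dt t ==> dt (%e. rl (s e) (t e))"
 by (rule dt_app2[where F=rl]) (unfold rl_def, intro dfi)
lemma dt_ru [dfi]: "dt s ==> dt t ==> dt (%e. ru (s e) (t e))"
 by (rule dt_app2[where F=ru]) (unfold ru_def, intro dfi)
lemma dt_un [dfi]: "dt s ==> dt t ==> dt (%e. un (s e) (t e))"
 by (rule dt_app2[where F=un]) (unfold un_def, intro dfi)
lemma StL_M: "l:M ==> StL l:M" unfolding StL_def by (rule dt_M0) (intro dfi St_M)
lemma StL_St: "s:$(StL l) ==> s:$St" by (simp add: StL_def)

lemma lep_stems: assumes "InfO k" "k:$(hsucc l)" "l:M" "!!dl. dl:$J ==> dl:$(hsucc l) ==> dl:$(hsucc k)"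
 shows "lep (StL l) k"
proof -
 have kM: "k:M" "Ord k" "$homega <= $k" using assms by (auto simp: InfO_def)
 have hk: "lep (hsucc k) k" by (rule lep_hsucc[OF kM])
 have PM: "Prod (hsucc k) (hsucc k):M" by (intro Prod_M hsucc_M kM)
 have "$(StL l) <= $(Fin (Prod (hsucc k) (hsucc k)))"
 proof
  fix s assume s: "s:$(StL l)"
  note sS = StD[OF StL_St[OF s]]
  have "z:$(Prod (hsucc k) (hsucc k))" if z: "z:$s" for z
  proof -
   obtain dl nv where z': "z = pair dl nv" "dl:$J" "nv:$dl" using z sS X0E by blast
   have "dl:$(hsucc l)" using s z z' by (auto simp: StL_def)
   hence "dl:$(hsucc k)" using assms(4) z' by blast
   moreover have "nv:$(hsucc k)" by (rule Ord_trans[OF Ord_hsucc[OF kM(2)] \<open>dl:$(hsucc k)\<close> z'(3)])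
   ultimately show ?thesis by (simp add: z'(1) del: elts_hsucc)
  qed
  thus "s:$(Fin (Prod (hsucc k) (hsucc k)))" using sS by auto
 qed
 hence "lep (StL l) (Fin (Prod (hsucc k) (hsucc k)))" by (intro lep_subset StL_M assms)
 moreover have "lep (Fin (Prod (hsucc k) (hsucc k))) k"
  by (rule lep_FinI[OF lep_ProdI[OF hk hk assms(1)] assms(1) PM]) (intro hsucc_M kM)+
 ultimately show ?thesis using lep_trans StL_M[OF assms(3)] by blast
qed

text \<open>A map from \<open>dl\<close> into the subsets of \<open>k\<close> is constant almost
  everywhere, hence not injective.\<close>

lemma meas_strong: assumes "meas dl u" "k:$dl" shows "~ lep dl (hPow M k)"
proof
 interpret m: measure M dl u by unfold_locales (rule assms)
 assume "lep dl (hPow M k)"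
 then obtain f where f: "f:M" "inj_into f dl (hPow M k)" by (auto simp: lep_iff)
 have kM: "k:M" using m.dsub assms by blast
 obtain C where C: "C:M" "$C <= $k" "m.L (%a. ALL x:$k. x:$(ap f a) <-> x:$C)"
  by (rule m.L_const[OF kM assms(2) lep_refl[OF kM] f(1)])
 have L: "m.L (%a. ap f a = C)"
 proof (rule m.L_mono[OF C(3)])
  fix a assume a: "a:$dl" "ALL x:$k. x:$(ap f a) <-> x:$C"
  hence "$(ap f a) <= $k" using f(2) by (auto simp: inj_into_def)
  thus "ap f a = C" using a(2) C(2) by (intro hc_eqI) blast
 qed (intro dfi f C)
 obtain a where a: "a:$dl" "ap f a = C" using m.L_ex[OF L] by blast
 show False
  by (rule m.L_no[OF L m.L_ne[OF a(1)]]) (use f(2) a in "unfold inj_into_def, blast", intro dfi f C, intro dfi m.dsub[OF a(1)])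
qed

end

locale prodg = prodf M J Um + genericc M "prodf.P M J Um" "prodf.L M J Um" G for M J Um G
begin

definition SG where "SG = Img Gh hfst"
lemma SG_N: "SG:N" unfolding SG_def by (rule N.dt_M0) (intro N.dfi Gh_N)
lemma SG: "t:$SG <-> (EX A. pair t A:G)"
proof -
 have "t:$SG <-> (EX p:G. hfst p = t)" by (auto simp: SG_def elts_Gh)
 also have "\<dots> <-> (EX A. pair t A:G)" using G_P PE by (metis hfst)
 finally show ?thesis .
qed
lemma SG_St: "t:$SG ==> t:$St" using SG G_P inP by blast

lemma G_stem: assumes "pair t1 A1:G" "pair t A:G" "$t1 <= $t"
 shows "EX B. pair t B:G & le (pair t B) (pair t1 A1)"
proof -
 obtain p where p: "p:G" "le p (pair t1 A1)" "le p (pair t A)" using G_dir[OF assms(1,2)] by blast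
 obtain t2 A2 where e: "p = pair t2 A2" using G_P[OF p(1)] by (rule PE)
 note i = p(2,3)[unfolded e inL inP]
 have I: "Int2 A A1:$Sd" using Sd_Int i by blast
 have "le p (pair t (Int2 A A1))" unfolding e inL inP using i I assms(3) by auto
 moreover have "le (pair t (Int2 A A1)) (pair t1 A1)" unfolding inL inP using i I assms(3) by auto
 ultimately show ?thesis using G_up[OF p(1)] leP by blast
qed

text \<open>There are at most \<open>l\<close> low stems, that is, stems with domain in
  \<open>l + 1\<close>. The measures above \<open>l\<close> can therefore intersect, over all
  \<open>x\<close> in \<open>W\<close> and all low stems, the side conditions deciding whether
  \<open>x\<close> belongs to \<open>val G ta\<close>; the answer then depends on the low stem
  alone. The clause about a common condition makes decoding unique when \<open>ta\<close> names an
  injection.\<close>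

lemma H_code:
 assumes ta: "ta:M" and W: "W:M" "lep W l" and l: "InfO l" and p0: "p0:G"
 obtains e where "e:M" "$e <= $(Prod W (StL l))"
  "!!x. x:$W ==> EX t1:$SG. ALL t:$SG. $t1 <= $t --> (pair x (rl l t):$e <-> x:$(val G ta))"
  "!!x x' s. pair x s:$e ==> pair x' s:$e ==>
   EX q:$P. le q p0 & memf q (check x) ta & memf q (check x') ta"
proof -
 have lM: "l:M" "Ord l" using l by (auto simp: InfO_def)
 define D where "D x p <-> memf p (check x) ta" for x p
 have dD: "df2 D" unfolding D_def by (intro dfi ta)
 note [dfi] = df_app2[where P=D, OF dD]
 have D: "oreg (D x)" if "x:M" for x unfolding oreg_def
 proof (intro conjI allI impI ballI)
  show "df1 (D x)" by (rule df_fixM[OF dD that])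
  fix p q assume "D x p" "le q p" thus "D x q" unfolding D_def using memf_mono leP by blast
 next
  fix p assume "p:$P" "ALL q:$P. le q p --> (EX r:$P. le r q & D x r)"
  thus "D x p" unfolding D_def using memf_dense by blast
 qed
 have WM: "x:M" if "x:$W" for x using trans[OF W(1) that] .
 define dc where "dc x p <-> D x p \<or> (ALL q:$P. le q p --> ~ D x q)" for x p
 have ddc: "df2 dc" unfolding dc_def by (intro dfi PM LM)
 note [dfi] = df_app2[where P=dc, OF ddc]
 \<comment> \<open>On coordinates above \<open>l\<close> the side condition \<open>A\<close> is
   contained in \<open>B\<close>; on the others \<open>B\<close> is arbitrary.\<close>
 define up where "up A B <-> (ALL z:$A. hfst z~:$(hsucc l) --> z:$B)" for A B
 have dup: "df2 up" unfolding up_def by (intro dfi lM)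
 note [dfi] = df_app2[where P=up, OF dup]
 define \<Psi> where "\<Psi> p <-> (ALL x:$W. ALL s:$(StL l). $(rl l (hfst p)) <= $s -->
  (EX B:$Sd. dc x (pair (un s (ru l (hfst p))) B) & up (hsnd p) B))" for p
 have d\<Psi>: "df (%e. \<Psi> (e 0))" unfolding \<Psi>_def by (intro dfi W StL_M Sd_M lM)
 have unSt: "un s (ru l t):$St" if s: "s:$(StL l)" and t: "t:$St" for s t
 proof -
  note i = StD[OF StL_St[OF s]] StD[OF t]
  show ?thesis
  proof (rule StI)
   show "un s (ru l t):M" by (rule dt_M0) (intro dfi lM, use i in auto)
   show "fnl (un s (ru l t))" using i s unfolding fnl_def StL_def elts_un ru_def by auto
  qed (use i in "auto simp: ru_def")
 qed
 have lepE: "lep (Prod W (StL l)) l"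
  by (rule lep_ProdI[OF W(2) lep_stems[OF l] l W(1)]) (auto intro: StL_M lM)
 have "EX q:$P. le q p & \<Psi> q" if p: "p:$P" for p
 proof -
  obtain t A where e: "p = pair t A" "t:$St" "A:$Sd" using p by (rule PE)
  have M: "t:M" "A:M" using e StD SdD by auto
  define R where "R w B <-> B:$Sd & dc (hfst w) (pair (un (hsnd w) (ru l t)) B)" for w B
  have dR: "df2 R" unfolding R_def by (intro dfi Sd_M lM M)
  have ex: "EX B:M. R w B" if w: "w:$(Prod W (StL l))" for w
  proof -
   obtain x s where xs: "w = pair x s" "x:$W" "s:$(StL l)" using w by auto
   obtain B where "B:$Sd" "D x (pair (un s (ru l t)) B) \<or> neg (D x) (pair (un s (ru l t)) B)"
    using Prikry[OF D[OF WM[OF xs(2)]] unSt[OF xs(3) e(2)]] by blast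
   thus ?thesis unfolding R_def dc_def neg_def xs using SdD by auto
  qed
  have EM: "Prod W (StL l):M" by (intro Prod_M W StL_M lM)
  obtain b where b: "b:M" "fun_on b (Prod W (StL l))" "!!w. w:$(Prod W (StL l)) ==> R w (ap b w) & ap b w:M"
   by (rule AC[OF EM dR ex]) (assumption, rule that)
  \<comment> \<open>Only coordinates above \<open>l\<close> are shrunk, simultaneously for all pairs
    of an element of \<open>W\<close> and a low stem.\<close>
  define A' where "A' = Sep A (%z. hfst z~:$(hsucc l) --> (ALL w:$(Prod W (StL l)). z:$(ap b w)))"
  have A'M: "A':M" unfolding A'_def by (rule dt_M0) (intro dfi M lM EM b)
  have A'S: "A':$Sd"
  proof (rule SdI[OF A'M])
   show "$A' <= $X0" using SdD[OF e(3)] by (auto simp: A'_def)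
   fix dl assume dl: "dl:$J"
   interpret m: measure M dl "ap Um dl" by (rule mz[OF dl])
   have d1: "df1 (%nv. pair dl nv:$A')" by (intro dfi m.d A'M)
   show "m.L (%nv. pair dl nv:$A')"
   proof (cases "dl:$(hsucc l)")
    case True
    show ?thesis by (rule m.L_mono[OF Sd_sec[OF e(3) dl] _ d1]) (use True in "simp add: A'_def del: elts_hsucc elts_Prod")
   next
    case False
    hence ldl: "l:$dl" using Ord_linear[OF m.d(3) lM(2)] by auto
    have "m.L (%nv. ALL w:$(Prod W (StL l)). pair dl nv:$(ap b w))"
    proof (rule m.L_completeE[where P="%w nv. pair dl nv:$(ap b w)", OF EM ldl lepE])
     show "df2 (%w nv. pair dl nv:$(ap b w))" by (intro dfi m.d b)
     fix w assume "w:$(Prod W (StL l))"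
     hence "ap b w:$Sd" using b(3) unfolding R_def by blast
     thus "m.L (%nv. pair dl nv:$(ap b w))" by (rule Sd_sec[OF _ dl])
    qed
    from Sd_sec[OF e(3) dl] this show ?thesis
     by (rule m.L_mono2) (simp add: A'_def del: elts_Prod elts_hsucc, intro dfi m.d M, intro dfi m.d EM b, rule d1)
   qed
  qed
  have le: "le (pair t A') p" unfolding e(1) inL inP using e A'S by (auto simp: A'_def)
  have "\<Psi> (pair t A')" unfolding \<Psi>_def hfst hsnd
  proof (intro ballI impI)
   fix x s assume xs: "x:$W" "s:$(StL l)"
   hence w: "pair x s:$(Prod W (StL l))" by auto
   have "R (pair x s) (ap b (pair x s))" using b(3)[OF w] by blast
   moreover have "up A' (ap b (pair x s))" unfolding up_def A'_def using w by (auto simp del: elts_hsucc elts_Prod)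
   ultimately show "EX B:$Sd. dc x (pair (un s (ru l t)) B) & up A' B" unfolding R_def by auto
  qed
  thus ?thesis using le leP by blast
 qed
 hence "EX p:G. le p p0 & \<Psi> p" by (intro G_dense_below d\<Psi> p0) blast
 then obtain p where p: "p:G" "le p p0" "\<Psi> p" by blast
 obtain t A where e: "p = pair t A" "t:$St" "A:$Sd" using G_P[OF p(1)] by (rule PE)
 have M: "t:M" "A:M" using e StD SdD by auto
 define E where "E = Sep (Prod W (StL l)) (%w. $(rl l t) <= $(hsnd w) & $(hsnd w) <= $t \<union> $A &
  (EX B:$Sd. D (hfst w) (pair (un (hsnd w) (ru l t)) B) & up A B))"
 have EM: "E:M"
 proof -
  have "E = Sep (Prod W (StL l)) (%w. $(rl l t) <= $(hsnd w) & $(hsnd w) <= $(un t A) &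
  (EX B:$Sd. D (hfst w) (pair (un (hsnd w) (ru l t)) B) & up A B))" by (simp add: E_def)
  also have "\<dots>:M" by (rule dt_M0) (intro dfi M W StL_M lM Sd_M)
  finally show ?thesis .
 qed
 have inE: "pair x s:$E <-> x:$W & s:$(StL l) & $(rl l t) <= $s & $s <= $t \<union> $A &
  (EX B:$Sd. D x (pair (un s (ru l t)) B) & up A B)" for x s by (auto simp: E_def)
 have tsub: "$t <= $s \<union> $(ru l t)" if "$(rl l t) <= $s" for s
  using that by (auto simp: rl_def ru_def simp del: elts_hsucc)
 show ?thesis
 proof (rule that[OF EM])
  show "$E <= $(Prod W (StL l))" by (auto simp: E_def)
 next
  fix x x' s assume "pair x s:$E" "pair x' s:$E"
  then obtain B B' where s: "s:$(StL l)" "$(rl l t) <= $s" "$s <= $t \<union> $A"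
   and B: "B:$Sd" "B':$Sd" "D x (pair (un s (ru l t)) B)" "D x' (pair (un s (ru l t)) B')"
   unfolding inE by blast
  define q where "q = pair (un s (ru l t)) (Int2 A (Int2 B B'))"
  have I: "Int2 A (Int2 B B'):$Sd" by (intro Sd_Int e B)
  have u: "un s (ru l t):$St" by (rule unSt[OF s(1) e(2)])
  have "le q (pair (un s (ru l t)) B)" "le q (pair (un s (ru l t)) B')" unfolding q_def inL inP using I B u by auto
  moreover have "le q p" unfolding q_def e(1) inL inP using I e u tsub[OF s(2)] s(3) by (auto simp: ru_def)
  moreover have "le q p0" using le_trans[OF \<open>le q p\<close> p(2)] leP[OF \<open>le q p\<close>] leP[OF p(2)] by blast
  ultimately show "EX q:$P. le q p0 & memf q (check x) ta & memf q (check x') ta"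
   using B(3,4) leP memf_mono unfolding D_def by blast
 next
  fix x assume x: "x:$W"
  have xM: "x:M" using WM x .
  have "EX q:G. le q p & ((x:$(val G ta) --> D x q) & (x~:$(val G ta) --> (ALL r:$P. le r q --> ~ D x r)))"
  proof (cases "x:$(val G ta)")
   case True
   then obtain q where q: "q:G" "D x q" unfolding D_def
    using mem_truth[OF check_M[OF xM] ta] by (auto simp: val_check G_one)
   obtain r where "r:G" "le r p" "le r q" using G_dir[OF p(1) q(1)] by blast
   thus ?thesis using True oregD(2)[OF D[OF xM] q(2)] by blast
  next
   case False
   have n: "~ D x q" if "q:G" for q unfolding D_def
    using mem_truth[OF check_M[OF xM] ta] that False by (auto simp: val_check G_one)
   obtain q where q: "q:G" "!!r. r:$P ==> le r q ==> ~ D x r"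
    by (rule Bad_dense[OF oregD(1)[OF D[OF xM]] n], assumption) (rule that)
   obtain r where "r:G" "le r p" "le r q" using G_dir[OF p(1) q(1)] by blast
   thus ?thesis using False q(2) le_trans G_P q(1) by blast
  qed
  then obtain q where q: "q:G" "le q p" "x:$(val G ta) ==> D x q"
   "!!r. x~:$(val G ta) ==> r:$P ==> le r q ==> ~ D x r" by blast
  obtain t1 A1 where e1: "q = pair t1 A1" using G_P[OF q(1)] by (rule PE)
  have "pair x (rl l t'):$E <-> x:$(val G ta)" if t': "t':$SG" "$t1 <= $t'" for t'
  proof -
   obtain A' where "pair t' A':G" using SG t' by blast
   then obtain B' where B': "pair t' B':G" "le (pair t' B') (pair t1 A1)"
    using G_stem[OF q(1)[unfolded e1] _ t'(2)] by blast
   have Bq: "le (pair t' B') q" using B' e1 by simp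
   have Bp: "le (pair t' B') (pair t A)" using le_trans[OF Bq q(2)] leP[OF Bq] leP[OF q(2)] e(1) by blast
   note i = Bp[unfolded inL inP]
   let ?s = "rl l t'"
   have sM: "?s:M" by (rule dt_M0) (intro dfi lM, use StD i in blast)
   have s: "?s:$(StL l)" unfolding StL_def using StI[OF sM] StD[of t'] i by (auto simp: rl_def fnl_def)
   have ts: "$(rl l t) <= elts ?s" "elts ?s <= $t \<union> $A" using i by (auto simp: rl_def)
   have u: "un ?s (ru l t):$St" by (rule unSt[OF s]) (use i in blast)
   \<comment> \<open>The generic condition and the deciding condition with the same low stem have a
     common extension with stem \<open>t'\<close>, so the decision agrees with the truth in the
     extension.\<close>
   have mid: "le (pair t' (Int2 B' B)) (pair (un ?s (ru l t)) B)" "le (pair t' (Int2 B' B)) (pair t' B')"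
    if B: "B:$Sd" "up A B" for B
   proof -
    have I: "Int2 B' B:$Sd" using Sd_Int i B by blast
    have "$t' - $(un ?s (ru l t)) <= $B"
    proof
     fix z assume z: "z:$t' - $(un ?s (ru l t))"
     hence "hfst z~:$(hsucc l)" "z~:$t" by (auto simp: rl_def ru_def simp del: elts_hsucc)
     thus "z:$B" using B(2) z i unfolding up_def by blast
    qed
    moreover have "$(un ?s (ru l t)) <= $t'" using i by (auto simp: rl_def ru_def)
    ultimately show "le (pair t' (Int2 B' B)) (pair (un ?s (ru l t)) B)" unfolding inL inP using I B u i by auto
    show "le (pair t' (Int2 B' B)) (pair t' B')" unfolding inL inP using I i by auto
   qed
   show ?thesis
   proof (cases "x:$(val G ta)")
    case True
    have Dx: "D x (pair t' B')" using oregD(2)[OF D[OF xM] q(3)[OF True] Bq] .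
    obtain B where B: "B:$Sd" "dc x (pair (un ?s (ru l t)) B)" "up A B"
     using p(3)[unfolded e(1) \<Psi>_def hfst hsnd] x s ts(1) by blast
    have "D x (pair t' (Int2 B' B))" using oregD(2)[OF D[OF xM] Dx mid(2)[OF B(1,3)]] .
    hence "D x (pair (un ?s (ru l t)) B)" using B(2) mid(1)[OF B(1,3)] leP unfolding dc_def by blast
    thus ?thesis using True x s ts B unfolding inE by blast
   next
    case False
    have "~ D x (pair (un ?s (ru l t)) B)" if B: "B:$Sd" "up A B" for B
    proof
     assume "D x (pair (un ?s (ru l t)) B)"
     hence "D x (pair t' (Int2 B' B))" using oregD(2)[OF D[OF xM] _ mid(1)[OF B]] by blast
     moreover have "le (pair t' (Int2 B' B)) q" using le_trans[OF mid(2)[OF B] Bq] leP[OF mid(2)[OF B]] leP[OF Bq] by blast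
     ultimately show False using q(4)[OF False] leP by blast
    qed
    thus ?thesis using False unfolding inE by blast
   qed
  qed
  thus "EX t1:$SG. ALL t:$SG. $t1 <= $t --> (pair x (rl l t):$E <-> x:$(val G ta))"
   using SG q(1) e1 by blast
 qed
qed


text \<open>All elements of \<open>J\<close> exceed omega, so the only low stem is empty and the
  code determines the real.\<close>

lemma reals_N: "reals_of N = reals_of M"
proof (intro subset_antisym subsetI)
 fix X assume "X:reals_of N"
 hence X: "X:N" "$X <= $homega" by (auto simp: reals_of_def)
 obtain ta where ta: "ta:M" "X = val G ta" using N_E X(1) by blast
 have l: "InfO homega" by (simp add: InfO_def homega_M Ord_homega)
 obtain p0 where p0: "p0:G" using G_one by blast
 obtain e where e: "e:M" "!!x. x:$homega ==> EX t1:$SG. ALL t:$SG. $t1 <= $t -->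
   (pair x (rl homega t):$e <-> x:$(val G ta))"
  by (rule H_code[OF ta(1) homega_M lep_refl[OF homega_M] l p0]) (rule that)
 have "rl homega t = hempty" if "t:$SG" for t
 proof (rule hc_eqI)
  have False if z: "z:$(rl homega t)" for z
  proof -
   have "z:$X0" using z StD[OF SG_St[OF \<open>t:$SG\<close>]] by (auto simp: rl_def)
   then obtain dl nv where z': "z = pair dl nv" "dl:$J" by (rule X0E)
   hence "dl = homega \<or> dl:$homega" "homega:$dl" using z Jm by (auto simp: rl_def meas_def)
   thus False using Ord_trans[OF Ord_homega, of dl homega] not_mem_self[of homega] by blast
  qed
  thus "$(rl homega t) = $hempty" by auto
 qed
 hence "pair x hempty:$e <-> x:$X" if "x:$homega" for x using e(2)[OF that] ta(2) by auto
 hence "X = Sep homega (%x. pair x hempty:$e)" using X(2) by (intro hc_eqI) auto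
 also have "\<dots>:M" by (rule dt_M0) (intro dfi homega_M e hempty_M)
 finally show "X:reals_of M" using X by (simp add: reals_of_def)
qed (auto simp: reals_of_def M_N)

context assumes GM: "GCH M" begin

text \<open>The graph of an injection from \<open>l\<close> into \<open>k\<close> is coded by
  \<open>e\<close>. No element of \<open>J\<close> above \<open>k\<close> is at most
  \<open>l\<close>: it would be a strong limit, but \<open>l\<close> injects into the power set of
  \<open>k\<close> by GCH. So there are only \<open>k\<close> low stems. Value and low stem
  determine the argument, which bounds \<open>l\<close> by \<open>k\<close> in the ground
  model.\<close>

lemma succ_pres:
 assumes k: "Card k" "$homega <= $k" "is_successor_cardinal M k l" shows "~ N.lep l k"
proof
 assume "N.lep l k"
 then obtain i where i: "i:N" "inj_into i l k" by (auto simp: N.lep_iff)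
 have kM: "k:M" "Ord k" using k Card_M Card_Ord by auto
 have lC: "Card l" "k:$l" using k by (auto simp: is_successor_cardinal_def)
 have lM: "l:M" "Ord l" using lC Card_M Card_Ord by auto
 have I: "InfO l" "InfO k" unfolding InfO_def using lM kM k Ord_trans[OF lM(2) lC(2)] by auto
 obtain ta where ta: "ta:M" "lam l (ap i) = val G ta"
 proof -
  have "lam l (ap i):N" by (rule N.dt_M0) (intro N.dfi i M_N lM)
  thus ?thesis using N_E that by metis
 qed
 have kl: "lep k l" by (rule lep_subset[OF kM(1)]) (use Ord_trans[OF lM(2) lC(2)] in blast)
 have W: "Prod l k:M" "lep (Prod l k) l"
  by (intro Prod_M lM kM) (rule lep_ProdI[OF lep_refl[OF lM(1)] kl I(1) lM(1) kM(1)])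
 have mt: "pair y v:$(val G ta) <-> y:$l & v = ap i y" for y v unfolding ta(2)[symmetric] by auto
 \<comment> \<open>Below \<open>p0\<close> no condition forces two different arguments to have the
   same value. Together with the common condition provided by \<open>H_code\<close> this gives
   \<open>single\<close>.\<close>
 obtain p0 where p0: "p0:G" "!!p x y y'. p:$P ==> le p p0 ==> x:$k ==> y:$l ==> y':$l ==>
  memf p (check (pair y x)) ta ==> memf p (check (pair y' x)) ta ==> y = y'"
 proof -
  define B where "B p <-> (EX x:$k. EX y:$l. EX y':$l. y ~= y' & memf p (check (pair y x)) ta & memf p (check (pair y' x)) ta)" for p
  have dB: "df (%e. B (e 0))" unfolding B_def by (intro dfi ta lM kM)
  have nB: "~ B p" if "p:G" for p
  proof
   assume "B p"
   then obtain x y y' where *: "x:$k" "y:$l" "y':$l" "y ~= y'" "memf p (check (pair y x)) ta" "memf p (check (pair y' x)) ta"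
    by (auto simp: B_def)
   have M: "check (pair y x):M" "check (pair y' x):M" using check_M pair_M trans[OF kM(1)] trans[OF lM(1)] * by blast+
   have "pair y x:$(val G ta)" "pair y' x:$(val G ta)"
    using mem_truth[OF M(1) ta(1)] mem_truth[OF M(2) ta(1)] * that val_check[OF G_one] by auto
   hence "ap i y = ap i y'" unfolding mt by simp
   thus False using i(2) * unfolding inj_into_def by blast
  qed
  obtain p where p: "p:G" "!!q. q:$P ==> le q p ==> ~ B q"
   by (rule Bad_dense[OF dB nB], assumption) (rule that)
  show ?thesis by (rule that[OF p(1)]) (use p(2) in "unfold B_def, blast")
 qed
 obtain e where e: "e:M" "$e <= $(Prod (Prod l k) (StL l))"
   "!!x. x:$(Prod l k) ==> EX t1:$SG. ALL t:$SG. $t1 <= $t --> (pair x (rl l t):$e <-> x:$(val G ta))"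
   "!!x x' s. pair x s:$e ==> pair x' s:$e ==>
   EX q:$P. le q p0 & memf q (check x) ta & memf q (check x') ta"
  by (rule H_code[OF ta(1) W I(1) p0(1)]) (rule that)
 have ln: "~ lep l k" by (rule succ_not_lep[OF k(3)])
 have lP: "lep l (hPow M k)"
  by (rule eqp_lep[OF eqp_sym[OF GCH_eqp[OF GM k] hPow_M[OF kM(1)] lM(1)]])
 have "lep (StL l) k"
 proof (rule lep_stems[OF I(2) _ lM(1)])
  fix dl assume dl: "dl:$J" "dl:$(hsucc l)"
  show "dl:$(hsucc k)"
  proof (rule ccontr)
   assume "dl~:$(hsucc k)"
   hence kdl: "k:$dl" using Ord_linear[OF J_Ord[OF dl(1)] kM(2)] by auto
   have "$dl <= $l" using dl(2) Ord_trans[OF lM(2)] by auto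
   hence "lep dl (hPow M k)" using lep_trans[OF lep_subset[OF J_M[OF dl(1)]] lP J_M[OF dl(1)]] by blast
   thus False using meas_strong[OF Jm[OF dl(1)] kdl] by blast
  qed
 qed (use lC in simp)
 hence c: "lep (Prod k (StL l)) k"
  by (rule lep_ProdI[OF lep_refl[OF kM(1)] _ I(2) kM(1) StL_M[OF lM(1)]])
 define Y where "Y w = Sep l (%y. pair (pair y (hfst w)) (hsnd w):$e)" for w
 have single: "y = y'" if "pair (pair y v) s:$e" "pair (pair y' v) s:$e" for y y' v s
 proof -
  have "y:$l" "v:$k" "y':$l" using that e(2) by auto
  thus ?thesis using e(4)[OF that] p0(2) by blast
 qed
 have "lep l (Prod k (StL l))"
 proof (rule lep_surj[OF _ lM(1), where F="%w. UU (Y w)"])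
  show "Prod k (StL l):M" by (intro Prod_M kM StL_M lM)
  show "dt (%x. UU (Y (x 0)))" unfolding Y_def by (intro dfi lM e)
  show "$l <= (%w. UU (Y w)) ` $(Prod k (StL l))"
  proof
   fix y assume y: "y:$l"
   hence x: "pair y (ap i y):$(Prod l k)" using i(2) by (auto simp: inj_into_def)
   obtain t1 where "t1:$SG" "ALL t:$SG. $t1 <= $t --> (pair (pair y (ap i y)) (rl l t):$e <-> pair y (ap i y):$(val G ta))"
    using e(3)[OF x] by blast
   hence in_e: "pair (pair y (ap i y)) (rl l t1):$e" using mt y by blast
   have "$(Y (pair (ap i y) (rl l t1))) = {y}" using in_e y single[OF in_e] by (auto simp: Y_def)
   hence "UU (Y (pair (ap i y) (rl l t1))) = y" by (rule UU_single)
   moreover have "pair (ap i y) (rl l t1):$(Prod k (StL l))" using in_e e(2) by auto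
   ultimately show "y:(%w. UU (Y w)) ` $(Prod k (StL l))" by force
  qed
 qed
 thus False using ln lep_trans[OF _ c lM(1)] by blast
qed

lemma Card_pres: "Card mm ==> N.Card mm"
 using E.Card_MN[of mm] succ_pres by blast

text \<open>A subset of \<open>k\<close> is recovered from a ground set \<open>e\<close> as the set
  of \<open>x\<close> that are paired in \<open>e\<close> with the low parts of all sufficiently
  large generic stems. The number of such \<open>e\<close> is that of the ground subsets of
  \<open>k\<close>.\<close>

lemma pow_N: assumes k: "Card k" "$homega <= $k" shows "N.lep (hPow N k) (hPow M k)"
proof -
 have kM: "k:M" "Ord k" using k Card_M Card_Ord by auto
 have I: "InfO k" using k kM by (simp add: InfO_def)
 have WM: "Prod k (StL k):M" by (intro Prod_M kM StL_M)
 obtain p0 where p0: "p0:G" using G_one by blast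
 define F where "F e = Sep k (%x. EX t1:$SG. ALL t:$SG. $t1 <= $t --> pair x (Sep t (%z. hfst z:$(hsucc k))):$e)" for e
 have "N.lep (hPow N k) (hPow M (Prod k (StL k)))"
 proof (rule N.lep_surj[where F=F])
  show "hPow M (Prod k (StL k)):N" "hPow N k:N" using M_N hPow_M N.hPow_M kM WM by auto
  show "N.dt (%e. F (e 0))" unfolding F_def by (intro N.dfi M_N kM SG_N)
  show "$(hPow N k) <= F ` $(hPow M (Prod k (StL k)))"
  proof
   fix X assume X: "X:$(hPow N k)"
   obtain ta where ta: "ta:M" "X = val G ta" using N_E X by auto
   obtain e where e: "e:M" "$e <= $(Prod k (StL k))"
    "!!x. x:$k ==> EX t1:$SG. ALL t:$SG. $t1 <= $t --> (pair x (rl k t):$e <-> x:$(val G ta))"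
    by (rule H_code[OF ta(1) kM(1) lep_refl[OF kM(1)] I p0]) (rule that)
   have "x:$(F e) <-> x:$X" if x: "x:$k" for x
   proof
    assume "x:$(F e)"
    then obtain t2 where t2: "t2:$SG" "ALL t:$SG. $t2 <= $t --> pair x (rl k t):$e"
     unfolding F_def rl_def by auto
    obtain t1 where t1: "t1:$SG" "ALL t:$SG. $t1 <= $t --> (pair x (rl k t):$e <-> x:$(val G ta))"
     using e(3)[OF x] by blast
    obtain A1 A2 where A: "pair t1 A1:G" "pair t2 A2:G" using t1(1) t2(1) SG by blast
    obtain r where r: "r:G" "le r (pair t1 A1)" "le r (pair t2 A2)" using G_dir[OF A] by blast
    obtain t B where rB: "r = pair t B" using G_P[OF r(1)] by (rule PE)
    have "t:$SG" "$t1 <= $t" "$t2 <= $t" using r SG unfolding rB inL by blast+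
    thus "x:$X" using t1(2) t2(2) ta(2) by blast
   next
    assume "x:$X"
    hence "EX t1:$SG. ALL t:$SG. $t1 <= $t --> pair x (rl k t):$e" using e(3)[OF x] ta(2) by simp
    thus "x:$(F e)" using x unfolding F_def rl_def by simp
   qed
   moreover have "$(F e) <= $k" "$X <= $k" using X by (auto simp: F_def)
   ultimately have "X = F e" by (intro hc_eqI) blast
   thus "X:F ` $(hPow M (Prod k (StL k)))" using e by auto
  qed
 qed
 moreover have "lep (Prod k (StL k)) k"
  by (rule lep_ProdI[OF lep_refl[OF kM(1)] lep_stems[OF I] I kM(1) StL_M[OF kM(1)]]) (use kM in auto)
 hence "N.lep (hPow M (Prod k (StL k))) (hPow M k)" by (intro E.lep_MN lep_hPow WM kM)
 ultimately show ?thesis by (rule N.lep_trans) (intro N.hPow_M M_N kM)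
qed

lemma GCH_ext: "GCH N"
proof (rule E.GCH_N[OF Card_pres GM])
 fix k l assume k: "Card k" "$homega <= $k" "is_successor_cardinal M k l"
 have "lep (hPow M k) l" by (rule eqp_lep[OF GCH_eqp[OF GM k]])
 thus "N.lep (hPow N k) l"
  by (intro N.lep_trans[OF pow_N[OF k(1,2)] E.lep_MN] N.hPow_M M_N Card_M k)
qed

end

section \<open>The generic points and the null sets they avoid\<close>

definition nu where "nu = UU SG"
lemma nu_N: "nu:N" unfolding nu_def by (rule N.dt_M0) (intro N.dfi SG_N)
lemma elts_nu: "z:$nu <-> (EX t:$SG. z:$t)" by (auto simp: nu_def)

lemma nu_fun: assumes "dl:$J" shows "ap nu dl:$dl" "pair dl y:$nu <-> y = ap nu dl"
proof -
 have dlM: "dl:M" using J_M assms .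
 have "EX p:G. EX nv:$dl. pair dl nv:$(hfst p)"
 proof (rule G_dense)
  show "df (%e. EX nv:$dl. pair dl nv:$(hfst (e 0)))" by (intro dfi dlM)
  fix p assume "p:$P"
  then obtain t A where p: "p = pair t A" "t:$St" "A:$Sd" by (rule PE)
  obtain r nv where r: "le (pair r A) (pair t A)" "pair dl nv:$r" by (rule ext_dom[OF p(2,3) assms])
  have "r:$St" using r(1) unfolding inL inP by blast
  hence "pair dl nv:$X0" using StD r(2) by blast
  hence "nv:$dl" by (simp add: X0)
  thus "EX q:$P. le q p & (EX nv:$dl. pair dl nv:$(hfst q))"
   using r p(1) leP by (metis hfst)
 qed
 then obtain p nv where p: "p:G" "nv:$dl" "pair dl nv:$(hfst p)" by blast
 have "hfst p:$SG" using p(1) by (auto simp: SG_def elts_Gh)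
 hence n: "pair dl nv:$nu" using p elts_nu by blast
 have u: "y = y'" if y: "pair dl y:$nu" "pair dl y':$nu" for y y'
 proof -
  obtain t1 t2 where t: "t1:$SG" "t2:$SG" "pair dl y:$t1" "pair dl y':$t2" using y elts_nu by blast
  obtain A1 A2 where A: "pair t1 A1:G" "pair t2 A2:G" using t SG by blast
  obtain r where r: "r:G" "le r (pair t1 A1)" "le r (pair t2 A2)" using G_dir[OF A] by blast
  obtain s B where rB: "r = pair s B" "s:$St" using G_P[OF r(1)] by (rule PE)
  have "$t1 <= $s" "$t2 <= $s" using r unfolding rB inL by blast+
  hence "pair dl y = pair dl y'" using t(3,4) StD[OF rB(2)] unfolding fnl_def by (metis hfst subsetD)
  thus ?thesis by simp
 qed
 have *: "ap nu dl = nv" by (rule ap_eq) (use n u in blast)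
 show "ap nu dl:$dl" using p(2) * by simp
 show "pair dl y:$nu <-> y = ap nu dl" using n u * by blast
qed

text \<open>Conditions whose side condition misses \<open>W\<close> are dense; below such a
  condition only the points of its stem can belong to \<open>W\<close>.\<close>

lemma nu_avoid: assumes "W:M" "!!dl. dl:$J ==> ~ Lg dl (ap Um dl) (%nv. pair dl nv:$W)"
 shows "finite {dl:$J. pair dl (ap nu dl):$W}"
proof -
 have "EX p:G. ALL z:$(hsnd p). z~:$W"
 proof (rule G_dense)
  show "df (%e. ALL z:$(hsnd (e 0)). z~:$W)" by (intro dfi assms)
  fix p assume "p:$P"
  then obtain t A where p: "p = pair t A" "t:$St" "A:$Sd" by (rule PE)
  define B where "B = Sep A (%z. z~:$W)"
  have BM: "B:M" unfolding B_def by (rule dt_M0) (intro dfi assms, use SdD p in blast)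
  have "B:$Sd"
  proof (rule SdI[OF BM])
   show "$B <= $X0" using SdD[OF p(3)] by (auto simp: B_def)
   fix dl assume dl: "dl:$J"
   interpret m: measure M dl "ap Um dl" by (rule mz[OF dl])
   have AM: "A:M" using SdD p by blast
   have "m.L (%nv. pair dl nv~:$W)" using assms(2)[OF dl] by (subst m.L_not) (intro dfi m.d assms)
   from Sd_sec[OF p(3) dl] this show "m.L (%nv. pair dl nv:$B)"
    by (rule m.L_mono2) (simp add: B_def, (intro dfi m.d AM BM assms(1))+)
  qed
  hence "le (pair t B) p" unfolding p(1) inL inP using p by (auto simp: B_def)
  thus "EX q:$P. le q p & (ALL z:$(hsnd q). z~:$W)" using leP by (intro bexI[of _ "pair t B"]) (auto simp: B_def)
 qed
 then obtain p where p: "p:G" "!!z. z:$(hsnd p) ==> z~:$W" by blast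
 obtain t A where e: "p = pair t A" "t:$St" using G_P[OF p(1)] by (rule PE)
 have "{dl:$J. pair dl (ap nu dl):$W} <= hfst ` $t"
 proof
  fix dl assume "dl:{dl:$J. pair dl (ap nu dl):$W}"
  hence dl: "dl:$J" "pair dl (ap nu dl):$W" by auto
  then obtain t1 where t1: "t1:$SG" "pair dl (ap nu dl):$t1" using nu_fun(2) elts_nu by blast
  then obtain A1 where A1: "pair t1 A1:G" using SG by blast
  obtain r where r: "r:G" "le r p" "le r (pair t1 A1)" using G_dir[OF p(1) A1] by blast
  obtain s B where rB: "r = pair s B" "s:$St" using G_P[OF r(1)] by (rule PE)
  have "$t1 <= $s" "$s - $t <= $A" using r unfolding rB e inL by blast+
  hence "pair dl (ap nu dl):$t \<or> pair dl (ap nu dl):$A" using t1(2) by blast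
  hence "pair dl (ap nu dl):$t" using p(2) dl(2) e by auto
  thus "dl:hfst ` $t" by force
 qed
 thus ?thesis using StD[OF e(2)] finite_surj by blast
qed

end

section \<open>Adding a function that is finite-to-one on countable ground sets\<close>

abbreviation uni :: "hc => hc => hc" where "uni a b \<equiv> UU (Upr a b)"
abbreviation hdom :: "hc => hc" where "hdom q \<equiv> Img q hfst"

lemma fun_onD: "fun_on q g ==> z:$q ==> z = pair (hfst z) (ap q (hfst z)) & hfst z:$g"
proof -
 assume f: "fun_on q g" and z: "z:$q"
 obtain x y where x: "z = pair x y" "x:$g" using f z unfolding fun_on_def by blast
 thus ?thesis using fun_on_ap[OF f x(2), of y] z by simp
qed

lemma hdom_fun: "fun_on q g ==> hdom q = g"
proof (rule hc_eqI)
 assume f: "fun_on q g"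
 have "x:hfst ` $q" if "x:$g" for x using fun_on_ap[OF f that, of "ap q x"] by force
 thus "$(hdom q) = $g" using fun_onD[OF f] by auto
qed

lemma fun_on_inj: "fun_on q g ==> fun_on q g' ==> g = g'" using hdom_fun by metis

text \<open>\<open>cov\<close> and \<open>bl\<close> isolate what the first extension contributes.
  In \<open>bl\<close> the map \<open>g\<close> distributes \<theta> tasks along \<open>J\<close>,
  the points \<open>x dl\<close> interleave with \<open>J\<close> below an ordinal \<open>d\<close>
  closed under successor, and a countable ground set contains \<open>x dl\<close> for only finitely
  many \<open>dl\<close>. The sequence \<open>cs\<close> witnesses that \<open>K\<close> has
  cofinality omega.\<close>

locale qf = exts M N for M N +
 fixes K K' cs
 assumes GM: "GCH M" and GN: "GCH N" and Cp: "!!mm. M.Card mm ==> N.Card mm"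
  and KC: "M.Card K" and Kw: "homega:$K" and sK: "is_successor_cardinal M K K'"
  and cs: "cs:M" "!!n. n:$homega ==> ap cs n:$K" "!!a. a:$K ==> EX n:$homega. a:$(ap cs n)"
  and cov: "!!S b. S:M ==> b:N ==> (!!s. s:$S ==> ap b s:$K') ==>
   EX B:M. ALL s:$S. ap B s:$K' & $(ap b s) <= $(ap B s)"
  and bl: "!!th. th:$K ==> EX d:$K. EX J:N. EX x:N. EX g:N. $J <= $d & (ALL ze:$d. hsucc ze:$d) & $th = ap g ` $J &
   (ALL dl:$J. ap x dl:$dl & (ALL dl':$J. dl':$dl --> dl':$(hsucc (ap x dl)))) &
   (ALL I:M. $I <= $d & M.lep I homega --> finite {dl:$J. ap x dl:$I})"
begin

lemma KM: "K:M" "Ord K" using KC M.Card_M M.Card_Ord by auto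
lemma K'C: "M.Card K'" "K:$K'" using sK by (auto simp: is_successor_cardinal_def)
lemma K'M: "K':M" "Ord K'" using K'C M.Card_M M.Card_Ord by auto
lemma KN: "K:N" "K':N" using KM K'M sub by auto
lemma KI: "M.InfO K" unfolding M.InfO_def using KM Kw Ord_trans[OF KM(2) Kw] by auto
lemma K_K': "a:$K ==> a:$K'" using Ord_trans[OF K'M(2) K'C(2)] .
lemma elK': "a:$K' ==> a:M & Ord a" using M.trans[OF K'M(1)] Ord_in[OF K'M(2)] by auto
lemma sup_K': "X:M ==> $X <= $K' ==> M.lep X K ==> UU X:$K'" by (rule M.succ_sup[OF sK KI])
lemma uni_K': assumes "a:$K'" "b:$K'" shows "uni a b:$K'"
 by (rule sup_K') (use assms elK' in "auto intro: M.Upr_M M.lep_Upr KI")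
lemma suc_K': assumes "a:$K'" shows "hsucc a:$K'"
proof (rule ccontr)
 assume n: "hsucc a~:$K'"
 have O: "Ord (hsucc a)" using Ord_hsucc elK' assms by blast
 have "$K' <= $(hsucc a)" using n Ord_not_sub[OF K'M(2) O] by blast
 hence "M.lep K' (hsucc a)" by (intro M.lep_subset K'M)
 moreover have "M.lep (hsucc a) (hsucc K)"
 proof -
  have aK: "M.lep a K" by (rule M.succ_lep[OF sK KM(2,1) assms])
  then obtain i where i: "i:M" "inj_into i a K" by (auto simp: M.lep_iff)
  show ?thesis
  proof (rule M.lepI[where F="%z. if z = a then K else ap i z"])
   show "hsucc a:M" using M.hsucc_M elK' assms by blast
   show "M.dt (%e. if e 0 = a then K else ap i (e 0))" by (intro M.dfi KM i conjunct1[OF elK'[OF assms]])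
   show "inj_on (%z. if z = a then K else ap i z) ($(hsucc a))"
    using i(2) unfolding inj_on_def inj_into_def by (auto split: if_splits)
   show "(if z = a then K else ap i z):$(hsucc K)" if "z:$(hsucc a)" for z
    using that i(2) unfolding inj_into_def by auto
  qed
 qed
 moreover have "M.lep (hsucc K) K" by (rule M.lep_hsucc[OF KM]) (use KI in "simp add: M.InfO_def")
 ultimately have "M.lep K' K" using M.lep_trans[OF M.lep_trans] K'M(1) by blast
 thus False using M.succ_not_lep[OF sK] by blast
qed

definition ctb where "ctb = Sep (hPow M K') (%I. M.lep I homega)"
lemma ctb: "I:$ctb <-> I:M & $I <= $K' & M.lep I homega" by (auto simp: ctb_def)
lemma ctb_M: "ctb:M" unfolding ctb_def by (rule M.dt_M0) (intro M.dfi K'M M.homega_M)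
lemma ctb_N: "ctb:N" using ctb_M sub by blast

definition Q where "Q = Sep (hPow N (Prod K' (Prod K K))) (%q. (EX ga:$K'. fun_on q ga) &
 (ALL I:$ctb. ALL v:$(Prod K K). finite ($(Sep I (%al. pair al v:$q)))))"
lemma Q_N: "Q:N" unfolding Q_def by (rule N.dt_M0) (intro N.dfi KN ctb_N)
definition QL where "QL = Sep (Prod Q Q) (%z. $(hsnd z) <= $(hfst z))"
lemma QL_N: "QL:N" unfolding QL_def by (rule N.dt_M0) (intro N.dfi Q_N)
lemma QL: "pair p q:$QL <-> p:$Q & q:$Q & $q <= $p" by (auto simp: QL_def)

lemma QD: assumes "q:$Q"
 shows "q:N" "$q <= $(Prod K' (Prod K K))" "hdom q:$K'" "fun_on q (hdom q)"
  "!!I v. I:M ==> $I <= $K' ==> M.lep I homega ==> v:$(Prod K K) ==> finite {al:$I. pair al v:$q}"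
proof -
 obtain ga where g: "ga:$K'" "fun_on q ga" using assms by (auto simp: Q_def)
 show "hdom q:$K'" "fun_on q (hdom q)" using g hdom_fun[OF g(2)] by auto
 show "q:N" "$q <= $(Prod K' (Prod K K))" using assms by (auto simp: Q_def)
 fix I v assume "I:M" "$I <= $K'" "M.lep I homega" "v:$(Prod K K)"
 thus "finite {al:$I. pair al v:$q}" using assms ctb unfolding Q_def by (simp del: elts_Prod)
qed
lemma QI: assumes "q:N" "fun_on q ga" "ga:$K'" "!!al. al:$ga ==> ap q al:$(Prod K K)"
  "!!I v. I:M ==> $I <= $K' ==> M.lep I homega ==> v:$(Prod K K) ==> finite {al:$I. pair al v:$q}"
 shows "q:$Q"
proof -
 have "$q <= $(Prod K' (Prod K K))"
 proof
  fix z assume "z:$q"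
  hence z: "z = pair (hfst z) (ap q (hfst z))" "hfst z:$ga" using fun_onD[OF assms(2)] by auto
  have "hfst z:$K'" using Ord_trans[OF K'M(2) assms(3) z(2)] .
  thus "z:$(Prod K' (Prod K K))" using z(1) assms(4)[OF z(2)] elts_Prod by blast
 qed
 thus ?thesis using assms ctb unfolding Q_def by (auto simp del: elts_Prod)
qed
lemma Q_dom: "q:$Q ==> pair al v:$q <-> al:$(hdom q) & v = ap q al"
 using QD(4)[of q] fun_on_ap[of q "hdom q"] fun_onD[of q "hdom q" "pair al v"] by (metis hfst)
lemma Q_val: "q:$Q ==> al:$(hdom q) ==> ap q al:$(Prod K K)"
 using QD(2)[of q] Q_dom[of q al "ap q al"] by auto

lemma hempty_Q: "hempty:$Q"
proof (rule QI[where ga=hempty])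
 show "hempty:N" "fun_on hempty hempty" using N.hempty_M by (auto simp: fun_on_def)
 have "hempty:$homega" using elts_homega hnat.simps(1) by (metis rangeI)
 thus "hempty:$K'" using K_K' Ord_trans[OF KM(2) Kw] by blast
qed auto

lemma Q_notion: "forcing_notion $Q (%p q. pair p q:$QL)"
 unfolding forcing_notion_def QL
proof (intro conjI)
 show "EX t:$Q. ALL p:$Q. p:$Q & t:$Q & $t <= $p" using hempty_Q elts_hempty by blast
qed blast+

lemma hinj: obtains h where "h:M" "!!ga. ga:$K' ==> inj_into (ap h ga) ga K"
proof -
 have R: "M.df (%e. inj_into (e (Suc 0)) (e 0) K)" by (intro M.dfi KM)
 have ex: "EX i:M. inj_into i ga K" if "ga:$K'" for ga
  using M.succ_lep[OF sK KM(2,1) that] by (auto simp: M.lep_iff)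
 obtain f where "f:M" "fun_on f K'" "!!ga. ga:$K' ==> inj_into (ap f ga) ga K & ap f ga:M"
  by (rule M.AC[OF K'M(1) R ex], assumption) (rule that)
 thus ?thesis using that by blast
qed

end

section \<open>Performing fewer than K tasks along the blocks\<close>

locale qrun = qf M N K K' cs for M N K K' cs +
 fixes d J x g th q0 c h and D :: "hc => hc => bool"
 assumes d: "d:$K" "!!ze. ze:$d ==> hsucc ze:$d"
  and NN: "J:N" "x:N" "g:N" "c:N" and J: "$J <= $d"
  and x: "!!dl. dl:$J ==> ap x dl:$dl" "!!dl dl'. dl:$J ==> dl':$J ==> dl':$dl ==> dl':$(hsucc (ap x dl))"
  and xfin: "!!I. I:M ==> $I <= $d ==> M.lep I homega ==> finite {dl:$J. ap x dl:$I}"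
  and g: "!!dl. dl:$J ==> ap g dl:$th" and q0: "q0:$Q"
  and pick: "!!i q. i:$th ==> q:$Q ==> $q0 <= $q ==>
   ap c (pair i q):$Q & $q <= $(ap c (pair i q)) & D i (ap c (pair i q))"
  and h: "h:M" "!!ga. ga:$K' ==> inj_into (ap h ga) ga K"
begin

lemma dO: "Ord d" "d:M" "d:N" using Ord_in[OF KM(2) d(1)] M.trans[OF KM(1) d(1)] sub by auto
lemma JO: "dl:$J ==> Ord dl & dl:$d" using J Ord_in[OF dO(1)] by blast
lemma dE: "ze:$d ==> Ord ze & ze:M & ze:$K"
 using Ord_in[OF dO(1)] M.trans[OF dO(2)] Ord_trans[OF KM(2) d(1)] by blast
lemma xd: "dl:$J ==> ap x dl:$d" using x(1) JO Ord_trans[OF dO(1)] by blast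
lemma x_mono: assumes "dl:$J" "dl':$J" "dl':$dl" shows "ap x dl':$(ap x dl)" "hsucc (ap x dl'):$(hsucc (ap x dl))"
proof -
 have O: "Ord (ap x dl)" "Ord (ap x dl')" using xd dE assms by auto
 show 1: "ap x dl':$(ap x dl)" using x(1)[OF assms(2)] x(2)[OF assms] Ord_trans[OF O(1)] by auto
 hence "$(hsucc (ap x dl')) <= $(ap x dl)" using Ord_trans[OF O(1)] by auto
 thus "hsucc (ap x dl'):$(hsucc (ap x dl))" using Ord_subset[OF Ord_hsucc[OF O(2)] O(1)] by auto
qed
lemma x_inj: assumes "dl:$J" "dl':$J" "ap x dl = ap x dl'" shows "dl = dl'"
 using Ord_linear[of dl dl'] JO assms x_mono(1)[of dl dl'] x_mono(1)[of dl' dl] not_mem_self by metis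

text \<open>\<open>xi e al\<close> is the index of the first bound \<open>e(ze)\<close> above
  \<open>al\<close>. The filler \<open>fl\<close> pairs it with the image of \<open>al\<close> under
  a fixed injection of that bound into \<open>K\<close>, and is therefore injective in
  \<open>al\<close>.\<close>

definition xi where "xi e al = UU (Sep d (%ze. al:$(ap e ze) & (ALL ze':$ze. al~:$(ap e ze'))))"
definition fl where "fl e al = pair (xi e al) (ap (ap h (ap e (xi e al))) al)"
definition exq where "exq u e ga = lam ga (%al. if al:$(hdom u) then ap u al else fl e al)"
definition XE where "XE z = Img (Sep J (%dl. dl:$(hsnd z))) (%dl. pair (hfst z) dl)"
text \<open>The step at \<open>z = (e, dl)\<close>: join \<open>q0\<close> with the earlier results,
  fill up to \<open>e(x dl)\<close>, and let \<open>c\<close> perform the task \<open>g dl\<close>.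
  The sequence of bounds is an argument of the recursion, so the step can be evaluated at initial
  segments before the sequence is complete.\<close>

definition RH where "RH z f = ap c (pair (ap g (hsnd z)) (exq (uni q0 (UU (Img (XE z) (ap f)))) (hfst z) (ap (hfst z) (ap x (hsnd z)))))"
definition RR where "RR = wfrec {(w, z). w:$(XE z)} (%f z. RH z (lam (XE z) f))"
definition UZ where "UZ e Z = uni q0 (UU (Img Z (%dl. RR (pair e dl))))"
abbreviation below where "below dl \<equiv> Sep J (%dl'. dl':$dl)"
definition T where "T e dl = exq (UZ e (below dl)) e (ap e (ap x dl))"

lemma wf_XE: "wf {(w, z). w:$(XE z)}"
 by (rule wf_subset[OF wf_inv_image[OF wf_elts, of hsnd]]) (auto simp: XE_def inv_image_def)
lemma RH_cong: "(!!w. w:$(XE z) ==> F w = F' w) ==> RH z (lam (XE z) F) = RH z (lam (XE z) F')"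
 using lam_cong[of "XE z" F F'] by simp
lemma RR: "RR z = RH z (lam (XE z) RR)"
 unfolding RR_def by (subst wfrec[OF wf_XE], rule RH_cong) (simp add: cut_apply)

lemma q0N: "q0:N" using QD(1)[OF q0] .
lemma hN: "h:N" using h sub by blast

lemma dt_xi: "N.dt s ==> N.dt t ==> N.dt (%e. xi (s e) (t e))"
 by (rule N.dt_app2[where F=xi]) (unfold xi_def, intro N.dfi dO)
lemma dt_fl: "N.dt s ==> N.dt t ==> N.dt (%e. fl (s e) (t e))"
 by (rule N.dt_app2[where F=fl]) (unfold fl_def, intro N.dfi dt_xi hN)
lemma dt_exq: "N.dt s ==> N.dt t ==> N.dt u ==> N.dt (%e. exq (s e) (t e) (u e))"
 by (rule N.dt_app3[where F=exq]) (unfold exq_def, intro N.dfi dt_fl)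
lemma dt_RR: "N.dt t ==> N.dt (%e. RR (t e))"
proof -
 have "tmrec N XE RH RR"
 proof unfold_locales
  show "N.dt (%e. XE (e 0))" unfolding XE_def by (intro N.dfi NN)
  hence dX: "N.dt t ==> N.dt (%e. XE (t e))" for t by (rule N.dt_app1)
  show "N.dt (%e. RH (e 0) (e (Suc 0)))" unfolding RH_def by (intro N.dfi dt_exq dX NN q0N)
 qed (rule wf_XE RR)+
 thus "N.dt t ==> N.dt (%e. RR (t e))" by (rule tmrec.dt_F)
qed
lemma dt_UZ: "N.dt s ==> N.dt t ==> N.dt (%e. UZ (s e) (t e))"
 by (rule N.dt_app2[where F=UZ]) (unfold UZ_def, intro N.dfi dt_RR q0N)

lemma RR_eq: "RR (pair e dl) = ap c (pair (ap g dl) (T e dl))"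
proof -
 have "Img (XE (pair e dl)) (ap (lam (XE (pair e dl)) RR)) = Img (XE (pair e dl)) RR"
  by (rule Img_cong) simp
 also have "\<dots> = Img (below dl) (%dl. RR (pair e dl))" by (rule hc_eqI) (auto simp: XE_def)
 finally show ?thesis by (subst RR) (simp add: RH_def T_def UZ_def)
qed

lemma xi: assumes "ze0:$d" "al:$(ap e ze0)"
 shows "xi e al:$(hsucc ze0)" "al:$(ap e (xi e al))"
  "!!ze. ze:$d ==> al:$(ap e ze) ==> (!!ze'. ze':$ze ==> al~:$(ap e ze')) ==> xi e al = ze"
proof -
 have O: "Ord ze0" using dE assms by blast
 obtain ze where z: "ze:$(hsucc ze0)" "al:$(ap e ze)" "!!c. c:$ze ==> ~ (c:$(hsucc ze0) & al:$(ap e c))"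
  using Ord_least[of "%ze. ze:$(hsucc ze0) & al:$(ap e ze)" ze0] O assms(2) by auto
 have zO: "Ord ze" using Ord_in[OF Ord_hsucc[OF O] z(1)] .
 have zd: "ze:$d" using z(1) Ord_trans[OF dO(1) assms(1)] assms(1) by auto
 have l: "al~:$(ap e ze')" if "ze':$ze" for ze' using z(3)[OF that] Ord_trans[OF Ord_hsucc[OF O] z(1) that] by blast
 have u: "ze1 = ze2" if "ze1:$d" "ze2:$d" "al:$(ap e ze1)" "al:$(ap e ze2)"
  "ALL ze':$ze1. al~:$(ap e ze')" "ALL ze':$ze2. al~:$(ap e ze')" for ze1 ze2
  using Ord_linear[of ze1 ze2] dE that by blast
 have e: "xi e al = ze1" if "ze1:$d" "al:$(ap e ze1)" "!!ze'. ze':$ze1 ==> al~:$(ap e ze')" for ze1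
  unfolding xi_def by (rule UU_single) (use that u in auto)
 show "xi e al:$(hsucc ze0)" "al:$(ap e (xi e al))" using e[OF zd z(2) l] z by auto
 show "!!ze. ze:$d ==> al:$(ap e ze) ==> (!!ze'. ze':$ze ==> al~:$(ap e ze')) ==> xi e al = ze" by (rule e)
qed

lemma xi_local: assumes "ze0:$d" "al:$(ap e ze0)" "!!ze. ze:$(hsucc ze0) ==> ap s ze = ap e ze"
 shows "fl s al = fl e al"
proof -
 have O: "Ord ze0" using dE assms by blast
 have as: "al:$(ap s ze0)" using assms by simp
 note e = xi[OF assms(1,2)] and s = xi[OF assms(1) as]
 have "xi e al:$d" using e(1) Ord_trans[OF dO(1) assms(1)] assms(1) by auto
 have "xi s al = xi e al"
 proof (rule s(3))
  show "al:$(ap s (xi e al))" using e(1,2) assms(3) by simp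
  fix ze' assume x: "ze':$(xi e al)"
  hence x': "ze':$(hsucc ze0)" using Ord_trans[OF Ord_hsucc[OF O] e(1)] by blast
  show "al~:$(ap s ze')"
  proof
   assume "al:$(ap s ze')"
   hence a: "al:$(ap e ze')" using assms(3) x' by simp
   have d': "ze':$d" using x' Ord_trans[OF dO(1) assms(1)] assms(1) by auto
   have "xi e al:$(hsucc ze')" using xi(1)[OF d' a] .
   thus False using x Ord_trans[of ze' "xi e al" ze'] dE[OF d'] not_mem_self by (metis elts_hsucc insertE)
  qed
 qed fact
 thus ?thesis unfolding fl_def using assms(3)[OF e(1)] by simp
qed

text \<open>The step at \<open>dl\<close> consults the bounds only up to \<open>x dl\<close>, as
  earlier points are smaller. This resolves a circle: the bounds must exceed the domains produced,
  and the domains depend on the bounds.\<close>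

lemma RR_local: assumes "dl:$J" "!!ze. ze:$(hsucc (ap x dl)) ==> ap s ze = ap e ze"
 shows "RR (pair s dl) = RR (pair e dl)"
 using assms
proof (induction dl rule: wf_elts_induct)
 case (step dl)
 have O: "Ord (ap x dl)" using xd dE step.prems by blast
 have "RR (pair s dl') = RR (pair e dl')" if b: "dl':$(below dl)" for dl'
 proof (rule step.IH)
  show "dl':$dl" "dl':$J" using b by auto
  fix ze assume "ze:$(hsucc (ap x dl'))"
  hence "ze:$(hsucc (ap x dl))" using x_mono(2)[OF step.prems(1)] b Ord_trans[OF Ord_hsucc[OF O]] unfolding elts_Sep by blast
  thus "ap s ze = ap e ze" by (rule step.prems(2))
 qed
 hence U: "UZ s (below dl) = UZ e (below dl)" unfolding UZ_def by (metis (no_types, lifting) Img_cong)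
 have "T s dl = T e dl" unfolding T_def U exq_def step.prems(2)[of "ap x dl", simplified]
 proof (rule lam_cong)
  fix al assume "al:$(ap e (ap x dl))"
  hence "fl s al = fl e al" by (rule xi_local[OF xd[OF step.prems(1)]]) (rule step.prems(2))
  thus "(if al:$(hdom (UZ e (below dl))) then ap (UZ e (below dl)) al else fl s al) =
   (if al:$(hdom (UZ e (below dl))) then ap (UZ e (below dl)) al else fl e al)" by simp
 qed
 thus ?case by (simp add: RR_eq)
qed

end

locale qrune = qrun +
 fixes e assumes e: "e:M" "!!ze. ze:$d ==> ap e ze:$K'"
  and e_mono: "!!ze ze'. ze:$d ==> ze':$ze ==> ap e ze':$(ap e ze)"
  and e_q0: "!!ze. ze:$d ==> $(hdom q0) <= $(ap e ze)"
  and e_bnd: "!!dl. dl:$J ==> RR (pair e dl):$Q ==> $(hdom (RR (pair e dl))) <= $(ap e (hsucc (ap x dl)))"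
begin

abbreviation "R dl \<equiv> RR (pair e dl)"
definition ok where "ok dl <-> R dl:$Q & $(T e dl) <= $(R dl) & $(UZ e (below dl)) <= $(T e dl) & D (ap g dl) (R dl)"

lemma elts_UZ: "$(UZ e Z) = $q0 \<union> (\<Union>dl\<in>$Z. $(R dl))" by (auto simp: UZ_def)
lemma eN: "e:N" using e sub by blast
lemma e_sub: "ze:$d ==> ze':$(hsucc ze) ==> $(ap e ze') <= $(ap e ze)"
proof -
 assume a: "ze:$d" "ze':$(hsucc ze)"
 have O: "Ord (ap e ze)" using elK'[OF e(2)[OF a(1)]] by blast
 show ?thesis
 proof (cases "ze' = ze")
  case False
  hence "ap e ze':$(ap e ze)" using e_mono[OF a(1)] a(2) by simp
  thus ?thesis using Ord_trans[OF O] by blast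
 qed simp
qed

lemma fl: assumes "ze0:$d" "al:$(ap e ze0)" shows "fl e al:$(Prod K K)"
 "ze1:$d ==> be:$(ap e ze1) ==> fl e al = fl e be ==> al = be"
proof -
 have xd: "xi e al:$d" if "ze0:$d" "al:$(ap e ze0)" for al ze0
  using xi(1)[OF that] Ord_trans[OF dO(1) that(1)] that(1) by auto
 note a = xd[OF assms] xi(2)[OF assms]
 have inj: "inj_into (ap h (ap e (xi e al))) (ap e (xi e al)) K" by (rule h(2)[OF e(2)[OF a(1)]])
 hence "ap (ap h (ap e (xi e al))) al:$K" using a(2) by (auto simp: inj_into_def)
 thus "fl e al:$(Prod K K)" using dE[OF a(1)] unfolding fl_def by auto
 assume b: "ze1:$d" "be:$(ap e ze1)" "fl e al = fl e be"
 hence "xi e be = xi e al" "ap (ap h (ap e (xi e al))) al = ap (ap h (ap e (xi e al))) be" by (auto simp: fl_def)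
 thus "al = be" using inj xi(2)[OF b(1,2)] a(2) unfolding inj_into_def by simp
qed

text \<open>The finiteness of fibres is the point at issue. The indices of the blocks met by a
  countable ground set \<open>I\<close> form a countable set \<open>I'\<close>, which belongs to the
  ground model because \<open>e\<close> does; so \<open>x dl\<close> is in \<open>I'\<close> for
  finitely many \<open>dl\<close> only. Other points of \<open>I\<close> receive their values from
  \<open>q0\<close> or from the injective filler.\<close>

lemma glue:
 assumes Z: "Z:N" "$Z <= $J" "!!dl dl'. dl:$Z ==> dl':$J ==> dl':$dl ==> dl':$Z"
  and ok: "!!dl. dl:$Z ==> ok dl"
  and ga: "ga:$K'" "$(hdom q0) <= $ga" "!!dl. dl:$Z ==> $(ap e (hsucc (ap x dl))) <= $ga"
   "!!al. al:$ga ==> EX ze:$d. al:$(ap e ze)"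
 shows "exq (UZ e Z) e ga:$Q" "$(UZ e Z) <= $(exq (UZ e Z) e ga)"
proof -
 define U where "U = UZ e Z"
 define X where "X = exq U e ga"
 have oQ: "R dl:$Q" if "dl:$Z" for dl using ok[OF that] unfolding ok_def by blast
 have q0R: "$q0 <= $(R dl)" if "dl:$Z" for dl using ok[OF that] elts_UZ unfolding ok_def by blast
 have RR': "$(R dl') <= $(R dl)" if "dl:$Z" "dl':$Z" "dl':$dl" for dl dl'
 proof -
  have "dl':$(below dl)" using that Z(2) by auto
  thus ?thesis using ok[OF that(1)] elts_UZ unfolding ok_def by blast
 qed
 have dir: "EX q:$Q. z:$q & w:$q" if zw: "z:$U" "w:$U" for z w
 proof -
  consider "z:$q0" "w:$q0" | dl where "dl:$Z" "z:$q0" "w:$(R dl)"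
   | dl where "dl:$Z" "w:$q0" "z:$(R dl)" | dl dl' where "dl:$Z" "dl':$Z" "w:$(R dl)" "z:$(R dl')"
   using zw unfolding U_def elts_UZ by blast
  thus ?thesis
  proof cases
   case 4
   hence "dl:$dl' \<or> dl = dl' \<or> dl':$dl" using Ord_linear JO Z(2) by blast
   thus ?thesis using RR' oQ 4 by blast
  qed (use q0 q0R oQ in blast)+
 qed
 have Uf: "y = y'" if yy: "pair al y:$U" "pair al y':$U" for al y y'
 proof -
  obtain q where "q:$Q" "pair al y:$q" "pair al y':$q" using dir[OF yy] by blast
  thus ?thesis using Q_dom by metis
 qed
 have Uap: "ap U al = y" if "pair al y:$U" for al y by (rule ap_eq) (use that Uf in blast)
 have UP: "EX al y. z = pair al y & y:$(Prod K K)" if z: "z:$U" for z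
 proof -
  obtain q where "q:$Q" "z:$q" using dir[OF z z] by blast
  hence "z:$(Prod K' (Prod K K))" using QD(2)[of q] by blast
  thus ?thesis by (subst (asm) elts_Prod) blast
 qed
 have Udom: "al:$(hdom U) <-> (EX y. pair al y:$U)" for al
 proof
  assume "al:$(hdom U)"
  then obtain z where "z:$U" "hfst z = al" by auto
  thus "EX y. pair al y:$U" using UP by (metis hfst)
 qed force
 have Xm: "pair al y:$X <-> al:$ga & (pair al y:$U \<or> (~ (EX y. pair al y:$U) & y = fl e al))" for al y
 proof -
  have "pair al y:$X <-> al:$ga & y = (if al:$(hdom U) then ap U al else fl e al)"
   unfolding X_def exq_def elts_lam image_iff pair_inj by blast
  thus ?thesis using Udom Uap Uf by metis
 qed
 have bd: "pair al y:$(R dl) ==> al:$(ap e (hsucc (ap x dl)))" if "dl:$Z" for al y dl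
  using e_bnd[OF _ oQ[OF that]] Q_dom[OF oQ[OF that]] that Z(2) by blast
 have Ug: "al:$ga" if "pair al y:$U" for al y
  using that bd ga(2,3) Q_dom[OF q0] unfolding U_def elts_UZ by blast
 show sub': "$(UZ e Z) <= $(exq (UZ e Z) e ga)"
 proof
  fix z assume z: "z:$(UZ e Z)"
  then obtain al y where "z = pair al y" using UP U_def by blast
  thus "z:$(exq (UZ e Z) e ga)" using z Ug[of al y] Xm[of al y] unfolding X_def U_def by blast
 qed
 have XN: "X:N" unfolding X_def U_def by (rule N.dt_M0) (intro dt_exq dt_UZ N.dfi eN Z(1) N.trans[OF KN(2) ga(1)])
 have Xf: "fun_on X ga" unfolding X_def exq_def by simp
 show "exq (UZ e Z) e ga:$Q" unfolding U_def[symmetric] X_def[symmetric]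
 proof (rule QI[OF XN Xf ga(1)])
  fix al assume a: "al:$ga"
  hence "pair al (ap X al):$X" using fun_on_ap[OF Xf] by blast
  thus "ap X al:$(Prod K K)" unfolding Xm using UP[of "pair al (ap X al)"] ga(4)[OF a] fl(1) unfolding pair_inj by metis
 next
  fix I v assume I: "I:M" "$I <= $K'" "M.lep I homega" and v: "v:$(Prod K K)"
  define bk where "bk al ze <-> al:$(ap e (hsucc ze)) & al~:$(ap e ze)" for al ze
  define I' where "I' = Sep d (%ze. EX al:$I. bk al ze)"
  have I'M: "I':M" unfolding I'_def bk_def by (rule M.dt_M0) (intro M.dfi dO I e)
  have bku: "ze = ze'" if "bk al ze" "bk al ze'" "ze:$d" "ze':$d" for al ze ze'
  proof -
   have n: False if "ze:$ze'" "bk al ze" "bk al ze'" "ze:$d" "ze':$d" for ze ze'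
   proof -
    have O: "Ord ze" "Ord ze'" using dE that by auto
    have "$(hsucc ze) <= $ze'" using that(1) Ord_trans[OF O(2)] by auto
    hence "hsucc ze:$(hsucc ze')" using Ord_subset[OF Ord_hsucc[OF O(1)] O(2)] by auto
    from e_sub[OF that(5) this] show False using that(2,3) unfolding bk_def by blast
   qed
   thus ?thesis using Ord_linear[of ze ze'] dE that by blast
  qed
  have "M.lep I' I"
  proof (rule M.lep_surj[OF I(1) I'M, where F="%al. UU (Sep d (bk al))"])
   show "M.dt (%e. UU (Sep d (bk (e 0))))" unfolding bk_def by (intro M.dfi dO e)
   show "$I' <= (%al. UU (Sep d (bk al))) ` $I"
   proof
    fix ze assume "ze:$I'"
    then obtain al where a: "al:$I" "ze:$d" "bk al ze" by (auto simp: I'_def)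
    hence "$(Sep d (bk al)) = {ze}" using bku by auto
    hence "UU (Sep d (bk al)) = ze" by (rule UU_single)
    thus "ze:(%al. UU (Sep d (bk al))) ` $I" using a(1) by blast
   qed
  qed
  hence lI': "M.lep I' homega" using M.lep_trans[OF _ I(3) I'M] by blast
  have f1: "finite {dl:$J. ap x dl:$I'}" by (rule xfin[OF I'M _ lI']) (auto simp: I'_def)
  have f2: "finite {al:$I. pair al v:$q}" if "q:$Q" for q by (rule QD(5)[OF that I v])
  have f3: "finite {al:$ga. fl e al = v}"
  proof -
   have s: "al = be" if "al:$ga" "be:$ga" "fl e al = v" "fl e be = v" for al be
    using ga(4)[OF that(1)] ga(4)[OF that(2)] fl(2) that(3,4) by metis
   have "{al:$ga. fl e al = v} = {} \<or> (EX al. {al:$ga. fl e al = v} = {al})"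
   proof (cases "EX al:$ga. fl e al = v")
    case True
    then obtain al where "al:$ga" "fl e al = v" by blast
    hence "{al:$ga. fl e al = v} = {al}" using s by blast
    thus ?thesis by blast
   qed blast
   thus ?thesis by (metis finite.simps)
  qed
  have "{al:$I. pair al v:$X} <= {al:$I. pair al v:$q0} \<union>
   (\<Union>dl\<in>{dl:$J. ap x dl:$I'} \<inter> $Z. {al:$I. pair al v:$(R dl)}) \<union> {al:$ga. fl e al = v}" (is "_ <= ?r")
  proof
   fix al assume "al:{al:$I. pair al v:$X}"
   hence a: "al:$I" "pair al v:$X" by auto
   \<comment> \<open>Descent along \<open>J\<close>: a value at a point below \<open>e(x dl)\<close>
     was present before the task at \<open>dl\<close>, so it stems from an earlier step, from
     \<open>q0\<close>, or from the filler.\<close>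
   have r1: "al:?r" if "dl:$Z" "pair al v:$(R dl)" for dl
    using that
   proof (induction dl rule: wf_elts_induct)
    case (step dl)
    have dJ: "dl:$J" using Z(2) step.prems by blast
    have ag: "al:$ga" using bd[OF step.prems] ga(3)[OF step.prems(1)] by blast
    show ?case
    proof (cases "al:$(ap e (ap x dl))")
     case True
     have Tf: "fun_on (T e dl) (ap e (ap x dl))" by (simp add: T_def exq_def)
     have p1: "pair al (ap (T e dl) al):$(T e dl)" using fun_on_ap[OF Tf True] by blast
     hence "pair al (ap (T e dl) al):$(R dl)" using ok[OF step.prems(1)] unfolding ok_def by blast
     hence vT: "v = ap (T e dl) al" using Q_dom[OF oQ[OF step.prems(1)]] step.prems(2) by metis
     have subU: "$(UZ e (below dl)) <= $(T e dl)" using ok[OF step.prems(1)] unfolding ok_def by blast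
     show ?thesis
     proof (cases "al:$(hdom (UZ e (below dl)))")
      case True
      then obtain z where z: "z:$(UZ e (below dl))" "hfst z = al" by auto
      hence "z = pair al v" using fun_onD[OF Tf, of z] subU vT by blast
      then consider "pair al v:$q0" | dl' where "dl':$J" "dl':$dl" "pair al v:$(R dl')"
       using z(1) unfolding elts_UZ elts_Sep by blast
      thus ?thesis
      proof cases
       case 1 thus ?thesis using a by blast
      next
       case 2 thus ?thesis using step.IH[OF 2(2) _ 2(3)] Z(3)[OF step.prems(1)] by blast
      qed
     next
      case n: False
      have "ap (T e dl) al = fl e al" unfolding T_def exq_def by (subst ap_lam[OF True], subst if_not_P[OF n], rule refl)
      hence "fl e al = v" unfolding vT by (rule sym)
      thus ?thesis using ag by (intro UnI2 CollectI conjI)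
     qed
    next
     case False
     hence "bk al (ap x dl)" using bd[OF step.prems] unfolding bk_def by blast
     hence "ap x dl:$I'" using a xd[OF dJ] by (auto simp: I'_def)
     thus ?thesis using a dJ step.prems by blast
    qed
   qed
   show "al:?r"
   proof (cases "EX y. pair al y:$U")
    case True
    hence "pair al v:$U" using a(2) Xm by blast
    thus ?thesis using a(1) r1 unfolding U_def elts_UZ by blast
   next
    case False
    hence "al:$ga" "fl e al = v" using a(2) Xm[of al v] by simp_all
    thus ?thesis by (intro UnI2 CollectI conjI)
   qed
  qed
  moreover have "finite ?r"
  proof -
   have "finite (\<Union>dl\<in>{dl:$J. ap x dl:$I'} \<inter> $Z. {al:$I. pair al v:$(R dl)})"
    by (rule finite_UN_I) (use f1 f2 oQ in auto)
   thus ?thesis using f2[OF q0] f3 by blast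
  qed
  ultimately show "finite {al:$I. pair al v:$X}" by (rule finite_subset)
 qed
qed

lemma all_ok: "dl:$J ==> ok dl"
proof (induction dl rule: wf_elts_induct)
 case (step dl)
 have dN: "dl:N" using N.trans[OF NN(1) step.prems] .
 have BN: "below dl:N" by (rule N.dt_M0) (intro N.dfi NN dN)
 have xe: "ap x dl:$d" by (rule xd[OF step.prems])
 have ga: "ap e (hsucc (ap x dl')):$(hsucc (ap e (ap x dl)))" if "dl':$(below dl)" for dl'
  using that x_mono(2)[OF step.prems, of dl'] e_mono[OF xe, of "hsucc (ap x dl')"] by auto
 have g1: "$(ap e (hsucc (ap x dl'))) <= $(ap e (ap x dl))" if "dl':$(below dl)" for dl'
  using ga[OF that] Ord_trans[of "ap e (ap x dl)"] elK'[OF e(2)[OF xe]] by auto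
 have TQ: "T e dl:$Q" "$(UZ e (below dl)) <= $(T e dl)"
  unfolding T_def
 proof (atomize (full), intro conjI)
  have c1: "$(below dl) <= $J" by auto
  have O: "Ord dl" using JO step.prems by blast
  have c2: "b:$(below dl)" if "a:$(below dl)" "b:$J" "b:$a" for a b
   using that Ord_trans[OF O] by auto
  have c3: "ok a" if "a:$(below dl)" for a using that step.IH by auto
  have c4: "EX ze:$d. al:$(ap e ze)" if "al:$(ap e (ap x dl))" for al using that xe by blast
  show "exq (UZ e (below dl)) e (ap e (ap x dl)):$Q"
   by (rule glue(1)[OF BN c1 c2 c3 e(2)[OF xe] e_q0[OF xe] g1 c4])
  show "$(UZ e (below dl)) <= $(exq (UZ e (below dl)) e (ap e (ap x dl)))"
   by (rule glue(2)[OF BN c1 c2 c3 e(2)[OF xe] e_q0[OF xe] g1 c4])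
 qed
 have "$q0 <= $(T e dl)" using TQ(2) elts_UZ by blast
 note p = pick[OF g[OF step.prems] TQ(1) this]
 show ?case unfolding ok_def RR_eq using p TQ by (simp add: RR_eq)
qed

lemma final: "EX q:$Q. $q0 <= $q & (ALL dl:$J. EX r:$Q. D (ap g dl) r & $r <= $q)"
proof -
 define ga where "ga = uni (hdom q0) (UU (Img d (ap e)))"
 have XM: "Img d (ap e):M" by (rule M.dt_M0) (intro M.dfi dO e)
 have "M.lep (Img d (ap e)) d"
  by (rule M.lep_surj[OF dO(2) XM, where F="ap e"]) (intro M.dfi e, simp)
 hence "M.lep (Img d (ap e)) K" using M.lep_trans[OF _ M.lep_subset[OF dO(2)] XM] Ord_trans[OF KM(2) d(1)] by blast
 hence "UU (Img d (ap e)):$K'" by (intro sup_K' XM) (use e in auto)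
 hence ga: "ga:$K'" unfolding ga_def using uni_K' QD(3)[OF q0] by blast
 show ?thesis
 proof (cases "$J = {}")
  case True thus ?thesis using q0 by blast
 next
  case False
  then obtain ze0 where ze0: "ze0:$d" using J by blast
  have G: "exq (UZ e J) e ga:$Q" "$(UZ e J) <= $(exq (UZ e J) e ga)"
  proof (atomize (full), intro conjI)
   have c: "$(ap e (hsucc (ap x dl))) <= $ga" if "dl:$J" for dl unfolding ga_def using d(2)[OF xd[OF that]] by auto
   have c2: "EX ze:$d. al:$(ap e ze)" if "al:$ga" for al using that e_q0[OF ze0] ze0 unfolding ga_def by auto
   have c1: "$(hdom q0) <= $ga" by (auto simp: ga_def)
   show "exq (UZ e J) e ga:$Q" by (rule glue(1)[OF NN(1) order_refl _ all_ok ga c1 c c2])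
   show "$(UZ e J) <= $(exq (UZ e J) e ga)" by (rule glue(2)[OF NN(1) order_refl _ all_ok ga c1 c c2])
  qed
  thus ?thesis using all_ok elts_UZ unfolding ok_def by blast
 qed
qed

end

context qf begin

lemma distrib:
 assumes th: "th:$K" and D: "N.df (%e. D (e 0) (e (Suc 0)))" and q0: "q0:$Q"
  and dense: "!!i q. i:$th ==> q:$Q ==> $q0 <= $q ==> EX q':$Q. $q <= $q' & D i q'"
  and opn: "!!i q r. q:$Q ==> r:$Q ==> $r <= $q ==> D i r ==> D i q"
 shows "EX q:$Q. $q0 <= $q & (ALL i:$th. D i q)"
proof -
 note [N.dfi] = N.df_app2[where P=D, OF D]
 have thN: "th:N" using N.trans[OF KN(1) th] .
 obtain d J x g where d: "d:$K" "!!ze. ze:$d ==> hsucc ze:$d" and NN: "J:N" "x:N" "g:N" and J: "$J <= $d"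
  and g: "$th = ap g ` $J"
  and x: "!!dl. dl:$J ==> ap x dl:$dl" "!!dl dl'. dl:$J ==> dl':$J ==> dl':$dl ==> dl':$(hsucc (ap x dl))"
  and xfin: "!!I. I:M ==> $I <= $d ==> M.lep I homega ==> finite {dl:$J. ap x dl:$I}"
 proof -
  from bl[OF th] obtain d J x g where 1: "d:$K" "J:N" "x:N" "g:N" and 2: "$J <= $d & (ALL ze:$d. hsucc ze:$d) & $th = ap g ` $J &
   (ALL dl:$J. ap x dl:$dl & (ALL dl':$J. dl':$dl --> dl':$(hsucc (ap x dl)))) &
   (ALL I:M. $I <= $d & M.lep I homega --> finite {dl:$J. ap x dl:$I})" by (elim bexE)
  show ?thesis by (rule that[OF 1(1) _ 1(2-4)]) (use 2 in blast)+
 qed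
 define R where "R w q' <-> q':$Q & ($q0 <= $(hsnd w) --> $(hsnd w) <= $q' & D (hfst w) q')" for w q'
 have q0N: "q0:N" using QD(1)[OF q0] .
 have dR: "N.df (%e. R (e 0) (e (Suc 0)))" unfolding R_def by (intro N.dfi Q_N q0N)
 have ex: "EX y:N. R w y" if w: "w:$(Prod th Q)" for w
 proof -
  obtain i q where iq: "w = pair i q" "i:$th" "q:$Q" using w by auto
  show ?thesis
  proof (cases "$q0 <= $q")
   case True
   then obtain q' where "q':$Q" "$q <= $q'" "D i q'" using dense iq by blast
   thus ?thesis using QD(1)[of q'] unfolding R_def iq hfst hsnd by blast
  next
   case False
   thus ?thesis using q0 q0N unfolding R_def iq hfst hsnd by blast
  qed
 qed
 have PN: "Prod th Q:N" by (intro N.Prod_M thN Q_N)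
 obtain c where c: "c:N" "fun_on c (Prod th Q)" "!!w. w:$(Prod th Q) ==> R w (ap c w) & ap c w:N"
  by (rule N.AC[OF PN dR ex], assumption) (rule that)
 have pick: "ap c (pair i q):$Q & $q <= $(ap c (pair i q)) & D i (ap c (pair i q))"
  if "i:$th" "q:$Q" "$q0 <= $q" for i q
 proof -
  have "pair i q:$(Prod th Q)" using that by auto
  thus ?thesis using c(3)[of "pair i q"] that(3) unfolding R_def hfst hsnd by blast
 qed
 obtain h where h: "h:M" "!!ga. ga:$K' ==> inj_into (ap h ga) ga K" by (rule hinj) (rule that)
 interpret r: qrun M N K K' cs d J x g th q0 c h D
 proof unfold_locales
  show "!!dl. dl:$J ==> ap g dl:$th" using g by blast
 qed (fact d NN c(1) J x xfin q0 pick h)+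
 define ga0 where "ga0 = hdom q0"
 have ga0: "ga0:$K'" unfolding ga0_def by (rule QD(3)[OF q0])
 have ga0M: "ga0:M" using elK' ga0 by blast
 \<comment> \<open>\<open>S\<close> holds the ground sequences of length below \<open>d\<close>, the
   candidates for initial segments of the bounds. For \<open>s\<close> of length
   \<open>x dl + 1\<close> the ordinal \<open>b s\<close> is the domain produced at
   \<open>dl\<close>, and \<open>dl\<close> is unique as \<open>x\<close> is injective. The ground
   function \<open>B\<close> from \<open>cov\<close> dominates \<open>b\<close>, so bounds
   \<open>E\<close> dominating these domains can be defined by recursion in the ground
   model.\<close>
 define S where "S = Sep (hPow M (Prod d K')) (%s. EX \<eta>:$d. fun_on s \<eta>)"
 have SM: "S:M" unfolding S_def by (rule M.dt_M0) (intro M.dfi r.dO K'M)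
 have SN: "S:N" using SM sub by blast
 define bb where "bb s = Sep J (%dl. fun_on s (hsucc (ap x dl)) & r.RR (pair s dl):$Q)" for s
 define b where "b = lam S (%s. UU (Img (bb s) (%dl. hdom (r.RR (pair s dl)))))"
 have bN: "b:N" unfolding b_def bb_def by (rule N.dt_M0) (intro N.dfi r.dt_RR SN NN Q_N)
 have bu: "dl = dl'" if "dl:$(bb s)" "dl':$(bb s)" for s dl dl'
 proof -
  have "dl:$J" "dl':$J" "fun_on s (hsucc (ap x dl))" "fun_on s (hsucc (ap x dl'))" using that by (auto simp: bb_def)
  thus ?thesis using r.x_inj fun_on_inj hsucc_inj by blast
 qed
 have b1: "ap b s = hdom (r.RR (pair s dl))" if "s:$S" "dl:$(bb s)" for s dl
 proof -
  have "$(Img (bb s) (%dl. hdom (r.RR (pair s dl)))) = {hdom (r.RR (pair s dl))}" using bu that(2) unfolding elts_Img by blast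
  thus ?thesis unfolding b_def ap_lam[OF that(1)] by (rule UU_single)
 qed
 have bK: "ap b s:$K'" if s: "s:$S" for s
 proof (cases "$(bb s) = {}")
  case True
  hence "ap b s = hempty" unfolding b_def ap_lam[OF s] by (intro hc_eqI) simp
  moreover have "hdom hempty = hempty" by (rule hc_eqI) simp
  ultimately show ?thesis using QD(3)[OF hempty_Q] by simp
 next
  case False
  then obtain dl where dl: "dl:$(bb s)" by blast
  hence "r.RR (pair s dl):$Q" by (simp add: bb_def)
  thus ?thesis unfolding b1[OF s dl] by (rule QD(3))
 qed
 obtain B where B: "B:M" "!!s. s:$S ==> ap B s:$K'" "!!s. s:$S ==> $(ap b s) <= $(ap B s)"
  using cov[OF SM bN bK] by blast
 define H where "H ze f = uni (UU (Img ze (%ze'. hsucc (ap f ze')))) (uni (ap B f) ga0)" for ze f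
 have dH: "M.dt (%e. H (e 0) (e (Suc 0)))" unfolding H_def by (intro M.dfi B ga0M)
 obtain E where E: "!!ze. E ze = H ze (lam ze E)" and dtE: "!!t. M.dt t ==> M.dt (%e. E (t e))"
  by (rule M.mrec[OF dH]) (rule that)
 have eE: "$(E ze) = (\<Union>ze'\<in>$ze. insert (E ze') ($(E ze'))) \<union> $(ap B (lam ze E)) \<union> $ga0" for ze
  by (subst E) (auto simp: H_def)
 have inS: "lam ze E:$S" if "ze:$d" "!!ze'. ze':$ze ==> E ze':$K'" for ze
 proof -
  have "lam ze E:M" by (rule M.dt_M0) (intro M.dt_lam dtE M.dfi conjunct1[OF conjunct2[OF r.dE[OF that(1)]]])
  moreover have "$(lam ze E) <= $(Prod d K')" using that Ord_trans[OF r.dO(1) that(1)] by auto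
  ultimately show ?thesis using that(1) unfolding S_def by (simp del: elts_Prod elts_lam) (blast intro: fun_on_lam)
 qed
 have EK: "E ze:$K'" if "ze:$d" for ze
  using that
 proof (induction ze rule: wf_elts_induct)
  case (step ze)
  have xM: "ze:M" "ze:$K" using r.dE step.prems by auto
  have IH: "E ze':$K'" if "ze':$ze" for ze' using step.IH[OF that] Ord_trans[OF r.dO(1) step.prems that] by blast
  define X where "X = Img ze (%ze'. hsucc (E ze'))"
  have XM: "X:M" unfolding X_def by (rule M.dt_M0) (intro M.dt_Img M.dt_hsucc dtE M.dfi xM)
  have "M.lep X ze"
   by (rule M.lep_surj[OF xM(1) XM, where F="%ze'. hsucc (E ze')"]) (intro M.dt_hsucc dtE M.dfi, simp add: X_def)
  hence "M.lep X K" using M.lep_trans[OF _ M.lep_subset[OF xM(1)] XM] Ord_trans[OF KM(2) xM(2)] by blast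
  hence UX: "UU X:$K'" by (intro sup_K' XM) (use IH suc_K' in "auto simp: X_def")
  have "E ze = uni (UU X) (uni (ap B (lam ze E)) ga0)" by (rule hc_eqI) (subst eE, auto simp: X_def)
  thus ?case using UX uni_K' B(2)[OF inS[OF step.prems IH]] ga0 by metis
 qed
 define e where "e = lam d E"
 have eM: "e:M" unfolding e_def by (rule M.dt_M0) (intro M.dt_lam dtE M.dfi r.dO)
 have ape: "ap e ze = E ze" if "ze:$d" for ze using that by (simp add: e_def)
 interpret q: qrune M N K K' cs d J x g th q0 c h D e
 proof unfold_locales
  show "e:M" by fact
  show "ap e ze:$K'" if "ze:$d" for ze using EK ape that by simp
  show "ap e ze':$(ap e ze)" if "ze:$d" "ze':$ze" for ze ze'
   unfolding ape[OF that(1)] ape[OF Ord_trans[OF r.dO(1) that]] by (subst eE) (use that(2) in blast)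
  show "$(hdom q0) <= $(ap e ze)" if "ze:$d" for ze
   unfolding ape[OF that] ga0_def[symmetric] by (subst eE) blast
  fix dl assume dl: "dl:$J" "r.RR (pair e dl):$Q"
  have sd: "hsucc (ap x dl):$d" using d(2) r.xd dl by blast
  define s where "s = lam (hsucc (ap x dl)) E"
  have sS: "s:$S" unfolding s_def by (rule inS[OF sd]) (use EK Ord_trans[OF r.dO(1) sd] in blast)
  have RRs: "r.RR (pair s dl) = r.RR (pair e dl)"
  proof (rule r.RR_local[OF dl(1)])
   fix ze assume "ze:$(hsucc (ap x dl))"
   thus "ap s ze = ap e ze" unfolding s_def using ape[OF Ord_trans[OF r.dO(1) sd]] by (subst ap_lam) simp_all
  qed
  have "dl:$(bb s)" using dl RRs by (simp add: bb_def s_def)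
  hence "ap b s = hdom (r.RR (pair e dl))" using b1[OF sS] RRs by simp
  hence "$(hdom (r.RR (pair e dl))) <= $(ap B s)" using B(3)[OF sS] by simp
  also have "\<dots> <= $(ap e (hsucc (ap x dl)))" unfolding ape[OF sd] by (subst eE) (unfold s_def, blast)
  finally show "$(hdom (r.RR (pair e dl))) <= $(ap e (hsucc (ap x dl)))" .
 qed
 from q.final obtain q where q: "q:$Q" "$q0 <= $q" "ALL dl:$J. EX r:$Q. D (ap g dl) r & $r <= $q" by blast
 have "D i q" if i: "i:$th" for i
 proof -
  obtain dl where "dl:$J" "i = ap g dl" using i unfolding g by (elim imageE)
  moreover then obtain r where "r:$Q" "D i r" "$r <= $q" using q(3) by blast
  ultimately show ?thesis using opn[OF q(1), of r i] by simp
 qed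
 thus ?thesis using q by blast
qed

end

context qf begin

lemma sKN: "is_successor_cardinal N K K'"
 using sK Cp Card_NM unfolding is_successor_cardinal_def by blast
lemma KIN: "N.InfO K" "N.InfO K'"
 unfolding N.InfO_def using KN KM K'M Kw Ord_trans[OF KM(2) Kw] K_K' by auto

text \<open>A condition is coded by its domain and a subset of \<open>K\<close>, hence by GCH there
  are at most \<open>K'\<close> conditions. This controls cardinals and power sets from
  \<open>K'\<close> on.\<close>

lemma lepQ: "N.lep Q K'"
proof -
 have R: "N.df (%e. inj_into (e (Suc 0)) (Prod (e 0) (Prod K K)) K)" by (intro N.dfi KN)
 have ex: "EX i:N. inj_into i (Prod ga (Prod K K)) K" if "ga:$K'" for ga
 proof -
  have gN: "ga:N" using N.trans[OF KN(2) that] .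
  have r: "N.lep K K" by (rule N.lep_refl[OF KN(1)])
  have "N.lep ga K" by (rule N.succ_lep[OF sKN KM(2) KN(1) that])
  hence "N.lep (Prod ga (Prod K K)) K"
   by (rule N.lep_ProdI[OF _ N.lep_ProdI[OF r r KIN(1)] KIN(1) gN]) (intro KN N.Prod_M)+
  thus ?thesis by (simp add: N.lep_iff)
 qed
 obtain f where f: "f:N" "fun_on f K'" "!!ga. ga:$K' ==> inj_into (ap f ga) (Prod ga (Prod K K)) K & ap f ga:N"
  by (rule N.AC[OF KN(2) R ex], assumption) (rule that)
 have QP: "$q <= $(Prod (hdom q) (Prod K K))" if q: "q:$Q" for q
 proof
  fix z assume z: "z:$q"
  hence "z = pair (hfst z) (ap q (hfst z))" "hfst z:$(hdom q)" using fun_onD[OF QD(4)[OF q] z] by auto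
  thus "z:$(Prod (hdom q) (Prod K K))" using Q_val[OF q] unfolding elts_Prod[of "hdom q"] by blast
 qed
 have "N.lep Q (Prod K' (hPow N K))"
 proof (rule N.lepI[OF Q_N, where F="%q. pair (hdom q) (Img q (ap (ap f (hdom q))))"])
  show dF: "N.dt (%e. pair (hdom (e 0)) (Img (e 0) (ap (ap f (hdom (e 0))))))" by (intro N.dfi f)
  show "inj_on (%q. pair (hdom q) (Img q (ap (ap f (hdom q))))) $Q"
  proof (rule inj_onI)
   fix p q assume *: "p:$Q" "q:$Q" "pair (hdom p) (Img p (ap (ap f (hdom p)))) = pair (hdom q) (Img q (ap (ap f (hdom q))))"
   hence d: "hdom p = hdom q" and im: "Img p (ap (ap f (hdom p))) = Img q (ap (ap f (hdom q)))" unfolding pair_inj by blast+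
   hence im: "ap (ap f (hdom q)) ` $p = ap (ap f (hdom q)) ` $q" by (metis elts_Img)
   have "inj_on (ap (ap f (hdom q))) ($(Prod (hdom q) (Prod K K)))"
    using f(3)[OF QD(3)[OF *(2)]] unfolding inj_into_def inj_on_def by blast
   hence "$p = $q" using inj_on_image_eq_iff[OF _ QP[OF *(1), unfolded d] QP[OF *(2)]] im by blast
   thus "p = q" by (rule hc_eqI)
  qed
  fix q assume q: "q:$Q"
  have "Img q (ap (ap f (hdom q))):N" by (rule N.dt_M0) (intro N.dfi f QD(1)[OF q])
  moreover have "$(Img q (ap (ap f (hdom q)))) <= $K"
   using QP[OF q] f(3)[OF QD(3)[OF q]] unfolding inj_into_def elts_Img by blast
  ultimately show "pair (hdom q) (Img q (ap (ap f (hdom q)))):$(Prod K' (hPow N K))"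
   using QD(3)[OF q] unfolding elts_Prod N.elts_hPow by blast
 qed
 moreover have hK: "N.lep (hPow N K) K'"
  by (rule N.eqp_lep[OF N.GCH_eqp[OF GN Cp[OF KC] _ sKN]]) (use KIN in "simp add: N.InfO_def")
 have "N.lep (Prod K' (hPow N K)) K'"
  by (rule N.lep_ProdI[OF N.lep_refl[OF KN(2)] hK KIN(2) KN(2) N.hPow_M[OF KN(1)]])
 ultimately show ?thesis by (rule N.lep_trans) (rule Q_N)
qed

end

locale qg = qf M N K K' cs + V: genericc N "qf.Q M N K K'" "qf.QL M N K K'" H for M N K K' cs H
begin

abbreviation "V1 \<equiv> V.N"

text \<open>Deciding the values of the function amounts to \<open>th\<close> many open dense tasks.
  \<open>distrib\<close> performs them below a suitable condition of the filter, and a condition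
  deciding all values defines the function over \<open>N\<close>.\<close>

lemma no_new0:
 assumes th: "th:$K" and f: "f:V1" "fun_on f th" and Y: "Y:N" "!!i. i:$th ==> ap f i:$Y"
 shows "f:N"
proof -
 obtain ta where ta: "ta:N" "f = val H ta" using V.N_E f(1) by blast
 have thN: "th:N" using N.trans[OF KN(1) th] .
 define D where "D i q <-> (EX y:$Y. V.memf q (V.check (pair i y)) ta)" for i q
 have dD: "N.df (%e. D (e 0) (e (Suc 0)))" unfolding D_def by (intro V.df_memf V.dt_check N.dfi Y ta)
 note dD2 = N.df_app2[where P=D, OF dD]
 define B where "B p <-> (EX i:$th. ALL q:$Q. V.le q p --> ~ D i q)" for p
 have dB: "N.df (%e. B (e 0))" unfolding B_def by (intro dD2 V.df_memf V.dt_check N.dfi thN Q_N QL_N)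
 have cN: "V.check (pair i y):N" if "i:$th" "y:$Y" for i y
  using V.check_M N.pair_M N.trans[OF thN] N.trans[OF Y(1)] that by blast
 have tr: "(EX p:H. V.memf p (V.check (pair i y)) ta) <-> y = ap f i" if "i:$th" "y:$Y" for i y
  using V.mem_truth[OF cN[OF that] ta(1)] fun_on_ap[OF f(2) that(1)] ta(2) by (simp add: V.val_check V.G_one)
 have nB: "~ B p" if p: "p:H" for p
 proof
  assume "B p"
  then obtain i where i: "i:$th" "!!q. q:$Q ==> V.le q p ==> ~ D i q" unfolding B_def by blast
  obtain r where r: "r:H" "V.memf r (V.check (pair i (ap f i))) ta" using tr[OF i(1) Y(2)[OF i(1)]] by blast
  obtain s where s: "s:H" "V.le s p" "V.le s r" using V.G_dir[OF p r(1)] by blast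
  have "D i s" unfolding D_def using V.memf_mono[OF r(2) s(3)] V.G_P s(1) Y(2)[OF i(1)] by blast
  thus False using i(2) s V.G_P by blast
 qed
 obtain p1 where p1: "p1:H" "!!q. q:$Q ==> V.le q p1 ==> ~ B q"
  by (rule V.Bad_dense[OF dB nB], assumption) (rule that)
 have "EX q:H. V.le q p1 & (ALL i:$th. D i q)"
 proof (rule V.G_dense_below[OF _ p1(1)])
  show "N.df (%e. ALL i:$th. D i (e 0))" by (intro dD2 V.df_memf V.dt_check N.dfi thN)
  fix p assume p: "p:$Q" "V.le p p1"
  have "EX q:$Q. $p <= $q & (ALL i:$th. D i q)"
  proof (rule distrib[OF th dD p(1)])
   fix i q assume iq: "i:$th" "q:$Q" "$p <= $q"
   have "V.le q p1" using iq p unfolding QL by blast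
   then obtain q' where "q':$Q" "V.le q' q" "D i q'" using p1(2)[OF iq(2)] iq(1) unfolding B_def by blast
   thus "EX q':$Q. $q <= $q' & D i q'" unfolding QL by blast
  next
   fix i q r assume "q:$Q" "r:$Q" "$r <= $q" "D i r"
   thus "D i q" unfolding D_def using V.memf_mono[of r _ ta q] QL by blast
  qed
  thus "EX q:$Q. V.le q p & (ALL i:$th. D i q)" using p(1) QL by blast
 qed
 then obtain q where q: "q:H" "!!i. i:$th ==> D i q" by blast
 have qN: "q:N" using V.G_P[OF q(1)] N.trans[OF Q_N] by blast
 have "f = lam th (%i. UU (Sep Y (%y. V.memf q (V.check (pair i y)) ta)))"
 proof (subst fun_on_eq[OF f(2)], rule lam_cong)
  fix i assume i: "i:$th"
  have *: "y = ap f i" if "y:$Y" "V.memf q (V.check (pair i y)) ta" for y using tr[OF i that(1)] that(2) q(1) by blast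
  moreover obtain y where "y:$Y" "V.memf q (V.check (pair i y)) ta" using q(2)[OF i] unfolding D_def by blast
  ultimately have "$(Sep Y (%y. V.memf q (V.check (pair i y)) ta)) = {ap f i}" by auto
  thus "ap f i = UU (Sep Y (%y. V.memf q (V.check (pair i y)) ta))" by (rule UU_single[symmetric])
 qed
 also have "\<dots>:N" by (rule N.dt_M0) (intro dD2 V.df_memf V.dt_check N.dfi thN Y ta qN)
 finally show ?thesis .
qed

text \<open>At length \<open>K\<close> the cofinality enters: the restrictions to the ordinals
  \<open>cs n\<close> belong to \<open>N\<close>, and so does the omega-sequence of these
  restrictions.\<close>

lemma no_new:
 assumes k: "k:$(hsucc K)" and f: "f:V1" "fun_on f k" and Y: "Y:N" "!!i. i:$k ==> ap f i:$Y"
 shows "f:N"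
proof (cases "k = K")
 case False
 thus ?thesis using no_new0[OF _ f Y] k by simp
next
 case True
 have csN: "cs:N" "homega:N" using cs(1) sub N.homega_M by auto
 define r where "r n = lam (ap cs n) (ap f)" for n
 have cK: "$(ap cs n) <= $K" if "n:$homega" for n using Ord_trans[OF KM(2) cs(2)[OF that]] by blast
 have rN: "r n:N" if n: "n:$homega" for n
 proof (rule no_new0[OF cs(2)[OF n] _ _ Y(1)])
  show "r n:V1" unfolding r_def by (rule V.N.dt_M0) (intro V.N.dfi f V.M_N N.ap_M csN N.trans[OF csN(2) n])
  show "fun_on (r n) (ap cs n)" by (simp add: r_def)
  fix i assume "i:$(ap cs n)"
  thus "ap (r n) i:$Y" using Y(2) True cK[OF n] unfolding r_def by auto
 qed
 define g where "g = lam homega r"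
 have gN: "g:N"
 proof (rule no_new0[OF Kw])
  show "g:V1" unfolding g_def r_def by (rule V.N.dt_M0) (intro V.N.dfi f V.M_N csN)
  show "hPow N (Prod K Y):N" by (intro N.hPow_M N.Prod_M KN Y)
  fix i assume i: "i:$homega"
  have "$(r i) <= $(Prod K Y)" using cK[OF i] Y(2) True unfolding r_def by auto
  thus "ap g i:$(hPow N (Prod K Y))" using rN[OF i] i unfolding g_def by (simp del: elts_Prod elts_homega)
 qed (simp add: g_def)
 have "f = UU (Img homega (ap g))"
 proof (rule hc_eqI, subst fun_on_eq[OF f(2)], unfold True)
  have "ap g n = r n" if "n:$homega" for n unfolding g_def by (rule ap_lam[OF that])
  hence "$(UU (Img homega (ap g))) = (\<Union>n\<in>$homega. $(r n))" by (simp del: elts_homega)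
  also have "\<dots> = $(lam K (ap f))" using cK cs(3) unfolding r_def elts_lam by (simp only: UN_simps image_UN[symmetric] set_eq_iff image_iff UN_iff Bex_def subset_iff) metis
  finally show "$(lam K (ap f)) = $(UU (Img homega (ap g)))" ..
 qed
 also have "\<dots>:N" by (rule N.dt_M0) (intro N.dfi csN gN)
 finally show ?thesis .
qed

lemma no_new_sub: assumes k: "k:$(hsucc K)" and X: "X:V1" "$X <= $k" shows "X:N"
proof -
 have kN: "k:N" using N.trans[OF N.hsucc_M[OF KN(1)] k] .
 define f where "f = lam k (%x. if x:$X then hnat 1 else hnat 0)"
 have "f:N"
 proof (rule no_new[OF k])
  show "f:V1" unfolding f_def by (rule V.N.dt_M0) (intro V.N.dfi X V.M_N kN V.N.hnat_M)
  show "ap f i:$(Upr (hnat 1) (hnat 0))" if "i:$k" for i using that unfolding f_def by simp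
  show "Upr (hnat 1) (hnat 0):N" by (intro N.Upr_M N.hnat_M)
 qed (simp_all add: f_def)
 hence "Sep k (%x. ap f x = hnat 1):N" by (intro N.Sep_M kN) (intro N.dfi N.hnat_M)
 moreover have "hnat 0 ~= hnat 1" by (simp del: hnat.simps One_nat_def)
 hence "Sep k (%x. ap f x = hnat 1) = X" using X(2) by (intro hc_eqI) (auto simp: f_def simp del: hnat.simps One_nat_def split: if_splits)
 ultimately show ?thesis by simp
qed

text \<open>Up to \<open>K\<close> there are no new functions on \<open>k\<close>. From
  \<open>K'\<close> on the forcing has size at most \<open>k\<close>, and the covering argument
  applies with each condition forming its own compatibility class.\<close>

lemma succ_pres1:
 assumes k: "N.Card k" "$homega <= $k" "is_successor_cardinal N k l" shows "~ V.N.lep l k"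
proof
 assume le: "V.N.lep l k"
 have kN: "k:N" "Ord k" using k N.Card_M N.Card_Ord by auto
 have lN: "l:N" using k N.Card_M by (auto simp: is_successor_cardinal_def)
 have nl: "~ N.lep l k" by (rule N.succ_not_lep[OF k(3)])
 have I: "N.InfO k" using kN k by (simp add: N.InfO_def)
 show False
 proof (cases "k:$(hsucc K)")
  case True
  obtain i where i: "i:V1" "inj_into i l k" using le by (auto simp: V.N.lep_iff)
  have "$l ~= {}" using k(3) by (auto simp: is_successor_cardinal_def)
  then obtain y0 where y0: "y0:$l" by blast
  obtain f where f: "f:V1" "fun_on f k" "!!y. y:$l ==> ap i y:$k & ap f (ap i y) = y"
   "!!x. x:$k ==> ap f x:$l" by (rule V.N.inv_fun[OF i V.M_N[OF lN] V.M_N[OF kN(1)] y0]) (rule that)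
  have "f:N" by (rule no_new[OF True f(1,2) lN f(4)])
  have "N.lep l k"
  proof (rule N.lep_surj[OF kN(1) lN, where F="ap f"])
   show "N.dt (%e. ap f (e 0))" by (intro N.dfi \<open>f:N\<close>)
   show "$l <= ap f ` $k" using f(3) by (metis imageI subsetI)
  qed
  thus False using nl by blast
 next
  case False
  hence "K:$k" using Ord_linear[OF kN(2) KM(2)] by auto
  hence "$K' <= $k" using sKN k(1) by (auto simp: is_successor_cardinal_def)
  hence "N.lep Q k" using N.lep_trans[OF lepQ N.lep_subset[OF KN(2)] Q_N] by blast
  moreover have "EX w:$Q. V.le w p & V.le w q" if "p:$Q" "p = q" for p q
   using that V.le_refl by blast
  ultimately have "~ V.N.lep l k"
   by (intro V.cover_no_surj[where st="%q. q", OF Q_N N.dt_var _ _ I _ lN nl])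
  thus False using le by blast
 qed
qed

lemma Card_pres1: "N.Card mm ==> V.N.Card mm"
 using V.E.Card_MN[of mm] succ_pres1 by blast

lemma pow_V1: assumes k: "N.Card k" "$homega <= $k" shows "V.N.lep (hPow V1 k) (hPow N k)"
proof (cases "k:$(hsucc K)")
 case True
 have "$(hPow V1 k) <= $(hPow N k)" using no_new_sub[OF True] by auto
 thus ?thesis by (intro V.N.lep_subset V.N.hPow_M V.M_N N.Card_M k)
next
 case False
 have kN: "k:N" "Ord k" using k N.Card_M N.Card_Ord by auto
 have I: "N.InfO k" using kN k by (simp add: N.InfO_def)
 have "K:$k" using False Ord_linear[OF kN(2) KM(2)] by auto
 hence "$K' <= $k" using sKN k(1) by (auto simp: is_successor_cardinal_def)
 hence Qk: "N.lep Q k" using N.lep_trans[OF lepQ N.lep_subset[OF KN(2)] Q_N] by blast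
 have PN: "Prod k Q:N" by (intro N.Prod_M kN Q_N)
 define F where "F e = Sep k (%x. EX q:$V.Gh. pair x q:$e)" for e
 have "V.N.lep (hPow V1 k) (hPow N (Prod k Q))"
 proof (rule V.N.lep_surj[where F=F])
  show "hPow N (Prod k Q):V1" "hPow V1 k:V1" by (intro V.M_N N.hPow_M V.N.hPow_M PN kN)+
  show "V.N.dt (%e. F (e 0))" unfolding F_def by (intro V.N.dfi V.M_N kN V.Gh_N)
  show "$(hPow V1 k) <= F ` $(hPow N (Prod k Q))"
  proof
   fix X assume X: "X:$(hPow V1 k)"
   obtain ta where ta: "ta:N" "X = val H ta" using V.N_E X by auto
   define e where "e = Sep (Prod k Q) (%z. V.memf (hsnd z) (V.check (hfst z)) ta)"
   have eN: "e:N" unfolding e_def by (rule N.dt_M0) (intro V.df_memf V.dt_check N.dfi PN ta)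
   have e: "pair x q:$e <-> x:$k & q:$Q & V.memf q (V.check x) ta" for x q by (auto simp: e_def)
   have "x:$(F e) <-> x:$X" if x: "x:$k" for x
   proof -
    have "x:$(F e) <-> (EX q:H. V.memf q (V.check x) ta)" using x e V.G_P by (auto simp: F_def V.elts_Gh)
    also have "\<dots> <-> x:$X" using V.mem_truth[OF V.check_M[OF N.trans[OF kN(1) x]] ta(1)] ta(2) by (simp add: V.val_check V.G_one)
    finally show ?thesis .
   qed
   moreover have "$(F e) <= $k" "$X <= $k" using X by (auto simp: F_def)
   ultimately have "X = F e" by (intro hc_eqI) blast
   moreover have "e:$(hPow N (Prod k Q))" using eN unfolding N.elts_hPow e_def by (auto simp del: elts_Prod)
   ultimately show "X:F ` $(hPow N (Prod k Q))" by blast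
  qed
 qed
 moreover have "N.lep (Prod k Q) k" by (rule N.lep_ProdI[OF N.lep_refl[OF kN(1)] Qk I kN(1) Q_N])
 hence "V.N.lep (hPow N (Prod k Q)) (hPow N k)" by (intro V.E.lep_MN N.lep_hPow PN kN)
 ultimately show ?thesis by (rule V.N.lep_trans) (intro V.N.hPow_M V.M_N kN)
qed

lemma GCH_V1: "GCH V1"
proof (rule V.E.GCH_N[OF Card_pres1 GN])
 fix k l assume k: "N.Card k" "$homega <= $k" "is_successor_cardinal N k l"
 have "N.lep (hPow N k) l" by (rule N.eqp_lep[OF N.GCH_eqp[OF GN k]])
 thus "V.N.lep (hPow V1 k) l"
  by (intro V.N.lep_trans[OF pow_V1[OF k(1,2)] V.E.lep_MN] V.N.hPow_M V.M_N N.Card_M k)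
qed

lemma reals_V1: "reals_of V1 = reals_of N"
 using no_new_sub[of homega] Kw V.M_N unfolding reals_of_def by auto

definition FF where "FF = UU V.Gh"
lemma FF_V1: "FF:V1" unfolding FF_def by (rule V.N.dt_M0) (intro V.N.dfi V.Gh_N)

lemma Q_ext: assumes q: "q:$Q" and ga: "ga:$K'" shows "EX r:$Q. $q <= $r & $ga <= $(hdom r)"
proof -
 define ga' where "ga' = uni ga (hdom q)"
 have g': "ga':$K'" unfolding ga'_def by (rule uni_K'[OF ga QD(3)[OF q]])
 have g'N: "ga':N" using elK'[OF g'] sub by blast
 obtain h where h: "h:M" "!!ga. ga:$K' ==> inj_into (ap h ga) ga K" by (rule hinj) (rule that)
 define i where "i = ap h ga'"
 have i: "i:N" "inj_into i ga' K" unfolding i_def using N.ap_M g'N h sub g' by blast+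
 define r where "r = lam ga' (%al. if al:$(hdom q) then ap q al else pair (ap i al) (ap i al))"
 have rf: "fun_on r ga'" by (simp add: r_def)
 have "r:$Q"
 proof (rule QI[OF _ rf g'])
  show "r:N" unfolding r_def by (rule N.dt_M0) (intro N.dfi g'N QD(1)[OF q] i)
  fix al assume a: "al:$ga'"
  hence "ap i al:$K" using i(2) by (auto simp: inj_into_def)
  hence "pair (ap i al) (ap i al):$(Prod K K)" by auto
  thus "ap r al:$(Prod K K)" using Q_val[OF q, of al] unfolding r_def ap_lam[OF a] by (simp split: if_splits)
 next
  fix I v assume I: "I:M" "$I <= $K'" "M.lep I homega" "v:$(Prod K K)"
  have f1: "finite {al:$ga'. pair (ap i al) (ap i al) = v}"
  proof (rule finite_subset)
   show "{al:$ga'. pair (ap i al) (ap i al) = v} <= inv_into $ga' (ap i) ` {hfst v}"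
   proof
    fix al assume "al:{al:$ga'. pair (ap i al) (ap i al) = v}"
    hence "al:$ga'" "ap i al = hfst v" by auto
    moreover have "inj_on (ap i) $ga'" using i(2) by (auto simp: inj_into_def inj_on_def)
    ultimately show "al:inv_into $ga' (ap i) ` {hfst v}" using inv_into_f_f by fastforce
   qed
  qed simp
  have "{al:$I. pair al v:$r} <= {al:$I. pair al v:$q} \<union> {al:$ga'. pair (ap i al) (ap i al) = v}"
  proof
   fix al assume "al:{al:$I. pair al v:$r}"
   hence a: "al:$I" "al:$ga'" "v = (if al:$(hdom q) then ap q al else pair (ap i al) (ap i al))"
    unfolding r_def elts_lam image_iff pair_inj by blast+
   show "al:{al:$I. pair al v:$q} \<union> {al:$ga'. pair (ap i al) (ap i al) = v}"
   proof (cases "al:$(hdom q)")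
    case True
    hence "pair al v:$q" using a(3) Q_dom[OF q] by simp
    thus ?thesis using a(1) by blast
   next
    case False
    thus ?thesis using a(2,3) by simp
   qed
  qed
  thus "finite {al:$I. pair al v:$r}" using f1 QD(5)[OF q I] finite_subset by blast
 qed
 moreover have "$q <= $r"
 proof
  fix z assume z: "z:$q"
  have zz: "z = pair (hfst z) (ap q (hfst z))" "hfst z:$(hdom q)" using fun_onD[OF QD(4)[OF q] z] by auto
  hence "hfst z:$ga'" "ap r (hfst z) = ap q (hfst z)" unfolding r_def ga'_def by (simp_all)
  thus "z:$r" using zz(1) fun_on_ap[OF rf] by metis
 qed
 moreover have "$ga <= $(hdom r)" unfolding hdom_fun[OF rf] by (simp add: ga'_def)
 ultimately show ?thesis by blast
qed

lemma FF_dom: assumes "ga:$K'" shows "EX q:H. $ga <= $(hdom q)"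
proof (rule V.G_dense)
 show "N.df (%e. $ga <= $(hdom (e 0)))" by (intro N.dfi N.trans[OF KN(2) assms])
 show "EX q:$Q. V.le q p & $ga <= $(hdom q)" if "p:$Q" for p
  using Q_ext[OF that assms] that QL by blast
qed

lemma FF_ap: assumes q: "q:H" "al:$(hdom q)" shows "ap FF al = ap q al"
proof (rule ap_eq)
 have qQ: "q:$Q" using q V.G_P by blast
 fix y show "pair al y:$FF <-> y = ap q al"
 proof
  assume "y = ap q al"
  thus "pair al y:$FF" using Q_dom[OF qQ, of al y] q unfolding FF_def by (auto simp: V.elts_Gh)
 next
  assume "pair al y:$FF"
  then obtain p where p: "p:H" "pair al y:$p" by (auto simp: FF_def V.elts_Gh)
  obtain r where r: "r:H" "V.le r q" "V.le r p" using V.G_dir[OF q(1) p(1)] by blast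
  have "pair al (ap q al):$q" using Q_dom[OF qQ] q(2) by blast
  hence "pair al y:$r" "pair al (ap q al):$r" using r(2,3) p(2) unfolding QL by auto
  thus "y = ap q al" using Q_dom[of r] V.G_P[OF r(1)] by metis
 qed
qed

lemma FF_val: assumes "al:$K'" shows "ap FF al:$(Prod K K)"
proof -
 obtain q where q: "q:H" "$(hsucc al) <= $(hdom q)" using FF_dom[OF suc_K'[OF assms]] by blast
 hence "al:$(hdom q)" by auto
 thus ?thesis using FF_ap[OF q(1)] Q_val V.G_P[OF q(1)] by metis
qed

text \<open>A countable ground subset of \<open>K'\<close> is bounded, so one condition of the
  filter is defined on all of it.\<close>

lemma FF_fin: assumes I: "I:M" "$I <= $K'" "M.lep I homega" and v: "v:$(Prod K K)"
 shows "finite {al:$I. ap FF al = v}"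
proof -
 define X where "X = Img I hsucc"
 have XM: "X:M" unfolding X_def by (rule M.dt_M0) (intro M.dfi I)
 have wK: "M.lep homega K" by (rule M.lep_subset) (use Ord_trans[OF KM(2) Kw] in auto)
 have "M.lep X I" by (rule M.lep_surj[OF I(1) XM, where F=hsucc]) (intro M.dfi, simp add: X_def)
 hence "M.lep X K" using M.lep_trans[OF M.lep_trans[OF _ I(3)] wK] XM by blast
 hence "UU X:$K'" by (intro sup_K' XM) (use I(2) suc_K' in "auto simp: X_def")
 then obtain q where q: "q:H" "$(UU X) <= $(hdom q)" using FF_dom by blast
 have IX: "al:$(hdom q)" if "al:$I" for al using q(2) that by (auto simp: X_def)
 have qQ: "q:$Q" using V.G_P[OF q(1)] .
 have "{al:$I. ap FF al = v} <= {al:$I. pair al v:$q}"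
  using FF_ap[OF q(1) IX] Q_dom[OF qQ] IX by auto
 thus ?thesis using QD(5)[OF qQ I v] finite_subset by blast
qed

end

section \<open>Reading more Cohen reals\<close>

definition bt :: "bool => hc" where "bt b = (if b then hnat 1 else hnat 0)"
lemma bt_inj [simp]: "bt a = bt b <-> a = b" by (auto simp: bt_def simp del: hnat.simps One_nat_def)
lemma bt_ex: "(EX b:{0, 1}. z = pair x (hnat b)) <-> (EX b. z = pair x (bt b))"
 by (auto simp: bt_def simp del: hnat.simps One_nat_def)

text \<open>Translates finite partial maps of HOL into Cohen conditions, so that extensions of
  conditions can be computed with \<open>++\<close>.\<close>

definition cnd :: "(hc \<times> nat => bool option) => hc" where
 "cnd ph = HSet {pair (pair ta (hnat n)) (bt b) | ta n b. ph (ta, n) = Some b}"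

lemma fin_cnd: assumes "finite (dom ph)" shows "finite {pair (pair ta (hnat n)) (bt b) | ta n b. ph (ta, n) = Some b}"
proof (rule finite_surj[OF assms])
 show "{pair (pair ta (hnat n)) (bt b) | ta n b. ph (ta, n) = Some b} <= (%x. pair (pair (fst x) (hnat (snd x))) (bt (the (ph x)))) ` dom ph"
  by (force simp: image_iff)
qed
lemma elts_cnd: "finite (dom ph) ==> $(cnd ph) = {pair (pair ta (hnat n)) (bt b) | ta n b. ph (ta, n) = Some b}"
 unfolding cnd_def by (rule elts_HSet) (rule countable_finite[OF fin_cnd])
lemma cnd_in: "finite (dom ph) ==> pair (pair ta (hnat n)) (bt b):$(cnd ph) <-> ph (ta, n) = Some b"
 by (auto simp: elts_cnd)
lemma cnd_mono: "finite (dom \<psi>) ==> ph \<subseteq>\<^sub>m \<psi> ==> $(cnd ph) <= $(cnd \<psi>)"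
proof -
 assume f: "finite (dom \<psi>)" and m: "ph \<subseteq>\<^sub>m \<psi>"
 have f': "finite (dom ph)" using finite_subset[OF map_le_implies_dom_le[OF m] f] .
 have "\<psi> x = Some b" if "ph x = Some b" for x b using m that unfolding map_le_def by (metis domI)
 thus ?thesis unfolding elts_cnd[OF f] elts_cnd[OF f'] by blast
qed

lemma Cohen_iff: "p:Cohen I <-> finite $p & (ALL z:$p. EX i:$I. EX n b. z = pair (pair i (hnat n)) (bt b)) &
  (ALL x y y'. pair x y:$p & pair x y':$p --> y = y')"
 unfolding Cohen_def mem_Collect_eq bt_ex ..

lemma cnd_Cohen: assumes "finite (dom ph)" "fst ` dom ph <= $I" shows "cnd ph:Cohen I"
 unfolding Cohen_iff
proof (intro conjI ballI allI impI)
 show "finite ($(cnd ph))" using fin_cnd assms elts_cnd by simp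
 fix z assume "z:$(cnd ph)"
 then obtain ta n b where z: "z = pair (pair ta (hnat n)) (bt b)" "ph (ta, n) = Some b" unfolding elts_cnd[OF assms(1)] by blast
 hence "ta:$I" using assms(2) by force
 thus "EX i:$I. EX n b. z = pair (pair i (hnat n)) (bt b)" using z by blast
next
 fix x y y' assume "pair x y:$(cnd ph) & pair x y':$(cnd ph)"
 thus "y = y'" unfolding elts_cnd[OF assms(1)] by auto
qed

lemma Cohen_cnd: assumes "p:Cohen I" obtains ph where "finite (dom ph)" "fst ` dom ph <= $I" "p = cnd ph"
proof -
 note p = assms[unfolded Cohen_iff]
 define ph where "ph x = (if EX b. pair (pair (fst x) (hnat (snd x))) (bt b):$p
   then Some (pair (pair (fst x) (hnat (snd x))) (bt True):$p) else None)" for x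
 have phi: "ph (ta, n) = Some b <-> pair (pair ta (hnat n)) (bt b):$p" for ta n b
 proof -
  have "~ (pair (pair ta (hnat n)) (bt True):$p & pair (pair ta (hnat n)) (bt False):$p)"
   using p bt_inj[of True False] by blast
  thus ?thesis by (cases b) (auto simp: ph_def ex_bool_eq)
 qed
 have "dom ph <= (%z. (hfst (hfst z), inv hnat (hsnd (hfst z)))) ` $p"
 proof
  fix x assume "x:dom ph"
  then obtain ta n b where x: "x = (ta, n)" "ph (ta, n) = Some b" by (metis domD surj_pair)
  have "inj hnat" by (rule injI) simp
  thus "x:(%z. (hfst (hfst z), inv hnat (hsnd (hfst z)))) ` $p"
   using x unfolding phi by (intro image_eqI[of _ _ "pair (pair ta (hnat n)) (bt b)"]) simp_all
 qed
 hence f: "finite (dom ph)" using finite_surj p by blast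
 show ?thesis
 proof (rule that[OF f])
  show "fst ` dom ph <= $I"
  proof
   fix ta assume "ta:fst ` dom ph"
   then obtain n b where "ph (ta, n) = Some b" by auto
   thus "ta:$I" using p unfolding phi by fastforce
  qed
  have "z:$p <-> z:$(cnd ph)" for z unfolding elts_cnd[OF f] phi mem_Collect_eq
  proof
   assume z: "z:$p"
   then obtain i n b where "z = pair (pair i (hnat n)) (bt b)" using p by blast
   thus "EX ta n b. z = pair (pair ta (hnat n)) (bt b) & pair (pair ta (hnat n)) (bt b):$p" using z by blast
  qed blast
  thus "p = cnd ph" by (intro hc_eqI set_eqI)
 qed
qed

context tm begin

definition CoS where "CoS I = Sep (Fin (Prod (Prod I homega) (Upr (bt True) (bt False))))
 (%f. ALL z:$f. ALL w:$f. hfst z = hfst w --> z = w)"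
lemma bt_M: "bt b:M" by (simp add: bt_def del: hnat.simps)
lemma dt_CoS [dfi]: "dt t ==> dt (%e. CoS (t e))"
 by (rule dt_app1[where F=CoS]) (unfold CoS_def, intro dfi homega_M bt_M)
lemma CoS_M: "I:M ==> CoS I:M" by (rule dt_M0) (intro dfi)
lemma elts_CoS: assumes "I:M" shows "$(CoS I) = Cohen I"
proof (intro subset_antisym subsetI)
 fix p assume "p:$(CoS I)"
 hence p: "finite $p" "$p <= $(Prod (Prod I homega) (Upr (bt True) (bt False)))"
  "!!z w. z:$p ==> w:$p ==> hfst z = hfst w ==> z = w" unfolding CoS_def by (simp_all del: elts_Prod elts_Upr)
 have "EX i:$I. EX n b. z = pair (pair i (hnat n)) (bt b)" if z: "z:$p" for z
 proof -
  have "z:$(Prod (Prod I homega) (Upr (bt True) (bt False)))" using p(2) z by blast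
  then obtain i n where "i:$I" "z = pair (pair i (hnat n)) (bt True) \<or> z = pair (pair i (hnat n)) (bt False)" by auto
  thus ?thesis by blast
 qed
 moreover have "y = y'" if "pair x y:$p" "pair x y':$p" for x y y' using p(3)[OF that] by simp
 ultimately show "p:Cohen I" using p(1) unfolding Cohen_iff by blast
next
 fix p assume "p:Cohen I"
 note p = this[unfolded Cohen_iff]
 have sub: "$p <= $(Prod (Prod I homega) (Upr (bt True) (bt False)))"
 proof
  fix z assume "z:$p"
  then obtain i n b where "i:$I" "z = pair (pair i (hnat n)) (bt b)" using p by blast
  thus "z:$(Prod (Prod I homega) (Upr (bt True) (bt False)))" by (cases b) auto
 qed
 have PM: "Prod (Prod I homega) (Upr (bt True) (bt False)):M" by (rule dt_M0) (intro dfi assms homega_M bt_M)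
 have "HSet $p:M" by (rule finite_M) (use p sub trans[OF PM] in blast)+
 hence pM: "p:M" by simp
 have "z = w" if zw: "z:$p" "w:$p" "hfst z = hfst w" for z w
 proof -
  obtain x y x' y' where "z = pair x y" "w = pair x' y'" using p zw(1,2) by metis
  thus ?thesis using zw p by simp
 qed
 thus "p:$(CoS I)" using pM sub p unfolding CoS_def elts_Sep elts_Fin by blast
qed

definition CL where "CL I = Sep (Prod (CoS I) (CoS I)) (%z. $(hsnd z) <= $(hfst z))"
lemma CL_M: "I:M ==> CL I:M" unfolding CL_def by (rule dt_M0) (intro dfi)
lemma CL: "pair p q:$(CL I) <-> p:$(CoS I) & q:$(CoS I) & $q <= $p" by (auto simp: CL_def)

end

lemma hempty_Cohen: "hempty:Cohen I" by (simp add: Cohen_iff)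

lemma (in tmc) Cohen_genericc: assumes I: "I:M" and G: "Cohen_generic M I G"
 shows "genericc M (CoS I) (CL I) G"
proof unfold_locales
 note e = elts_CoS[OF I]
 show "CoS I:M" "CL I:M" using I CoS_M CL_M by auto
 show "forcing_notion ($(CoS I)) (%p q. pair p q:$(CL I))"
  unfolding forcing_notion_def CL
 proof (intro conjI)
  show "EX t:$(CoS I). ALL p:$(CoS I). p:$(CoS I) & t:$(CoS I) & $t <= $p"
   using hempty_Cohen[of I] elts_hempty unfolding e by blast
 qed blast+
 note g = G[unfolded Cohen_generic_def generic_filter_def Cohen_le_def]
 have sub: "G <= Cohen I" using g by blast
 show "generic_filter M ($(CoS I)) (%p q. pair p q:$(CL I)) G"
  unfolding generic_filter_def CL e
 proof (intro conjI ballI impI)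
  fix p q assume pq: "p:G" "q:G"
  then obtain r where "r:G" "$p <= $r" "$q <= $r" using g by meson
  thus "EX r:G. (r:Cohen I & p:Cohen I & $p <= $r) & r:Cohen I & q:Cohen I & $q <= $r"
   using pq sub by blast
 next
  fix D assume D: "D:M" "$D <= Cohen I & (ALL p:Cohen I. EX q:$D. q:Cohen I & p:Cohen I & $p <= $q)"
  hence "ALL p:Cohen I. EX q:$D. $p <= $q" by blast
  thus "G \<inter> $D ~= {}" using g D by blast
 qed (use g in blast)+
qed

lemma (in tmc) lep_finite: assumes "x:M" "finite $x" shows "lep x homega"
proof -
 obtain n f where f: "n:$homega" "f:M" "x = Img n (ap f)" using finite_iff[OF assms(1)] assms(2) by blast
 have nM: "n:M" using trans[OF homega_M f(1)] .
 have "lep x n" by (rule lep_surj[OF nM assms(1), where F="ap f"]) (intro dfi f, simp add: f(3))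
 moreover have "lep n homega" by (rule lep_subset[OF nM]) (use Ord_trans[OF Ord_homega f(1)] in blast)
 ultimately show ?thesis by (rule lep_trans) (rule assms)
qed

text \<open>This replaces an appeal to the countable chain condition. \<open>I\<close> is obtained
  in omega steps by closing under a function that chooses extensions in \<open>D\<close>; a
  countable set carries only countably many conditions, and a finite domain is caught by one
  stage.\<close>

lemma (in tmc) Cohen_closure:
 assumes K: "K:M" and D: "D:M" "$D <= Cohen K" "!!p. p:Cohen K ==> EX q:$D. $p <= $q"
 obtains I where "I:M" "$I <= $(Prod K homega)" "lep I homega"
  "!!p. p:Cohen K ==> $(hdom p) <= $I ==> EX q:$D. $p <= $q & $(hdom q) <= $I"
proof -
 have w: "InfO homega" by (simp add: InfO_def)
 have CM: "CoS K:M" using CoS_M K .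
 have R: "df (%e. e (Suc 0):$D & $(e 0) <= $(e (Suc 0)))" by (intro dfi D)
 have ex: "EX q:M. q:$D & $p <= $q" if "p:$(CoS K)" for p
  using D(3)[of p] that trans[OF D(1)] unfolding elts_CoS[OF K] by blast
 obtain c where c: "c:M" "fun_on c (CoS K)" "!!p. p:$(CoS K) ==> (ap c p:$D & $p <= $(ap c p)) & ap c p:M"
  by (rule AC[OF CM R ex], assumption) (rule that)
 define T where "T i = Sep (CoS K) (%p. $(hdom p) <= $i)" for i
 define Cl where "Cl i = uni i (UU (Img (T i) (%p. hdom (ap c p))))" for i
 have dT: "dt (%e. T (t e))" if "dt t" for t by (rule dt_app1[OF _ that]) (unfold T_def, intro dfi CM)
 have dCl: "dt (%e. Cl (t e))" if "dt t" for t by (rule dt_app1[OF _ that]) (unfold Cl_def, intro dfi c dT)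
 have dH: "dt (%e. UU (Img (e 0) (%m. Cl (ap (e (Suc 0)) m))))" by (intro dfi dCl)
 obtain E where E0: "!!n. E n = UU (Img n (%m. Cl (ap (lam n E) m)))" and dE: "!!t. dt t ==> dt (%e. E (t e))"
  by (rule mrec[OF dH]) (rule that)
 have E: "E n = UU (Img n (%m. Cl (E m)))" for n by (subst E0, rule arg_cong[where f=UU], rule Img_cong) simp
 have EM: "E n:M" if "n:M" for n by (rule dt_M0) (intro dE dfi that)
 have hd: "$(hdom q) <= $(Prod K homega)" if "q:Cohen K" for q
 proof
  fix a assume "a:$(hdom q)"
  then obtain z where "z:$q" "a = hfst z" by auto
  then obtain i n b where "i:$K" "a = pair i (hnat n)" using \<open>q:Cohen K\<close> unfolding Cohen_iff by (metis hfst)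
  thus "a:$(Prod K homega)" by auto
 qed
 have cD: "ap c p:Cohen K" "$p <= $(ap c p)" "ap c p:$D" if "p:$(T i)" for p i
  using c(3)[of p] that D(2) unfolding T_def by auto
 have Clb: "$(Cl i) <= $(Prod K homega) & lep (Cl i) homega" if i: "i:M" "$i <= $(Prod K homega)" "lep i homega" for i
 proof
  show "$(Cl i) <= $(Prod K homega)"
  proof
   fix a assume "a:$(Cl i)"
   then consider "a:$i" | p where "p:$(T i)" "a:$(hdom (ap c p))" unfolding Cl_def by auto
   thus "a:$(Prod K homega)" using i(2) hd[OF cD(1)] by cases blast+
  qed
  have TM: "T i:M" by (rule dt_M0) (intro dT dfi i)
  have tM: "Upr (bt True) (bt False):M" by (intro Upr_M bt_M)
  have "$(T i) <= $(Fin (Prod i (Upr (bt True) (bt False))))"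
  proof
   fix p assume p: "p:$(T i)"
   hence pC: "p:Cohen K" "$(hdom p) <= $i" "p:M" using trans[OF CM] unfolding T_def elts_Sep elts_CoS[OF K] by blast+
   have "z:$(Prod i (Upr (bt True) (bt False)))" if z: "z:$p" for z
   proof -
    obtain a b where ab: "z = pair a (bt b)" using pC(1) z unfolding Cohen_iff by blast
    have "a:$i" using pC(2) z ab by force
    thus ?thesis using ab by (cases b) auto
   qed
   thus "p:$(Fin (Prod i (Upr (bt True) (bt False))))" using pC unfolding elts_Fin Cohen_iff by blast
  qed
  hence "lep (T i) (Fin (Prod i (Upr (bt True) (bt False))))" by (rule lep_subset[OF TM])
  moreover have "lep (Fin (Prod i (Upr (bt True) (bt False)))) homega"
   by (intro lep_FinI lep_ProdI lep_Upr w i tM bt_M Prod_M)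
  ultimately have lT: "lep (T i) homega" using lep_trans TM by blast
  define X where "X = Img (T i) (%p. hdom (ap c p))"
  have XM: "X:M" unfolding X_def by (rule dt_M0) (intro dfi dT i c)
  have "lep X (T i)" by (rule lep_surj[OF TM XM, where F="%p. hdom (ap c p)"]) (intro dfi c, simp add: X_def)
  hence lX: "lep X homega" using lep_trans[OF _ lT XM] by blast
  have lUX: "lep (UU X) homega"
  proof (rule lep_UU[OF XM lX w])
   fix x assume x: "x:$X"
   then obtain p where p: "p:$(T i)" "x = hdom (ap c p)" unfolding X_def by auto
   have "finite $x" using cD(1)[OF p(1)] p(2) unfolding Cohen_iff by simp
   thus "lep x homega" using lep_finite trans[OF XM x] by blast
  qed
  have "lep (UU (Upr i (UU X))) homega"
   by (rule lep_UU[OF Upr_M[OF i(1) UU_M[OF XM]] lep_Upr[OF w i(1) UU_M[OF XM]] w]) (use i(3) lUX in auto)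
  thus "lep (Cl i) homega" by (simp add: Cl_def X_def)
 qed
 have Eb: "$(E n) <= $(Prod K homega) & lep (E n) homega" if "n:$homega" for n
  using that
 proof (induction n rule: wf_elts_induct)
  case (step n)
  have nM: "n:M" using trans[OF homega_M step.prems] .
  have mw: "m:$homega" if "m:$n" for m using Ord_trans[OF Ord_homega step.prems that] .
  have IH: "$(Cl (E m)) <= $(Prod K homega) & lep (Cl (E m)) homega" if m: "m:$n" for m
   using Clb[OF EM[OF trans[OF nM m]]] step.IH[OF m mw[OF m]] by blast
  define X where "X = Img n (%m. Cl (E m))"
  have XM: "X:M" unfolding X_def by (rule dt_M0) (intro dt_Img dCl dE dfi nM)
  have "lep X n" by (rule lep_surj[OF nM XM, where F="%m. Cl (E m)"]) (intro dCl dE dfi, simp add: X_def)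
  moreover have "lep n homega" by (rule lep_subset[OF nM]) (use mw in blast)
  ultimately have lX: "lep X homega" using lep_trans XM by blast
  have eq: "E n = UU X" unfolding X_def by (rule E)
  have "lep (UU X) homega" by (rule lep_UU[OF XM lX w]) (use IH in "auto simp: X_def")
  thus ?case unfolding eq using IH unfolding X_def elts_UU elts_Img by blast
 qed
 define I where "I = UU (Img homega E)"
 have XM: "Img homega E:M" by (rule dt_M0) (intro dt_Img dE dfi homega_M)
 have step: "$(Cl (E m)) <= $(E n)" if "m:$n" for m n by (subst E[of n]) (use that in auto)
 have mono: "$(E (hnat m)) <= $(E (hnat n))" if "m <= n" for m n
 proof (cases "m = n")
  case False
  hence "hnat m:$(hnat n)" using that by (auto simp: elts_hnat)
  thus ?thesis using step[of "hnat m" "hnat n"] unfolding Cl_def by auto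
 qed simp
 show ?thesis
 proof (rule that)
  show "I:M" unfolding I_def by (rule UU_M[OF XM])
  show "$I <= $(Prod K homega)" unfolding I_def elts_UU elts_Img using Eb by blast
  have "lep (Img homega E) homega"
   by (rule lep_surj[OF homega_M XM, where F=E]) (intro dE dfi, simp)
  thus "lep I homega" unfolding I_def by (rule lep_UU[OF XM _ w]) (use Eb in "unfold elts_Img, blast")
  fix p assume p: "p:Cohen K" "$(hdom p) <= $I"
  have "EX n. $(hdom p) <= $(E (hnat n))"
  proof -
   have "ALL a:$(hdom p). EX n. a:$(E (hnat n))" using p(2) by (auto simp: I_def)
   then obtain f where f: "!!a. a:$(hdom p) ==> a:$(E (hnat (f a)))" by metis
   have "finite (f ` $(hdom p))" using p(1) by (simp add: Cohen_iff)
   then obtain n where "!!a. a:$(hdom p) ==> f a <= n" by (metis finite_nat_set_iff_bounded_le imageI)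
   thus ?thesis using f mono by blast
  qed
  then obtain n where n: "$(hdom p) <= $(E (hnat n))" by blast
  hence pT: "p:$(T (E (hnat n)))" using p(1) by (simp add: T_def elts_CoS[OF K])
  have "$(hdom (ap c p)) <= $(Cl (E (hnat n)))" using pT unfolding Cl_def by auto
  also have "\<dots> <= $(E (hnat (Suc n)))" by (rule step) simp
  also have "\<dots> <= $I" using rangeI[of hnat "Suc n"] unfolding I_def elts_UU elts_Img elts_homega by blast
  finally show "EX q:$D. $p <= $q & $(hdom q) <= $I" using cD[OF pT] by blast
 qed
qed

locale coh = qg M N K K' cs H for M N K K' cs H +
 fixes G
 assumes Kpow: "!!a. a:$K ==> M.lep (hPow M a) K"
  and cs_mono: "!!m n. m <= n ==> $(ap cs (hnat m)) <= $(ap cs (hnat n))"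
  and G: "Cohen_generic (val H ` N) K G"
begin

lemma V1_eq: "val H ` N = V1" by (simp add: V.N_def)
lemma KV1: "K:V1" "K':V1" using KN V.M_N by auto
lemma MV1: "x:M ==> x:V1" using sub V.M_N by blast
lemma elts_CoK: "$(V.N.CoS K) = Cohen K" by (rule V.N.elts_CoS[OF KV1(1)])
lemma CoK': "$(M.CoS K') = Cohen K'" by (rule M.elts_CoS[OF K'M(1)])

sublocale W: genericc V1 "tm.CoS V1 K" "tm.CL V1 K" G
 by (rule V.N.Cohen_genericc[OF KV1(1)]) (use G V1_eq in simp)

definition Y where "Y = UU (Img homega (%n. hPow M (ap cs n)))"
text \<open>The index set of the columns in use: values of F and codes, kept apart by a tag. As
  \<open>K\<close> is a strong limit, \<open>u\<close> embeds all of them into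
  \<open>K\<close>.\<close>

definition Z where "Z = Prod (Upr (bt True) (bt False)) (uni (Prod K K) Y)"
lemma Y_M: "Y:M" unfolding Y_def by (rule M.dt_M0) (intro M.dfi cs M.homega_M)
lemma Zu: "EX u:M. inj_into u Z K"
proof -
 have K: "M.lep K K" by (rule M.lep_refl[OF KM(1)])
 have wK: "M.lep homega K" by (rule M.lep_subset) (use Ord_trans[OF KM(2) Kw] in auto)
 have XM: "Img homega (%n. hPow M (ap cs n)):M" by (rule M.dt_M0) (intro M.dfi cs M.homega_M)
 have "M.lep (Img homega (%n. hPow M (ap cs n))) homega"
  by (rule M.lep_surj[OF M.homega_M XM, where F="%n. hPow M (ap cs n)"]) (intro M.dfi cs, simp)
 hence "M.lep (Img homega (%n. hPow M (ap cs n))) K" using M.lep_trans[OF _ wK XM] by blast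
 hence lY: "M.lep Y K" unfolding Y_def
  by (rule M.lep_UU[OF XM _ KI]) (use Kpow cs(2) in "unfold elts_Img, blast")
 have KK: "M.lep (Prod K K) K" by (rule M.lep_ProdI[OF K K KI KM(1) KM(1)])
 have P: "Prod K K:M" by (intro M.Prod_M KM)
 have "M.lep (uni (Prod K K) Y) K"
  by (rule M.lep_UU[OF M.Upr_M[OF P Y_M] M.lep_Upr[OF KI P Y_M] KI]) (use KK lY in auto)
 hence "M.lep Z K" unfolding Z_def
  by (rule M.lep_ProdI[OF M.lep_Upr[OF KI M.bt_M M.bt_M] _ KI M.Upr_M[OF M.bt_M M.bt_M] M.UU_M[OF M.Upr_M[OF P Y_M]]])
 thus ?thesis by (simp add: M.lep_iff)
qed

definition u where "u = (SOME u. u:M & inj_into u Z K)"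
lemma u: "u:M" "inj_into u Z K"
 using someI_ex[of "%u. u:M & inj_into u Z K"] Zu unfolding u_def by blast+

text \<open>An element of \<open>Prod K' homega\<close> is the place of a single bit.
  \<open>j\<close> gives each bit its own argument of F and its own subset of
  \<open>K\<close>.\<close>

lemma jex: "EX j:M. inj_into j (Prod K' homega) K'"
proof -
 have I: "M.InfO K'" using K'M KI K_K' unfolding M.InfO_def by blast
 have w: "M.lep homega K'" by (rule M.lep_subset) (use I in "auto simp: M.InfO_def")
 show ?thesis using M.lep_ProdI[OF M.lep_refl[OF K'M(1)] w I K'M(1) M.homega_M] by (simp add: M.lep_iff)
qed
definition j where "j = (SOME u. u:M & inj_into u (Prod K' homega) K')"
lemma j: "j:M" "inj_into j (Prod K' homega) K'"
 using someI_ex[of "%u. u:M & inj_into u (Prod K' homega) K'"] jex unfolding j_def by blast+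

lemma xex: "EX x:M. inj_into x K' (hPow M K)"
proof -
 have "M.eqp (hPow M K) K'" by (rule M.GCH_eqp[OF GM KC _ sK]) (use KI in "simp add: M.InfO_def")
 hence "M.lep K' (hPow M K)" by (rule M.eqp_lep[OF M.eqp_sym[OF _ M.hPow_M[OF KM(1)] K'M(1)]])
 thus ?thesis by (simp add: M.lep_iff)
qed
definition xx where "xx = (SOME u. u:M & inj_into u K' (hPow M K))"
lemma xx: "xx:M" "inj_into xx K' (hPow M K)"
 using someI_ex[of "%u. u:M & inj_into u K' (hPow M K)"] xex unfolding xx_def by blast+

definition colA where "colA v = ap u (pair (bt False) v)"
definition colB where "colB y = ap u (pair (bt True) y)"
definition vv where "vv a = ap FF (ap j a)"
definition yy where "yy a n = Sep (ap xx (ap j a)) (%t. t:$(ap cs n))"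

lemma inZ: "pair (bt b) y:$Z <-> y:$(Prod K K) \<or> y:$Y"
 unfolding Z_def by (cases b) (auto simp del: elts_Prod simp: elts_Prod[of "Upr (bt True) (bt False)"])
lemma colA: "v:$(Prod K K) ==> colA v:$K" "v:$(Prod K K) ==> v':$(Prod K K) ==> colA v = colA v' <-> v = v'"
 using u(2) inZ[of False] unfolding colA_def inj_into_def by (blast, metis pair_inj)
lemma colB: "y:$Y ==> colB y:$K" "y:$Y ==> y':$Y ==> colB y = colB y' <-> y = y'"
 using u(2) inZ[of True] unfolding colB_def inj_into_def by (blast, metis pair_inj)
lemma colAB: "v:$(Prod K K) ==> y:$Y ==> colA v ~= colB y"
 using u(2) inZ[of False v] inZ[of True y] bt_inj[of False True] unfolding colA_def colB_def inj_into_def by (metis pair_inj)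
lemma jj: "a:$(Prod K' homega) ==> ap j a:$K'" using j(2) unfolding inj_into_def by blast
lemma vv: "a:$(Prod K' homega) ==> vv a:$(Prod K K)" unfolding vv_def using FF_val jj by blast
lemma yy: assumes "a:$(Prod K' homega)" "n:$homega" shows "yy a n:$Y"
proof -
 have a1: "ap xx (ap j a):M" using xx(2) jj[OF assms(1)] by (auto simp: inj_into_def)
 have a2: "ap cs n:M" using M.trans[OF KM(1) cs(2)[OF assms(2)]] .
 have "yy a n:M" unfolding yy_def by (rule M.dt_M0) (intro M.dfi a1 a2)
 hence "yy a n:$(hPow M (ap cs n))" by (auto simp: yy_def)
 thus ?thesis using assms(2) unfolding Y_def elts_UU elts_Img by blast
qed

lemma yy_diff: assumes "a:$(Prod K' homega)" "a':$(Prod K' homega)" "a ~= a'"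
 shows "EX n0. ALL n>=n0. yy a (hnat n) ~= yy a' (hnat n)"
proof -
 have "ap j a ~= ap j a'" using j(2) assms unfolding inj_into_def by blast
 hence "ap xx (ap j a) ~= ap xx (ap j a')" using xx(2) jj assms unfolding inj_into_def by blast
 moreover have s: "$(ap xx (ap j a)) <= $K" "$(ap xx (ap j a')) <= $K"
  using xx(2) jj assms by (auto simp: inj_into_def)
 ultimately obtain t where t: "t:$K" "~ (t:$(ap xx (ap j a)) <-> t:$(ap xx (ap j a')))"
  using hc_eqI[of "ap xx (ap j a)" "ap xx (ap j a')"] by blast
 obtain n0 where n0: "t:$(ap cs (hnat n0))" using cs(3)[OF t(1)] by auto
 have "yy a (hnat n) ~= yy a' (hnat n)" if "n >= n0" for n
 proof
  assume "yy a (hnat n) = yy a' (hnat n)"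
  hence "t:$(yy a (hnat n)) <-> t:$(yy a' (hnat n))" by simp
  thus False using t(2) n0 cs_mono[OF that] unfolding yy_def by auto
 qed
 thus ?thesis by blast
qed

lemma yy_ev: assumes "finite E" "E <= $(Prod K' homega)"
 shows "EX n>=m. ALL a:E. ALL a':E. yy a (hnat n) = yy a' (hnat n) --> a = a'"
proof -
 have "eventually (%n. ALL a:E. ALL a':E. yy a (hnat n) = yy a' (hnat n) --> a = a') sequentially"
 proof (intro eventually_ball_finite assms ballI)
  fix a a' assume a: "a:E" "a':E"
  show "eventually (%n. yy a (hnat n) = yy a' (hnat n) --> a = a') sequentially"
  proof (cases "a = a'")
   case False
   then obtain n0 where "ALL n>=n0. yy a (hnat n) ~= yy a' (hnat n)" using yy_diff a assms(2) by blast
   thus ?thesis unfolding eventually_sequentially by blast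
  qed simp
 qed
 then obtain n0 where "ALL n>=n0. ALL a:E. ALL a':E. yy a (hnat n) = yy a' (hnat n) --> a = a'" unfolding eventually_sequentially by blast
 thus ?thesis using max.cobounded1[of m n0] max.cobounded2[of n0 m] by blast
qed

text \<open>The bit at \<open>a\<close> of the new Cohen sequence is read at the first index \<open>n\<close> at which the first column
  attached to \<open>a\<close> has value 1.\<close>

definition rd where "rd p a n b <-> n:$homega & pair (pair (colA (vv a)) n) (bt True):$p &
 (ALL m:$n. pair (pair (colA (vv a)) m) (bt False):$p) & pair (pair (colB (yy a n)) n) b:$p"

lemma dt_col: "V.N.dt t ==> V.N.dt (%e. colA (t e))" "V.N.dt t ==> V.N.dt (%e. colB (t e))"
 "V.N.dt t ==> V.N.dt (%e. vv (t e))" "V.N.dt s ==> V.N.dt t ==> V.N.dt (%e. yy (t e) (s e))"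
proof -
 note f = MV1[OF u(1)] MV1[OF j(1)] MV1[OF xx(1)] MV1[OF cs(1)] FF_V1 V.N.bt_M
 show "V.N.dt t ==> V.N.dt (%e. colA (t e))" unfolding colA_def by (intro V.N.dfi f)
 show "V.N.dt t ==> V.N.dt (%e. colB (t e))" unfolding colB_def by (intro V.N.dfi f)
 show "V.N.dt t ==> V.N.dt (%e. vv (t e))" unfolding vv_def by (intro V.N.dfi f)
 show "V.N.dt s ==> V.N.dt t ==> V.N.dt (%e. yy (t e) (s e))"
  by (rule V.N.dt_app2[where F="%a b. yy a b"]) (unfold yy_def, intro V.N.dfi f)
qed
lemma df_rd: "V.N.dt s ==> V.N.dt t ==> V.N.dt r ==> V.N.dt w ==> V.N.df (%e. rd (s e) (t e) (r e) (w e))"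
 by (rule V.N.df_app4[where P=rd]) (unfold rd_def, intro dt_col V.N.dfi V.N.bt_M V.N.homega_M)

text \<open>Here F being finite-to-one on countable ground sets enters: \<open>j\<close> carries
  \<open>I\<close> to such a set.\<close>

lemma I0_fin: assumes I: "I:M" "$I <= $(Prod K' homega)" "M.lep I homega" and T: "finite T" "T <= $(Prod K K)"
 shows "finite {a:$I. vv a:T}"
proof -
 define I' where "I' = Img I (ap j)"
 have I'M: "I':M" unfolding I'_def by (rule M.dt_M0) (intro M.dfi I j)
 have "M.lep I' I" by (rule M.lep_surj[OF I(1) I'M, where F="ap j"]) (intro M.dfi j, simp add: I'_def)
 hence l: "M.lep I' homega" using M.lep_trans[OF _ I(3) I'M] by blast
 have s: "$I' <= $K'" using jj I(2) unfolding I'_def elts_Img by blast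
 have f: "finite (\<Union>v\<in>T. {al:$I'. ap FF al = v})" using FF_fin[OF I'M s l] T by blast
 have "ap j ` {a:$I. vv a:T} <= (\<Union>v\<in>T. {al:$I'. ap FF al = v})" by (auto simp: I'_def vv_def)
 hence "finite (ap j ` {a:$I. vv a:T})" using f by (rule finite_subset)
 moreover have "inj_on (ap j) {a:$I. vv a:T}" using j(2) I(2) unfolding inj_into_def inj_on_def by blast
 ultimately show ?thesis by (rule finite_imageD)
qed

end

lemma fin_bound: "finite (dom ph) ==> EX N::nat. ALL ta n. ph (ta, n) ~= None --> n < N"
proof -
 assume "finite (dom ph)"
 hence "finite (snd ` dom ph)" by simp
 then obtain N where "ALL n:snd ` dom ph. n < N" by (metis finite_nat_set_iff_bounded)
 hence "n < N" if "ph (ta, n) ~= None" for ta n using that by (force simp: dom_def)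
 thus ?thesis by blast
qed

context coh begin

text \<open>Only finitely many bits on \<open>I\<close>, those in \<open>I0\<close>, have a first
  column touched by \<open>p\<close>. Their reading is completed and gives \<open>d0\<close>. An
  extension \<open>d\<close> of \<open>d0\<close> in \<open>D\<close> adds finitely many bits
  \<open>E\<close> with untouched first columns, which can all be read at one late position
  \<open>k\<close> where their codes differ.\<close>

lemma read_dense:
 assumes D: "D:M" "$D <= Cohen K'" "!!p. p:Cohen K' ==> EX q:$D. $p <= $q" and p: "p:Cohen K"
 shows "EX q:Cohen K. $p <= $q & (EX d:$D. ALL z:$d. EX n:$homega. rd q (hfst z) n (hsnd z))"
proof -
 obtain I where I: "I:M" "$I <= $(Prod K' homega)" "M.lep I homega"
  "!!p. p:Cohen K' ==> $(hdom p) <= $I ==> EX q:$D. $p <= $q & $(hdom q) <= $I"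
  by (rule M.Cohen_closure[OF K'M(1) D], assumption) (rule that)
 obtain ph where ph: "finite (dom ph)" "fst ` dom ph <= $K" "p = cnd ph" using Cohen_cnd[OF p] by blast
 define T where "T = {v:$(Prod K K). colA v:fst ` dom ph}"
 have finT: "finite T"
 proof (rule finite_imageD[of colA])
  show "finite (colA ` T)" by (rule finite_subset[of _ "fst ` dom ph"]) (auto simp: T_def ph(1))
  show "inj_on colA T" using colA(2) by (auto simp: inj_on_def T_def simp del: elts_Prod)
 qed
 have TK: "T <= $(Prod K K)" by (auto simp: T_def)
 obtain N0 where N0: "!!ta n. ph (ta, n) ~= None ==> n < N0" using fin_bound[OF ph(1)] by blast
 \<comment> \<open>The touched first columns are completed up to \<open>N0\<close>, beyond all of
   \<open>p\<close>, with value 1 at \<open>N0\<close>; so the first 1 is determined. Values of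
   \<open>p\<close> take precedence in \<open>b1 ++ ph\<close>.\<close>
 define b1 where "b1 x = (if fst x:colA ` T & snd x <= N0 then Some (snd x = N0) else None)" for x :: "hc \<times> nat"
 define ph1 where "ph1 = b1 ++ ph"
 have dom1: "dom b1 <= (colA ` T) \<times> {..N0}" by (auto simp: b1_def split: if_splits)
 have f1: "finite (dom ph1)" unfolding ph1_def dom_map_add using ph(1) finite_subset[OF dom1] finT by auto
 have k1: "fst ` dom ph1 <= $K"
 proof -
  have "fst ` dom b1 <= $K" using dom1 TK colA(1) by force
  thus ?thesis unfolding ph1_def dom_map_add using ph(2) by blast
 qed
 define kk where "kk v = (LEAST n. ph1 (colA v, n) = Some True)" for v
 have top: "ph1 (colA v, N0) = Some True" if "v:T" for v
  using N0[of "colA v" N0] that by (auto simp: ph1_def b1_def map_add_def split: option.split)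
 have kk: "ph1 (colA v, kk v) = Some True" if "v:T" for v unfolding kk_def by (rule LeastI) (rule top[OF that])
 have kl: "ph1 (colA v, m) = Some False" if v: "v:T" "m < kk v" for v m
 proof -
  have "kk v <= N0" unfolding kk_def by (rule Least_le) (rule top[OF v(1)])
  hence "ph1 (colA v, m) ~= None" using v by (auto simp: ph1_def b1_def)
  moreover have "ph1 (colA v, m) ~= Some True" using not_less_Least[of m "%n. ph1 (colA v, n) = Some True"] v(2) unfolding kk_def by blast
  ultimately show ?thesis by (metis (full_types) not_None_eq)
 qed
 define I0 where "I0 = {a:$I. vv a:T}"
 have finI0: "finite I0" unfolding I0_def by (rule I0_fin[OF I(1-3) finT TK])
 have Ia: "a:$(Prod K' homega)" if "a:$I" for a using I(2) that by blast
 define pos where "pos a = (colB (yy a (hnat (kk (vv a)))), kk (vv a))" for a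
 \<comment> \<open>\<open>False\<close> is an arbitrary choice: the bits of \<open>I0\<close> only
   have to be decided before \<open>d\<close> is taken from \<open>D\<close>.\<close>
 define b2 where "b2 x = (if x:pos ` I0 then Some False else None)" for x :: "hc \<times> nat"
 define ph2 where "ph2 = b2 ++ ph1"
 have dom2: "dom b2 = pos ` I0" by (auto simp: b2_def split: if_splits)
 have f2: "finite (dom ph2)" unfolding ph2_def dom_map_add dom2 using f1 finI0 by blast
 have hw: "hnat n:$homega" for n by simp
 have k2: "fst ` dom ph2 <= $K"
 proof -
  have "fst (pos a):$K" if "a:I0" for a using colB(1)[OF yy[OF Ia hw]] that unfolding pos_def I0_def by simp
  thus ?thesis unfolding ph2_def dom_map_add dom2 using k1 by blast
 qed
 have A2: "ph2 (colA v, n) = ph1 (colA v, n)" if v: "v:$(Prod K K)" for v n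
 proof -
  have "(colA v, n)~:pos ` I0" using colAB[OF v yy[OF Ia hw]] unfolding pos_def I0_def by auto
  thus ?thesis unfolding ph2_def b2_def map_add_def by (simp split: option.split)
 qed
 have val2: "ph2 (pos a) ~= None" if "a:I0" for a using that by (auto simp: ph2_def b2_def)
 define d0 where "d0 = HSet ((%a. pair a (bt (the (ph2 (pos a))))) ` I0)"
 have ed0: "$d0 = (%a. pair a (bt (the (ph2 (pos a))))) ` I0"
  unfolding d0_def by (rule elts_HSet) (simp add: countable_finite finI0)
 have "d0:Cohen K'" unfolding Cohen_iff
 proof (intro conjI ballI allI impI)
  show "finite $d0" using ed0 finI0 by simp
  fix z assume "z:$d0"
  then obtain a where a: "a:I0" "z = pair a (bt (the (ph2 (pos a))))" unfolding ed0 by blast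
  then obtain i n where "i:$K'" "a = pair i (hnat n)" using Ia[of a] unfolding I0_def by auto
  thus "EX i:$K'. EX n b. z = pair (pair i (hnat n)) (bt b)" using a(2) by blast
 qed (auto simp: ed0)
 moreover have "$(hdom d0) <= $I" by (auto simp: ed0 I0_def)
 ultimately obtain d where d: "d:$D" "$d0 <= $d" "$(hdom d) <= $I" using I(4) by blast
 have dC: "d:Cohen K'" using d(1) D(2) by blast
 define E where "E = $(hdom d) - I0"
 have finE: "finite E" unfolding E_def using dC by (simp add: Cohen_iff)
 have EI: "E <= $I" unfolding E_def using d(3) by blast
 have EP: "E <= $(Prod K' homega)" using EI Ia by blast
 have ET: "vv a~:T" if "a:E" for a using that EI unfolding E_def I0_def by blast
 obtain N2 where N2: "!!ta n. ph2 (ta, n) ~= None ==> n < N2" using fin_bound[OF f2] by blast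
 obtain k where k: "k >= N2" "!!a a'. a:E ==> a':E ==> yy a (hnat k) = yy a' (hnat k) ==> a = a'"
  using yy_ev[OF finE EP] by blast
 \<comment> \<open>Elements of \<open>E\<close> with the same value of F share a first column and
   hence the position \<open>k\<close>. Their codes at \<open>k\<close> are distinct, so the bits
   prescribed by \<open>d\<close> go to different columns.\<close>
 define b3 where "b3 x = (if fst x:colA ` vv ` E & snd x <= k then Some (snd x = k)
  else if snd x = k & fst x:(%a. colB (yy a (hnat k))) ` E then Some (EX a:E. fst x = colB (yy a (hnat k)) & pair a (bt True):$d)
  else None)" for x :: "hc \<times> nat"
 define ph3 where "ph3 = b3 ++ ph2"
 have dom3: "dom b3 <= (colA ` vv ` E \<union> (%a. colB (yy a (hnat k))) ` E) \<times> {..k}"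
  by (auto simp: b3_def split: if_splits)
 have f3: "finite (dom ph3)" unfolding ph3_def dom_map_add using f2 finite_subset[OF dom3] finE by auto
 have k3: "fst ` dom ph3 <= $K"
 proof -
  have b3s: "fst ` dom b3 <= colA ` vv ` E \<union> (%a. colB (yy a (hnat k))) ` E" using dom3 by force
  have cK: "colA (vv a):$K" "colB (yy a (hnat k)):$K" if "a:E" for a
   using colA(1)[OF vv[OF subsetD[OF EP that]]] colB(1)[OF yy[OF subsetD[OF EP that] hw]] .
  have "fst ` dom b3 <= $K"
  proof
   fix ta assume "ta:fst ` dom b3"
   then consider a where "a:E" "ta = colA (vv a)" | a where "a:E" "ta = colB (yy a (hnat k))" using b3s by blast
   thus "ta:$K" by cases (simp_all only: cK)
  qed
  thus ?thesis unfolding ph3_def dom_map_add using k2 by (simp only: image_Un Un_least)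
 qed
 define q where "q = cnd ph3"
 have qC: "q:Cohen K" unfolding q_def by (rule cnd_Cohen[OF f3 k3])
 have le: "ph \<subseteq>\<^sub>m ph1" "ph1 \<subseteq>\<^sub>m ph2" "ph2 \<subseteq>\<^sub>m ph3" unfolding ph1_def ph2_def ph3_def by (rule map_le_map_add)+
 have pq: "$p <= $q" unfolding q_def ph(3) by (intro cnd_mono f3 map_le_trans[OF map_le_trans[OF le(1,2)] le(3)])
 have in_q: "pair (pair ta (hnat n)) (bt b):$q <-> ph3 (ta, n) = Some b" for ta n b unfolding q_def by (rule cnd_in[OF f3])
 have up: "ph3 x = Some b" if "ph2 x = Some b" for x b using that unfolding ph3_def by simp
 have mh: "EX l<n. m = hnat l" if "m:$(hnat n)" for m n using that by (auto simp: elts_hnat)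
 have "EX n:$homega. rd q (hfst z) n (hsnd z)" if z: "z:$d" for z
 proof -
  obtain a b where ab: "z = pair a (bt b)" using dC z unfolding Cohen_iff by blast
  have aI: "a:$I" using d(3) z ab by force
  have aP: "a:$(Prod K' homega)" using Ia aI .
  show ?thesis
  proof (cases "a:I0")
   case True
   have vT: "vv a:T" "vv a:$(Prod K K)" using True vv[OF aP] unfolding I0_def by auto
   obtain c where c: "ph2 (pos a) = Some c" using val2[OF True] by blast
   hence "pair a (bt c):$d" using d(2) True unfolding ed0 by force
   hence "bt b = bt c" using dC z ab unfolding Cohen_iff by blast
   hence bc: "ph2 (pos a) = Some b" using c by simp
   have "rd q a (hnat (kk (vv a))) (bt b)" unfolding rd_def
   proof (intro conjI ballI hw)
    show "pair (pair (colA (vv a)) (hnat (kk (vv a)))) (bt True):$q"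
     unfolding in_q using up A2[OF vT(2)] kk[OF vT(1)] by simp
    show "pair (pair (colB (yy a (hnat (kk (vv a))))) (hnat (kk (vv a)))) (bt b):$q"
     unfolding in_q using up bc unfolding pos_def by simp
    fix m assume "m:$(hnat (kk (vv a)))"
    then obtain l where "l < kk (vv a)" "m = hnat l" using mh by blast
    thus "pair (pair (colA (vv a)) m) (bt False):$q"
     using in_q up A2[OF vT(2)] kl[OF vT(1)] by simp
   qed
   thus ?thesis using ab by auto
  next
   case False
   have aE: "a:E" using False z ab unfolding E_def by force
   have vP: "vv a:$(Prod K K)" by (rule vv[OF aP])
   have n2: "ph2 (colA (vv a), m) = None" for m
   proof -
    have 1: "colA (vv a)~:colA ` T" using ET[OF aE] colA(2)[OF vP] TK by blast
    have "colA (vv a)~:fst ` dom ph" using ET[OF aE] vP unfolding T_def by blast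
    hence "ph (colA (vv a), m) = None" by force
    thus ?thesis unfolding A2[OF vP] ph1_def b1_def using 1 by simp
   qed
   have c3: "ph3 (colA (vv a), m) = Some (m = k)" if "m <= k" for m
    unfolding ph3_def b3_def using n2 that aE by (simp add: map_add_def)
   have nB: "colB (yy a (hnat k))~:colA ` vv ` E"
   proof
    assume "colB (yy a (hnat k)):colA ` vv ` E"
    then obtain a' where a': "a':E" "colB (yy a (hnat k)) = colA (vv a')" by auto
    thus False using colAB[OF vv[OF subsetD[OF EP a'(1)]] yy[OF aP hw[of k]]] by simp
   qed
   have "ph2 (colB (yy a (hnat k)), k) = None" using N2[of "colB (yy a (hnat k))" k] k(1) by (meson not_less)
   hence "ph3 (colB (yy a (hnat k)), k) = Some (EX a':E. colB (yy a (hnat k)) = colB (yy a' (hnat k)) & pair a' (bt True):$d)"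
    unfolding ph3_def b3_def using nB aE by (simp add: map_add_def)
   moreover have "(EX a':E. colB (yy a (hnat k)) = colB (yy a' (hnat k)) & pair a' (bt True):$d) <-> b"
   proof
    assume "EX a':E. colB (yy a (hnat k)) = colB (yy a' (hnat k)) & pair a' (bt True):$d"
    then obtain a' where a': "a':E" "colB (yy a (hnat k)) = colB (yy a' (hnat k))" "pair a' (bt True):$d" by blast
    have "a':$(Prod K' homega)" using EP a'(1) by blast
    hence "yy a (hnat k) = yy a' (hnat k)" using a'(2) colB(2)[OF yy[OF aP hw] yy[OF _ hw]] by blast
    hence "a = a'" using k(2) aE a'(1) by blast
    hence "bt b = bt True" using a'(3) z ab dC unfolding Cohen_iff by blast
    thus b by simp
   next
    assume b thus "EX a':E. colB (yy a (hnat k)) = colB (yy a' (hnat k)) & pair a' (bt True):$d"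
     using aE z ab by auto
   qed
   ultimately have v3: "ph3 (colB (yy a (hnat k)), k) = Some b" by simp
   have "rd q a (hnat k) (bt b)" unfolding rd_def
   proof (intro conjI ballI hw)
    show "pair (pair (colA (vv a)) (hnat k)) (bt True):$q" unfolding in_q using c3[of k] by simp
    show "pair (pair (colB (yy a (hnat k))) (hnat k)) (bt b):$q" unfolding in_q by (rule v3)
    fix m assume "m:$(hnat k)"
    then obtain l where "l < k" "m = hnat l" using mh by blast
    thus "pair (pair (colA (vv a)) m) (bt False):$q" using in_q c3[of l] by simp
   qed
   thus ?thesis using ab by auto
  qed
 qed
 thus ?thesis using qC pq d(1) by blast
qed

definition HH where "HH = Sep (M.CoS K') (%d. EX q:$W.Gh. ALL z:$d. EX n:$homega. rd q (hfst z) n (hsnd z))"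

text \<open>\<open>rd\<close> is definable over \<open>V1\<close>. To use it over the extension by
  \<open>G\<close> it is turned into a set: \<open>ls\<close> in \<open>V1\<close> maps each
  condition to the bits it reads.\<close>

lemma HH_in: "HH:W.N"
proof -
 have "V.N.df (%e. rd (e 0) (e (Suc 0)) (e (Suc (Suc 0))) (e (Suc (Suc (Suc 0)))))" by (intro df_rd V.N.dfi)
 define rs where "rs p = Sep (Prod (Prod (Prod K' homega) homega) (Upr (bt True) (bt False))) (%w. rd p (hfst (hfst w)) (hsnd (hfst w)) (hsnd w))" for p
 define ls where "ls = lam (V.N.CoS K) rs"
 have lsV: "ls:V1" unfolding ls_def rs_def
  by (rule V.N.dt_M0) (intro df_rd V.N.dfi V.N.CoS_M KV1 V.N.bt_M V.N.homega_M)
 have CM: "M.CoS K':W.N" by (rule W.M_N[OF MV1[OF M.CoS_M[OF K'M(1)]]])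
 have "HH = Sep (M.CoS K') (%d. EX q:$W.Gh. ALL z:$d. EX n:$homega. pair (pair (hfst z) n) (hsnd z):$(ap ls q))"
  unfolding HH_def
 proof (rule M.Sep_cong, intro bex_cong ball_cong refl)
  fix d q z n assume d: "d:$(M.CoS K')" and q: "q:$W.Gh" and z: "z:$d" and n: "n:$homega"
  have "q:$(V.N.CoS K)" using q W.G_P unfolding W.elts_Gh by blast
  hence ls: "ap ls q = rs q" unfolding ls_def by (rule ap_lam)
  obtain i m b where "z = pair (pair i (hnat m)) (bt b)" "i:$K'" using d z unfolding CoK' Cohen_iff by blast
  hence "pair (pair (hfst z) n) (hsnd z):$(Prod (Prod (Prod K' homega) homega) (Upr (bt True) (bt False)))"
   using n by (cases b) auto
  thus "rd q (hfst z) n (hsnd z) <-> pair (pair (hfst z) n) (hsnd z):$(ap ls q)"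
   unfolding ls rs_def by (simp del: elts_Prod)
 qed
 also have "\<dots>:W.N" by (rule W.N.dt_M0) (intro W.N.dfi CM W.Gh_N W.N.homega_M W.M_N[OF lsV])
 finally show ?thesis .
qed

lemma rd_unique: assumes q: "q:G" "q':G" "rd q a n b" "rd q' a n' b'" shows "b = b'"
proof -
 obtain r where r: "r:G" "$q <= $r" "$q' <= $r" using W.G_dir[OF q(1,2)] unfolding V.N.CL by blast
 have rC: "r:Cohen K" using W.G_P[OF r(1)] elts_CoK by blast
 have fn: "y = y'" if "pair x y:$r" "pair x y':$r" for x y y' using rC that unfolding Cohen_iff by blast
 have R: "rd r a n b" "rd r a n' b'" using q(3,4) r(2,3) unfolding rd_def by blast+
 have nn: "n = n'"
 proof -
  have "Ord n" "Ord n'" using R unfolding rd_def by auto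
  then consider "n:$n'" | "n = n'" | "n':$n" using Ord_linear by blast
  thus ?thesis
  proof cases
   case 1
   hence "bt True = bt False" using R fn unfolding rd_def by blast
   thus ?thesis by simp
  next
   case 3
   hence "bt True = bt False" using R fn unfolding rd_def by blast
   thus ?thesis by simp
  qed
 qed
 thus ?thesis using R fn unfolding rd_def by blast
qed

lemma elts_HH: "d:$HH <-> d:Cohen K' & (EX q:G. ALL z:$d. EX n:$homega. rd q (hfst z) n (hsnd z))"
 unfolding HH_def elts_Sep CoK' W.elts_Gh by blast

theorem Cohen_read: "Cohen_generic M K' $HH"
 unfolding Cohen_generic_def generic_filter_def Cohen_le_def
proof (intro conjI ballI impI)
 show "$HH <= Cohen K'" using elts_HH by blast
 obtain q0 where "q0:G" using W.G_one by blast
 hence "hempty:$HH" unfolding elts_HH using hempty_Cohen by auto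
 thus "$HH ~= {}" by blast
 show "q:$HH" if "p:$HH" "q:Cohen K'" "$q <= $p" for p q using that unfolding elts_HH by blast
next
 fix p q assume p: "p:$HH" and q: "q:$HH"
 obtain g h where g: "g:G" "!!z. z:$p ==> EX n:$homega. rd g (hfst z) n (hsnd z)"
  and h: "h:G" "!!z. z:$q ==> EX n:$homega. rd h (hfst z) n (hsnd z)" using p q unfolding elts_HH by blast
 obtain r where r: "r:G" "$g <= $r" "$h <= $r" using W.G_dir[OF g(1) h(1)] unfolding V.N.CL by blast
 have rm: "rd r a n b" if "rd g a n b \<or> rd h a n b" for a n b using that r(2,3) unfolding rd_def by blast
 have R: "EX n:$homega. rd r (hfst z) n (hsnd z)" if "z:$(uni p q)" for z using that g(2) h(2) rm by auto blast+
 have pC: "p:Cohen K'" "q:Cohen K'" using p q elts_HH by auto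
 have "uni p q:Cohen K'" unfolding Cohen_iff
 proof (intro conjI ballI allI impI)
  show "finite ($(uni p q))" using pC by (auto simp: Cohen_iff)
  show "EX i:$K'. EX n b. z = pair (pair i (hnat n)) (bt b)" if "z:$(uni p q)" for z
   using that pC unfolding Cohen_iff by auto
  fix x y y' assume "pair x y:$(uni p q) & pair x y':$(uni p q)"
  then obtain n n' where "rd r x n y" "rd r x n' y'" using R[of "pair x y"] R[of "pair x y'"] unfolding hfst hsnd by blast
  thus "y = y'" using rd_unique[OF r(1) r(1)] by blast
 qed
 hence "uni p q:$HH" unfolding elts_HH using R r(1) by blast
 thus "EX r:$HH. $p <= $r & $q <= $r" by (rule bexI[rotated]) auto
next
 fix D assume D: "D:M" "$D <= Cohen K' & (ALL p:Cohen K'. EX q:$D. $p <= $q)"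
 have "EX q:G. EX d:$D. ALL z:$d. EX n:$homega. rd q (hfst z) n (hsnd z)"
 proof (rule W.G_dense)
  show "V.N.df (%e. EX d:$D. ALL z:$d. EX n:$homega. rd (e 0) (hfst z) n (hsnd z))"
   by (intro df_rd V.N.dfi MV1[OF D(1)] V.N.homega_M)
  fix p assume "p:$(V.N.CoS K)"
  hence pC: "p:Cohen K" using elts_CoK by blast
  obtain q where "q:Cohen K" "$p <= $q" "EX d:$D. ALL z:$d. EX n:$homega. rd q (hfst z) n (hsnd z)"
   using read_dense[OF D(1) _ _ pC] D(2) by blast
  thus "EX q:$(V.N.CoS K). W.le q p & (EX d:$D. ALL z:$d. EX n:$homega. rd q (hfst z) n (hsnd z))"
   unfolding V.N.CL elts_CoK using pC by blast
 qed
 thus "$HH \<inter> $D ~= {}" using D(2) elts_HH by blast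
qed

lemma HH_ext: "EX H':gen_ext V1 (Cohen K) G. Cohen_generic M K' $H'"
 using Cohen_read HH_in W.N_gen unfolding elts_CoK by blast

end

section \<open>Existence of generic filters\<close>

text \<open>The model is countable, so its dense sets can be met one after another by a descending
  sequence.\<close>

lemma (in forcing) ex_generic: "EX G. generic_filter M $P (%p q. pair p q:$L) G"
proof -
 define Ds where "Ds = {D:M. $D <= $P & (ALL p:$P. EX q:$D. le q p)}"
 have Dc: "countable Ds" by (rule countable_subset[OF _ countable_M]) (auto simp: Ds_def)
 have PD: "P:Ds" using PM le_refl by (auto simp: Ds_def)
 define D where "D n = from_nat_into Ds n" for n
 have D: "D n:Ds" for n unfolding D_def by (rule from_nat_into) (use PD in blast)
 define f where "f n p = (SOME q. q:$(D n) & le q p)" for n p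
 have f: "f n p:$(D n) & le (f n p) p" if "p:$P" for n p
  unfolding f_def by (rule someI_ex) (use D[of n] that in "auto simp: Ds_def")
 define s where "s = rec_nat one f"
 have sS: "s (Suc n) = f n (s n)" for n by (simp add: s_def)
 have sP: "s n:$P" for n
 proof (induction n)
  case 0 show ?case using one(1) by (simp add: s_def)
 next
  case (Suc n) thus ?case using f[of "s n" n] D[of n] unfolding sS Ds_def by blast
 qed
 have dec: "m <= n ==> le (s n) (s m)" for m n
 proof (induction n)
  case 0 thus ?case using le_refl sP by simp
 next
  case (Suc n)
  show ?case
  proof (cases "m = Suc n")
   case False
   hence "le (s n) (s m)" using Suc by simp
   moreover have "le (s (Suc n)) (s n)" unfolding sS using f sP by blast
   ultimately show ?thesis using le_trans sP by blast
  qed (use le_refl sP in simp)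
 qed
 show ?thesis
 proof (rule exI, unfold generic_filter_def, intro conjI ballI impI)
  let ?G = "{p:$P. EX n. le (s n) p}"
  show "?G <= $P" by blast
  show "?G ~= {}" using sP le_refl by blast
  show "q:?G" if "p:?G" "q:$P" "le p q" for p q using that le_trans sP by blast
  show "EX r:?G. le r p & le r q" if pq: "p:?G" "q:?G" for p q
  proof -
   obtain m n where mn: "le (s m) p" "le (s n) q" "p:$P" "q:$P" using pq by blast
   have "le (s (max m n)) p" "le (s (max m n)) q"
    using le_trans[OF dec[of m "max m n"] mn(1)] le_trans[OF dec[of n "max m n"] mn(2)] sP mn(3,4) by simp_all
   thus ?thesis using sP le_refl by blast
  qed
  fix D' assume D': "D':M" "$D' <= $P & (ALL p:$P. EX q:$D'. le q p)"
  hence "D':Ds" by (simp add: Ds_def)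
  then obtain n where "D' = D n" unfolding D_def using from_nat_into_surj[OF Dc] by metis
  hence "s (Suc n):$D'" unfolding sS using f sP by blast
  thus "?G \<inter> $D' ~= {}" using sP le_refl by blast
 qed
qed

section \<open>Exploiting the Mitchell orders and assembling the two extensions\<close>

locale limit_mitchell = tmc V for V +
 fixes \<kappa> \<kappa>p and \<kappa>s os :: "nat => hc"
 assumes gch: "GCH V" and seq: "hseq \<kappa>s:V" and sC: "!!n. is_cardinal V (\<kappa>s n)" and sK: "!!n. \<kappa>s n:$\<kappa>"
  and kap: "\<kappa> = hUnion (range \<kappa>s)" and mo: "!!n. mitchell_order V (\<kappa>s n) (os n)"
  and osK: "hUnion (range os) = \<kappa>" and succ: "is_successor_cardinal V \<kappa> \<kappa>p"
begin

lemma elts_hUnion: "$(hUnion (range f)) = (\<Union>n::nat. $(f n))"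
 unfolding hUnion_def by (subst elts_HSet) simp_all
lemma elK: "$\<kappa> = (\<Union>n. $(\<kappa>s n))" and elO: "$\<kappa> = (\<Union>n. $(os n))"
 using elts_hUnion[of \<kappa>s] elts_hUnion[of os] unfolding osK kap[symmetric] .

lemma sq: "ap (hseq \<kappa>s) (hnat n) = \<kappa>s n"
proof (rule ap_eq)
 have "$(hseq \<kappa>s) = range (%n. pair (hnat n) (\<kappa>s n))" unfolding hseq_def by (rule elts_HSet) simp
 thus "pair (hnat n) y:$(hseq \<kappa>s) <-> y = \<kappa>s n" for y by auto
qed

lemma sM: "\<kappa>s n:V" and sO: "Ord (\<kappa>s n)" using sC Card_M Card_Ord by auto
lemma KO: "Ord \<kappa>"
proof (rule OrdI)
 fix y z assume "y:$\<kappa>"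
 then obtain n where n: "y:$(\<kappa>s n)" unfolding elK by blast
 show "Ord y" using Ord_in[OF sO n] .
 show "z:$\<kappa>" if "z:$y" using Ord_trans[OF sO n that] unfolding elK by blast
qed
lemma KV: "\<kappa>:V"
proof -
 have "\<kappa> = UU (Img homega (ap (hseq \<kappa>s)))" by (rule hc_eqI) (simp add: elK image_image sq)
 also have "\<dots>:V" by (rule dt_M0) (intro dfi seq homega_M)
 finally show ?thesis .
qed
lemma elV: "a:$\<kappa> ==> a:V & Ord a" using trans[OF KV] Ord_in[OF KO] by blast
lemma KC: "Card \<kappa>"
 unfolding Card_iff
proof (intro conjI ballI notI KV KO)
 fix a assume a: "a:$\<kappa>" "eqp a \<kappa>"
 obtain n where n: "a:$(\<kappa>s n)" using a(1) elK by blast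
 have "lep \<kappa> a" using eqp_lep[OF eqp_sym[OF a(2)]] elV[OF a(1)] KV by blast
 moreover have "lep (\<kappa>s n) \<kappa>" by (rule lep_subset[OF sM]) (use elK in blast)
 ultimately show False using lep_trans[OF _ _ sM] Card_not_lep[OF sC n] by blast
qed

lemma above: assumes "a:$\<kappa>" "b:$\<kappa>" obtains n where "a:$(\<kappa>s n)" "b:$(\<kappa>s n)"
proof -
 obtain m n where mn: "a:$(\<kappa>s m)" "b:$(\<kappa>s n)" using assms elK by blast
 consider "\<kappa>s m:$(\<kappa>s n)" | "\<kappa>s m = \<kappa>s n" | "\<kappa>s n:$(\<kappa>s m)" using Ord_linear[OF sO sO] by blast
 thus ?thesis
 proof cases
  case 1 show ?thesis by (rule that[OF Ord_trans[OF sO 1 mn(1)] mn(2)])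
 next
  case 2 show ?thesis by (rule that[of m]) (use mn 2 in simp_all)
 next
  case 3 show ?thesis by (rule that[OF mn(1) Ord_trans[OF sO 3 mn(2)]])
 qed
qed

text \<open>Some \<open>os n\<close> is nonempty, so \<open>\<kappa>s n\<close> carries a normal
  measure and exceeds omega.\<close>

lemma wK: "homega:$\<kappa>"
proof -
 obtain n where "\<kappa>s 0:$(os n)" using sK[of 0] elO by blast
 hence "os n ~= HSet {}" by auto
 moreover obtain rh where "os n = hUnion {hsucc (rh U) |U. normal_measure V (\<kappa>s n) U}"
  using mo[of n] unfolding mitchell_order_def by blast
 ultimately have "EX U. normal_measure V (\<kappa>s n) U" by (cases "EX U. normal_measure V (\<kappa>s n) U") (simp_all add: hUnion_def)
 then obtain U where U: "normal_measure V (\<kappa>s n) U" by blast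
 thus ?thesis using elK normal_meas[OF U] by (auto simp: meas_def)
qed
lemma KI: "InfO \<kappa>" unfolding InfO_def using KV KO Ord_trans[OF KO wK] by blast

lemma powK: assumes "a:$\<kappa>" obtains m where "lep (hPow V a) (\<kappa>s m)"
proof -
 obtain n where n: "a:$(\<kappa>s n)" "homega:$(\<kappa>s n)" by (rule above[OF assms wK])
 obtain m where m: "\<kappa>s n:$(\<kappa>s m)" using sK elK by blast
 have "Card (\<kappa>s m) & \<kappa>s n:$(\<kappa>s m)" using sC m by blast
 then obtain l where l: "Card l" "\<kappa>s n:$l" "!!c. c:$l ==> ~ (Card c & \<kappa>s n:$c)"
  using Ord_least[of "%l. Card l & \<kappa>s n:$l"] by blast
 have sub: "$l <= $c" if "Card c" "\<kappa>s n:$c" for c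
  using l(3) that Ord_not_sub[OF Card_Ord[OF l(1)] Card_Ord[OF that(1)]] by blast
 have s: "is_successor_cardinal V (\<kappa>s n) l" unfolding is_successor_cardinal_def using l(1,2) sub by blast
 have w: "$homega <= $(\<kappa>s n)" using Ord_trans[OF sO n(2)] by blast
 have lM: "l:V" using Card_M l by blast
 have aV: "a:V" using elV assms by blast
 have "lep a (\<kappa>s n)" by (rule lep_subset[OF aV]) (use Ord_trans[OF sO n(1)] in blast)
 hence "lep (hPow V a) (hPow V (\<kappa>s n))" by (rule lep_hPow[OF _ aV sM])
 moreover have "lep (hPow V (\<kappa>s n)) l" by (rule eqp_lep[OF GCH_eqp[OF gch sC w s]])
 moreover have "lep l (\<kappa>s m)" by (rule lep_subset[OF lM sub[OF sC m]])
 ultimately show ?thesis using that lep_trans hPow_M aV by meson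
qed

text \<open>If \<open>\<kappa>s n\<close> were at most \<open>b\<close>, then
  \<open>\<kappa>s m3\<close>, an element of its Mitchell order, would inject into the double power
  set of \<open>b\<close> and hence into the smaller cardinal \<open>\<kappa>s m2\<close>: the
  indices \<open>m1\<close> and \<open>m2\<close> bound the two power sets. Since
  \<open>\<kappa>s m3\<close> also exceeds omega, the order is at least 2.\<close>

lemma o_large: assumes b: "b:$\<kappa>" obtains n where "b:$(\<kappa>s n)" "$(hnat 2) <= $(os n)"
proof -
 obtain m1 where m1: "lep (hPow V b) (\<kappa>s m1)" by (rule powK[OF b])
 obtain m2 where m2: "lep (hPow V (\<kappa>s m1)) (\<kappa>s m2)" by (rule powK[OF sK])
 obtain m3 where m3: "\<kappa>s m2:$(\<kappa>s m3)" "homega:$(\<kappa>s m3)" by (rule above[OF sK wK])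
 obtain n where n: "\<kappa>s m3:$(os n)" using sK[of m3] elO by blast
 note bd = mitchell_order_bound[OF mo sM sM sO n]
 have bV: "b:V" "Ord b" using elV b by auto
 have "b:$(\<kappa>s n)"
 proof (rule ccontr)
  assume "b~:$(\<kappa>s n)"
  hence "lep (\<kappa>s n) b" using Ord_not_sub[OF sO bV(2)] by (intro lep_subset sM) blast
  hence "lep (hPow V (\<kappa>s n)) (\<kappa>s m1)" using lep_trans[OF lep_hPow[OF _ sM bV(1)] m1] hPow_M sM by blast
  hence "lep (hPow V (hPow V (\<kappa>s n))) (\<kappa>s m2)" using lep_trans[OF lep_hPow[OF _ hPow_M[OF sM] sM] m2] hPow_M sM by blast
  hence "lep (\<kappa>s m3) (\<kappa>s m2)" using lep_trans[OF bd(1)] sM by blast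
  thus False using Card_not_lep[OF sC m3(1)] by blast
 qed
 moreover have "$(hnat 2) <= $(os n)"
 proof
  fix x assume "x:$(hnat 2)"
  hence "x:$homega" by (auto simp: elts_hnat)
  thus "x:$(os n)" using Ord_trans[OF sO m3(2)] bd(2) by blast
 qed
 ultimately show ?thesis using that by blast
qed

definition msb where "msb dl <-> (EX v:V. meas dl v)"
text \<open>Measurable cardinals below \<kappa> that are not limits of measurable cardinals. This
  discreteness is the boundedness that \<open>prodf\<close> demands.\<close>

definition J where "J = Sep \<kappa> (%dl. msb dl & (EX be:$dl. ALL x:$dl. msb x --> x:$be))"
lemma df_msb [dfi]: "dt t ==> df (%e. msb (t e))" by (rule df_app1[where P=msb]) (unfold msb_def, intro dfi)
lemma JV: "J:V" unfolding J_def by (rule dt_M0) (intro dfi KV)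

text \<open>Mitchell order at least 2 makes \<open>\<kappa>s n\<close> a limit of measurable
  cardinals; the least one above a given \<open>c\<close> has no measurable cardinal between
  \<open>c\<close> and itself, so it belongs to \<open>J\<close>.\<close>

lemma J_unb: assumes b: "b:$\<kappa>"
 obtains n where "b:$(\<kappa>s n)" "msb (\<kappa>s n)" "!!c. c:$(\<kappa>s n) ==> EX dl:$J. dl:$(\<kappa>s n) & c:$dl"
proof -
 obtain n where n: "b:$(\<kappa>s n)" "$(hnat 2) <= $(os n)" by (rule o_large[OF b])
 obtain U W where UW: "mitchell_less V (\<kappa>s n) U W" using mitchell_order_pos[OF mo n(2)] by blast
 have m: "msb (\<kappa>s n)" using UW normal_meas unfolding mitchell_less_def msb_def meas_def by blast
 show ?thesis
 proof (rule that[OF n(1) m])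
  fix c assume c: "c:$(\<kappa>s n)"
  obtain a where a: "a:$(\<kappa>s n)" "c:$a" "msb a" using mitchell_meas[OF UW c] unfolding msb_def by blast
  have aO: "Ord a" using Ord_in[OF sO a(1)] .
  obtain dl where d: "dl:$(hsucc a)" "c:$dl" "msb dl" "!!x. x:$dl ==> ~ (x:$(hsucc a) & c:$x & msb x)"
   using Ord_least[of "%x. x:$(hsucc a) & c:$x & msb x" a] a by auto
  have dO: "Ord dl" using Ord_in[OF Ord_hsucc[OF aO] d(1)] .
  have dn: "dl:$(\<kappa>s n)" using d(1) a(1) Ord_trans[OF sO a(1)] by auto
  obtain v where "meas dl v" using d(3) unfolding msb_def by blast
  then interpret m: measure V dl v by unfold_locales
  have "x:$(hsucc c)" if x: "x:$dl" "msb x" for x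
  proof -
   have "c~:$x" using d(4)[OF x(1)] x(2) Ord_trans[OF Ord_hsucc[OF aO] d(1) x(1)] by blast
   thus ?thesis using Ord_linear[of x c] Ord_in[OF dO] x(1) d(2) by auto
  qed
  hence "EX be:$dl. ALL x:$dl. msb x --> x:$be" by (intro bexI[OF _ m.dsucc[OF d(2)]]) blast
  moreover have "dl:$\<kappa>" using dn elK by blast
  ultimately have "dl:$J" unfolding J_def using d(3) by simp
  thus "EX dl:$J. dl:$(\<kappa>s n) & c:$dl" using dn d(2) by blast
 qed
qed

lemma ex_Um: "EX u:V. ALL dl:$J. meas dl (ap u dl)"
proof -
 have dm: "df (%e. meas (e 0) (e (Suc 0)))" by (intro dfi)
 have ex: "EX v:V. meas dl v" if "dl:$J" for dl using that unfolding J_def msb_def by auto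
 obtain u where "u:V" "fun_on u J" "!!dl. dl:$J ==> meas dl (ap u dl) & ap u dl:V"
  by (rule AC[OF JV dm ex], assumption) (rule that)
 thus ?thesis by blast
qed
definition Um where "Um = (SOME u. u:V & (ALL dl:$J. meas dl (ap u dl)))"
lemma Um: "Um:V" "dl:$J ==> meas dl (ap Um dl)"
 using someI_ex[of "%u. u:V & (ALL dl:$J. meas dl (ap u dl))"] ex_Um unfolding Um_def by blast+

sublocale p: prodf V J Um
proof unfold_locales
 show "J:V" "Um:V" by (rule JV Um)+
 fix dl assume dl: "dl:$J"
 show "meas dl (ap Um dl)" by (rule Um(2)[OF dl])
 show "EX be:$dl. ALL x:$J. x:$dl --> x:$be" using dl unfolding J_def by auto
qed

text \<open>The maximum of the first \<open>n + 1\<close> cardinals, since the given sequence need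
  not be increasing.\<close>

definition cs where "cs = lam homega (%n. UU (Img (hsucc n) (ap (hseq \<kappa>s))))"
lemma csV: "cs:V" unfolding cs_def by (rule dt_M0) (intro dfi homega_M seq)
lemma cs: "$(ap cs (hnat n)) = (\<Union>m\<le>n. $(\<kappa>s m))"
proof -
 have "$(hsucc (hnat n)) = hnat ` {..n}" using elts_hnat[of "Suc n"] by (simp add: lessThan_Suc_atMost)
 thus ?thesis unfolding cs_def by (simp add: image_image sq del: elts_hsucc)
qed
lemma csK: "ap cs (hnat n):$\<kappa>"
proof (induction n)
 case 0
 have "ap cs (hnat 0) = \<kappa>s 0" by (rule hc_eqI) (subst cs, simp)
 thus ?case using sK by simp
next
 case (Suc n)
 have O: "Ord (ap cs (hnat n))" using elV Suc by blast
 have e: "$(ap cs (hnat (Suc n))) = $(ap cs (hnat n)) \<union> $(\<kappa>s (Suc n))" unfolding cs by (simp add: atMost_Suc Un_commute)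
 have "$(ap cs (hnat n)) <= $(\<kappa>s (Suc n)) \<or> $(\<kappa>s (Suc n)) <= $(ap cs (hnat n))"
  using Ord_linear[OF O sO[of "Suc n"]] Ord_subset[OF O sO[of "Suc n"]] Ord_subset[OF sO[of "Suc n"] O] by blast
 hence "$(ap cs (hnat (Suc n))) = $(\<kappa>s (Suc n)) \<or> $(ap cs (hnat (Suc n))) = $(ap cs (hnat n))" unfolding e by blast
 hence "ap cs (hnat (Suc n)) = \<kappa>s (Suc n) \<or> ap cs (hnat (Suc n)) = ap cs (hnat n)" using hc_eqI by blast
 thus ?case using Suc sK by metis
qed

end

locale limit_generic = limit_mitchell V \<kappa> \<kappa>p \<kappa>s os + g: prodg V "limit_mitchell.J V \<kappa>" "limit_mitchell.Um V \<kappa>" G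
 for V \<kappa> \<kappa>p \<kappa>s os G
begin

text \<open>Conditions with the same stem are compatible and there are at most \<kappa> stems. So
  each value of \<open>b\<close> lies in a ground set of size at most \<kappa>, whose supremum stays
  below the successor.\<close>

lemma cover_K:
 assumes S: "S:V" and b: "b:g.N" "!!s. s:$S ==> ap b s:$\<kappa>p"
 shows "EX B:V. ALL s:$S. ap B s:$\<kappa>p & $(ap b s) <= $(ap B s)"
proof -
 have kpC: "Card \<kappa>p" using succ by (simp add: is_successor_cardinal_def)
 have kpV: "\<kappa>p:V" "Ord \<kappa>p" using Card_M Card_Ord kpC by auto
 define f where "f = lam S (ap b)"
 have fN: "f:g.N" unfolding f_def by (rule g.N.dt_M0) (intro g.N.dfi g.M_N S b)
 obtain C where C: "C:V" "!!s. s:$S ==> $(ap C s) <= $\<kappa>p & ap f s:$(ap C s) & lep (ap C s) p.St"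
 proof (rule g.cover[where st=hfst and S=p.St and f=f and a=S and b=\<kappa>p])
  show "p.St:V" "dt (%e. hfst (e 0))" by (rule p.St_M, intro dfi)
  show "hfst p:$p.St" if "p:$p.P" for p using that by (auto elim: p.PE)
  fix p q r assume pq: "p:$p.P" "q:$p.P" "hfst p = hfst q"
  obtain t A where p: "p = pair t A" "t:$p.St" "A:$p.Sd" using pq(1) by (rule p.PE)
  obtain t' A' where q: "q = pair t' A'" "A':$p.Sd" using pq(2) by (rule p.PE)
  have "p.Int2 A A':$p.Sd" using p.Sd_Int p q by blast
  hence "p.leq (pair t (p.Int2 A A')) p & p.leq (pair t (p.Int2 A A')) q"
   using pq p q unfolding p(1) q(1) p.inL p.inP by auto
  thus "EX w:$p.P. p.leq w p & p.leq w q" using p.leP by blast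
 next
  show "f:g.N" "S:V" "\<kappa>p:V" by fact+
  show "fun_on f S" by (simp add: f_def)
  show "ap f s:$\<kappa>p" if "s:$S" for s using b(2) that by (simp add: f_def)
 qed (rule that)
 have "$p.St <= $(p.StL \<kappa>)"
 proof
  fix t assume t: "t:$p.St"
  have "hfst z:$(hsucc \<kappa>)" if "z:$t" for z
  proof -
   have "z:$p.X0" using p.StD[OF t] that by blast
   then obtain dl nv where "z = pair dl nv" "dl:$J" by (rule p.X0E)
   thus ?thesis by (auto simp: J_def)
  qed
  thus "t:$(p.StL \<kappa>)" using t unfolding p.StL_def by simp
 qed
 hence "lep p.St (p.StL \<kappa>)" by (rule lep_subset[OF p.St_M])
 hence lSt: "lep p.St \<kappa>" by (rule lep_trans[OF _ p.lep_stems[OF KI _ KV] p.St_M]) simp_all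
 show ?thesis
 proof (intro bexI ballI conjI)
  show "lam S (%s. UU (ap C s)):V" by (rule dt_M0) (intro dfi S C)
  fix s assume s: "s:$S"
  have CsV: "ap C s:V" using ap_M C(1) trans[OF S s] by blast
  have "lep (ap C s) \<kappa>" using lep_trans[OF _ lSt CsV] C(2)[OF s] by blast
  thus "ap (lam S (%s. UU (ap C s))) s:$\<kappa>p"
   unfolding ap_lam[OF s] using succ_sup[OF succ KI CsV] C(2)[OF s] by blast
  show "$(ap b s) <= $(ap (lam S (%s. UU (ap C s))) s)"
   unfolding ap_lam[OF s] using C(2)[OF s] s by (auto simp: f_def)
 qed
qed

lemma blocks:
 assumes th: "th:$\<kappa>"
 shows "EX d:$\<kappa>. EX J':g.N. EX x:g.N. EX h:g.N. $J' <= $d & (ALL ze:$d. hsucc ze:$d) & $th = ap h ` $J' &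
   (ALL dl:$J'. ap x dl:$dl & (ALL dl':$J'. dl':$dl --> dl':$(hsucc (ap x dl)))) &
   (ALL I:V. $I <= $d & lep I homega --> finite {dl:$J'. ap x dl:$I})"
proof -
 obtain n where n: "th:$(\<kappa>s n)" "msb (\<kappa>s n)" "!!c. c:$(\<kappa>s n) ==> EX dl:$J. dl:$(\<kappa>s n) & c:$dl"
  by (rule J_unb[OF th]) (rule that)
 define d where "d = \<kappa>s n"
 have dV: "d:V" "Ord d" using sM sO by (auto simp: d_def)
 obtain v where "meas d v" using n(2) unfolding d_def msb_def by blast
 then interpret m: measure V d v by unfold_locales
 have thV: "th:V" "Ord th" using elV[OF th] by auto
 show ?thesis
 proof (cases "$th = {}")
  case True
  have "hempty:g.N" by (rule g.N.hempty_M)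
  thus ?thesis using True m.dsucc sK[of n] unfolding d_def[symmetric]
   by (intro bexI[of _ d] bexI[of _ hempty]) auto
 next
  case False
  then obtain y0 where y0: "y0:$th" by blast
  define J' where "J' = Sep J (%dl. dl:$d)"
  have J'V: "J':V" unfolding J'_def by (rule dt_M0) (intro dfi JV dV)
  \<comment> \<open>Fewer than \<open>d\<close> many elements of \<open>d\<close> are bounded in
    \<open>d\<close> by completeness, but \<open>J'\<close> is unbounded.\<close>
  have nl: "~ lep J' th"
  proof
   assume l: "lep J' th"
   have "m.L (%a. ALL dl:$J'. dl:$a)"
    by (rule m.L_completeE[OF J'V _ l, where P="%x a. x:$a"]) (use n(1) m.L_tail in "auto simp: d_def J'_def intro: dfi")
   then obtain a where a: "a:$d" "ALL dl:$J'. dl:$a" using m.L_ex by blast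
   then obtain dl where "dl:$J'" "a:$dl" using n(3)[of a] unfolding J'_def d_def by auto
   thus False using a Ord_trans[OF Ord_in[OF dV(2) a(1)], of dl a] by auto
  qed
  obtain al where al: "al:V" "Ord al" "eqp al J'" using Zermelo[OF J'V] by blast
  have "~ $al <= $th" using nl lep_trans[OF eqp_lep[OF eqp_sym[OF al(3,1) J'V]] lep_subset[OF al(1)] J'V] by blast
  hence "th:$al" using Ord_not_sub[OF al(2) thV(2)] by blast
  hence "lep th al" using Ord_trans[OF al(2)] by (intro lep_subset thV) blast
  hence "lep th J'" using lep_trans[OF _ eqp_lep[OF al(3)] thV(1)] by blast
  then obtain i where i: "i:V" "inj_into i th J'" by (auto simp: lep_iff)
  obtain h where hV: "h:V" and hi: "!!y. y:$th ==> ap i y:$J' & ap h (ap i y) = y"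
   and hJ: "!!x. x:$J' ==> ap h x:$th" by (rule inv_fun[OF i thV(1) J'V y0]) (rule that)
  have hh: "$th = ap h ` $J'" using hi hJ by (metis (no_types, lifting) imageE imageI subsetI subset_antisym)
  define s where "s dl = UU (Sep J (%dl'. dl':$dl))" for dl
  \<comment> \<open>\<open>s dl\<close> is the supremum of the elements of \<open>J\<close> below
    \<open>dl\<close>. It replaces the generic point where that point fails to exceed it, so the
    interleaving holds without exception.\<close>
  define x where "x = lam J' (%dl. if s dl:$(ap g.nu dl) then ap g.nu dl else s dl)"
  have xN: "x:g.N" unfolding x_def s_def by (rule g.N.dt_M0) (intro g.N.dfi g.M_N J'V g.nu_N JV)
  have J'J: "dl:$J & Ord dl & dl:V & dl:$d" if "dl:$J'" for dl
   using that p.J_Ord p.J_M unfolding J'_def by auto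
  have sO': "Ord (s dl)" for dl unfolding s_def by (rule Ord_UU) (use p.J_Ord in auto)
  have sdl: "s dl:$dl" if dl: "dl:$J" for dl
  proof -
   obtain be where be: "be:$dl" "ALL x:$J. x:$dl --> x:$be" using p.Jb[OF dl] by blast
   have O: "Ord dl" "Ord be" using p.J_Ord[OF dl] Ord_in be(1) by auto
   have "$(s dl) <= $be" using be(2) Ord_trans[OF O(2)] by (auto simp: s_def)
   thus ?thesis using Ord_subset[OF sO' O(2)] Ord_trans[OF O(1) be(1)] be(1) by auto
  qed
  have xs: "ap x dl = (if s dl:$(ap g.nu dl) then ap g.nu dl else s dl)" if "dl:$J'" for dl
   using that by (simp add: x_def)
  have sx: "dl':$(hsucc (ap x dl))" if dl: "dl:$J'" "dl':$J'" "dl':$dl" for dl dl'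
  proof -
   have nO: "Ord (ap g.nu dl)" using g.nu_fun(1) J'J[OF dl(1)] Ord_in by blast
   have xO: "Ord (ap x dl)" using xs[OF dl(1)] nO sO' by simp
   have "$dl' <= $(s dl)" using dl J'J unfolding s_def by auto
   also have "\<dots> <= $(ap x dl)" using xs[OF dl(1)] Ord_trans[OF nO] by auto
   finally show ?thesis using Ord_subset[of dl' "ap x dl"] xO J'J[OF dl(2)] by auto
  qed
  have fin: "finite {dl:$J'. ap x dl:$I}" if I: "I:V" "$I <= $d" "lep I homega" for I
  proof -
   \<comment> \<open>Points not above \<open>s\<close> are included, so the same null set also
     covers the arguments at which \<open>x\<close> takes the replacement value.\<close>
   define W where "W = Sep p.X0 (%z. hsnd z:$I \<or> s (hfst z)~:$(hsnd z))"
   have WV: "W:V" unfolding W_def s_def by (rule dt_M0) (intro dfi p.X0_M I JV)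
   have "finite {dl:$J. pair dl (ap g.nu dl):$W}"
   proof (rule g.nu_avoid[OF WV], rule notI)
    fix dl assume dl: "dl:$J" "Lg dl (ap Um dl) (%nv. pair dl nv:$W)"
    interpret k: measure V dl "ap Um dl" by (rule p.mz[OF dl(1)])
    have sV: "s dl:V" using k.dsub sdl[OF dl(1)] by blast
    have 1: "k.L (%a. ALL x:$I. a ~= x)"
    proof (rule k.L_completeE[OF I(1) k.d(4) I(3), where P="%x a. a ~= x"])
     show "k.L (%a. a ~= x)" for x
      by (cases "x:$dl") (use k.L_ne in "blast", intro k.L_all, blast)
    qed (intro dfi)
    have d1: "df (%e. ALL x:$I. e 0 ~= x)" "df (%e. s dl:$(e 0))" by (intro dfi I sV)+
    have 2: "k.L (%a. (ALL x:$I. a ~= x) & s dl:$a)" by (rule k.L_conj[OF 1 k.L_tail[OF sdl[OF dl(1)]] d1])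
    have W: False if "(ALL x:$I. a ~= x) & s dl:$a" "pair dl a:$W" for a
     using that(1) that(2)[unfolded W_def] by auto
    show False by (rule k.L_no[OF 2 dl(2)]) (rule W, assumption+, intro dfi I sV, intro dfi WV k.d)
   qed
   moreover have "{dl:$J'. ap x dl:$I} <= {dl:$J. pair dl (ap g.nu dl):$W}"
   proof
    fix dl assume "dl:{dl:$J'. ap x dl:$I}"
    hence a: "dl:$J'" "ap x dl:$I" by auto
    have "pair dl (ap g.nu dl):$p.X0" using g.nu_fun(1) J'J[OF a(1)] by (simp add: p.X0)
    hence "pair dl (ap g.nu dl):$W" using a xs[OF a(1)] by (auto simp: W_def split: if_splits)
    thus "dl:{dl:$J. pair dl (ap g.nu dl):$W}" using J'J[OF a(1)] by blast
   qed
   ultimately show ?thesis using finite_subset by blast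
  qed
  have xdl: "ap x dl:$dl" if "dl:$J'" for dl
   using xs[OF that] sdl[of dl] g.nu_fun(1)[of dl] J'J[OF that] by simp
  have "d:$\<kappa>" "J':g.N" "h:g.N" using sK g.M_N J'V hV by (auto simp: d_def)
  moreover have "$J' <= $d" using J'J by blast
  ultimately show ?thesis using xN m.dsucc hh xdl sx fin by blast
 qed
qed

sublocale q: qf V g.N \<kappa> \<kappa>p cs
proof unfold_locales
 show "GCH V" "GCH g.N" "is_cardinal V \<kappa>" "homega:$\<kappa>" "is_successor_cardinal V \<kappa> \<kappa>p" "cs:V"
  by (fact gch g.GCH_ext[OF gch] KC wK succ csV)+
 show "is_cardinal g.N mm" if "is_cardinal V mm" for mm using g.Card_pres[OF gch that] .
 show "ap cs n:$\<kappa>" if "n:$homega" for n using that csK by auto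
 show "EX n:$homega. a:$(ap cs n)" if "a:$\<kappa>" for a
 proof -
  obtain n where "a:$(\<kappa>s n)" using \<open>a:$\<kappa>\<close> elK by blast
  hence "a:$(ap cs (hnat n))" unfolding cs by blast
  thus ?thesis by auto
 qed
qed (use cover_K blocks in blast)+

end

theorem theorem2p5:
  fixes V :: "hc set" and \<kappa> \<kappa>plus :: hc and \<kappa>s os :: "nat \<Rightarrow> hc"
  assumes "ctm V" and "GCH V"
    and "hseq \<kappa>s \<in> V"
    and "\<And>n. is_cardinal V (\<kappa>s n)"
    and "\<And>n. \<kappa>s n \<in> elts \<kappa>"
    and "\<kappa> = hUnion (range \<kappa>s)"
    and "\<And>n. mitchell_order V (\<kappa>s n) (os n)"
    and "hUnion (range os) = \<kappa>"
    and "is_successor_cardinal V \<kappa> \<kappa>plus"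
  shows "\<exists>V\<^sub>1. is_generic_extension V V\<^sub>1 \<and>
           (\<forall>\<mu>. is_cardinal V \<mu> \<longrightarrow> is_cardinal V\<^sub>1 \<mu>) \<and>
           GCH V\<^sub>1 \<and>
           reals_of V\<^sub>1 = reals_of V \<and>
           (\<forall>G. Cohen_generic V\<^sub>1 \<kappa> G \<longrightarrow>
              (\<exists>H\<in>gen_ext V\<^sub>1 (Cohen \<kappa>) G. Cohen_generic V \<kappa>plus (elts H)))"
proof -
 interpret tmc V using assms(1) by (simp add: tmc_ctm)
 interpret limit_mitchell V \<kappa> \<kappa>plus \<kappa>s os by unfold_locales (fact assms)+
 obtain G where G: "generic_filter V ($p.P) (%p q. pair p q:$p.L) G" using p.ex_generic by blast
 interpret g: limit_generic V \<kappa> \<kappa>plus \<kappa>s os G by unfold_locales (rule G)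
 interpret f: forcing g.g.N g.q.Q g.q.QL
  by unfold_locales (fact g.q.Q_N g.q.QL_N g.q.Q_notion)+
 obtain H where H: "generic_filter g.g.N ($g.q.Q) (%p q. pair p q:$g.q.QL) H" using f.ex_generic by blast
 interpret h: qg V g.g.N \<kappa> \<kappa>plus cs H by unfold_locales (rule H)
 have "EX H':gen_ext h.V1 (Cohen \<kappa>) C. Cohen_generic V \<kappa>plus $H'" if C: "Cohen_generic h.V1 \<kappa> C" for C
 proof -
  interpret c: coh V g.g.N \<kappa> \<kappa>plus cs H C
  proof unfold_locales
   show "lep (hPow V a) \<kappa>" if a: "a:$\<kappa>" for a
   proof -
    obtain m where m: "lep (hPow V a) (\<kappa>s m)" by (rule powK[OF a])
    have "lep (\<kappa>s m) \<kappa>" by (rule lep_subset[OF sM]) (use elK in blast)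
    thus ?thesis using lep_trans[OF m] hPow_M elV[OF a] by blast
   qed
   show "$(ap cs (hnat m)) <= $(ap cs (hnat n))" if "m <= n" for m n
    unfolding cs using that by (intro UN_mono) auto
   show "Cohen_generic (val H ` g.g.N) \<kappa> C" using C by (simp add: h.V.N_def)
  qed
  show ?thesis by (rule c.HH_ext)
 qed
 moreover have "is_generic_extension V h.V1"
  by (rule generic_extension_trans[OF assms(1) g.g.is_gen_ext h.V.is_gen_ext])
 moreover have "is_cardinal h.V1 mm" if "is_cardinal V mm" for mm
  using h.Card_pres1 g.g.Card_pres[OF assms(2) that] by blast
 moreover have "reals_of h.V1 = reals_of V" using h.reals_V1 g.g.reals_N by simp
 ultimately show ?thesis using h.GCH_V1 by blast
qed

end
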